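(* Assume Hypotheses 1, 2 and 3 listed in the context. Let $U_n(x)$ be an $n$-pulse solution of $\partial_x^4u+c^2\partial_x^2u+e^u-1=0$ (as described in the context), let $\nu_1,\dots,\nu_n$ be the small magnitude eigenvalues of $\mathcal{A}_0(U_n)$, assumed simple, with eigenfunctions $s_1,\dots,s_n$, and let $S=\mathrm{span}\{s_1,\dots,s_n\}$. Under a suitable normalization of the eigenfunctions, namely $\langle s_i,s_j\rangle=\|\partial_xU\|^2\delta_{ij}$, the Krein matrix of the pencil $\mathcal{P}_2(\lambda;U_n)=\lambda^2\mathcal{I}-2c\lambda\,\partial_x+\mathcal{A}_0(U_n)$ associated with $S$ has, near the origin, the asymptotic expansion $$-\frac{\boldsymbol{K}_S(z)}{z}=\|\partial_xU\|^2\,\mathrm{diag}(\nu_1,\dots,\nu_n)+d''(c)\,\boldsymbol{I}_n\,\overline{z}^2+\mathcal{O}\left(e^{-(3\alpha/2)X_{\min}}|z|+|z|^3\right),$$ which is diagonal to leading order. Here $d''(c)=-\partial_c(c\|\partial_xU\|^2)$ and $\boldsymbol{I}_n$ is the $n\times n$ identity matrix.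
   Context: Setting. Write $\partial_x^4u+c^2\partial_x^2u+e^u-1=0$ as $Y'=F(Y;c)$, $Y=(u,u_x,u_{xx},u_{xxx})$, with conserved energy $H(Y;c)=y_2y_4-\tfrac12y_3^2+\tfrac{c^2}{2}y_2^2+e^{y_1}-y_1-1$ and reversor $R(y_1,y_2,y_3,y_4)=(y_1,-y_2,y_3,-y_4)$. For $c\in(0,\sqrt2)$ the origin is hyperbolic with eigenvalues $\pm\alpha\pm\mathrm{i}\beta$, $\alpha,\beta>0$. For a solution $U_*$, $\mathcal{A}_0(U_* )=\partial_x^4+c^2\partial_x^2+e^{U_*}$ on $L^2(\mathbb{R})$ with domain $H^4(\mathbb{R})$. $\langle f,g\rangle=\int f\overline{g}\,dx$ and $\|\cdot\|$ is the $L^2(\mathbb{R})$ norm. Hypothesis 1: for some $c_0\in(0,\sqrt2)$ there is a nontrivial symmetric ($RY(x)=Y(-x)$) homoclinic orbit $Y(x;c_0)$ to $0$, and the stable and unstable manifolds of $0$ intersect transversely in $H^{-1}(0;c_0)$ at $Y(0;c_0)$. Then there is an open interval $(c_-,c_+)\ni c_0$ on which such a symmetric transverse homoclinic orbit $Y(x;c)$ persists, smoothly in $c$; its first component $U(x;c)$ is even, and $Y,\partial_cY$ are exponentially localized. Fix $c\in(c_-,c_+)$ and write $U(x)$ for the primary pulse. Hypothesis 2: $\mathcal{A}_0(U)$ has exactly one negative eigenvalue $\lambda_-$, which is simple, and there is $\delta_0>0$ such that its only spectrum in $(-\infty,\delta_0)$ is the two simple eigenvalues $0$ and $\lambda_-$.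 Hypothesis 3: for all initial data the PDE $\partial_t^2u-2c\,\partial_x\partial_tu+\partial_x^4u+c^2\partial_x^2u+e^u-1=0$ has a solution on $[0,T]$, with $T$ depending only on $\max\{\|u(\cdot,0)\|,\|\partial_tu(\cdot,0)\|\}$; and $d''(c)>0$. $n$-pulses. Fix $n\ge2$ and nonnegative integers $k_1,\dots,k_{n-1}$, at least one of which is in $\{0,1\}$. Under Hypotheses 1 and 2 there are $m_0$ and $\delta\in(0,\delta_0)$ such that for every integer $m\ge m_0$ there is a unique $n$-modal solution $U_n=\sum_{j=1}^nU^j+r$, where each $U^j$ is a translate of $U$, the distance between the peaks of $U^j$ and $U^{j+1}$ is $2X_j$ with $X_j\approx\frac{\pi}{\beta}(2m+k_j)+\tilde X$ ($\tilde X$ a constant), and $\|r\|_\infty\le Ce^{-\alpha X_{\min}}$, $X_{\min}=\min_jX_j$ (likewise for $x$-derivatives of $r$). $\mathcal{A}_0(U_n)$ has exactly $2n$ eigenvalues in $(-\infty,\delta_0)$: $n$ negative ones $\delta$-close to $\lambda_-$, and $n$ real "small magnitude" ones $\nu_1,\dots,\nu_n$ with $|\nu_j|<\delta$, where $\nu_n=0$ is simple with eigenfunction $\partial_xU_n$, and for $j\le n-1$, $\nu_j=\mathcal{O}(e^{-2\alpha X_{\min}})$ with $\nu_j<0$ if $k_j$ is odd and $\nu_j>0$ if $k_j$ is even, with eigenfunctions $s_j=\sum_{k=1}^nd_{jk}\partial_xU^k+w_j$, $d_{jk}$ constants, $\|w_j\|_\infty,\|\partial_xw_j\|_\infty\le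 Ce^{-2\alpha X_{\min}}$. The essential spectrum of $\mathcal{A}_0(U_n)$ is $[1-c^4/4,\infty)$. Constants in $\mathcal{O}(\cdot)$ are independent of $m$ (equivalently of $X_{\min}$) and $z$. Krein matrix. With $P_{S^\perp}$ the orthogonal projection onto $S^\perp$ and $(\mathcal{T}|_S)_{ij}=\langle s_i,\mathcal{T}s_j\rangle$, $$\boldsymbol{K}_S(z)=-z\left[\mathcal{P}_2(\mathrm{i}z)|_S-\mathcal{P}_2(\mathrm{i}z)P_{S^\perp}(P_{S^\perp}\mathcal{P}_2(\mathrm{i}z)P_{S^\perp})^{-1}P_{S^\perp}\mathcal{P}_2(\mathrm{i}z)|_{S}\right],$$ where $\mathcal{P}_2(\lambda)=\mathcal{P}_2(\lambda;U_n)$. *)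

theory Defs
  imports "HOL-Analysis.Analysis"
begin

section \<open>The travelling wave equation as a Hamiltonian system on R^4\<close>

definition wave_field :: "real \<Rightarrow> real^4 \<Rightarrow> real^4" where
  "wave_field c y = vector [y $ 2, y $ 3, y $ 4, - c\<^sup>2 * y $ 3 - exp (y $ 1) + 1]"

definition energy :: "real \<Rightarrow> real^4 \<Rightarrow> real" where
  "energy c y = y $ 2 * y $ 4 - (y $ 3)\<^sup>2 / 2 + c\<^sup>2 / 2 * (y $ 2)\<^sup>2 + exp (y $ 1) - y $ 1 - 1"

definition reversor :: "real^4 \<Rightarrow> real^4" where
  "reversor y = vector [y $ 1, - (y $ 2), y $ 3, - (y $ 4)]"

definition solves_on :: "real \<Rightarrow> real set \<Rightarrow> (real \<Rightarrow> real^4) \<Rightarrow> bool" where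
  "solves_on c I Y \<longleftrightarrow> (\<forall>x\<in>I. (Y has_vector_derivative wave_field c (Y x)) (at x within I))"

definition origin_eigenvalues :: "real \<Rightarrow> complex set" where
  "origin_eigenvalues c =
     (let J = (\<chi> i j. complex_of_real (matrix (frechet_derivative (wave_field c) (at 0)) $ i $ j))
      in {l. \<exists>v :: complex^4. v \<noteq> 0 \<and> J *v v = l *s v})"

definition homoclinic_orbit :: "real \<Rightarrow> (real \<Rightarrow> real^4) \<Rightarrow> bool" where
  "homoclinic_orbit c Y \<longleftrightarrow>
     solves_on c UNIV Y \<and> (\<exists>x. Y x \<noteq> 0) \<and> (Y \<longlongrightarrow> 0) at_top \<and> (Y \<longlongrightarrow> 0) at_bot"

definition symmetric_orbit :: "(real \<Rightarrow> real^4) \<Rightarrow> bool" where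
  "symmetric_orbit Y \<longleftrightarrow> (\<forall>x. reversor (Y x) = Y (- x))"

definition asymptotic_set :: "real \<Rightarrow> real set \<Rightarrow> real filter \<Rightarrow> (real^4) set" where
  "asymptotic_set c I F = {p. \<exists>\<phi>. solves_on c I \<phi> \<and> \<phi> 0 = p \<and> (\<phi> \<longlongrightarrow> 0) F}"

text \<open>
  The global (un)stable manifolds are only injectively immersed, so a tangent vector is taken to be
  the velocity of a C^1 curve that is a curve in the manifold topology, not merely in the set.
  Uniform convergence to the origin along the curve expresses this: it says that some time map of
  the flow takes the whole curve into an (arbitrarily small) embedded local manifold.
\<close>
definition asymptotic_tangent :: "real \<Rightarrow> real set \<Rightarrow> real filter \<Rightarrow> real^4 \<Rightarrow> (real^4) set" where
  "asymptotic_tangent c I F p = {v. \<exists>\<epsilon>>0. \<exists>\<gamma> \<gamma>' \<Phi>.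
     (\<forall>s\<in>{-\<epsilon><..<\<epsilon>}. (\<gamma> has_vector_derivative \<gamma>' s) (at s)) \<and>
     continuous_on {-\<epsilon><..<\<epsilon>} \<gamma>' \<and> \<gamma> 0 = p \<and> \<gamma>' 0 = v \<and>
     (\<forall>s\<in>{-\<epsilon><..<\<epsilon>}. solves_on c I (\<Phi> s) \<and> \<Phi> s 0 = \<gamma> s) \<and>
     uniform_limit {-\<epsilon><..<\<epsilon>} (\<lambda>x s. \<Phi> s x) (\<lambda>_. 0) F}"

abbreviation stable_manifold :: "real \<Rightarrow> (real^4) set" where
  "stable_manifold c \<equiv> asymptotic_set c {0..} at_top"

abbreviation unstable_manifold :: "real \<Rightarrow> (real^4) set" where
  "unstable_manifold c \<equiv> asymptotic_set c {..0} at_bot"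

abbreviation stable_tangent :: "real \<Rightarrow> real^4 \<Rightarrow> (real^4) set" where
  "stable_tangent c \<equiv> asymptotic_tangent c {0..} at_top"

abbreviation unstable_tangent :: "real \<Rightarrow> real^4 \<Rightarrow> (real^4) set" where
  "unstable_tangent c \<equiv> asymptotic_tangent c {..0} at_bot"

text \<open>The tangent space of the level set of the energy at p is the kernel of the differential.\<close>
definition transverse_at :: "real \<Rightarrow> real^4 \<Rightarrow> bool" where
  "transverse_at c p \<longleftrightarrow>
     p \<in> stable_manifold c \<and> p \<in> unstable_manifold c \<and> energy c p = 0 \<and>
     {v + w | v w. v \<in> stable_tangent c p \<and> w \<in> unstable_tangent c p}
       = {u. frechet_derivative (energy c) (at p) u = 0}"

definition hypothesis1 :: "real \<Rightarrow> (real \<Rightarrow> real^4) \<Rightarrow> bool" where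
  "hypothesis1 c Y \<longleftrightarrow>
     c \<in> {0<..<sqrt 2} \<and> homoclinic_orbit c Y \<and> symmetric_orbit Y \<and> transverse_at c (Y 0)"

primrec Ck_on :: "nat \<Rightarrow> 'a::real_normed_vector set \<Rightarrow> ('a \<Rightarrow> 'b::real_normed_vector) \<Rightarrow> bool" where
  "Ck_on 0 S f \<longleftrightarrow> continuous_on S f"
| "Ck_on (Suc k) S f \<longleftrightarrow>
     (\<forall>x\<in>S. f differentiable (at x)) \<and> (\<forall>v. Ck_on k S (\<lambda>x. frechet_derivative f (at x) v))"

text \<open>
  The rates of exponential localization are locally uniform in c, as is needed for
  the derivative of the squared norm of the pulse with respect to c to make sense.
\<close>
definition pulse_family :: "real \<Rightarrow> real \<Rightarrow> (real \<Rightarrow> real \<Rightarrow> real^4) \<Rightarrow> bool" where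
  "pulse_family cm cp Y \<longleftrightarrow>
     (\<forall>c\<in>{cm<..<cp}. hypothesis1 c (Y c)) \<and>
     (\<forall>k. Ck_on k ({cm<..<cp} \<times> UNIV) (\<lambda>(c, x). Y c x)) \<and>
     (\<forall>a b. {a..b} \<subseteq> {cm<..<cp} \<longrightarrow>
        (\<exists>C. \<exists>\<eta>>0. \<forall>c\<in>{a..b}. \<forall>x.
           norm (Y c x) \<le> C * exp (- \<eta> * \<bar>x\<bar>) \<and>
           norm (vector_derivative (\<lambda>c. Y c x) (at c)) \<le> C * exp (- \<eta> * \<bar>x\<bar>)))"

definition profile :: "(real \<Rightarrow> real^4) \<Rightarrow> real \<Rightarrow> real" where
  "profile Y x = Y x $ 1"

definition jet :: "(real \<Rightarrow> real) \<Rightarrow> real \<Rightarrow> real^4" where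
  "jet u x = vector [u x, deriv u x, (deriv ^^ 2) u x, (deriv ^^ 3) u x]"


section \<open>Square integrable functions and Sobolev spaces on the line\<close>

text \<open>
  Elements of the complex space L^2(R) are represented by square integrable Borel functions;
  equality of elements is equality almost everywhere, written \<open>=\<^sub>2\<close>.
\<close>
definition L2 :: "(real \<Rightarrow> complex) set" where
  "L2 = {f. f \<in> borel_measurable lborel \<and> integrable lborel (\<lambda>x. (cmod (f x))\<^sup>2)}"

definition L2_eq :: "(real \<Rightarrow> complex) \<Rightarrow> (real \<Rightarrow> complex) \<Rightarrow> bool" (infix \<open>=\<^sub>2\<close> 50) where
  "f =\<^sub>2 g \<longleftrightarrow> (AE x in lborel. f x = g x)"

definition L2_inner :: "(real \<Rightarrow> complex) \<Rightarrow> (real \<Rightarrow> complex) \<Rightarrow> complex" where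
  "L2_inner f g = (LINT x|lborel. f x * cnj (g x))"

definition L2_norm :: "(real \<Rightarrow> complex) \<Rightarrow> real" where
  "L2_norm f = sqrt (LINT x|lborel. (cmod (f x))\<^sup>2)"

abbreviation (input) cfun :: "(real \<Rightarrow> real) \<Rightarrow> real \<Rightarrow> complex" where
  "cfun f \<equiv> \<lambda>x. complex_of_real (f x)"

definition test_functions :: "(real \<Rightarrow> real) set" where
  "test_functions =
     {\<phi>. (\<forall>k x. (deriv ^^ k) \<phi> differentiable (at x)) \<and> (\<exists>R. \<forall>x. \<bar>x\<bar> > R \<longrightarrow> \<phi> x = 0)}"

definition is_weak_deriv :: "nat \<Rightarrow> (real \<Rightarrow> complex) \<Rightarrow> (real \<Rightarrow> complex) \<Rightarrow> bool" where
  "is_weak_deriv k f g \<longleftrightarrow> (\<forall>\<phi>\<in>test_functions.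
     (LINT x|lborel. f x * cfun ((deriv ^^ k) \<phi>) x) = (-1) ^ k * (LINT x|lborel. g x * cfun \<phi> x))"

definition sobolev :: "nat \<Rightarrow> (real \<Rightarrow> complex) set" where
  "sobolev k = {f\<in>L2. \<forall>j\<le>k. \<exists>g\<in>L2. is_weak_deriv j f g}"

text \<open>Determined up to equality almost everywhere.\<close>
definition weak_deriv :: "nat \<Rightarrow> (real \<Rightarrow> complex) \<Rightarrow> real \<Rightarrow> complex" where
  "weak_deriv k f = (SOME g. g \<in> L2 \<and> is_weak_deriv k f g)"

definition sobolev_norm :: "nat \<Rightarrow> (real \<Rightarrow> complex) \<Rightarrow> real" where
  "sobolev_norm k f = sqrt (\<Sum>j\<le>k. (L2_norm (weak_deriv j f))\<^sup>2)"


section \<open>Unbounded operators on L^2\<close>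

type_synonym oper = "(real \<Rightarrow> complex) \<Rightarrow> real \<Rightarrow> complex"

definition boundedly_invertible ::
  "(real \<Rightarrow> complex) set \<Rightarrow> (real \<Rightarrow> complex) set \<Rightarrow> oper \<Rightarrow> bool" where
  "boundedly_invertible D E T \<longleftrightarrow>
     (\<forall>f\<in>D. T f \<in> E) \<and>
     (\<forall>f\<in>D. \<forall>g\<in>D. T f =\<^sub>2 T g \<longrightarrow> f =\<^sub>2 g) \<and>
     (\<forall>g\<in>E. \<exists>f\<in>D. T f =\<^sub>2 g) \<and>
     (\<exists>C. \<forall>f\<in>D. L2_norm f \<le> C * L2_norm (T f))"

definition inverse_on :: "(real \<Rightarrow> complex) set \<Rightarrow> oper \<Rightarrow> oper" where
  "inverse_on D T g = (SOME f. f \<in> D \<and> T f =\<^sub>2 g)"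

definition spectrum_on :: "(real \<Rightarrow> complex) set \<Rightarrow> oper \<Rightarrow> complex set" where
  "spectrum_on D T = {l. \<not> boundedly_invertible D L2 (\<lambda>f x. T f x - l * f x)}"

definition eigenspace :: "(real \<Rightarrow> complex) set \<Rightarrow> oper \<Rightarrow> complex \<Rightarrow> (real \<Rightarrow> complex) set" where
  "eigenspace D T l = {f\<in>D. T f =\<^sub>2 (\<lambda>x. l * f x)}"

definition eigenfunction ::
  "(real \<Rightarrow> complex) set \<Rightarrow> oper \<Rightarrow> complex \<Rightarrow> (real \<Rightarrow> complex) \<Rightarrow> bool" where
  "eigenfunction D T l f \<longleftrightarrow> f \<in> eigenspace D T l \<and> \<not> f =\<^sub>2 (\<lambda>_. 0)"

definition eigenvalue :: "(real \<Rightarrow> complex) set \<Rightarrow> oper \<Rightarrow> complex \<Rightarrow> bool" where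
  "eigenvalue D T l \<longleftrightarrow> (\<exists>f. eigenfunction D T l f)"

text \<open>Dimension over the complex numbers, modulo equality almost everywhere.\<close>
definition has_L2_dim :: "(real \<Rightarrow> complex) set \<Rightarrow> nat \<Rightarrow> bool" where
  "has_L2_dim E d \<longleftrightarrow> (\<exists>b :: nat \<Rightarrow> real \<Rightarrow> complex.
     (\<forall>i<d. b i \<in> E) \<and>
     (\<forall>f\<in>E. \<exists>a. f =\<^sub>2 (\<lambda>x. \<Sum>i<d. a i * b i x)) \<and>
     (\<forall>a. (\<lambda>x. \<Sum>i<d. a i * b i x) =\<^sub>2 (\<lambda>_. 0) \<longrightarrow> (\<forall>i<d. a i = 0)))"

text \<open>
  Multiplicities and the essential spectrum are used for self-adjoint operators only. Hence
  algebraic and geometric multiplicity agree, and the essential spectrum is what is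
  left of the spectrum after removing the isolated eigenvalues of finite multiplicity.
\<close>
definition simple_eigenvalue :: "(real \<Rightarrow> complex) set \<Rightarrow> oper \<Rightarrow> complex \<Rightarrow> bool" where
  "simple_eigenvalue D T l \<longleftrightarrow> has_L2_dim (eigenspace D T l) 1"

definition essential_spectrum :: "(real \<Rightarrow> complex) set \<Rightarrow> oper \<Rightarrow> complex set" where
  "essential_spectrum D T = spectrum_on D T -
     {l. \<not> l islimpt spectrum_on D T \<and> eigenvalue D T l \<and> (\<exists>d. has_L2_dim (eigenspace D T l) d)}"


section \<open>The linearized operator and the quadratic pencil\<close>

definition lin_op :: "real \<Rightarrow> (real \<Rightarrow> real) \<Rightarrow> oper" where
  "lin_op c W f = (\<lambda>x. weak_deriv 4 f x + of_real (c\<^sup>2) * weak_deriv 2 f x + of_real (exp (W x)) * f x)"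

definition pencil :: "real \<Rightarrow> (real \<Rightarrow> real) \<Rightarrow> complex \<Rightarrow> oper" where
  "pencil c W l f = (\<lambda>x. l\<^sup>2 * f x - 2 * of_real c * l * weak_deriv 1 f x + lin_op c W f x)"

definition hypothesis2 :: "real \<Rightarrow> (real \<Rightarrow> real) \<Rightarrow> real \<Rightarrow> real \<Rightarrow> bool" where
  "hypothesis2 c U lm \<delta>0 \<longleftrightarrow>
     lm < 0 \<and> \<delta>0 > 0 \<and>
     {l::real. l < 0 \<and> eigenvalue (sobolev 4) (lin_op c U) (of_real l)} = {lm} \<and>
     simple_eigenvalue (sobolev 4) (lin_op c U) (of_real lm) \<and>
     simple_eigenvalue (sobolev 4) (lin_op c U) 0 \<and>
     spectrum_on (sobolev 4) (lin_op c U) \<inter> of_real ` {..<\<delta>0} = {of_real lm, 0}"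


section \<open>The wave equation and the convexity of the action\<close>

text \<open>
  Solutions of the partial differential equation in the energy space: u is continuous into H^2, its
  time derivative v is continuous into L^2, and the equation holds weakly in x
  against test functions.
\<close>
definition wave_solution ::
  "real \<Rightarrow> real \<Rightarrow> (real \<Rightarrow> real) \<Rightarrow> (real \<Rightarrow> real) \<Rightarrow> (real \<Rightarrow> real \<Rightarrow> real) \<Rightarrow> bool" where
  "wave_solution c T u0 v0 u \<longleftrightarrow> (\<exists>v :: real \<Rightarrow> real \<Rightarrow> real.
     cfun (u 0) =\<^sub>2 cfun u0 \<and> cfun (v 0) =\<^sub>2 cfun v0 \<and>
     (\<forall>t\<in>{0..T}. cfun (u t) \<in> sobolev 2 \<and> cfun (v t) \<in> L2 \<and>
        ((\<lambda>t'. sobolev_norm 2 (\<lambda>x. cfun (u t') x - cfun (u t) x)) \<longlongrightarrow> 0) (at t within {0..T}) \<and>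
        ((\<lambda>t'. L2_norm (\<lambda>x. cfun (v t') x - cfun (v t) x)) \<longlongrightarrow> 0) (at t within {0..T}) \<and>
        ((\<lambda>t'. L2_norm (\<lambda>x. (cfun (u t') x - cfun (u t) x) / of_real (t' - t) - cfun (v t) x)) \<longlongrightarrow> 0)
          (at t within {0..T})) \<and>
     (\<forall>\<phi>\<in>test_functions. \<forall>t\<in>{0..T}.
        ((\<lambda>t. LINT x|lborel. v t x * \<phi> x) has_real_derivative
           - 2 * c * (LINT x|lborel. v t x * deriv \<phi> x)
           - (LINT x|lborel. u t x * ((deriv ^^ 4) \<phi> x + c\<^sup>2 * (deriv ^^ 2) \<phi> x))
           - (LINT x|lborel. (exp (u t x) - 1) * \<phi> x)) (at t within {0..T})))"

definition d_second :: "(real \<Rightarrow> real \<Rightarrow> real^4) \<Rightarrow> real \<Rightarrow> real" where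
  "d_second Y c = - deriv (\<lambda>c. c * (L2_norm (cfun (deriv (profile (Y c)))))\<^sup>2) c"

definition hypothesis3 :: "(real \<Rightarrow> real \<Rightarrow> real^4) \<Rightarrow> real \<Rightarrow> bool" where
  "hypothesis3 Y c \<longleftrightarrow>
     (\<exists>T :: real \<Rightarrow> real. (\<forall>\<rho>\<ge>0. T \<rho> > 0) \<and>
        (\<forall>u0 v0. cfun u0 \<in> sobolev 2 \<and> cfun v0 \<in> L2 \<longrightarrow>
           (\<exists>u. wave_solution c (T (max (L2_norm (cfun u0)) (L2_norm (cfun v0)))) u0 v0 u))) \<and>
     d_second Y c > 0"


section \<open>Multi-pulses\<close>

definition X_min :: "nat \<Rightarrow> (nat \<Rightarrow> real) \<Rightarrow> real" where
  "X_min n X = Min (X ` {1..n-1})"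

text \<open>
  \<open>p m j\<close> is the position of the j-th peak of the m-th n-pulse. The approximate
  equality prescribed for the half-distances \<open>X m j\<close> is read as equality up to an error
  that is bounded in m.
\<close>
definition n_pulses ::
  "real \<Rightarrow> real \<Rightarrow> real \<Rightarrow> (real \<Rightarrow> real) \<Rightarrow> nat \<Rightarrow> (nat \<Rightarrow> nat) \<Rightarrow> nat \<Rightarrow>
   (nat \<Rightarrow> nat \<Rightarrow> real) \<Rightarrow> (nat \<Rightarrow> nat \<Rightarrow> real) \<Rightarrow> (nat \<Rightarrow> real \<Rightarrow> real) \<Rightarrow> bool" where
  "n_pulses c \<alpha> \<beta> U n k m0 p X V \<longleftrightarrow>
     (\<forall>m\<ge>m0. homoclinic_orbit c (jet (V m))) \<and>
     (\<forall>m\<ge>m0. \<forall>j\<in>{1..n-1}. X m j > 0 \<and> p m (j + 1) - p m j = 2 * X m j) \<and>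
     (\<exists>Xt C. \<forall>m\<ge>m0. \<forall>j\<in>{1..n-1}. \<bar>X m j - (pi / \<beta> * real (2 * m + k j) + Xt)\<bar> \<le> C) \<and>
     (\<forall>i. \<exists>C. \<forall>m\<ge>m0. \<forall>x.
        \<bar>(deriv ^^ i) (\<lambda>x. V m x - (\<Sum>j=1..n. U (x - p m j))) x\<bar> \<le> C * exp (- \<alpha> * X_min n (X m)))"

definition n_pulse_spectrum ::
  "real \<Rightarrow> real \<Rightarrow> (real \<Rightarrow> real) \<Rightarrow> real \<Rightarrow> real \<Rightarrow> real \<Rightarrow> nat \<Rightarrow> (nat \<Rightarrow> nat) \<Rightarrow> nat \<Rightarrow>
   (nat \<Rightarrow> nat \<Rightarrow> real) \<Rightarrow> (nat \<Rightarrow> nat \<Rightarrow> real) \<Rightarrow> (nat \<Rightarrow> real \<Rightarrow> real) \<Rightarrow>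
   (nat \<Rightarrow> nat \<Rightarrow> real) \<Rightarrow> (nat \<Rightarrow> nat \<Rightarrow> real \<Rightarrow> complex) \<Rightarrow> bool" where
  "n_pulse_spectrum c \<alpha> U lm \<delta>0 \<delta> n k m0 p X V \<nu> s \<longleftrightarrow>
     (\<forall>m\<ge>m0.
        (\<exists>\<mu>. (\<forall>j\<in>{1..n}. \<mu> j < 0 \<and> \<bar>\<mu> j - lm\<bar> < \<delta> \<and> \<bar>\<nu> m j\<bar> < \<delta>) \<and>
           (\<forall>l<\<delta>0. has_L2_dim (eigenspace (sobolev 4) (lin_op c (V m)) (of_real l))
              (card {j\<in>{1..n}. \<mu> j = l} + card {j\<in>{1..n}. \<nu> m j = l}))) \<and>
        \<nu> m n = 0 \<and>
        simple_eigenvalue (sobolev 4) (lin_op c (V m)) 0 \<and>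
        eigenfunction (sobolev 4) (lin_op c (V m)) 0 (cfun (deriv (V m))) \<and>
        (\<forall>j\<in>{1..n-1}. (odd (k j) \<longrightarrow> \<nu> m j < 0) \<and> (even (k j) \<longrightarrow> \<nu> m j > 0)) \<and>
        (\<forall>j\<in>{1..n}. eigenfunction (sobolev 4) (lin_op c (V m)) (of_real (\<nu> m j)) (s m j)) \<and>
        essential_spectrum (sobolev 4) (lin_op c (V m)) = of_real ` {1 - c ^ 4 / 4..}) \<and>
     (\<exists>C. \<forall>m\<ge>m0. \<forall>j\<in>{1..n-1}.
        \<bar>\<nu> m j\<bar> \<le> C * exp (- 2 * \<alpha> * X_min n (X m)) \<and>
        (\<exists>(d :: nat \<Rightarrow> complex) w w'. \<forall>x.
           s m j x = (\<Sum>i=1..n. d i * of_real (deriv U (x - p m i))) + w x \<and>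
           (w has_vector_derivative w' x) (at x) \<and>
           cmod (w x) \<le> C * exp (- 2 * \<alpha> * X_min n (X m)) \<and>
           cmod (w' x) \<le> C * exp (- 2 * \<alpha> * X_min n (X m))))"


section \<open>The Krein matrix\<close>

definition L2_span :: "nat \<Rightarrow> (nat \<Rightarrow> real \<Rightarrow> complex) \<Rightarrow> (real \<Rightarrow> complex) set" where
  "L2_span n s = {\<lambda>x. \<Sum>j=1..n. a j * s j x | a. True}"

definition L2_perp :: "(real \<Rightarrow> complex) set \<Rightarrow> (real \<Rightarrow> complex) set" where
  "L2_perp S = {f\<in>L2. \<forall>g\<in>S. L2_inner f g = 0}"

text \<open>Orthogonal projection onto the complement of S, for a finite-dimensional subspace S.\<close>
definition proj_perp :: "(real \<Rightarrow> complex) set \<Rightarrow> oper" where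
  "proj_perp S f = (\<lambda>x. f x - (SOME g. g \<in> S \<and> (\<lambda>x. f x - g x) \<in> L2_perp S) x)"

definition compression :: "(real \<Rightarrow> complex) set \<Rightarrow> oper \<Rightarrow> oper" where
  "compression S T f = proj_perp S (T (proj_perp S f))"

text \<open>Here D is the common domain of the operators \<open>P l\<close> of the pencil P.\<close>
definition krein_matrix ::
  "(real \<Rightarrow> complex) set \<Rightarrow> (complex \<Rightarrow> oper) \<Rightarrow> nat \<Rightarrow> (nat \<Rightarrow> real \<Rightarrow> complex) \<Rightarrow>
   complex \<Rightarrow> nat \<Rightarrow> nat \<Rightarrow> complex" where
  "krein_matrix D P n s z i j =
     (let S = L2_span n s; T = P (\<i> * z); Q = proj_perp S;
          G = inverse_on (D \<inter> L2_perp S) (compression S T)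
      in - z * (L2_inner (s i) (T (s j)) - L2_inner (s i) (T (Q (G (Q (T (s j))))))))"

end

theory Submission
  imports Defs "HOL-Complex_Analysis.Great_Picard"
begin

text \<open>
  On the orthogonal complement of \<open>S\<close> the operator \<open>A\<close> linearized at the \<open>n\<close>-pulse is invertible with a
  bound that is uniform in \<open>m\<close>: a sequence of approximate null vectors, recentred at the peaks, would
  converge to null vectors of the operator linearized at \<open>U\<close> that are orthogonal to \<open>U'\<close>, hence to zero.
  A perturbation argument then turns the Krein matrix into
  \<open>\<nu>\<^sub>i \<langle>s\<^sub>i, s\<^sub>j\<rangle> - \<langle>s\<^sub>i, s\<^sub>j\<rangle> \<zeta>\<^sup>2 + 2ic \<langle>s\<^sub>i, s\<^sub>j'\<rangle> \<zeta> - 4c\<^sup>2 \<langle>s\<^sub>i', f\<^sub>j\<rangle> \<zeta>\<^sup>2 + O(|z|\<^sup>3)\<close>, where \<open>\<zeta>\<close> is the conjugate of \<open>z\<close>,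
  \<open>P\<close> the orthogonal projection onto the complement, and \<open>f\<^sub>j\<close> the solution of \<open>A f\<^sub>j = P s\<^sub>j'\<close> in it.

  Write \<open>s\<^sub>i = \<Sum>\<^sub>k d\<^sub>i\<^sub>k \<partial>\<^sub>xU\<^sup>k + w\<^sub>i\<close>. Differentiating the equation of the pulse in \<open>c\<close> gives \<open>A(U) \<partial>\<^sub>cU = - 2c U''\<close>, so
  \<open>f\<^sub>j\<close> is close to \<open>- (1/2c) \<Sum>\<^sub>k d\<^sub>j\<^sub>k \<partial>\<^sub>cU\<^sup>k\<close>, and the coefficient of \<open>\<zeta>\<^sup>2\<close> is \<open>d''(c)\<close> up to \<open>O(exp (- \<alpha> X))\<close>. Both \<open>U\<close> and
  \<open>\<partial>\<^sub>cU\<close> decay faster than \<open>exp (- 3\<alpha>|x|/4)\<close>, so different pulses overlap by \<open>O(exp (- 3\<alpha>X/2))\<close>; the overlaps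
  that are left in \<open>\<langle>s\<^sub>i, s\<^sub>j'\<rangle>\<close> are eliminated by pairing \<open>A w\<^sub>i\<close> with \<open>\<partial>\<^sub>cU\<^sup>k\<close>.
\<close>

section \<open>Square integrable functions\<close>

text \<open>The target accuracy exp (- 3\<alpha>X/2) lies between the two accuracies at hand. For i
  < n the remainder \<open>w\<^sub>i\<close> is of order exp (- 2\<alpha>X), but the last
  eigenfunction is a multiple of the derivative of the n-pulse, which follows the sum of the single
  pulses only to order exp (- \<alpha>X). Inserting the decomposition therefore falls short exactly
  for pairings with \<open>s\<^sub>n'\<close>. These are rewritten by pairing
  \<open>A s\<^sub>n = 0\<close> with \<open>\<partial>\<^sub>cU\<close> at one peak. What is left
  is an overlap of U' and \<open>\<partial>\<^sub>cU\<close> weighted with the difference of two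
  potentials, and the equation for \<open>w\<^sub>i\<close>, i < n, bounds this overlap once it
  carries the factor \<open>d\<^sub>i\<^sub>k\<close>. Compactness gives constants for large m only.
  For each of the finitely many other m the same argument runs with a constant sequence, and the
  constants are merged, so that the estimates hold from \<open>m0\<close> on. The lower bound on the
  complement of S yields injectivity; solvability is taken from points of the resolvent set next to
  0, which exist because 0 is isolated in the spectrum.\<close>

lemma L2_iff: "f \<in> L2 \<longleftrightarrow> f \<in> borel_measurable borel \<and> integrable lborel (\<lambda>x. (cmod (f x))\<^sup>2)"
  by (simp add: L2_def)

lemma L2_measurable [measurable_dest]: "f \<in> L2 \<Longrightarrow> f \<in> borel_measurable borel"
  by (simp add: L2_iff)

lemma L2_integrable: "f \<in> L2 \<Longrightarrow> integrable lborel (\<lambda>x. (cmod (f x))\<^sup>2)"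
  by (simp add: L2_iff)

lemma L2_bound:
  assumes "integrable lborel h" "f \<in> borel_measurable borel" "\<And>x. (cmod (f x))\<^sup>2 \<le> h x"
  shows "f \<in> L2"
  unfolding L2_iff using assms(2) by (auto intro!: Bochner_Integration.integrable_bound[OF assms(1)] AE_I2 order_trans[OF assms(3) abs_ge_self])

lemma cmod_sum_square: "(cmod (a + b))\<^sup>2 \<le> 2 * (cmod a)\<^sup>2 + 2 * (cmod b)\<^sup>2"
proof -
  have "(cmod (a + b))\<^sup>2 \<le> (cmod a + cmod b)\<^sup>2" by (simp add: norm_triangle_ineq power_mono)
  also have "\<dots> \<le> 2 * (cmod a)\<^sup>2 + 2 * (cmod b)\<^sup>2" using sum_squares_bound[of "cmod a" "cmod b"] by (simp add: power2_sum)
  finally show ?thesis .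
qed

lemma L2_add [intro]:
  assumes "f \<in> L2" "g \<in> L2" shows "(\<lambda>x. f x + g x) \<in> L2"
proof (rule L2_bound)
  show "integrable lborel (\<lambda>x. 2 * (cmod (f x))\<^sup>2 + 2 * (cmod (g x))\<^sup>2)" using assms[THEN L2_integrable] by auto
qed (use assms in \<open>auto intro!: cmod_sum_square\<close>)

lemma L2_bounded_mult:
  assumes "f \<in> L2" "q \<in> borel_measurable borel" "\<And>x. cmod (q x) \<le> B"
  shows "(\<lambda>x. q x * f x) \<in> L2"
proof (rule L2_bound)
  show "integrable lborel (\<lambda>x. B\<^sup>2 * (cmod (f x))\<^sup>2)" using assms L2_integrable by auto
  show "(cmod (q x * f x))\<^sup>2 \<le> B\<^sup>2 * (cmod (f x))\<^sup>2" for x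
    using assms(3)[of x] by (auto simp: norm_mult power_mult_distrib intro!: mult_right_mono power_mono)
qed (use assms in auto)

lemma L2_cmul [intro]: "f \<in> L2 \<Longrightarrow> (\<lambda>x. a * f x) \<in> L2"
  by (rule L2_bounded_mult[of _ _ "cmod a"]) auto

lemma L2_zero [simp, intro]: "(\<lambda>x. 0) \<in> L2" by (simp add: L2_iff)

lemma L2_uminus [intro]: "f \<in> L2 \<Longrightarrow> (\<lambda>x. - f x) \<in> L2"
  using L2_cmul[of f "-1"] by simp

lemma L2_diff [intro]: "f \<in> L2 \<Longrightarrow> g \<in> L2 \<Longrightarrow> (\<lambda>x. f x - g x) \<in> L2"
  using L2_add[OF _ L2_uminus] by fastforce

lemma L2_sum [intro]: "(\<And>i. i \<in> I \<Longrightarrow> f i \<in> L2) \<Longrightarrow> (\<lambda>x. \<Sum>i\<in>I. f i x) \<in> L2"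
  by (induction I rule: infinite_finite_induct) auto

lemma L2_cnj [intro]: "f \<in> L2 \<Longrightarrow> (\<lambda>x. cnj (f x)) \<in> L2"
  by (auto simp: L2_iff intro!: measurable_compose[OF _ borel_measurable_continuous_onI[of cnj]] continuous_intros)

lemma L2_mult_integrable:
  assumes "f \<in> L2" "g \<in> L2" shows "integrable lborel (\<lambda>x. f x * g x)"
proof (rule Bochner_Integration.integrable_bound)
  show "integrable lborel (\<lambda>x. (cmod (f x))\<^sup>2 + (cmod (g x))\<^sup>2)" using assms[THEN L2_integrable] by auto
  show "AE x in lborel. norm (f x * g x) \<le> norm ((cmod (f x))\<^sup>2 + (cmod (g x))\<^sup>2)"
  proof (intro AE_I2)
    fix x
    show "norm (f x * g x) \<le> norm ((cmod (f x))\<^sup>2 + (cmod (g x))\<^sup>2)"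
      using sum_squares_bound[of "cmod (f x)" "cmod (g x)"] mult_nonneg_nonneg[of "cmod (f x)" "cmod (g x)"] unfolding norm_mult real_norm_def by linarith
  qed
qed (use assms in auto)

lemma L2_inner_integrable: "f \<in> L2 \<Longrightarrow> g \<in> L2 \<Longrightarrow> integrable lborel (\<lambda>x. f x * cnj (g x))"
  by (intro L2_mult_integrable L2_cnj)

lemma L2_norm_mult_integrable: "f \<in> L2 \<Longrightarrow> g \<in> L2 \<Longrightarrow> integrable lborel (\<lambda>x. cmod (f x) * cmod (g x))"
  using integrable_norm[OF L2_mult_integrable] by (simp add: norm_mult)

lemma L2_norm_nonneg [simp]: "L2_norm f \<ge> 0"
  by (simp add: L2_norm_def)

lemma L2_norm_square: "(L2_norm f)\<^sup>2 = (LINT x|lborel. (cmod (f x))\<^sup>2)"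
  by (simp add: L2_norm_def)

lemma L2_norm_cong: "f =\<^sub>2 g \<Longrightarrow> f \<in> L2 \<Longrightarrow> g \<in> L2 \<Longrightarrow> L2_norm f = L2_norm g"
  unfolding L2_norm_def L2_eq_def by (intro arg_cong[where f=sqrt] integral_cong_AE) auto

lemma L2_inner_cong:
  "f =\<^sub>2 f' \<Longrightarrow> g =\<^sub>2 g' \<Longrightarrow> f \<in> L2 \<Longrightarrow> g \<in> L2 \<Longrightarrow> f' \<in> L2 \<Longrightarrow> g' \<in> L2 \<Longrightarrow>
   L2_inner f g = L2_inner f' g'" unfolding L2_inner_def L2_eq_def by (intro integral_cong_AE borel_measurable_times) (auto simp: L2_cnj L2_measurable)

lemma L2_eq_refl [simp, intro]: "f =\<^sub>2 f" by (simp add: L2_eq_def)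
lemma L2_eq_sym: "f =\<^sub>2 g \<Longrightarrow> g =\<^sub>2 f" by (auto simp: L2_eq_def)
lemma L2_eq_trans [trans]: "f =\<^sub>2 g \<Longrightarrow> g =\<^sub>2 h \<Longrightarrow> f =\<^sub>2 h"
  unfolding L2_eq_def by (erule eventually_elim2, assumption, simp)
lemma L2_eq_add: "f =\<^sub>2 g \<Longrightarrow> f' =\<^sub>2 g' \<Longrightarrow> (\<lambda>x. f x + f' x) =\<^sub>2 (\<lambda>x. g x + g' x)"
  unfolding L2_eq_def by (erule eventually_elim2, assumption, simp)
lemma L2_eq_diff: "f =\<^sub>2 g \<Longrightarrow> f' =\<^sub>2 g' \<Longrightarrow> (\<lambda>x. f x - f' x) =\<^sub>2 (\<lambda>x. g x - g' x)"
  unfolding L2_eq_def by (erule eventually_elim2, assumption, simp)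
lemma L2_eq_mult: "f =\<^sub>2 g \<Longrightarrow> (\<lambda>x. q x * f x) =\<^sub>2 (\<lambda>x. q x * g x)"
  unfolding L2_eq_def by (erule eventually_mono, simp)
lemma L2_eq_sum: "(\<And>i. i \<in> I \<Longrightarrow> f i =\<^sub>2 g i) \<Longrightarrow> (\<lambda>x. \<Sum>i\<in>I. f i x) =\<^sub>2 (\<lambda>x. \<Sum>i\<in>I. g i x)"
  by (induction I rule: infinite_finite_induct) (auto intro: L2_eq_add)

section \<open>The inner product, linear in its first and antilinear in its second argument\<close>

lemma L2_inner_add_left:
  "f \<in> L2 \<Longrightarrow> g \<in> L2 \<Longrightarrow> h \<in> L2 \<Longrightarrow> L2_inner (\<lambda>x. f x + g x) h = L2_inner f h + L2_inner g h"
  unfolding L2_inner_def by (simp add: distrib_right L2_inner_integrable)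

lemma L2_inner_diff_left:
  "f \<in> L2 \<Longrightarrow> g \<in> L2 \<Longrightarrow> h \<in> L2 \<Longrightarrow> L2_inner (\<lambda>x. f x - g x) h = L2_inner f h - L2_inner g h"
  unfolding L2_inner_def by (simp add: left_diff_distrib L2_inner_integrable)

lemma L2_inner_cmul_left: "L2_inner (\<lambda>x. a * f x) h = a * L2_inner f h"
  unfolding L2_inner_def by (simp add: mult.assoc)

lemma L2_inner_cnj: "cnj (L2_inner f g) = L2_inner g f"
  unfolding L2_inner_def by (subst Bochner_Integration.integral_cnj[symmetric]) (simp add: mult.commute)

lemma L2_inner_cmul_right: "L2_inner f (\<lambda>x. a * g x) = cnj a * L2_inner f g"
  using arg_cong[OF L2_inner_cmul_left[of a g f], of cnj] by (simp add: L2_inner_cnj)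

lemma L2_inner_add_right:
  "f \<in> L2 \<Longrightarrow> g \<in> L2 \<Longrightarrow> h \<in> L2 \<Longrightarrow> L2_inner f (\<lambda>x. g x + h x) = L2_inner f g + L2_inner f h"
  using arg_cong[OF L2_inner_add_left[of g h f], of cnj] by (simp add: L2_inner_cnj)

lemma L2_inner_diff_right:
  "f \<in> L2 \<Longrightarrow> g \<in> L2 \<Longrightarrow> h \<in> L2 \<Longrightarrow> L2_inner f (\<lambda>x. g x - h x) = L2_inner f g - L2_inner f h"
  using arg_cong[OF L2_inner_diff_left[of g h f], of cnj] by (simp add: L2_inner_cnj)

lemma L2_inner_zero_left [simp]: "L2_inner (\<lambda>x. 0) f = 0"
  by (simp add: L2_inner_def)
lemma L2_inner_zero_right [simp]: "L2_inner f (\<lambda>x. 0) = 0"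
  by (simp add: L2_inner_def)

lemma L2_inner_sum_left:
  "(\<And>i. i \<in> I \<Longrightarrow> f i \<in> L2) \<Longrightarrow> h \<in> L2 \<Longrightarrow> L2_inner (\<lambda>x. \<Sum>i\<in>I. f i x) h = (\<Sum>i\<in>I. L2_inner (f i) h)"
  by (induction I rule: infinite_finite_induct) (auto simp: L2_inner_add_left L2_sum)

lemma L2_inner_sum_right:
  "(\<And>i. i \<in> I \<Longrightarrow> f i \<in> L2) \<Longrightarrow> h \<in> L2 \<Longrightarrow> L2_inner h (\<lambda>x. \<Sum>i\<in>I. f i x) = (\<Sum>i\<in>I. L2_inner h (f i))"
  by (induction I rule: infinite_finite_induct) (auto simp: L2_inner_add_right L2_sum)

lemma L2_inner_self: "L2_inner f f = of_real ((L2_norm f)\<^sup>2)"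
proof -
  have "L2_inner f f = (LINT x|lborel. of_real ((cmod (f x))\<^sup>2))" unfolding L2_inner_def by (simp only: complex_norm_square)
  then show ?thesis by (simp only: L2_norm_square integral_complex_of_real)
qed

lemma L2_norm_zero [simp]: "L2_norm (\<lambda>x. 0) = 0"
  by (simp add: L2_norm_def)

lemma L2_norm_cmul: "L2_norm (\<lambda>x. a * f x) = cmod a * L2_norm f"
  by (simp add: L2_norm_def norm_mult power_mult_distrib real_sqrt_mult)

lemma L2_norm_uminus [simp]: "L2_norm (\<lambda>x. - f x) = L2_norm f"
  by (simp add: L2_norm_def)

lemma L2_norm_eq_0_iff: "f \<in> L2 \<Longrightarrow> L2_norm f = 0 \<longleftrightarrow> f =\<^sub>2 (\<lambda>x. 0)"
  by (simp add: L2_norm_def L2_eq_def L2_integrable integral_nonneg_eq_0_iff_AE)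

text \<open>A quadratic polynomial in t that is nonnegative everywhere has nonpositive discriminant.
  The minimiser is t = I / B; for B = 0 a large t forces I = 0.\<close>

lemma quadratic_form_bound:
  fixes I A B :: real
  assumes "I \<ge> 0" "A \<ge> 0" "B \<ge> 0" and "\<And>t. 2 * t * I \<le> A + t\<^sup>2 * B"
  shows "I \<le> sqrt A * sqrt B"
proof (cases "B = 0")
  case True
  have "I = 0"
  proof (rule ccontr)
    assume "I \<noteq> 0"
    then show False using assms(4)[of "(A + 1) / (2 * I)"] True by simp
  qed
  then show ?thesis using assms by simp
next
  case False
  then have "B > 0" using assms by simp
  have "2 * (I / B) * I \<le> A + (I / B)\<^sup>2 * B" using assms(4) .
  then have "I\<^sup>2 \<le> A * B" using \<open>B > 0\<close> by (simp add: field_simps power2_eq_square)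
  then show ?thesis using assms by (simp add: real_le_rsqrt flip: real_sqrt_mult)
qed

lemma L2_Cauchy_Schwarz_abs:
  assumes "f \<in> L2" "g \<in> L2"
  shows "(LINT x|lborel. cmod (f x) * cmod (g x)) \<le> L2_norm f * L2_norm g"
  unfolding L2_norm_def
proof (rule quadratic_form_bound)
  fix t :: real
  note [simp] = L2_integrable[OF assms(1)] L2_integrable[OF assms(2)] L2_norm_mult_integrable[OF assms]
  have "2 * t * (LINT x|lborel. cmod (f x) * cmod (g x)) = (LINT x|lborel. 2 * t * (cmod (f x) * cmod (g x)))" by simp
  also have "\<dots> \<le> (LINT x|lborel. (cmod (f x))\<^sup>2 + t\<^sup>2 * (cmod (g x))\<^sup>2)"
  proof (intro integral_mono)
    fix x
    have "0 \<le> (cmod (f x) - t * cmod (g x))\<^sup>2" by simp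
    then show "2 * t * (cmod (f x) * cmod (g x)) \<le> (cmod (f x))\<^sup>2 + t\<^sup>2 * (cmod (g x))\<^sup>2"
      by (simp add: power2_diff algebra_simps power_mult_distrib)
  qed auto
  also have "\<dots> = (LINT x|lborel. (cmod (f x))\<^sup>2) + t\<^sup>2 * (LINT x|lborel. (cmod (g x))\<^sup>2)" by simp
  finally show "2 * t * (LINT x|lborel. cmod (f x) * cmod (g x)) \<le> \<dots>" .
qed auto

lemma L2_Cauchy_Schwarz:
  assumes "f \<in> L2" "g \<in> L2" shows "cmod (L2_inner f g) \<le> L2_norm f * L2_norm g"
proof -
  have "cmod (L2_inner f g) \<le> (LINT x|lborel. norm (f x * cnj (g x)))" unfolding L2_inner_def by (rule integral_norm_bound)
  also have "\<dots> \<le> L2_norm f * L2_norm g" using L2_Cauchy_Schwarz_abs[OF assms] by (simp add: norm_mult)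
  finally show ?thesis .
qed

lemma L2_triangle:
  assumes "f \<in> L2" "g \<in> L2" shows "L2_norm (\<lambda>x. f x + g x) \<le> L2_norm f + L2_norm g"
proof -
  note [simp] = L2_integrable[OF assms(1)] L2_integrable[OF assms(2)] L2_norm_mult_integrable[OF assms]
  have "(L2_norm (\<lambda>x. f x + g x))\<^sup>2 \<le> (LINT x|lborel. (cmod (f x))\<^sup>2 + 2 * (cmod (f x) * cmod (g x)) + (cmod (g x))\<^sup>2)"
    unfolding L2_norm_square
  proof (intro integral_mono)
    show "integrable lborel (\<lambda>x. (cmod (f x + g x))\<^sup>2)" using L2_add[OF assms] by (rule L2_integrable)
    show "(cmod (f x + g x))\<^sup>2 \<le> (cmod (f x))\<^sup>2 + 2 * (cmod (f x) * cmod (g x)) + (cmod (g x))\<^sup>2" for x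
      using power_mono[OF norm_triangle_ineq[of "f x" "g x"], of 2] by (simp add: power2_sum)
  qed auto
  also have "\<dots> \<le> (L2_norm f + L2_norm g)\<^sup>2" using L2_Cauchy_Schwarz_abs[OF assms] by (simp add: power2_sum L2_norm_square)
  finally show ?thesis by (rule power2_le_imp_le) simp
qed

lemma L2_triangle_diff:
  assumes "f \<in> L2" "g \<in> L2" shows "L2_norm (\<lambda>x. f x - g x) \<le> L2_norm f + L2_norm g"
  using L2_triangle[OF assms(1) L2_uminus[OF assms(2)]] by simp

lemma L2_triangle_reverse:
  assumes "f \<in> L2" "g \<in> L2" shows "L2_norm f - L2_norm g \<le> L2_norm (\<lambda>x. f x - g x)"
  using L2_triangle[OF L2_diff[OF assms] assms(2)] by simp

lemma L2_norm_sum: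
  "(\<And>i. i \<in> I \<Longrightarrow> f i \<in> L2) \<Longrightarrow> L2_norm (\<lambda>x. \<Sum>i\<in>I. f i x) \<le> (\<Sum>i\<in>I. L2_norm (f i))"
proof (induction I rule: infinite_finite_induct)
  case (insert i I)
  then have "L2_norm (\<lambda>x. f i x + (\<Sum>i\<in>I. f i x)) \<le> L2_norm (f i) + L2_norm (\<lambda>x. \<Sum>i\<in>I. f i x)"
    by (intro L2_triangle L2_sum) auto
  then show ?case using insert by force
qed auto

lemma L2_norm_mono:
  assumes "f \<in> L2" "g \<in> L2" "\<And>x. cmod (f x) \<le> cmod (g x)"
  shows "L2_norm f \<le> L2_norm g"
  unfolding L2_norm_def using assms by (auto intro!: integral_mono L2_integrable power_mono)

lemma L2_norm_bounded_mult:
  assumes "f \<in> L2" "q \<in> borel_measurable borel" "\<And>x. cmod (q x) \<le> B"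
  shows "L2_norm (\<lambda>x. q x * f x) \<le> B * L2_norm f"
proof -
  have "B \<ge> 0" using assms(3)[of 0] norm_ge_zero order_trans by blast
  have "L2_norm (\<lambda>x. q x * f x) \<le> L2_norm (\<lambda>x. of_real B * f x)"
    using assms \<open>B \<ge> 0\<close> by (intro L2_norm_mono L2_bounded_mult L2_cmul) (auto simp: norm_mult intro!: mult_right_mono)
  then show ?thesis using \<open>B \<ge> 0\<close> by (simp add: L2_norm_cmul)
qed

text \<open>Riesz-Fischer for a geometrically dominated series. The sums \<open>G N\<close> of
  absolute values increase and stay bounded by 2 B in norm, so they converge almost everywhere to a
  square integrable \<open>Ginf\<close>, and \<open>Ginf\<close> dominates all tails of the
  series.\<close>

lemma L2_complete:
  fixes u :: "nat \<Rightarrow> real \<Rightarrow> complex"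
  assumes u: "\<And>k. u k \<in> L2" and B: "\<And>k. L2_norm (u k) \<le> B * (1/2) ^ k"
  shows "\<exists>v\<in>L2. (\<lambda>N. L2_norm (\<lambda>x. v x - (\<Sum>k<N. u k x))) \<longlonglongrightarrow> 0"
proof -
  define G :: "nat \<Rightarrow> real \<Rightarrow> real" where "G N x = (\<Sum>k<N. cmod (u k x))" for N x
  have [measurable]: "u k \<in> borel_measurable borel" for k using u by auto
  have Gmeas[measurable]: "G N \<in> borel_measurable borel" for N unfolding G_def by measurable
  have GL2: "cfun (G N) \<in> L2" for N unfolding G_def of_real_sum by (intro L2_sum) (auto simp: L2_iff u[THEN L2_integrable])
  have Gnorm: "L2_norm (cfun (G N)) \<le> 2 * B" for N
  proof -
    have Bnn: "B \<ge> 0" using order_trans[OF L2_norm_nonneg B[of 0]] by simp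
    have "L2_norm (cfun (G N)) \<le> (\<Sum>k<N. L2_norm (\<lambda>x. complex_of_real (cmod (u k x))))" unfolding G_def of_real_sum
      by (intro L2_norm_sum) (auto simp: L2_iff u[THEN L2_integrable])
    also have "\<dots> = (\<Sum>k<N. L2_norm (u k))" by (simp add: L2_norm_def)
    also have "\<dots> \<le> (\<Sum>k<N. B * (1/2) ^ k)" by (intro sum_mono B)
    also have "\<dots> = B * (\<Sum>k<N. (1/2) ^ k)" by (simp only: sum_distrib_left)
    also have "(\<Sum>k<N. (1/2::real) ^ k) = 2 * (1 - (1/2) ^ N)" by (simp add: sum_gp_strict)
    also have "B * (2 * (1 - (1/2) ^ N)) \<le> B * 2" using Bnn by (intro mult_left_mono) auto
    finally show ?thesis by simp
  qed
  have Gint: "integrable lborel (\<lambda>x. (G N x)\<^sup>2)" for N using L2_integrable[OF GL2] by simp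
  have Gint_le: "(LINT x|lborel. (G N x)\<^sup>2) \<le> (2 * B)\<^sup>2" for N using power_mono[OF Gnorm, of N 2] by (simp add: L2_norm_square)
  have Gmono: "G N x \<le> G M x" if "N \<le> M" for N M x unfolding G_def using that by (intro sum_mono2) auto
  have Gnn: "G N x \<ge> 0" for N x unfolding G_def by (intro sum_nonneg) auto
  \<comment> \<open>In \<open>ennreal\<close> monotone convergence applies before the limit is known
    to be finite; finiteness almost everywhere is then a consequence.\<close>
  define H where "H x = (SUP N. ennreal ((G N x)\<^sup>2))" for x
  have Hmeas: "H \<in> borel_measurable lborel" unfolding H_def by measurable
  have "(\<integral>\<^sup>+x. H x \<partial>lborel) = (SUP N. \<integral>\<^sup>+x. ennreal ((G N x)\<^sup>2) \<partial>lborel)" unfolding H_def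
    by (intro nn_integral_monotone_convergence_SUP) (auto simp: incseq_def le_fun_def intro!: ennreal_leI power_mono Gmono Gnn)
  also have "\<dots> \<le> ennreal ((2 * B)\<^sup>2)" by (intro SUP_least) (use Gint_le in \<open>simp add: nn_integral_eq_integral Gint ennreal_leI\<close>)
  finally have "(\<integral>\<^sup>+x. H x \<partial>lborel) \<noteq> \<infinity>" by (auto simp: top_unique)
  then have "AE x in lborel. H x \<noteq> \<infinity>" using Hmeas by (intro nn_integral_PInf_AE)
  then have conv: "AE x in lborel. summable (\<lambda>k. cmod (u k x))"
  proof eventually_elim
    fix x assume "H x \<noteq> \<infinity>"
    then obtain r where r: "H x = ennreal r" "r \<ge> 0" by (cases "H x") auto
    have "(G N x)\<^sup>2 \<le> r" for N
    proof -
      have "ennreal ((G N x)\<^sup>2) \<le> H x" unfolding H_def by (rule SUP_upper) simp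
      then show ?thesis using r by simp
    qed
    then have "G N x \<le> sqrt r" for N by (simp add: real_le_rsqrt)
    then show "summable (\<lambda>k. cmod (u k x))" unfolding G_def by (intro summableI_nonneg_bounded[where x="sqrt r"]) auto
  qed
  define Ginf where "Ginf x = lim (\<lambda>N. G N x)" for x
  define v where "v x = lim (\<lambda>N. \<Sum>k<N. u k x)" for x
  have [measurable]: "Ginf \<in> borel_measurable borel" "v \<in> borel_measurable borel" unfolding Ginf_def v_def by (auto intro!: borel_measurable_lim_metric)
  have Glim: "AE x in lborel. (\<lambda>N. G N x) \<longlonglongrightarrow> Ginf x" using conv unfolding G_def Ginf_def
    by eventually_elim (auto simp: summable_iff_convergent convergent_LIMSEQ_iff)
  have ulim: "AE x in lborel. (\<lambda>N. \<Sum>k<N. u k x) \<longlonglongrightarrow> v x" using conv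
  proof eventually_elim
    case (elim x)
    then have "summable (\<lambda>k. u k x)" by (rule summable_norm_cancel)
    then show ?case unfolding v_def by (simp add: summable_iff_convergent convergent_LIMSEQ_iff)
  qed
  have Ginf_int: "integrable lborel (\<lambda>x. (Ginf x)\<^sup>2)"
  proof -
    have "incseq (\<lambda>N. LINT x|lborel. (G N x)\<^sup>2)" by (auto simp: incseq_def intro!: integral_mono Gint power_mono Gmono Gnn)
    then obtain L where L: "(\<lambda>N. LINT x|lborel. (G N x)\<^sup>2) \<longlonglongrightarrow> L"
      using incseq_convergent[of _ "(2*B)\<^sup>2"] Gint_le by blast
    show ?thesis by (rule integrable_monotone_convergence[where f="\<lambda>N x. (G N x)\<^sup>2", OF _ _ _ L])
        (use Glim in \<open>auto simp: mono_def intro!: Gint power_mono Gmono Gnn tendsto_intros elim!: eventually_mono\<close>)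
  qed
  have le: "AE x in lborel. \<forall>N. cmod (v x - (\<Sum>k<N. u k x)) \<le> Ginf x" using conv Glim ulim
  proof eventually_elim
    fix x assume a: "summable (\<lambda>k. cmod (u k x))" "(\<lambda>N. G N x) \<longlonglongrightarrow> Ginf x" "(\<lambda>N. \<Sum>k<N. u k x) \<longlonglongrightarrow> v x"
    show "\<forall>N. cmod (v x - (\<Sum>k<N. u k x)) \<le> Ginf x"
    proof
      fix N
      have "(\<lambda>M. cmod ((\<Sum>k<M. u k x) - (\<Sum>k<N. u k x))) \<longlonglongrightarrow> cmod (v x - (\<Sum>k<N. u k x))" by (intro tendsto_intros a)
      moreover have "\<forall>\<^sub>F M in sequentially. cmod ((\<Sum>k<M. u k x) - (\<Sum>k<N. u k x)) \<le> Ginf x"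
      proof (rule eventually_mono[OF eventually_ge_at_top[of N]])
        fix M assume "N \<le> M"
        then have "(\<Sum>k<M. u k x) - (\<Sum>k<N. u k x) = (\<Sum>k\<in>{N..<M}. u k x)"
          using sum_diff_nat_ivl[of 0 N M "\<lambda>k. u k x"] by (simp add: lessThan_atLeast0)
        then have "cmod ((\<Sum>k<M. u k x) - (\<Sum>k<N. u k x)) \<le> (\<Sum>k\<in>{N..<M}. cmod (u k x))" by (simp add: norm_sum)
        also have "\<dots> \<le> G M x" unfolding G_def by (intro sum_mono2) auto
        also have "\<dots> \<le> Ginf x" using incseq_le[OF _ a(2)] Gmono by (auto simp: incseq_def)
        finally show "cmod ((\<Sum>k<M. u k x) - (\<Sum>k<N. u k x)) \<le> Ginf x" .
      qed
      ultimately show "cmod (v x - (\<Sum>k<N. u k x)) \<le> Ginf x" by (intro tendsto_upperbound[of _ _ sequentially]) auto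
    qed
  qed
  have le2: "AE x in lborel. (cmod (v x - (\<Sum>k<N. u k x)))\<^sup>2 \<le> (Ginf x)\<^sup>2" for N using le by eventually_elim (auto intro!: power_mono)
  have vL2: "v \<in> L2" unfolding L2_iff using le2[of 0] by (auto intro!: Bochner_Integration.integrable_bound[OF Ginf_int])
  have "(\<lambda>N. LINT x|lborel. (cmod (v x - (\<Sum>k<N. u k x)))\<^sup>2) \<longlonglongrightarrow> (LINT x|(lborel::real measure). (0::real))"
  proof (rule integral_dominated_convergence[where w="\<lambda>x. (Ginf x)\<^sup>2"])
    show "AE x in lborel. (\<lambda>N. (cmod (v x - (\<Sum>k<N. u k x)))\<^sup>2) \<longlonglongrightarrow> 0" using ulim
    proof eventually_elim
      case (elim x)
      have "(\<lambda>N. (cmod (v x - (\<Sum>k<N. u k x)))\<^sup>2) \<longlonglongrightarrow> (cmod (v x - v x))\<^sup>2" by (intro tendsto_intros elim)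
      then show ?case by simp
    qed
  qed (use le2 Ginf_int in auto)
  then have "(\<lambda>N. L2_norm (\<lambda>x. v x - (\<Sum>k<N. u k x))) \<longlonglongrightarrow> sqrt 0" unfolding L2_norm_def by (intro tendsto_intros) simp
  then show ?thesis using vL2 by auto
qed

section \<open>Test functions and weak derivatives\<close>

text \<open>The differentiability half of \<open>test_functions\<close>, separated from compact
  support so that closure properties can be proved for it alone.\<close>

definition smooth :: "(real \<Rightarrow> real) \<Rightarrow> bool" where
  "smooth f \<longleftrightarrow> (\<forall>k x. (deriv ^^ k) f differentiable (at x))"

text \<open>Smoothness is a greatest fixed point: a class of differentiable functions that is closed
  under \<open>deriv\<close> contains only smooth functions. The later smoothness proofs exhibit
  such a class instead of computing higher derivatives.\<close>

lemma smooth_coinduct: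
  assumes "P f" and "\<And>f. P f \<Longrightarrow> (\<forall>x. f differentiable (at x)) \<and> P (deriv f)"
  shows "smooth f"
proof -
  have "P ((deriv ^^ k) f)" for k by (induction k) (use assms in auto)
  then show ?thesis using assms(2) by (auto simp: smooth_def)
qed

lemma smooth_differentiable: "smooth f \<Longrightarrow> f differentiable (at x)"
  unfolding smooth_def by (metis funpow_0)

lemma smooth_has_derivative: "smooth f \<Longrightarrow> (f has_real_derivative deriv f x) (at x)"
  using DERIV_deriv_iff_real_differentiable smooth_differentiable by blast

lemma smooth_deriv: "smooth f \<Longrightarrow> smooth (deriv f)"
  unfolding smooth_def by (metis comp_apply funpow_Suc_right)

lemma smooth_continuous: "smooth f \<Longrightarrow> continuous_on A f"
  by (meson DERIV_isCont continuous_at_imp_continuous_on smooth_has_derivative)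

lemma smooth_antiderivative:
  assumes "\<And>x. (f has_real_derivative g x) (at x)" "smooth g"
  shows "smooth f"
proof -
  have "deriv f = g" using assms(1) by (auto intro: DERIV_imp_deriv)
  then have "(deriv ^^ k) f differentiable (at x)" for k x
    using assms by (cases k) (auto simp: smooth_def funpow_Suc_right real_differentiable_def simp del: funpow.simps(2))
  then show ?thesis by (simp add: smooth_def)
qed

text \<open>The product rule leads from a product to a sum of two products, so the class that is
  closed under differentiation has to contain sums.\<close>

inductive smooth_products :: "(real \<Rightarrow> real) \<Rightarrow> bool" where
  base: "smooth f \<Longrightarrow> smooth g \<Longrightarrow> smooth_products (\<lambda>x. f x * g x)"
| add: "smooth_products f \<Longrightarrow> smooth_products g \<Longrightarrow> smooth_products (\<lambda>x. f x + g x)"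

lemma smooth_products_deriv:
  "smooth_products h \<Longrightarrow> (\<forall>x. h differentiable (at x)) \<and> smooth_products (deriv h)"
proof (induction rule: smooth_products.induct)
  case (base f g)
  have D: "((\<lambda>x. f x * g x) has_real_derivative (deriv f x * g x + f x * deriv g x)) (at x)" for x
    using base by (auto intro!: derivative_eq_intros smooth_has_derivative)
  then have "deriv (\<lambda>x. f x * g x) = (\<lambda>x. deriv f x * g x + f x * deriv g x)" by (auto intro: DERIV_imp_deriv)
  then show ?case using D base by (auto intro!: smooth_products.intros smooth_deriv simp: real_differentiable_def)
next
  case (add f g)
  have fg: "(f has_real_derivative deriv f x) (at x)" "(g has_real_derivative deriv g x) (at x)" for x using add DERIV_deriv_iff_real_differentiable by blast+
  have D: "((\<lambda>x. f x + g x) has_real_derivative (deriv f x + deriv g x)) (at x)" for x by (intro derivative_intros fg)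
  then have "deriv (\<lambda>x. f x + g x) = (\<lambda>x. deriv f x + deriv g x)" by (auto intro: DERIV_imp_deriv)
  then show ?case using D add by (auto intro!: smooth_products.intros simp: real_differentiable_def)
qed

lemma smooth_mult: "smooth f \<Longrightarrow> smooth g \<Longrightarrow> smooth (\<lambda>x. f x * g x)"
  by (rule smooth_coinduct[where P=smooth_products]) (auto intro: smooth_products.intros dest: smooth_products_deriv)

lemma smooth_const: "smooth (\<lambda>x. c)"
  by (rule smooth_coinduct[where P="\<lambda>f. \<exists>c. f = (\<lambda>x. c)"]) auto

lemma smooth_add:
  assumes "smooth f" "smooth g" shows "smooth (\<lambda>x. f x + g x)"
proof -
  have "smooth_products (\<lambda>x. 1 * f x + 1 * g x)" by (intro smooth_products.intros smooth_const assms)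
  then show ?thesis by (intro smooth_coinduct[where P=smooth_products]) (auto dest: smooth_products_deriv)
qed

text \<open>The constant \<open>C\<close> in the invariant class collects the factors
  \<open>a\<close> that the chain rule produces.\<close>

lemma smooth_affine: "smooth f \<Longrightarrow> smooth (\<lambda>x. f (a * x + b))"
proof (rule smooth_coinduct[where P="\<lambda>h. \<exists>C g. smooth g \<and> h = (\<lambda>x. C * g (a * x + b))"])
  assume "smooth f" then show "\<exists>C g. smooth g \<and> (\<lambda>x. f (a * x + b)) = (\<lambda>x. C * g (a * x + b))"
    by (intro exI[of _ 1] exI[of _ f]) simp
next
  fix h assume "\<exists>C g. smooth g \<and> h = (\<lambda>x. C * g (a * x + b))"
  then obtain C g where g: "smooth g" and h: "h = (\<lambda>x. C * g (a * x + b))" by blast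
  have D: "(h has_real_derivative (C * a) * deriv g (a * x + b)) (at x)" for x
    unfolding h by (rule derivative_eq_intros DERIV_chain2[OF smooth_has_derivative[OF g]] refl | simp)+
  then have "deriv h = (\<lambda>x. (C * a) * deriv g (a * x + b))" by (auto intro: DERIV_imp_deriv)
  then show "(\<forall>x. h differentiable (at x)) \<and> (\<exists>C g. smooth g \<and> deriv h = (\<lambda>x. C * g (a * x + b)))"
    using D smooth_deriv[OF g] by (auto simp: real_differentiable_def)
qed

section \<open>Flat exponentials and bump functions\<close>

text \<open>The classical function exp (- 1/x), continued by zero. The polynomial in 1/x is there to
  make the family closed under differentiation.\<close>

definition flat_exp :: "real poly \<Rightarrow> real \<Rightarrow> real" where
  "flat_exp p x = (if x > 0 then poly p (1 / x) * exp (- (1 / x)) else 0)"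

lemma poly_exp_tendsto_0: "((\<lambda>y. poly p y * exp (- y)) \<longlongrightarrow> (0::real)) at_top"
proof -
  have "((\<lambda>y. \<Sum>i\<le>degree p. coeff p i * (y ^ i / exp y)) \<longlongrightarrow> (\<Sum>i\<le>degree p. coeff p i * 0)) at_top"
    by (intro tendsto_intros tendsto_power_div_exp_0)
  then show ?thesis by (simp add: poly_altdef exp_minus field_simps sum_divide_distrib)
qed

text \<open>With y = 1/x, the derivative of p(y) exp (- y) in x is y^2 (p(y) - p'(y)) exp (- y),
  which explains the new polynomial. At 0 both one-sided difference quotients tend to 0, as exp (-
  y) beats every polynomial.\<close>

lemma flat_exp_derivative:
  "(flat_exp p has_real_derivative flat_exp (monom 1 2 * (p - pderiv p)) x) (at x)"
proof -
  consider "x > 0" | "x < 0" | "x = 0" by linarith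
  then show ?thesis
  proof cases
    case 1
    have "((\<lambda>x. poly p (1 / x) * exp (- (1 / x))) has_real_derivative
        flat_exp (monom 1 2 * (p - pderiv p)) x) (at x)" using 1 by (auto intro!: derivative_eq_intros DERIV_chain2[OF poly_DERIV]
        simp: flat_exp_def poly_monom field_simps power2_eq_square)
    then show ?thesis by (rule has_field_derivative_transform_within_open[where S="{0<..}"]) (use 1 in \<open>auto simp: flat_exp_def\<close>)
  next
    case 2
    have "((\<lambda>x. 0) has_real_derivative flat_exp (monom 1 2 * (p - pderiv p)) x) (at x)" using 2 by (simp add: flat_exp_def)
    then show ?thesis by (rule has_field_derivative_transform_within_open[where S="{..<0}"]) (use 2 in \<open>auto simp: flat_exp_def\<close>)
  next
    case 3
    have r: "((\<lambda>y. (flat_exp p y - flat_exp p 0) / (y - 0)) \<longlongrightarrow> 0) (at_right 0)"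
    proof -
      have "((\<lambda>y. poly (monom 1 1 * p) y * exp (- y)) \<longlongrightarrow> 0) at_top" by (rule poly_exp_tendsto_0)
      then have "((\<lambda>y. poly (monom 1 1 * p) (inverse y) * exp (- inverse y)) \<longlongrightarrow> 0) (at_right 0)"
        by (simp add: filterlim_at_right_to_top)
      then show ?thesis by (rule Lim_transform_eventually) (auto simp: eventually_at_filter flat_exp_def poly_monom field_simps)
    qed
    have l: "((\<lambda>y. (flat_exp p y - flat_exp p 0) / (y - 0)) \<longlongrightarrow> 0) (at_left 0)"
      by (rule tendsto_eventually) (auto simp: eventually_at_filter flat_exp_def)
    show ?thesis unfolding 3 has_field_derivative_iff using filterlim_split_at[OF l r] by (simp add: flat_exp_def)
  qed
qed

lemma smooth_flat_exp: "smooth (flat_exp p)"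
proof (rule smooth_coinduct[where P="\<lambda>h. \<exists>p. h = flat_exp p"])
  fix h assume "\<exists>p. h = flat_exp p"
  then obtain p where h: "h = flat_exp p" by blast
  have "deriv h = flat_exp (monom 1 2 * (p - pderiv p))" unfolding h using flat_exp_derivative by (auto intro: DERIV_imp_deriv)
  then show "(\<forall>x. h differentiable (at x)) \<and> (\<exists>p. deriv h = flat_exp p)"
    using flat_exp_derivative h by (auto simp: real_differentiable_def)
qed auto

text \<open>As \<open>k\<close> grows, both factors tend to 1 inside the interval, and outside one
  of them vanishes: these test functions approach the indicator of the open interval from
  below.\<close>

definition bump :: "real \<Rightarrow> real \<Rightarrow> real \<Rightarrow> real \<Rightarrow> real" where
  "bump k a b x = flat_exp 1 (k * (x - a)) * flat_exp 1 (k * (b - x))"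

lemma test_functions_iff:
  "\<phi> \<in> test_functions \<longleftrightarrow> smooth \<phi> \<and> (\<exists>R. \<forall>x. \<bar>x\<bar> > R \<longrightarrow> \<phi> x = 0)"
  by (simp add: test_functions_def smooth_def)

lemma bump_test:
  assumes "k > 0" shows "bump k a b \<in> test_functions"
proof -
  have "smooth (\<lambda>x. flat_exp 1 (k * x + (- k * a)) * flat_exp 1 ((- k) * x + k * b))" by (intro smooth_mult smooth_affine smooth_flat_exp)
  then have "smooth (bump k a b)" by (simp add: bump_def[abs_def] algebra_simps)
  moreover have "bump k a b x = 0" if "\<bar>x\<bar> > \<bar>a\<bar> + \<bar>b\<bar>" for x
  proof -
    have "x < a \<or> x > b" using that by linarith
    then have "k * (x - a) \<le> 0 \<or> k * (b - x) \<le> 0" using assms by (auto simp: mult_le_0_iff)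
    then show ?thesis by (auto simp: bump_def flat_exp_def)
  qed
  ultimately show ?thesis unfolding test_functions_iff by blast
qed

lemma bump_bounds:
  assumes "k > 0" shows "0 \<le> bump k a b x" "bump k a b x \<le> indicator {a<..<b} x"
proof -
  have f: "0 \<le> flat_exp 1 y" "flat_exp 1 y \<le> 1" for y by (auto simp: flat_exp_def)
  show "0 \<le> bump k a b x" by (simp add: bump_def f)
  show "bump k a b x \<le> indicator {a<..<b} x"
  proof (cases "x \<in> {a<..<b}")
    case True then show ?thesis by (simp add: bump_def f mult_le_one)
  next
    case False
    then have "k * (x - a) \<le> 0 \<or> k * (b - x) \<le> 0" using assms by (auto simp: mult_le_0_iff)
    then show ?thesis using False by (auto simp: bump_def flat_exp_def)
  qed
qed

lemma bump_tendsto: "(\<lambda>n. bump (real (Suc n)) a b x) \<longlonglongrightarrow> indicator {a<..<b} x"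
proof (cases "x \<in> {a<..<b}")
  case True
  have lim: "(\<lambda>n. flat_exp 1 (real (Suc n) * c)) \<longlonglongrightarrow> 1" if "c > 0" for c
  proof -
    have "(\<lambda>n. exp (- (inverse (real (Suc n)) * (1 / c)))) \<longlonglongrightarrow> exp (- (0 * (1 / c)))"
      by (intro tendsto_intros LIMSEQ_inverse_real_of_nat)
    moreover have "flat_exp 1 (real (Suc n) * c) = exp (- (inverse (real (Suc n)) * (1 / c)))" for n
      using that mult_pos_pos[of "real (Suc n)" c] by (simp add: flat_exp_def field_simps del: of_nat_Suc)
    ultimately show ?thesis by simp
  qed
  have "(\<lambda>n. bump (real (Suc n)) a b x) \<longlonglongrightarrow> 1 * 1" unfolding bump_def by (intro tendsto_mult lim) (use True in auto)
  then show ?thesis using True by simp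
next
  case False
  have "bump (real (Suc n)) a b x = 0" for n using bump_bounds[of "real (Suc n)" a b x] False by simp
  then show ?thesis using False by simp
qed

section \<open>The fundamental lemma of the calculus of variations\<close>

lemma L2_set_integrable:
  assumes "f \<in> L2" shows "set_integrable lborel {a..b::real} f"
  unfolding set_integrable_def
proof (rule Bochner_Integration.integrable_bound)
  show "integrable lborel (\<lambda>x. (cmod (f x))\<^sup>2 + indicator {a..b} x :: real)"
    using L2_integrable[OF assms] by (intro Bochner_Integration.integrable_add integrable_real_indicator) (auto simp: emeasure_lborel_Icc_eq)
  show "AE x in lborel. norm (indicat_real {a..b} x *\<^sub>R f x) \<le> norm ((cmod (f x))\<^sup>2 + indicat_real {a..b} x)"
  proof (intro AE_I2)
    fix x
    have "cmod (f x) \<le> (cmod (f x))\<^sup>2 + 1" using sum_squares_bound[of "cmod (f x)" 1] norm_ge_zero[of "f x"] unfolding one_power2 by linarith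
    then show "norm (indicat_real {a..b} x *\<^sub>R f x) \<le> norm ((cmod (f x))\<^sup>2 + indicat_real {a..b} x)" by (auto simp: indicator_def)
  qed
qed (use assms in auto)

lemma continuous_set_integrable:
  fixes f :: "real \<Rightarrow> 'a::{banach, second_countable_topology}"
  shows "continuous_on {a..b} f \<Longrightarrow> set_integrable lborel {a..b} f"
  unfolding set_integrable_def by (rule borel_integrable_compact) auto

text \<open>The positive and the negative part of \<open>u\<close> are densities of two measures
  that agree on all rays. Rays determine a measure, so the densities agree almost everywhere, and
  the two parts of a real number are equal only if it is 0.\<close>

lemma AE_zero_from_rays:
  fixes u :: "real \<Rightarrow> real"
  assumes u: "integrable lborel u" and 0: "\<And>x. (LINT y:{x<..}|lborel. u y) = 0"
  shows "AE x in lborel. u x = 0"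
proof -
  have [measurable]: "u \<in> borel_measurable borel" using borel_measurable_integrable[OF u] by simp
  let ?M = "density lborel (\<lambda>x. ennreal (u x))" and ?N = "density lborel (\<lambda>x. ennreal (- u x))"
  have int: "integrable lborel (\<lambda>y. u y * indicator {x<..} y)" for x using integrable_real_mult_indicator[OF _ u, of "{x<..}"] by simp
  have e: "emeasure ?M {x<..} = (\<integral>\<^sup>+y. ennreal (u y * indicator {x<..} y) \<partial>lborel)"
    "emeasure ?N {x<..} = (\<integral>\<^sup>+y. ennreal (- (u y * indicator {x<..} y)) \<partial>lborel)" for x
    by (auto simp: emeasure_density intro!: nn_integral_cong split: split_indicator)
  have fin: "(\<integral>\<^sup>+y. ennreal (u y * indicator {x<..} y) \<partial>lborel) \<noteq> \<infinity>"
    "(\<integral>\<^sup>+y. ennreal (- (u y * indicator {x<..} y)) \<partial>lborel) \<noteq> \<infinity>" for x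
    using int[of x] unfolding real_integrable_def by auto
  have eq: "emeasure ?M {x<..} = emeasure ?N {x<..}" for x
  proof -
    have "(LINT y|lborel. u y * indicator {x<..} y) = 0" using 0[of x] by (simp add: set_lebesgue_integral_def mult.commute)
    then have r: "enn2real (\<integral>\<^sup>+y. ennreal (u y * indicator {x<..} y) \<partial>lborel) =
        enn2real (\<integral>\<^sup>+y. ennreal (- (u y * indicator {x<..} y)) \<partial>lborel)" unfolding real_lebesgue_integral_def[OF int] by simp
    have eq_of_real: "A = B" if "enn2real A = enn2real B" "A \<noteq> \<infinity>" "B \<noteq> \<infinity>" for A B
      using that by (metis ennreal_enn2real infinity_ennreal_def less_top)
    show ?thesis unfolding e by (rule eq_of_real[OF r fin])
  qed
  have "?M = ?N" using fin eq by (intro measure_eqI_lessThan) (auto simp: e top.not_eq_extremum)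
  then have "AE x in lborel. ennreal (u x) = ennreal (- u x)" by (intro sigma_finite_measure.density_unique[OF sigma_finite_lborel]) auto
  then show ?thesis
  proof eventually_elim
    case (elim x)
    then show ?case by (cases "u x \<ge> 0") (auto simp: ennreal_eq_0_iff ennreal_neg)
  qed
qed

text \<open>Bump functions carry the hypothesis over to indicators of bounded intervals, and these
  determine the function. Local integrability is the right assumption because the lemma is later
  applied to a primitive that need not be square integrable.\<close>

lemma fundamental_lemma:
  fixes h :: "real \<Rightarrow> complex"
  assumes [measurable]: "h \<in> borel_measurable borel" and int: "\<And>a b. set_integrable lborel {a..b} h"
    and test: "\<And>\<phi>. \<phi> \<in> test_functions \<Longrightarrow> (LINT x|lborel. h x * cfun \<phi> x) = 0"
  shows "AE x in lborel. h x = 0"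
proof -
  have interval: "(LINT x|lborel. indicator {a<..<b} x *\<^sub>R h x) = 0" for a b
  proof -
    have "(\<lambda>n. LINT x|lborel. h x * cfun (bump (real (Suc n)) a b) x) \<longlonglongrightarrow>
        (LINT x|lborel. indicator {a<..<b} x *\<^sub>R h x)"
    proof (rule integral_dominated_convergence)
      show "integrable lborel (\<lambda>x. norm (indicator {a..b} x *\<^sub>R h x))" using int[of a b] unfolding set_integrable_def by (rule integrable_norm)
      show "AE x in lborel. (\<lambda>n. h x * cfun (bump (real (Suc n)) a b) x) \<longlonglongrightarrow> indicator {a<..<b} x *\<^sub>R h x"
      proof (intro AE_I2)
        fix x
        have "(\<lambda>n. h x * cfun (bump (real (Suc n)) a b) x) \<longlonglongrightarrow> h x * of_real (indicator {a<..<b} x)"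
          by (intro tendsto_intros bump_tendsto)
        then show "(\<lambda>n. h x * cfun (bump (real (Suc n)) a b) x) \<longlonglongrightarrow> indicator {a<..<b} x *\<^sub>R h x"
          by (simp add: scaleR_conv_of_real mult.commute)
      qed
      show "AE x in lborel. norm (h x * cfun (bump (real (Suc n)) a b) x) \<le> norm (indicator {a..b} x *\<^sub>R h x)" for n
      proof (intro AE_I2)
        fix x
        have "\<bar>bump (real (Suc n)) a b x\<bar> \<le> indicator {a..b} x"
        proof -
          have "indicator {a<..<b} x \<le> (indicator {a..b} x :: real)" by (auto simp: indicator_def)
          then show ?thesis using bump_bounds[of "real (Suc n)" a b x] by linarith
        qed
        then have "cmod (h x) * \<bar>bump (real (Suc n)) a b x\<bar> \<le> cmod (h x) * indicator {a..b} x" by (intro mult_left_mono) auto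
        then show "norm (h x * cfun (bump (real (Suc n)) a b) x) \<le> norm (indicator {a..b} x *\<^sub>R h x)" by (simp add: norm_mult mult.commute)
      qed
      have "bump (real (Suc n)) a b \<in> borel_measurable borel" for n using bump_test[of "real (Suc n)" a b]
        by (auto simp: test_functions_iff intro!: borel_measurable_continuous_onI smooth_continuous)
      then show "(\<lambda>x. h x * cfun (bump (real (Suc n)) a b) x) \<in> borel_measurable lborel" for n by simp
    qed simp
    then show ?thesis using test[OF bump_test, of "real (Suc _)"] by (simp add: LIMSEQ_const_iff)
  qed
  \<comment> \<open>\<open>h\<close> is only locally integrable, so it is cut off before the
    criterion on rays, which asks for integrability, is applied to its real and imaginary
    part.\<close>
  have bounded: "AE x in lborel. indicator {-R<..<R} x *\<^sub>R h x = 0" for R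
  proof -
    let ?h = "\<lambda>x. indicator {-R<..<R} x *\<^sub>R h x"
    have hint: "integrable lborel ?h" unfolding set_integrable_def[symmetric] by (rule set_integrable_subset[OF int[of "-R" R]]) auto
    have ray: "(LINT y|lborel. indicator {x<..} y *\<^sub>R ?h y) = 0" for x
    proof -
      have "(LINT y|lborel. indicator {x<..} y *\<^sub>R ?h y) = (LINT y|lborel. indicator {max x (-R)<..<R} y *\<^sub>R h y)"
        by (intro Bochner_Integration.integral_cong) (auto simp: indicator_def)
      then show ?thesis by (simp only: interval)
    qed
    have hint': "integrable lborel (\<lambda>y. indicator {x<..} y *\<^sub>R ?h y)" for x by (rule integrable_mult_indicator) (use hint in auto)
    have "(LINT y:{x<..}|lborel. Re (?h y)) = 0" for x using integral_Re[OF hint', of x] ray[of x] by (simp add: set_lebesgue_integral_def mult.assoc)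
    then have "AE x in lborel. Re (?h x) = 0" by (intro AE_zero_from_rays integrable_Re hint)
    moreover have "(LINT y:{x<..}|lborel. Im (?h y)) = 0" for x using integral_Im[OF hint', of x] ray[of x] by (simp add: set_lebesgue_integral_def mult.assoc)
    then have "AE x in lborel. Im (?h x) = 0" by (intro AE_zero_from_rays integrable_Im hint)
    ultimately show ?thesis by eventually_elim (simp add: complex_eq_iff)
  qed
  have "AE x in lborel. \<forall>n. indicator {-real n<..<real n} x *\<^sub>R h x = 0" unfolding AE_all_countable using bounded by blast
  then show ?thesis
  proof eventually_elim
    case (elim x)
    obtain n where "\<bar>x\<bar> < real n" using reals_Archimedean2 by blast
    then show ?case using elim[rule_format, of n] by (auto simp: indicator_def split: if_splits)
  qed
qed

section \<open>Calculus of test functions and uniqueness of weak derivatives\<close>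

lemma test_continuous: "\<phi> \<in> test_functions \<Longrightarrow> continuous_on A \<phi>"
  by (simp add: test_functions_iff smooth_continuous)

lemma test_measurable [measurable_dest]: "\<phi> \<in> test_functions \<Longrightarrow> \<phi> \<in> borel_measurable borel"
  by (intro borel_measurable_continuous_onI test_continuous)

lemma test_deriv:
  assumes "\<phi> \<in> test_functions" shows "deriv \<phi> \<in> test_functions"
proof -
  obtain R where R: "\<bar>x\<bar> > R \<Longrightarrow> \<phi> x = 0" for x using assms by (auto simp: test_functions_iff)
  have "deriv \<phi> x = 0" if "\<bar>x\<bar> > R" for x
  proof -
    have "(\<phi> has_real_derivative 0) (at x)"
    proof (rule has_field_derivative_transform_within_open[where f="\<lambda>x. 0" and S="{x. \<bar>x\<bar> > R}"])
      show "open {x::real. \<bar>x\<bar> > R}" by (intro open_Collect_less continuous_intros)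
      show "0 = \<phi> y" if "y \<in> {x. \<bar>x\<bar> > R}" for y using R[of y] that by simp
    qed (use that in auto)
    then show ?thesis by (rule DERIV_imp_deriv)
  qed
  then show ?thesis using assms smooth_deriv by (auto simp: test_functions_iff)
qed

lemma test_has_derivative: "\<phi> \<in> test_functions \<Longrightarrow> (\<phi> has_real_derivative deriv \<phi> x) (at x)"
  by (simp add: test_functions_iff smooth_has_derivative)

lemma test_L2:
  assumes "\<phi> \<in> test_functions" shows "cfun \<phi> \<in> L2"
proof -
  obtain R where R: "\<bar>x\<bar> > R \<Longrightarrow> \<phi> x = 0" for x using assms by (auto simp: test_functions_iff)
  have "set_integrable lborel {-R..R} (\<lambda>x. (\<phi> x)\<^sup>2)" by (intro continuous_set_integrable continuous_intros test_continuous assms)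
  moreover have "indicator {-R..R} x *\<^sub>R (\<phi> x)\<^sup>2 = (\<phi> x)\<^sup>2" for x
    using R[of x] by (cases "\<bar>x\<bar> > R") (auto simp: indicator_def)
  ultimately have "integrable lborel (\<lambda>x. (\<phi> x)\<^sup>2)" unfolding set_integrable_def by (simp only:)
  then show ?thesis using assms by (simp add: L2_iff test_measurable)
qed

lemma weak_deriv_unique:
  assumes "g \<in> L2" "g' \<in> L2" "is_weak_deriv k f g" "is_weak_deriv k f g'"
  shows "g =\<^sub>2 g'"
proof -
  have "AE x in lborel. g x - g' x = 0"
  proof (rule fundamental_lemma)
    fix \<phi> assume \<phi>: "\<phi> \<in> test_functions"
    have "(LINT x|lborel. g x * cfun \<phi> x) = (LINT x|lborel. g' x * cfun \<phi> x)" using assms(3,4) \<phi> by (auto simp: is_weak_deriv_def)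
    then show "(LINT x|lborel. (g x - g' x) * cfun \<phi> x) = 0" using assms(1,2) \<phi> by (simp add: left_diff_distrib L2_mult_integrable test_L2)
  qed (use L2_diff[OF assms(1,2)] in \<open>auto intro: L2_set_integrable\<close>)
  then show ?thesis by (simp add: L2_eq_def)
qed

lemma is_weak_deriv_cong: "f =\<^sub>2 f' \<Longrightarrow> f \<in> L2 \<Longrightarrow> f' \<in> L2 \<Longrightarrow> is_weak_deriv k f g = is_weak_deriv k f' g"
proof -
  assume a: "f =\<^sub>2 f'" "f \<in> L2" "f' \<in> L2"
  have "(LINT x|lborel. f x * cfun ((deriv ^^ k) \<phi>) x) = (LINT x|lborel. f' x * cfun ((deriv ^^ k) \<phi>) x)"
    if "\<phi> \<in> test_functions" for \<phi>
  proof -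
    have [measurable]: "(deriv ^^ k) \<phi> \<in> borel_measurable borel" using that by (intro test_measurable) (induction k, auto intro: test_deriv)
    show ?thesis using a unfolding L2_eq_def by (intro integral_cong_AE) auto
  qed
  then show ?thesis by (simp add: is_weak_deriv_def)
qed

lemma weak_deriv_cong: "f =\<^sub>2 f' \<Longrightarrow> f \<in> L2 \<Longrightarrow> f' \<in> L2 \<Longrightarrow> weak_deriv k f = weak_deriv k f'"
  unfolding weak_deriv_def by (simp add: is_weak_deriv_cong[of f f'])

section \<open>Primitives and integration by parts\<close>

text \<open>A relation between given representatives, whereas \<open>weak_deriv\<close> is a choice
  up to null sets. Chains of derivatives, sums and limits are stated through it.\<close>

definition wd :: "(real \<Rightarrow> complex) \<Rightarrow> (real \<Rightarrow> complex) \<Rightarrow> bool" where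
  "wd f g \<longleftrightarrow> f \<in> L2 \<and> g \<in> L2 \<and> is_weak_deriv 1 f g"

text \<open>\<open>F\<close> is locally absolutely continuous with derivative \<open>f\<close>
  almost everywhere; the integral form expresses this without mentioning pointwise
  derivatives.\<close>

definition antideriv :: "(real \<Rightarrow> complex) \<Rightarrow> (real \<Rightarrow> complex) \<Rightarrow> bool" where
  "antideriv F f \<longleftrightarrow> (\<forall>a b. a \<le> b \<longrightarrow> set_integrable lborel {a..b} f \<and> F b - F a = (LINT x:{a..b}|lborel. f x))"

lemma antiderivI:
  "(\<And>a b. a \<le> b \<Longrightarrow> set_integrable lborel {a..b} f) \<Longrightarrow>
   (\<And>a b. a \<le> b \<Longrightarrow> F b - F a = (LINT x:{a..b}|lborel. f x)) \<Longrightarrow> antideriv F f" by (simp add: antideriv_def)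

lemma antideriv_integrable: "antideriv F f \<Longrightarrow> set_integrable lborel {a..b} f"
  by (cases "a \<le> b") (auto simp: antideriv_def)

lemma antideriv_eq: "antideriv F f \<Longrightarrow> a \<le> b \<Longrightarrow> F b - F a = (LINT x:{a..b}|lborel. f x)"
  by (simp add: antideriv_def)

lemma antideriv_continuous:
  assumes "antideriv F f" shows "continuous_on A F"
proof -
  have "continuous_on {a..b} F" if "a \<le> b" for a b
  proof -
    have int: "set_integrable lborel {a..b} f" using assms by (rule antideriv_integrable)
    have "f integrable_on {a..b}" using set_borel_integral_eq_integral(1)[OF int] .
    then have "continuous_on {a..b} (\<lambda>x. F a + integral {a..x} f)" by (intro continuous_intros indefinite_integral_continuous_1)
    then show ?thesis
    proof (rule continuous_on_eq)
      fix x assume x: "x \<in> {a..b}"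
      have "F x - F a = (LINT y:{a..x}|lborel. f y)" using assms x by (auto intro: antideriv_eq)
      also have "\<dots> = integral {a..x} f" by (rule set_borel_integral_eq_integral(2)) (rule antideriv_integrable[OF assms])
      finally show "F a + integral {a..x} f = F x" by (simp add: algebra_simps)
    qed
  qed
  then have "isCont F x" for x using continuous_on_interior[of "{x-1..x+1}" F x] by auto
  then show ?thesis by (simp add: continuous_at_imp_continuous_on)
qed

lemma antideriv_cong: "antideriv F f \<Longrightarrow> f =\<^sub>2 g \<Longrightarrow> g \<in> L2 \<Longrightarrow> f \<in> L2 \<Longrightarrow> antideriv F g"
  unfolding antideriv_def L2_eq_def by (auto intro!: L2_set_integrable set_lebesgue_integral_cong_AE elim: eventually_mono)

lemma antideriv_has_vector_derivative:
  assumes "antideriv F f" "continuous_on UNIV f"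
  shows "(F has_vector_derivative f x) (at x)"
proof -
  have eq: "F y = F (x-1) + integral {x-1..y} f" if "y \<in> {x-1<..<x+1}" for y
  proof -
    have "F y - F (x-1) = (LINT t:{x-1..y}|lborel. f t)" using that by (intro antideriv_eq assms) auto
    also have "\<dots> = integral {x-1..y} f" by (rule set_borel_integral_eq_integral(2)) (rule antideriv_integrable[OF assms(1)])
    finally show ?thesis by (simp add: algebra_simps)
  qed
  have "((\<lambda>y. F (x-1) + integral {x-1..y} f) has_vector_derivative f x) (at x within {x-1..x+1})"
    using has_vector_derivative_add[OF has_vector_derivative_const integral_has_vector_derivative[of "x-1" "x+1" f x]]
      continuous_on_subset[OF assms(2)] by simp
  then have "((\<lambda>y. F (x-1) + integral {x-1..y} f) has_vector_derivative f x) (at x)" by (simp add: at_within_interior[of x "{x-1..x+1}"])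
  then show ?thesis by (rule has_vector_derivative_transform_within_open[where S="{x-1<..<x+1}"]) (use eq in auto)
qed

lemma has_vector_derivative_antideriv:
  assumes "\<And>x. (F has_vector_derivative f x) (at x)" "continuous_on UNIV f"
  shows "antideriv F f"
proof (rule antiderivI)
  fix a b :: real assume "a \<le> b"
  show int: "set_integrable lborel {a..b} f" by (rule continuous_set_integrable) (rule continuous_on_subset[OF assms(2)], simp)
  have "(f has_integral F b - F a) {a..b}"
    by (rule fundamental_theorem_of_calculus[OF \<open>a \<le> b\<close>]) (rule has_vector_derivative_at_within[OF assms(1)])
  then show "F b - F a = (LINT x:{a..b}|lborel. f x)" using set_borel_integral_eq_integral(2)[OF int] by (simp add: integral_unique)
qed

text \<open>Fubini on the triangle t <= x. It is the core of integration by parts for primitives of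
  merely integrable functions, where no pointwise product rule is at hand.\<close>

lemma integral_triangle_swap:
  fixes g k :: "real \<Rightarrow> complex"
  assumes g: "integrable lborel g" and k: "integrable lborel k"
  shows "(LINT x|lborel. (LINT t|lborel. indicator {..x} t *\<^sub>R g t) * k x) =
         (LINT t|lborel. g t * (LINT x|lborel. indicator {t..} x *\<^sub>R k x))"
    and "integrable lborel (\<lambda>x. (LINT t|lborel. indicator {..x} t *\<^sub>R g t) * k x)"
    and "integrable lborel (\<lambda>t. g t * (LINT x|lborel. indicator {t..} x *\<^sub>R k x))"
proof -
  have [measurable]: "g \<in> borel_measurable borel" "k \<in> borel_measurable borel"
    using borel_measurable_integrable[OF g] borel_measurable_integrable[OF k] by auto
  define p :: "real \<Rightarrow> real \<Rightarrow> complex" where "p x t = (if t \<le> x then g t * k x else 0)" for x t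
  have pm: "case_prod p \<in> borel_measurable (lborel \<Otimes>\<^sub>M lborel)" unfolding p_def[abs_def] by measurable
  have base: "integrable (lborel \<Otimes>\<^sub>M lborel) (\<lambda>(x, t). g t * k x)"
  proof (rule lborel_pair.Fubini_integrable)
    have "integrable lborel (\<lambda>x. norm (k x) * (LINT t|lborel. norm (g t)))" using k by (intro integrable_mult_left integrable_norm)
    then show "integrable lborel (\<lambda>x. LINT t|lborel. norm (case (x, t) of (x, t) \<Rightarrow> g t * k x))" by (simp add: norm_mult mult.commute)
    show "AE x in lborel. integrable lborel (\<lambda>t. case (x, t) of (x, t) \<Rightarrow> g t * k x)" using g by auto
  qed measurable
  have pint: "integrable (lborel \<Otimes>\<^sub>M lborel) (case_prod p)"
    by (rule Bochner_Integration.integrable_bound[OF base]) (use pm in \<open>auto simp: p_def\<close>)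
  have px: "(LINT t|lborel. p x t) = (LINT t|lborel. indicator {..x} t *\<^sub>R g t) * k x" for x
    by (subst integral_mult_left_zero[symmetric]) (auto simp: p_def indicator_def intro!: Bochner_Integration.integral_cong)
  have pt: "(LINT x|lborel. p x t) = g t * (LINT x|lborel. indicator {t..} x *\<^sub>R k x)" for t
    by (subst integral_mult_right_zero[symmetric]) (auto simp: p_def indicator_def intro!: Bochner_Integration.integral_cong)
  show "(LINT x|lborel. (LINT t|lborel. indicator {..x} t *\<^sub>R g t) * k x) =
         (LINT t|lborel. g t * (LINT x|lborel. indicator {t..} x *\<^sub>R k x))" using lborel_pair.Fubini_integral[OF pint] unfolding px pt by simp
  show "integrable lborel (\<lambda>x. (LINT t|lborel. indicator {..x} t *\<^sub>R g t) * k x)" using lborel_pair.integrable_fst[OF pint] unfolding px .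
  show "integrable lborel (\<lambda>t. g t * (LINT x|lborel. indicator {t..} x *\<^sub>R k x))" using lborel_pair.integrable_snd[OF pint] unfolding pt .
qed

lemma antideriv_by_parts:
  assumes F: "antideriv F f" and G: "antideriv G g" and "a \<le> b"
  shows "(LINT x:{a..b}|lborel. f x * G x + F x * g x) = F b * G b - F a * G a"
proof -
  let ?I = "indicator {a..b} :: real \<Rightarrow> real"
  let ?f = "\<lambda>x. ?I x *\<^sub>R f x" and ?g = "\<lambda>x. ?I x *\<^sub>R g x"
  have int: "integrable lborel ?f" "integrable lborel ?g"
    using antideriv_integrable[OF F, of a b] antideriv_integrable[OF G, of a b] by (auto simp: set_integrable_def)
  have 1: "(LINT t|lborel. indicator {..x} t *\<^sub>R ?f t) = F x - F a" if "x \<in> {a..b}" for x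
  proof -
    have "(LINT t|lborel. indicator {..x} t *\<^sub>R ?f t) = (LINT t:{a..x}|lborel. f t)" unfolding set_lebesgue_integral_def
      by (intro Bochner_Integration.integral_cong) (use that in \<open>auto simp: indicator_def\<close>)
    then show ?thesis using antideriv_eq[OF F, of a x] that by simp
  qed
  have 2: "(LINT t|lborel. indicator {x..} t *\<^sub>R ?g t) = G b - G x" if "x \<in> {a..b}" for x
  proof -
    have "(LINT t|lborel. indicator {x..} t *\<^sub>R ?g t) = (LINT t:{x..b}|lborel. g t)" unfolding set_lebesgue_integral_def
      by (intro Bochner_Integration.integral_cong) (use that in \<open>auto simp: indicator_def\<close>)
    then show ?thesis using antideriv_eq[OF G, of x b] that by simp
  qed
  have e1: "(LINT t|lborel. indicator {..x} t *\<^sub>R ?f t) * ?g x = (F x - F a) * ?g x" for x using 1[of x] by (cases "x \<in> {a..b}") auto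
  have e2: "?f x * (LINT t|lborel. indicator {x..} t *\<^sub>R ?g t) = ?f x * (G b - G x)" for x using 2[of x] by (cases "x \<in> {a..b}") auto
  note sw = integral_triangle_swap[OF int, unfolded e1 e2]
  \<comment> \<open>\<open>G\<close> is measured from its value at b and \<open>F\<close> from its
    value at a. The two resulting double integrals run over the same triangle and cancel.\<close>
  have "(LINT x:{a..b}|lborel. f x * G x + F x * g x) =
     (LINT x|lborel. ?f x * G b - ?f x * (G b - G x) + ((F x - F a) * ?g x + F a * ?g x))" unfolding set_lebesgue_integral_def
    by (intro Bochner_Integration.integral_cong) (auto simp: indicator_def algebra_simps)
  also have "\<dots> = (LINT x|lborel. ?f x) * G b - (LINT x|lborel. ?f x * (G b - G x)) +
      ((LINT x|lborel. (F x - F a) * ?g x) + F a * (LINT x|lborel. ?g x))"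
  proof -
    have I: "integrable lborel (\<lambda>x. ?f x * G b)" "integrable lborel (\<lambda>x. F a * ?g x)"
      by (rule integrable_mult_left, rule int, rule integrable_mult_right, rule int)
    show ?thesis
      by (simp only: Bochner_Integration.integral_add[OF Bochner_Integration.integrable_diff[OF I(1) sw(3)] Bochner_Integration.integrable_add[OF sw(2) I(2)]]
          Bochner_Integration.integral_diff[OF I(1) sw(3)] Bochner_Integration.integral_add[OF sw(2) I(2)]
          integral_mult_left_zero integral_mult_right_zero)
  qed
  also have "\<dots> = (F b - F a) * G b + F a * (G b - G a)"
    using sw(1) antideriv_eq[OF F \<open>a \<le> b\<close>] antideriv_eq[OF G \<open>a \<le> b\<close>] by (simp add: set_lebesgue_integral_def)
  finally show ?thesis by (simp add: algebra_simps)
qed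

lemma antideriv_exists:
  assumes "\<And>a b. set_integrable lborel {a..b} g" shows "\<exists>F. antideriv F g"
proof
  \<comment> \<open>For x different from 0 one of the two intervals is empty, so this is the signed
    integral from 0 to x.\<close>
  let ?F = "\<lambda>x. (LINT t:{0..x}|lborel. g t) - (LINT t:{x..0}|lborel. g t)"
  have split: "(LINT t:{a..c}|lborel. g t) = (LINT t:{a..b}|lborel. g t) + (LINT t:{b..c}|lborel. g t)"
    if "a \<le> b" "b \<le> c" for a b c
  proof -
    have "{a..c} = {a..b} \<union> {b..c}" using that by auto
    moreover have "(LINT t:{a..b} \<union> {b..c}|lborel. g t) = (LINT t:{a..b}|lborel. g t) + (LINT t:{b..c}|lborel. g t)"
    proof (rule set_integral_Un_AE)
      show "AE x in lborel. \<not> (x \<in> {a..b} \<and> x \<in> {b..c})" using AE_lborel_singleton[of b] by eventually_elim auto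
    qed (use assms in auto)
    ultimately show ?thesis by simp
  qed
  have z: "(LINT t:{0..0::real}|lborel. g t) = 0" using split[of 0 0 0] by simp
  show "antideriv ?F g"
  proof (rule antiderivI[OF assms])
    fix a b :: real assume "a \<le> b"
    then consider "0 \<le> a" | "a < 0" "0 < b" | "b \<le> 0" by linarith
    then show "?F b - ?F a = (LINT t:{a..b}|lborel. g t)"
    proof cases
      case 1
      then show ?thesis using split[of 0 a b] \<open>a \<le> b\<close> z by (cases "a = 0"; cases "b = 0") (auto simp: set_lebesgue_integral_def)
    next
      case 2
      then show ?thesis using split[of a 0 b] by (auto simp: set_lebesgue_integral_def)
    next
      case 3
      then show ?thesis using split[of a b 0] \<open>a \<le> b\<close> z by (cases "a = 0"; cases "b = 0") (auto simp: set_lebesgue_integral_def)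
    qed
  qed
qed

section \<open>Primitives paired with test functions, and integration by parts on the line\<close>

lemma supported_scale:
  fixes g :: "real \<Rightarrow> 'a::real_vector"
  assumes "\<And>x. \<bar>x\<bar> \<ge> R \<Longrightarrow> g x = 0" shows "(\<lambda>x. indicator {-R..R} x *\<^sub>R g x) = g"
proof
  fix x show "indicator {-R..R} x *\<^sub>R g x = g x" using assms[of x] by (cases "\<bar>x\<bar> \<ge> R") (auto simp: indicator_def)
qed

lemma supported_integrable:
  fixes g :: "real \<Rightarrow> 'a::{banach, second_countable_topology}"
  assumes "set_integrable lborel {-R..R} g" "\<And>x. \<bar>x\<bar> \<ge> R \<Longrightarrow> g x = 0"
  shows "integrable lborel g"
  using assms(1) unfolding set_integrable_def by (rule arg_cong[where f="integrable lborel", OF supported_scale, THEN iffD1, rotated]) (rule assms(2))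

lemma supported_integral:
  fixes g :: "real \<Rightarrow> 'a::{banach, second_countable_topology}"
  assumes "\<And>x. \<bar>x\<bar> \<ge> R \<Longrightarrow> g x = 0"
  shows "(LINT x:{-R..R}|lborel. g x) = integral\<^sup>L lborel g"
  unfolding set_lebesgue_integral_def by (rule arg_cong[where f="integral\<^sup>L lborel", OF supported_scale]) (rule assms)

lemma test_support:
  assumes "\<phi> \<in> test_functions"
  shows "\<exists>R>0. \<forall>x. \<bar>x\<bar> \<ge> R \<longrightarrow> \<phi> x = 0 \<and> deriv \<phi> x = 0"
proof -
  obtain R where R: "\<bar>x\<bar> > R \<Longrightarrow> \<phi> x = 0" for x using assms by (auto simp: test_functions_iff)
  obtain R' where R': "\<bar>x\<bar> > R' \<Longrightarrow> deriv \<phi> x = 0" for x using test_deriv[OF assms] by (auto simp: test_functions_iff)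
  show ?thesis by (rule exI[of _ "\<bar>R\<bar> + \<bar>R'\<bar> + 1"]) (auto intro!: R R')
qed

lemma test_integrable:
  assumes "\<psi> \<in> test_functions" shows "integrable lborel \<psi>"
proof -
  obtain R where R: "R > 0" "\<And>x. \<bar>x\<bar> \<ge> R \<Longrightarrow> \<psi> x = 0" using test_support[OF assms] by blast
  have "set_integrable lborel {-R..R} \<psi>" by (intro continuous_set_integrable test_continuous assms)
  then show ?thesis by (rule supported_integrable) (rule R(2))
qed

lemma test_cmul: "\<phi> \<in> test_functions \<Longrightarrow> (\<lambda>x. c * \<phi> x) \<in> test_functions"
  by (auto simp: test_functions_iff intro!: smooth_mult smooth_const)

lemma test_antideriv: "\<phi> \<in> test_functions \<Longrightarrow> antideriv (cfun \<phi>) (cfun (deriv \<phi>))"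
  by (intro has_vector_derivative_antideriv has_vector_derivative_of_real)
    (auto intro!: continuous_intros test_continuous[OF test_deriv] simp: has_real_derivative_iff_has_vector_derivative[symmetric] test_has_derivative)

text \<open>Integration by parts on [-R, R], where the boundary terms vanish with the test function.
  A primitive thus satisfies the weak derivative identity even when it is not square
  integrable.\<close>

lemma antideriv_test:
  assumes F: "antideriv F f" and \<phi>: "\<phi> \<in> test_functions"
  shows "(LINT x|lborel. F x * cfun (deriv \<phi>) x) = - (LINT x|lborel. f x * cfun \<phi> x)"
    and "integrable lborel (\<lambda>x. F x * cfun \<phi> x)" "integrable lborel (\<lambda>x. f x * cfun \<phi> x)"
proof -
  obtain R where R: "R > 0" "\<And>x. \<bar>x\<bar> \<ge> R \<Longrightarrow> \<phi> x = 0" "\<And>x. \<bar>x\<bar> \<ge> R \<Longrightarrow> deriv \<phi> x = 0"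
    using test_support[OF \<phi>] by blast
  have i1: "integrable lborel (\<lambda>x. F x * cfun \<psi> x)" if "\<And>x. \<bar>x\<bar> \<ge> R \<Longrightarrow> \<psi> x = 0" "\<psi> \<in> test_functions" for \<psi>
  proof -
    have "set_integrable lborel {-R..R} (\<lambda>x. F x * cfun \<psi> x)"
      by (intro continuous_set_integrable continuous_intros antideriv_continuous[OF F] test_continuous that)
    then show ?thesis by (rule supported_integrable) (simp add: that(1))
  qed
  have i2: "integrable lborel (\<lambda>x. f x * cfun \<psi> x)" if "\<And>x. \<bar>x\<bar> \<ge> R \<Longrightarrow> \<psi> x = 0" "\<psi> \<in> test_functions" for \<psi>
  proof -
    have "compact (\<psi> ` {-R..R})" by (intro compact_continuous_image test_continuous that) auto
    then obtain B where B: "\<And>x. x \<in> {-R..R} \<Longrightarrow> \<bar>\<psi> x\<bar> \<le> B"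
      using compact_imp_bounded bounded_iff by (metis image_eqI real_norm_def)
    have fi: "integrable lborel (\<lambda>x. indicator {-R..R} x *\<^sub>R f x)" using antideriv_integrable[OF F, of "-R" R] by (simp add: set_integrable_def)
    have m: "\<psi> \<in> borel_measurable borel" using that(2) by (rule test_measurable)
    have m2: "(\<lambda>x. (indicator {-R..R} x *\<^sub>R f x) * cfun \<psi> x) \<in> borel_measurable lborel"
      using borel_measurable_integrable[OF fi] m by (intro borel_measurable_times) auto
    have "integrable lborel (\<lambda>x. (indicator {-R..R} x *\<^sub>R f x) * cfun \<psi> x)"
    proof (rule Bochner_Integration.integrable_bound[OF _ m2])
      show "integrable lborel (\<lambda>x. B *\<^sub>R (indicator {-R..R} x *\<^sub>R f x))" using fi by (rule integrable_scaleR_right)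
      show "AE x in lborel. norm (indicat_real {- R..R} x *\<^sub>R f x * complex_of_real (\<psi> x))
          \<le> norm (B *\<^sub>R indicat_real {- R..R} x *\<^sub>R f x)"
      proof (intro AE_I2)
        fix x
        show "norm (indicat_real {- R..R} x *\<^sub>R f x * complex_of_real (\<psi> x))
          \<le> norm (B *\<^sub>R indicat_real {- R..R} x *\<^sub>R f x)"
        proof (cases "x \<in> {-R..R}")
          case True
          then have "\<bar>\<psi> x\<bar> \<le> \<bar>B\<bar>" using B[of x] by linarith
          then show ?thesis using True by (simp add: norm_mult mult.commute[of "\<bar>B\<bar>"] mult_left_mono)
        qed simp
      qed
    qed
    then have "set_integrable lborel {-R..R} (\<lambda>x. f x * cfun \<psi> x)" by (simp add: set_integrable_def)
    then show ?thesis by (rule supported_integrable) (simp add: that(1))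
  qed
  have "(LINT x:{-R..R}|lborel. f x * cfun \<phi> x + F x * cfun (deriv \<phi>) x) = 0"
    using antideriv_by_parts[OF F test_antideriv[OF \<phi>], of "-R" R] R by simp
  then have "(LINT x|lborel. f x * cfun \<phi> x + F x * cfun (deriv \<phi>) x) = 0" by (subst (asm) supported_integral) (auto simp: R)
  then show "(LINT x|lborel. F x * cfun (deriv \<phi>) x) = - (LINT x|lborel. f x * cfun \<phi> x)"
    using i1[OF R(3) test_deriv[OF \<phi>]] i2[OF R(2) \<phi>] by (simp add: eq_neg_iff_add_eq_0 add.commute)
  show "integrable lborel (\<lambda>x. F x * cfun \<phi> x)" "integrable lborel (\<lambda>x. f x * cfun \<phi> x)" using i1 i2 R \<phi> by auto
qed

lemma wd_of_antideriv:
  assumes "antideriv F f" "F \<in> L2" "f \<in> L2" shows "wd F f"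
  using antideriv_test(1)[OF assms(1)] assms(2,3) by (simp add: wd_def is_weak_deriv_def)

lemma test_normalized: "\<exists>\<theta>\<in>test_functions. (LINT x|lborel. \<theta> x) = 1"
proof -
  define b where "b = bump 1 0 1"
  have b: "b \<in> test_functions" unfolding b_def by (intro bump_test) simp
  obtain R where R: "R > 0" "\<And>x. \<bar>x\<bar> \<ge> R \<Longrightarrow> b x = 0" using test_support[OF b] by blast
  have nn: "b x \<ge> 0" for x unfolding b_def by (intro bump_bounds) simp
  have int: "integrable lborel b" by (rule test_integrable[OF b])
  have "(LINT x|lborel. b x) \<noteq> 0"
  proof
    assume "(LINT x|lborel. b x) = 0"
    then have "AE x in lborel. b x = 0" using integral_nonneg_eq_0_iff_AE[OF int] nn by auto
    moreover have "b x \<noteq> 0" if "x \<in> {0<..<1}" for x using that by (auto simp: b_def bump_def flat_exp_def)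
    ultimately have "AE x in lborel. x \<notin> {0<..<1::real}" by (auto elim!: eventually_mono)
    then have "emeasure lborel {0<..<1::real} = 0" by (subst (asm) AE_iff_null_sets[symmetric]) (auto simp: null_sets_def)
    then show False by simp
  qed
  moreover have "(\<lambda>x. (1 / (LINT x|lborel. b x)) * b x) \<in> test_functions" by (rule test_cmul[OF b])
  ultimately show ?thesis by (intro bexI[of _ "\<lambda>x. (1 / (LINT x|lborel. b x)) * b x"]) auto
qed

text \<open>The primitive that starts at the left end of the support is constant to the right of the
  support, and this constant is the integral of \<open>\<psi>\<close>; hence it has compact
  support.\<close>

lemma test_primitive:
  assumes \<psi>: "\<psi> \<in> test_functions" and 0: "(LINT x|lborel. \<psi> x) = 0"
  shows "\<exists>\<phi>\<in>test_functions. deriv \<phi> = \<psi>"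
proof -
  obtain R where R: "R > 0" "\<And>x. \<bar>x\<bar> \<ge> R \<Longrightarrow> \<psi> x = 0" using test_support[OF \<psi>] by blast
  have "\<exists>F. antideriv F (cfun \<psi>)" by (intro antideriv_exists L2_set_integrable test_L2 \<psi>)
  then obtain F where F: "antideriv F (cfun \<psi>)" by blast
  define \<phi> where "\<phi> x = Re (F x - F (-R))" for x
  have D: "(\<phi> has_real_derivative \<psi> x) (at x)" for x
  proof -
    have "(F has_vector_derivative cfun \<psi> x) (at x)" by (rule antideriv_has_vector_derivative[OF F]) (intro continuous_intros test_continuous \<psi>)
    then have "((\<lambda>x. F x - F (-R)) has_vector_derivative cfun \<psi> x - 0) (at x)" by (intro derivative_intros)
    from bounded_linear.has_vector_derivative[OF bounded_linear_Re this]
    show ?thesis by (simp add: \<phi>_def[abs_def] has_real_derivative_iff_has_vector_derivative)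
  qed
  have z: "F b = F a" if "a \<le> b" "b \<le> -R \<or> a \<ge> R" for a b
  proof -
    have "(LINT x:{a..b}|lborel. cfun \<psi> x) = (LINT x:{a..b}|lborel. 0)" by (intro set_lebesgue_integral_cong) (use that R in auto)
    then show ?thesis using antideriv_eq[OF F that(1)] by simp
  qed
  have FR: "F R = F (-R)"
  proof -
    have "F R - F (-R) = (LINT x:{-R..R}|lborel. cfun \<psi> x)" using R by (intro antideriv_eq F) auto
    also have "\<dots> = (LINT x|lborel. cfun \<psi> x)" by (rule supported_integral) (simp add: R)
    finally show ?thesis using 0 by (simp add: integral_complex_of_real)
  qed
  have "\<phi> x = 0" if "\<bar>x\<bar> > R" for x
  proof (cases "x > 0")
    case True
    then show ?thesis using z[of R x] that FR by (simp add: \<phi>_def)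
  next
    case False
    then show ?thesis using z[of x "-R"] that by (simp add: \<phi>_def)
  qed
  then have "\<phi> \<in> test_functions" using smooth_antiderivative[OF D] \<psi> by (auto simp: test_functions_iff)
  moreover have "deriv \<phi> = \<psi>" using D by (auto intro: DERIV_imp_deriv)
  ultimately show ?thesis by blast
qed

text \<open>For any primitive \<open>G\<close> of g, the difference f - G has weak derivative zero.
  Every test function is the derivative of a test function plus its integral times a fixed
  \<open>\<theta>\<close> of integral 1, so f - G equals the constant \<open>C\<close> almost
  everywhere.\<close>

lemma wd_antideriv:
  assumes "wd f g" obtains F where "F =\<^sub>2 f" "antideriv F g"
proof -
  have L2: "f \<in> L2" "g \<in> L2" and w: "is_weak_deriv 1 f g" using assms by (auto simp: wd_def)
  obtain G where G: "antideriv G g" using antideriv_exists[OF L2_set_integrable[OF L2(2)]] by blast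
  obtain \<theta> where \<theta>: "\<theta> \<in> test_functions" "(LINT x|lborel. \<theta> x) = 1" using test_normalized by blast
  have Gm[measurable]: "G \<in> borel_measurable borel" by (intro borel_measurable_continuous_onI antideriv_continuous[OF G])
  have fi: "integrable lborel (\<lambda>x. (f x - G x) * cfun \<psi> x)" if "\<psi> \<in> test_functions" for \<psi>
    using antideriv_test(2)[OF G that] L2_mult_integrable[OF L2(1) test_L2[OF that]] by (simp add: left_diff_distrib)
  define C where "C = (LINT x|lborel. (f x - G x) * cfun \<theta> x)"
  note tint = test_integrable
  have "AE x in lborel. f x - G x - C = 0"
  proof (rule fundamental_lemma)
    show "set_integrable lborel {a..b} (\<lambda>x. f x - G x - C)" for a b
      by (intro set_integral_diff L2_set_integrable L2 continuous_set_integrable continuous_intros antideriv_continuous[OF G])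
    fix \<psi> assume \<psi>: "\<psi> \<in> test_functions"
    define m where "m = (LINT x|lborel. \<psi> x)"
    have \<rho>: "(\<lambda>x. \<psi> x + (- m) * \<theta> x) \<in> test_functions"
    proof -
      obtain R R' where "\<And>x. \<bar>x\<bar> \<ge> R \<Longrightarrow> \<psi> x = 0" "\<And>x. \<bar>x\<bar> \<ge> R' \<Longrightarrow> \<theta> x = 0"
        using test_support[OF \<psi>] test_support[OF \<theta>(1)] by blast
      then have "\<psi> x + (- m) * \<theta> x = 0" if "\<bar>x\<bar> > max R R'" for x using that by auto
      moreover have "smooth (\<lambda>x. \<psi> x + (- m) * \<theta> x)"
        by (intro smooth_add smooth_mult smooth_const) (use \<psi> \<theta>(1) in \<open>auto simp: test_functions_iff\<close>)
      ultimately show ?thesis unfolding test_functions_iff by blast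
    qed
    have "(LINT x|lborel. \<psi> x + (- m) * \<theta> x) = 0" using \<theta> tint[OF \<psi>] tint[OF \<theta>(1)] by (simp add: m_def)
    then obtain \<phi> where \<phi>: "\<phi> \<in> test_functions" "deriv \<phi> = (\<lambda>x. \<psi> x + (- m) * \<theta> x)"
      using test_primitive[OF \<rho>] by blast
    have 0: "(LINT x|lborel. (f x - G x) * cfun (deriv \<phi>) x) = 0"
      using w \<phi>(1) antideriv_test(1)[OF G \<phi>(1)] antideriv_test(2)[OF G test_deriv[OF \<phi>(1)]]
        L2_mult_integrable[OF L2(1) test_L2[OF test_deriv[OF \<phi>(1)]]] by (simp add: left_diff_distrib is_weak_deriv_def)
    have "(LINT x|lborel. (f x - G x - C) * cfun \<psi> x) =
        (LINT x|lborel. (f x - G x) * cfun (deriv \<phi>) x + (of_real m * ((f x - G x) * cfun \<theta> x) - C * cfun \<psi> x))"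
      by (intro Bochner_Integration.integral_cong) (auto simp: \<phi>(2) algebra_simps)
    also have "\<dots> = (LINT x|lborel. (f x - G x) * cfun (deriv \<phi>) x) + (of_real m * C - C * of_real m)"
      using fi[OF test_deriv[OF \<phi>(1)]] fi[OF \<theta>(1)] tint[OF \<psi>] by (simp add: C_def m_def integral_complex_of_real)
    finally show "(LINT x|lborel. (f x - G x - C) * cfun \<psi> x) = 0" using 0 by simp
  qed (use L2 in auto)
  then have "(\<lambda>x. G x + C) =\<^sub>2 f" unfolding L2_eq_def by eventually_elim (simp add: algebra_simps)
  moreover have "antideriv (\<lambda>x. G x + C) g" using G by (simp add: antideriv_def)
  ultimately show ?thesis using that by blast
qed

text \<open>An integrable function cannot stay above a positive constant near infinity; this removes
  the boundary terms in \<open>wd_by_parts\<close>.\<close>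

lemma no_limit_integrable:
  fixes p :: "real \<Rightarrow> real"
  assumes "integrable lborel p" "\<And>x. x \<ge> b \<Longrightarrow> p x \<ge> e" "\<And>x. p x \<ge> 0"
  shows "e \<le> 0"
proof (rule ccontr)
  assume "\<not> e \<le> 0"
  then obtain n :: nat where n: "real n * e > (LINT x|lborel. p x)" using reals_Archimedean3[of e] by auto
  have "real n * e = (LINT x|lborel. e * indicator {b..b + real n} x)" by simp
  also have "\<dots> \<le> (LINT x|lborel. p x)" by (intro integral_mono assms(1) integrable_mult_right integrable_real_indicator)
      (use assms in \<open>auto simp: indicator_def\<close>)
  finally show False using n by simp
qed

text \<open>Integration by parts on [-b, b] leaves a boundary term \<open>H b\<close> that converges
  to the full integral \<open>I\<close>. Being built from products of square integrable functions,
  \<open>H\<close> is integrable in b, so its limit can only be 0.\<close>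

lemma wd_by_parts:
  assumes f: "wd f f'" and g: "wd g g'"
  shows "L2_inner f' g = - L2_inner f g'"
proof -
  have L2: "f \<in> L2" "f' \<in> L2" "g \<in> L2" "g' \<in> L2" using assms by (auto simp: wd_def)
  obtain F where F: "F =\<^sub>2 f" "antideriv F f'" using wd_antideriv[OF f] by blast
  obtain G where G: "G =\<^sub>2 g" "antideriv G g'" using wd_antideriv[OF g] by blast
  have [measurable]: "F \<in> borel_measurable borel" "G \<in> borel_measurable borel"
    by (intro borel_measurable_continuous_onI antideriv_continuous[OF F(2)] antideriv_continuous[OF G(2)])+
  have L2_rep: "H \<in> L2" if "H =\<^sub>2 h" "h \<in> L2" "H \<in> borel_measurable borel" for H h using that unfolding L2_iff L2_eq_def
    by (auto intro!: integrable_cong_AE_imp[of _ "\<lambda>x. (cmod (h x))\<^sup>2"] elim: eventually_mono)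
  have FL: "F \<in> L2" "G \<in> L2" by (auto intro!: L2_rep[OF F(1) L2(1)] L2_rep[OF G(1) L2(3)])
  have cG: "antideriv (\<lambda>x. cnj (G x)) (\<lambda>x. cnj (g' x))" using G(2) unfolding antideriv_def set_integrable_def set_lebesgue_integral_def
    by (auto simp flip: complex_cnj_diff complex_cnj_scaleR simp del: complex_cnj_diff complex_cnj_scaleR)
  let ?w = "\<lambda>x. f' x * cnj (G x) + F x * cnj (g' x)"
  have wint: "integrable lborel ?w" by (intro Bochner_Integration.integrable_add L2_inner_integrable L2 FL)
  define I where "I = (LINT x|lborel. ?w x)"
  define H where "H b = F b * cnj (G b) - F (-b) * cnj (G (-b))" for b
  have H: "H b = (LINT x:{-b..b}|lborel. ?w x)" if "b \<ge> 0" for b using antideriv_by_parts[OF F(2) cG, of "-b" b] that by (simp add: H_def)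
  have lim: "((\<lambda>b. LINT x:{-b..b}|lborel. ?w x) \<longlongrightarrow> I) at_top" unfolding I_def set_lebesgue_integral_def
  proof (rule integral_dominated_convergence_at_top)
    show "integrable lborel (\<lambda>x. norm (?w x))" using wint by (rule integrable_norm)
    show "\<forall>\<^sub>F b in at_top. AE x in lborel. norm (indicat_real {- b..b} x *\<^sub>R ?w x) \<le> norm (?w x)" by (auto simp: indicator_def)
    show "AE x in lborel. ((\<lambda>b. indicat_real {- b..b} x *\<^sub>R ?w x) \<longlongrightarrow> ?w x) at_top"
    proof (intro AE_I2 tendsto_eventually)
      fix x show "\<forall>\<^sub>F b in at_top. indicat_real {- b..b} x *\<^sub>R ?w x = ?w x"
        by (rule eventually_mono[OF eventually_ge_at_top[of "\<bar>x\<bar>"]]) (auto simp: indicator_def)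
    qed
  qed (use wint in auto)
  have "((\<lambda>b. cmod (H b)) \<longlongrightarrow> cmod I) at_top"
  proof (rule tendsto_norm, rule Lim_transform_eventually[OF lim])
    show "\<forall>\<^sub>F b in at_top. (LINT x:{-b..b}|lborel. ?w x) = H b" by (rule eventually_mono[OF eventually_ge_at_top[of 0]]) (simp add: H)
  qed
  then have "cmod I / 2 \<le> 0"
  proof -
    assume l: "((\<lambda>b. cmod (H b)) \<longlongrightarrow> cmod I) at_top"
    show ?thesis
    proof (cases "I = 0")
      case False
      then have "\<forall>\<^sub>F b in at_top. cmod (H b) > cmod I / 2" using l by (intro order_tendstoD(1)) auto
      then obtain b0 where b0: "\<And>b. b \<ge> b0 \<Longrightarrow> cmod (H b) > cmod I / 2" by (auto simp: eventually_at_top_linorder)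
      have p1: "integrable lborel (\<lambda>b. F b * cnj (G b))" using L2_inner_integrable[OF FL] .
      have p2: "integrable lborel (\<lambda>b. F (-b) * cnj (G (-b)))" using lborel_integrable_real_affine[OF p1, of "-1" 0] by simp
      have "integrable lborel (\<lambda>b. cmod (H b))" unfolding H_def by (intro integrable_norm Bochner_Integration.integrable_diff p1 p2)
      then show ?thesis by (rule no_limit_integrable[of _ b0]) (use b0 less_imp_le in auto)
    qed simp
  qed
  then have "I = 0" by simp
  moreover have "I = L2_inner f' G + L2_inner F g'" unfolding I_def L2_inner_def by (intro Bochner_Integration.integral_add L2_inner_integrable L2 FL)
  moreover have "L2_inner f' G = L2_inner f' g" "L2_inner F g' = L2_inner f g'" using F(1) G(1) L2 FL by (auto intro!: L2_inner_cong)
  ultimately show ?thesis by (simp add: eq_neg_iff_add_eq_0)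
qed

section \<open>The fourth-order operator\<close>

lemma wd_L2: assumes "wd f g" shows "f \<in> L2" "g \<in> L2" using assms by (auto simp: wd_def)

lemma weak_deriv_integrable:
  "f \<in> L2 \<Longrightarrow> \<phi> \<in> test_functions \<Longrightarrow> integrable lborel (\<lambda>x. f x * cfun \<phi> x)"
  by (intro L2_mult_integrable test_L2)

lemma wd_add: assumes "wd f f'" "wd g g'" shows "wd (\<lambda>x. f x + g x) (\<lambda>x. f' x + g' x)"
  using assms by (auto simp: wd_def is_weak_deriv_def distrib_right weak_deriv_integrable test_deriv)

lemma wd_cmul: assumes "wd f f'" shows "wd (\<lambda>x. a * f x) (\<lambda>x. a * f' x)"
  using assms by (auto simp: wd_def is_weak_deriv_def mult.assoc)

lemma wd_zero: "wd (\<lambda>x. 0) (\<lambda>x. 0)"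
  by (simp add: wd_def is_weak_deriv_def)

lemma wd_diff: assumes "wd f f'" "wd g g'" shows "wd (\<lambda>x. f x - g x) (\<lambda>x. f' x - g' x)"
  using wd_add[OF assms(1) wd_cmul[OF assms(2), of "-1"]] by simp

lemma wd_sum: "(\<And>i. i \<in> I \<Longrightarrow> wd (f i) (g i)) \<Longrightarrow> wd (\<lambda>x. \<Sum>i\<in>I. f i x) (\<lambda>x. \<Sum>i\<in>I. g i x)"
  by (induction I rule: infinite_finite_induct) (auto simp: wd_zero intro: wd_add)

lemma is_weak_deriv_cong_right:
  assumes "g =\<^sub>2 g'" "g \<in> L2" "g' \<in> L2" shows "is_weak_deriv k f g = is_weak_deriv k f g'"
proof -
  have "(LINT x|lborel. g x * cfun \<phi> x) = (LINT x|lborel. g' x * cfun \<phi> x)" if "\<phi> \<in> test_functions" for \<phi>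
    using assms that unfolding L2_eq_def by (intro integral_cong_AE) auto
  then show ?thesis by (simp add: is_weak_deriv_def)
qed

lemma wd_cong: "wd f g \<Longrightarrow> f =\<^sub>2 f' \<Longrightarrow> g =\<^sub>2 g' \<Longrightarrow> f' \<in> L2 \<Longrightarrow> g' \<in> L2 \<Longrightarrow> wd f' g'"
  using is_weak_deriv_cong[of f f' 1 g] is_weak_deriv_cong_right[of g g' 1 f'] by (auto simp: wd_def)

lemma wd_unique: "wd f g \<Longrightarrow> wd f g' \<Longrightarrow> g =\<^sub>2 g'"
  unfolding wd_def by (blast intro: weak_deriv_unique)

text \<open>Links \<open>sobolev\<close>, which asks for each weak derivative of f separately, with
  chains of first-order relations.\<close>

lemma is_weak_deriv_Suc:
  assumes "is_weak_deriv k f g"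
  shows "is_weak_deriv 1 g h \<longleftrightarrow> is_weak_deriv (Suc k) f h"
proof -
  have e: "(LINT x|lborel. f x * cfun ((deriv ^^ Suc k) \<phi>) x) = (-1) ^ k * (LINT x|lborel. g x * cfun (deriv \<phi>) x)"
    if "\<phi> \<in> test_functions" for \<phi> using assms test_deriv[OF that] by (simp add: is_weak_deriv_def funpow_Suc_right del: funpow.simps(2))
  have one: "(deriv ^^ 1) \<phi> = deriv \<phi>" for \<phi> :: "real \<Rightarrow> real" by simp
  have s: "(- 1) ^ k * a = (- 1) ^ Suc k * b \<longleftrightarrow> a = - b" for a b :: complex by (cases "even k") (auto simp: minus_equation_iff)
  show ?thesis unfolding is_weak_deriv_def by (intro ball_cong refl) (simp only: e s one power_one_right mult_minus1)
qed

section \<open>Chains of four derivatives and the Sobolev space of order four\<close>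

abbreviation (input) free_op :: "real \<Rightarrow> (real \<Rightarrow> complex) \<Rightarrow> (real \<Rightarrow> complex) \<Rightarrow> (real \<Rightarrow> complex) \<Rightarrow> real \<Rightarrow> complex" where
  "free_op c u u2 u4 \<equiv> \<lambda>x. u4 x + of_real (c\<^sup>2) * u2 x + u x"

abbreviation (input) pot_op :: "real \<Rightarrow> (real \<Rightarrow> real) \<Rightarrow> (real \<Rightarrow> complex) \<Rightarrow> (real \<Rightarrow> complex) \<Rightarrow> (real \<Rightarrow> complex) \<Rightarrow> real \<Rightarrow> complex" where
  "pot_op c W u u2 u4 \<equiv> \<lambda>x. u4 x + of_real (c\<^sup>2) * u2 x + of_real (exp (W x)) * u x"

text \<open>A certificate for membership in \<open>sobolev 4\<close>: with four explicit
  derivatives, sums, limits and estimates act on given functions and not on the choices made by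
  \<open>weak_deriv\<close>.\<close>

definition H4 where
  "H4 f f1 f2 f3 f4 \<longleftrightarrow> wd f f1 \<and> wd f1 f2 \<and> wd f2 f3 \<and> wd f3 f4"

lemma H4_is_weak_deriv:
  assumes "H4 f f1 f2 f3 f4"
  shows "is_weak_deriv 0 f f" "is_weak_deriv 1 f f1" "is_weak_deriv 2 f f2" "is_weak_deriv 3 f f3" "is_weak_deriv 4 f f4"
proof -
  show "is_weak_deriv 0 f f" by (simp add: is_weak_deriv_def)
  show 1: "is_weak_deriv 1 f f1" using assms by (simp add: H4_def wd_def)
  show 2: "is_weak_deriv 2 f f2" using is_weak_deriv_Suc[OF 1, of f2] assms by (simp add: H4_def wd_def numeral_2_eq_2)
  show 3: "is_weak_deriv 3 f f3" using is_weak_deriv_Suc[OF 2, of f3] assms by (simp add: H4_def wd_def numeral_3_eq_3)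
  show "is_weak_deriv 4 f f4" using is_weak_deriv_Suc[OF 3, of f4] assms by (simp add: H4_def wd_def)
qed

lemma H4_L2:
  assumes "H4 f f1 f2 f3 f4" shows "f \<in> L2" "f1 \<in> L2" "f2 \<in> L2" "f3 \<in> L2" "f4 \<in> L2"
  using assms by (auto simp: H4_def wd_def)

lemma H4_sobolev: "H4 f f1 f2 f3 f4 \<Longrightarrow> f \<in> sobolev 4"
proof -
  assume H: "H4 f f1 f2 f3 f4"
  have "\<exists>g\<in>L2. is_weak_deriv j f g" if "j \<le> 4" for j
  proof -
    have "j \<in> {0,1,2,3,4}" using that by auto
    then show ?thesis using H4_is_weak_deriv[OF H] H4_L2[OF H] by blast
  qed
  then show ?thesis using H4_L2[OF H] by (simp add: sobolev_def)
qed

lemma sobolev_weak_deriv: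
  assumes "f \<in> sobolev k" "j \<le> k" shows "weak_deriv j f \<in> L2" "is_weak_deriv j f (weak_deriv j f)"
proof -
  have "\<exists>g. g \<in> L2 \<and> is_weak_deriv j f g" using assms by (auto simp: sobolev_def)
  from someI_ex[OF this] show "weak_deriv j f \<in> L2" "is_weak_deriv j f (weak_deriv j f)" by (auto simp: weak_deriv_def)
qed

lemma sobolev_L2: "f \<in> sobolev k \<Longrightarrow> f \<in> L2" by (simp add: sobolev_def)

lemma sobolev_H4:
  assumes "f \<in> sobolev 4"
  shows "H4 f (weak_deriv 1 f) (weak_deriv 2 f) (weak_deriv 3 f) (weak_deriv 4 f)"
  using sobolev_weak_deriv[OF assms, of 1] sobolev_weak_deriv[OF assms, of 2] sobolev_weak_deriv[OF assms, of 3]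
    sobolev_weak_deriv[OF assms, of 4] sobolev_L2[OF assms]
    is_weak_deriv_Suc[of 1 f "weak_deriv 1 f" "weak_deriv 2 f"]
    is_weak_deriv_Suc[of 2 f "weak_deriv 2 f" "weak_deriv 3 f"]
    is_weak_deriv_Suc[of 3 f "weak_deriv 3 f" "weak_deriv 4 f"] by (simp add: H4_def wd_def numeral_2_eq_2[symmetric])

lemma H4_weak_deriv:
  assumes "H4 f f1 f2 f3 f4"
  shows "weak_deriv 1 f =\<^sub>2 f1" "weak_deriv 2 f =\<^sub>2 f2" "weak_deriv 3 f =\<^sub>2 f3" "weak_deriv 4 f =\<^sub>2 f4"
  using sobolev_weak_deriv[OF H4_sobolev[OF assms]] H4_is_weak_deriv[OF assms] H4_L2[OF assms] by (auto intro!: weak_deriv_unique)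

lemma H4_add: "H4 f f1 f2 f3 f4 \<Longrightarrow> H4 g g1 g2 g3 g4 \<Longrightarrow>
   H4 (\<lambda>x. f x + g x) (\<lambda>x. f1 x + g1 x) (\<lambda>x. f2 x + g2 x) (\<lambda>x. f3 x + g3 x) (\<lambda>x. f4 x + g4 x)"
  by (simp add: H4_def wd_add)

lemma H4_diff: "H4 f f1 f2 f3 f4 \<Longrightarrow> H4 g g1 g2 g3 g4 \<Longrightarrow>
   H4 (\<lambda>x. f x - g x) (\<lambda>x. f1 x - g1 x) (\<lambda>x. f2 x - g2 x) (\<lambda>x. f3 x - g3 x) (\<lambda>x. f4 x - g4 x)"
  by (simp add: H4_def wd_diff)

lemma H4_cmul: "H4 f f1 f2 f3 f4 \<Longrightarrow>
   H4 (\<lambda>x. a * f x) (\<lambda>x. a * f1 x) (\<lambda>x. a * f2 x) (\<lambda>x. a * f3 x) (\<lambda>x. a * f4 x)" by (simp add: H4_def wd_cmul)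

lemma H4_sum: "(\<And>i. i \<in> I \<Longrightarrow> H4 (f i) (f1 i) (f2 i) (f3 i) (f4 i)) \<Longrightarrow>
   H4 (\<lambda>x. \<Sum>i\<in>I. f i x) (\<lambda>x. \<Sum>i\<in>I. f1 i x) (\<lambda>x. \<Sum>i\<in>I. f2 i x) (\<lambda>x. \<Sum>i\<in>I. f3 i x) (\<lambda>x. \<Sum>i\<in>I. f4 i x)"
  by (simp add: H4_def wd_sum)

lemma sobolev_add: "f \<in> sobolev 4 \<Longrightarrow> g \<in> sobolev 4 \<Longrightarrow> (\<lambda>x. f x + g x) \<in> sobolev 4"
  by (rule H4_sobolev, rule H4_add, erule sobolev_H4, erule sobolev_H4)
lemma sobolev_diff: "f \<in> sobolev 4 \<Longrightarrow> g \<in> sobolev 4 \<Longrightarrow> (\<lambda>x. f x - g x) \<in> sobolev 4"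
  by (rule H4_sobolev, rule H4_diff, erule sobolev_H4, erule sobolev_H4)
lemma sobolev_cmul: "f \<in> sobolev 4 \<Longrightarrow> (\<lambda>x. a * f x) \<in> sobolev 4"
  by (rule H4_sobolev, rule H4_cmul, erule sobolev_H4)
lemma sobolev_sum:
  assumes "\<And>i. i \<in> I \<Longrightarrow> f i \<in> sobolev 4" shows "(\<lambda>x. \<Sum>i\<in>I. f i x) \<in> sobolev 4"
  by (rule H4_sobolev[OF H4_sum[OF sobolev_H4]]) (rule assms)

lemma H4_lin_op:
  assumes "H4 f f1 f2 f3 f4"
  shows "lin_op c W f =\<^sub>2 (pot_op c W f f2 f4)"
  unfolding lin_op_def by (intro L2_eq_add L2_eq_mult H4_weak_deriv[OF assms] L2_eq_refl)

definition bounded_potential :: "(real \<Rightarrow> real) \<Rightarrow> bool" where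
  "bounded_potential W \<longleftrightarrow> W \<in> borel_measurable borel \<and> (\<exists>B. \<forall>x. exp (W x) \<le> B)"

lemma potential_mult_L2:
  assumes "bounded_potential W" "f \<in> L2" shows "(\<lambda>x. of_real (exp (W x)) * f x) \<in> L2"
proof -
  obtain B where "\<And>x. exp (W x) \<le> B" and [measurable]: "W \<in> borel_measurable borel" using assms by (auto simp: bounded_potential_def)
  then show ?thesis by (intro L2_bounded_mult[where B=B] assms) auto
qed

lemma lin_op_L2: "f \<in> sobolev 4 \<Longrightarrow> bounded_potential W \<Longrightarrow> lin_op c W f \<in> L2"
  unfolding lin_op_def by (intro L2_add L2_cmul potential_mult_L2 sobolev_weak_deriv sobolev_L2) auto

lemma lin_op_linear:
  assumes "f \<in> sobolev 4" "g \<in> sobolev 4"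
  shows "lin_op c W (\<lambda>x. f x + g x) =\<^sub>2 (\<lambda>x. lin_op c W f x + lin_op c W g x)"
    and "lin_op c W (\<lambda>x. f x - g x) =\<^sub>2 (\<lambda>x. lin_op c W f x - lin_op c W g x)"
    and "lin_op c W (\<lambda>x. a * f x) =\<^sub>2 (\<lambda>x. a * lin_op c W f x)"
  by (rule L2_eq_trans[OF H4_lin_op[OF H4_add[OF assms[THEN sobolev_H4]]]], simp add: lin_op_def algebra_simps)
    (rule L2_eq_trans[OF H4_lin_op[OF H4_diff[OF assms[THEN sobolev_H4]]]], simp add: lin_op_def algebra_simps,
     rule L2_eq_trans[OF H4_lin_op[OF H4_cmul[OF assms(1)[THEN sobolev_H4]]]], simp add: lin_op_def algebra_simps)

lemma lin_op_sum:
  assumes "\<And>i. i \<in> I \<Longrightarrow> f i \<in> sobolev 4"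
  shows "lin_op c W (\<lambda>x. \<Sum>i\<in>I. f i x) =\<^sub>2 (\<lambda>x. \<Sum>i\<in>I. lin_op c W (f i) x)"
  by (rule L2_eq_trans[OF H4_lin_op[OF H4_sum[OF sobolev_H4[OF assms]]]])
    (simp_all add: lin_op_def sum.distrib sum_distrib_left)

lemma lin_op_cong: "f =\<^sub>2 g \<Longrightarrow> f \<in> L2 \<Longrightarrow> g \<in> L2 \<Longrightarrow> lin_op c W f =\<^sub>2 lin_op c W g"
  unfolding lin_op_def by (simp add: weak_deriv_cong[of f g] L2_eq_add L2_eq_mult)

text \<open>Two and four integrations by parts move the derivatives across without boundary terms,
  and the potential is real.\<close>

lemma lin_op_symmetric:
  assumes "f \<in> sobolev 4" "g \<in> sobolev 4" and W: "bounded_potential W"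
  shows "L2_inner (lin_op c W f) g = L2_inner f (lin_op c W g)"
proof -
  obtain f1 f2 f3 f4 where f: "H4 f f1 f2 f3 f4" using sobolev_H4[OF assms(1)] by blast
  obtain g1 g2 g3 g4 where g: "H4 g g1 g2 g3 g4" using sobolev_H4[OF assms(2)] by blast
  note L = H4_L2[OF f] H4_L2[OF g] potential_mult_L2[OF W H4_L2(1)[OF f]] potential_mult_L2[OF W H4_L2(1)[OF g]]
  have w: "wd f f1" "wd f1 f2" "wd f2 f3" "wd f3 f4" "wd g g1" "wd g1 g2" "wd g2 g3" "wd g3 g4" using f g by (auto simp: H4_def)
  have 2: "L2_inner f2 g = L2_inner f g2" using wd_by_parts[OF w(2,5)] wd_by_parts[OF w(1,6)] by simp
  have 4: "L2_inner f4 g = L2_inner f g4" using wd_by_parts[OF w(4,5)] wd_by_parts[OF w(3,6)] wd_by_parts[OF w(2,7)] wd_by_parts[OF w(1,8)] by simp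
  have 0: "L2_inner (\<lambda>x. of_real (exp (W x)) * f x) g = L2_inner f (\<lambda>x. of_real (exp (W x)) * g x)"
    unfolding L2_inner_def by (simp add: mult.assoc mult.left_commute)
  have "L2_inner (lin_op c W f) g = L2_inner (pot_op c W f f2 f4) g"
    using assms L by (intro L2_inner_cong H4_lin_op[OF f] L2_eq_refl lin_op_L2 L2_add L2_cmul) auto
  also have "\<dots> = L2_inner f4 g + of_real (c\<^sup>2) * L2_inner f2 g + L2_inner (\<lambda>x. of_real (exp (W x)) * f x) g"
    using L by (simp add: L2_inner_add_left L2_inner_cmul_left L2_add L2_cmul del: of_real_power)
  also have "\<dots> = L2_inner f (pot_op c W g g2 g4)" using L by (simp add: L2_inner_add_right L2_inner_cmul_right L2_add L2_cmul 0 2 4 del: of_real_power)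
  also have "\<dots> = L2_inner f (lin_op c W g)" using assms L by (intro L2_inner_cong L2_eq_sym[OF H4_lin_op[OF g]] L2_eq_refl lin_op_L2 L2_add L2_cmul) auto
  finally show ?thesis .
qed

section \<open>Elliptic estimates\<close>

text \<open>The worst case is the fourth derivative. The equation bounds it by N + c^2 |f''| + |f|,
  where c^2 < 2 and both |f''| and |f| are at most N / (1 - c^2/2); hence the numerator 3.\<close>

definition ellip :: "real \<Rightarrow> real" where "ellip c = 1 + 3 / (1 - c\<^sup>2 / 2)"

lemma ellip_ge_1: "c\<^sup>2 < 2 \<Longrightarrow> ellip c \<ge> 1" by (simp add: ellip_def)

text \<open>The free operator has symbol x^4 - c^2 x^2 + 1 >= (1 - c^2/2) (x^4 + 1). Without Fourier
  transform this is the pairing of the equation with f, in which the negative term is controlled by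
  |f'|^2 <= |f''| |f|.\<close>

lemma H4_elliptic:
  assumes c: "c\<^sup>2 < 2" and f: "H4 f f1 f2 f3 f4"
  defines "N \<equiv> L2_norm (free_op c f f2 f4)"
  shows "L2_norm f \<le> ellip c * N" "L2_norm f1 \<le> ellip c * N" "L2_norm f2 \<le> ellip c * N"
    "L2_norm f3 \<le> ellip c * N" "L2_norm f4 \<le> ellip c * N"
proof -
  define k where "k = 1 - c\<^sup>2 / 2"
  have k: "k > 0" using c by (simp add: k_def)
  note L = H4_L2[OF f]
  have w: "wd f f1" "wd f1 f2" "wd f2 f3" "wd f3 f4" using f by (auto simp: H4_def)
  define a b d where "a = L2_norm f" and "b = L2_norm f2" and "d = L2_norm f1"
  have nn: "a \<ge> 0" "b \<ge> 0" "d \<ge> 0" "N \<ge> 0" by (auto simp: a_def b_def d_def N_def)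
  have i2: "L2_inner f2 f = - of_real (d\<^sup>2)" using wd_by_parts[OF w(2,1)] by (simp add: L2_inner_self d_def)
  have i4: "L2_inner f4 f = of_real (b\<^sup>2)" using wd_by_parts[OF w(4,1)] wd_by_parts[OF w(3,2)] by (simp add: L2_inner_self b_def)
  have d: "d\<^sup>2 \<le> b * a" using L2_Cauchy_Schwarz[OF L(3,1)] unfolding i2 by (simp add: a_def b_def norm_power)
  have ab: "b * a \<le> (b\<^sup>2 + a\<^sup>2) / 2" using sum_squares_bound[of b a] by simp
  have "L2_inner (free_op c f f2 f4) f = of_real (b\<^sup>2 - c\<^sup>2 * d\<^sup>2 + a\<^sup>2)"
    using L by (simp add: L2_inner_add_left L2_inner_cmul_left L2_add L2_cmul i2 i4 L2_inner_self a_def del: of_real_power)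
  moreover have "cmod (L2_inner (free_op c f f2 f4) f) \<le> N * a" unfolding N_def a_def by (intro L2_Cauchy_Schwarz L2_add L2_cmul L)
  ultimately have "\<bar>b\<^sup>2 - c\<^sup>2 * d\<^sup>2 + a\<^sup>2\<bar> \<le> N * a" by (simp only: norm_of_real)
  moreover have "c\<^sup>2 * d\<^sup>2 \<le> c\<^sup>2 * ((b\<^sup>2 + a\<^sup>2) / 2)" using d ab by (intro mult_left_mono) auto
  ultimately have main: "k * (b\<^sup>2 + a\<^sup>2) \<le> N * a" by (simp add: k_def algebra_simps)
  have a: "a \<le> N / k"
  proof (cases "a = 0")
    case False
    have "k * a\<^sup>2 \<le> k * (b\<^sup>2 + a\<^sup>2)" using k by (intro mult_left_mono) auto
    then have "(k * a) * a \<le> N * a" using main by (simp add: power2_eq_square)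
    then have "k * a \<le> N" using False nn by simp
    then show ?thesis using k by (simp add: field_simps)
  qed (use nn k in auto)
  have s: "b\<^sup>2 + a\<^sup>2 \<le> (N / k)\<^sup>2"
  proof -
    have "k * (b\<^sup>2 + a\<^sup>2) \<le> N * (N / k)" using main mult_left_mono[OF a nn(4)] by linarith
    then show ?thesis using k by (simp add: field_simps power2_eq_square)
  qed
  have Nk: "N / k \<ge> 0" using nn k by simp
  have b: "b \<le> N / k" by (rule power2_le_imp_le[OF _ Nk]) (use s in \<open>smt (verit) zero_le_power2\<close>)
  have d': "d \<le> N / k"
  proof (rule power2_le_imp_le[OF _ Nk])
    have "d\<^sup>2 \<le> (b\<^sup>2 + a\<^sup>2) / 2" using d ab by linarith
    also have "\<dots> \<le> b\<^sup>2 + a\<^sup>2" by simp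
    also note s
    finally show "d\<^sup>2 \<le> (N / k)\<^sup>2" .
  qed
  have e: "ellip c * N = N + 3 * (N / k)" by (simp add: ellip_def k_def algebra_simps)
  show 0: "L2_norm f \<le> ellip c * N" using a nn Nk unfolding e a_def by linarith
  show "L2_norm f1 \<le> ellip c * N" using d' nn Nk unfolding e d_def by linarith
  show 2: "L2_norm f2 \<le> ellip c * N" using b nn Nk unfolding e b_def by linarith
  \<comment> \<open>The equation itself bounds the fourth derivative; the third then follows by
    interpolation between the second and the fourth.\<close>
  have "L2_norm f4 = L2_norm (\<lambda>x. (f4 x + of_real (c\<^sup>2) * f2 x + f x) - (of_real (c\<^sup>2) * f2 x + f x))" by simp
  also have "\<dots> \<le> N + L2_norm (\<lambda>x. of_real (c\<^sup>2) * f2 x + f x)" unfolding N_def using L by (intro L2_triangle_diff L2_add L2_cmul) auto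
  also have "L2_norm (\<lambda>x. of_real (c\<^sup>2) * f2 x + f x) \<le> L2_norm (\<lambda>x. of_real (c\<^sup>2) * f2 x) + L2_norm f"
    using L by (intro L2_triangle L2_cmul) auto
  also have "L2_norm (\<lambda>x. of_real (c\<^sup>2) * f2 x) = c\<^sup>2 * b" by (simp add: L2_norm_cmul b_def norm_power)
  also have "c\<^sup>2 * b \<le> 2 * (N / k)" using c b nn by (intro mult_mono) auto
  finally show 4: "L2_norm f4 \<le> ellip c * N" using a Nk unfolding e a_def by linarith
  show "L2_norm f3 \<le> ellip c * N"
  proof (rule power2_le_imp_le)
    have "L2_inner f4 f2 = - of_real ((L2_norm f3)\<^sup>2)" using wd_by_parts[OF w(4,3)] by (simp add: L2_inner_self)
    then have "(L2_norm f3)\<^sup>2 \<le> L2_norm f4 * L2_norm f2" using L2_Cauchy_Schwarz[OF L(5,3)] by (simp add: norm_power)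
    also have "\<dots> \<le> (ellip c * N) * (ellip c * N)" using 2 4 by (intro mult_mono) (auto simp: order_trans[OF L2_norm_nonneg 2])
    finally show "(L2_norm f3)\<^sup>2 \<le> (ellip c * N)\<^sup>2" by (simp add: power2_eq_square)
  qed (rule order_trans[OF L2_norm_nonneg 2])
qed

lemma H4_elliptic_potential:
  assumes c: "c\<^sup>2 < 2" and f: "H4 f f1 f2 f3 f4"
    and W: "W \<in> borel_measurable borel" "\<And>x. \<bar>exp (W x) - 1\<bar> \<le> B"
  shows "L2_norm (free_op c f f2 f4) \<le>
     L2_norm (pot_op c W f f2 f4) + B * L2_norm f"
proof -
  note L = H4_L2[OF f]
  have "bounded_potential W" unfolding bounded_potential_def using W by (auto intro!: exI[of _ "B + 1"] simp: abs_le_iff algebra_simps)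
  note L' = potential_mult_L2[OF this L(1)]
  have q: "cmod (complex_of_real (exp (W x) - 1)) \<le> B" for x using W(2)[of x] by (simp only: norm_of_real)
  have qm: "(\<lambda>x. complex_of_real (exp (W x) - 1)) \<in> borel_measurable borel" using W(1) by measurable
  have "L2_norm (free_op c f f2 f4) =
    L2_norm (\<lambda>x. (f4 x + of_real (c\<^sup>2) * f2 x + of_real (exp (W x)) * f x) - of_real (exp (W x) - 1) * f x)" by (simp add: algebra_simps)
  also have "\<dots> \<le> L2_norm (pot_op c W f f2 f4) +
      L2_norm (\<lambda>x. of_real (exp (W x) - 1) * f x)" using L L' L2_bounded_mult[OF L(1) qm q] by (intro L2_triangle_diff L2_add L2_cmul) auto
  also have "L2_norm (\<lambda>x. of_real (exp (W x) - 1) * f x) \<le> B * L2_norm f" by (rule L2_norm_bounded_mult[OF L(1) qm q])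
  finally show ?thesis by simp
qed

section \<open>Pointwise control and continuous representatives\<close>

text \<open>Cauchy-Schwarz against the indicator of [a, b]: the one-dimensional Sobolev embedding
  into functions of Hoelder exponent 1/2.\<close>

lemma antideriv_Hoelder:
  assumes "antideriv F f" "f \<in> L2" "a \<le> b"
  shows "cmod (F b - F a) \<le> sqrt (b - a) * L2_norm f"
proof -
  have i: "(\<lambda>x. complex_of_real (indicator {a..b} x)) \<in> L2"
    by (auto simp: L2_iff power2_eq_square simp flip: indicator_inter_arith intro!: integrable_real_indicator) (simp add: emeasure_lborel_Icc_eq)
  have n: "L2_norm (\<lambda>x. complex_of_real (indicator {a..b} x)) = sqrt (b - a)"
    using assms(3) by (simp add: L2_norm_def power2_eq_square flip: indicator_inter_arith)
  have "F b - F a = L2_inner f (\<lambda>x. complex_of_real (indicator {a..b} x))"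
    using antideriv_eq[OF assms(1,3)] unfolding L2_inner_def set_lebesgue_integral_def by (simp add: scaleR_conv_of_real mult.commute)
  then show ?thesis using L2_Cauchy_Schwarz[OF assms(2) i] n by (simp add: mult.commute)
qed

text \<open>The value at x is compared with the values on [x, x + 1] by the Hoelder bound and then
  averaged over this interval of length 1.\<close>

lemma antideriv_sup_bound:
  assumes F: "antideriv F f" "F \<in> L2" "f \<in> L2"
  shows "cmod (F x) \<le> L2_norm F + L2_norm f"
proof -
  let ?I = "\<lambda>y. complex_of_real (indicator {x..x+1} y)"
  have i: "?I \<in> L2" by (auto simp: L2_iff power2_eq_square simp flip: indicator_inter_arith intro!: integrable_real_indicator)
  have n: "L2_norm ?I = 1" by (simp add: L2_norm_def power2_eq_square flip: indicator_inter_arith)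
  have le: "cmod (F x) \<le> cmod (F y) + L2_norm f" if "y \<in> {x..x+1}" for y
  proof -
    have "cmod (F y - F x) \<le> sqrt (y - x) * L2_norm f" using that by (intro antideriv_Hoelder F) auto
    also have "\<dots> \<le> 1 * L2_norm f" using that by (intro mult_right_mono) auto
    finally show ?thesis using norm_triangle_ineq2[of "F x" "F y"] by (simp add: norm_minus_commute)
  qed
  have ints: "integrable lborel (\<lambda>y. indicator {x..x+1} y :: real)" by (intro integrable_real_indicator) auto
  have "cmod (F x) = (LINT y|lborel. cmod (F x) * indicator {x..x+1} y)" by simp
  also have "\<dots> \<le> (LINT y|lborel. cmod (F y) * cmod (?I y) + L2_norm f * indicator {x..x+1} y)" using L2_norm_mult_integrable[OF F(2) i] ints
  proof (intro integral_mono Bochner_Integration.integrable_add integrable_mult_right)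
    fix y
    show "cmod (F x) * indicator {x..x+1} y \<le> cmod (F y) * cmod (?I y) + L2_norm f * indicator {x..x+1} y" using le[of y] by (cases "y \<in> {x..x+1}") auto
  qed auto
  also have "\<dots> = (LINT y|lborel. cmod (F y) * cmod (?I y)) + L2_norm f"
    by (subst Bochner_Integration.integral_add[OF L2_norm_mult_integrable[OF F(2) i] integrable_mult_right[OF ints]]) simp
  also have "\<dots> \<le> L2_norm F + L2_norm f" using L2_Cauchy_Schwarz_abs[OF F(2) i] n by simp
  finally show ?thesis .
qed

text \<open>The representatives are chosen so that each function is a primitive of the next. All but
  the last are then continuous and have meaningful point values, as locally uniform limits
  require.\<close>

definition H4c where
  "H4c f f1 f2 f3 f4 \<longleftrightarrow> H4 f f1 f2 f3 f4 \<and> antideriv f f1 \<and> antideriv f1 f2 \<and> antideriv f2 f3 \<and> antideriv f3 f4"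

lemma L2_eq_measurable_L2:
  assumes "F =\<^sub>2 f" "f \<in> L2" "F \<in> borel_measurable borel" shows "F \<in> L2"
  using assms unfolding L2_iff L2_eq_def by (auto intro!: integrable_cong_AE_imp[of _ "\<lambda>x. (cmod (f x))\<^sup>2"] elim: eventually_mono)

text \<open>Each derivative has a representative that is a primitive, and a primitive does not
  notice changes of its integrand on null sets, so the four representatives fit together.\<close>

lemma sobolev_H4c:
  assumes "f \<in> sobolev 4"
  obtains F F1 F2 F3 F4 where "f =\<^sub>2 F" "H4c F F1 F2 F3 F4"
proof -
  obtain f1 f2 f3 f4 where H: "H4 f f1 f2 f3 f4" using sobolev_H4[OF assms] by blast
  have w: "wd f f1" "wd f1 f2" "wd f2 f3" "wd f3 f4" using H by (auto simp: H4_def)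
  note L = H4_L2[OF H]
  obtain F where F: "F =\<^sub>2 f" "antideriv F f1" using wd_antideriv[OF w(1)] by blast
  obtain F1 where F1: "F1 =\<^sub>2 f1" "antideriv F1 f2" using wd_antideriv[OF w(2)] by blast
  obtain F2 where F2: "F2 =\<^sub>2 f2" "antideriv F2 f3" using wd_antideriv[OF w(3)] by blast
  obtain F3 where F3: "F3 =\<^sub>2 f3" "antideriv F3 f4" using wd_antideriv[OF w(4)] by blast
  have L': "F \<in> L2" "F1 \<in> L2" "F2 \<in> L2" "F3 \<in> L2"
    by (rule L2_eq_measurable_L2[OF F(1) L(1) borel_measurable_continuous_onI[OF antideriv_continuous[OF F(2)]]],
        rule L2_eq_measurable_L2[OF F1(1) L(2) borel_measurable_continuous_onI[OF antideriv_continuous[OF F1(2)]]],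
        rule L2_eq_measurable_L2[OF F2(1) L(3) borel_measurable_continuous_onI[OF antideriv_continuous[OF F2(2)]]],
        rule L2_eq_measurable_L2[OF F3(1) L(4) borel_measurable_continuous_onI[OF antideriv_continuous[OF F3(2)]]])
  have a: "antideriv F F1" "antideriv F1 F2" "antideriv F2 F3" "antideriv F3 f4" using F F1 F2 F3 L L' by (auto intro: antideriv_cong L2_eq_sym)
  then have "H4c F F1 F2 F3 f4" using L' L by (auto simp: H4c_def H4_def intro: wd_of_antideriv)
  then show ?thesis using that F(1) L2_eq_sym by blast
qed

lemma classical_wd:
  assumes "\<And>x. (f has_vector_derivative g x) (at x)" "continuous_on UNIV g" "f \<in> L2" "g \<in> L2"
  shows "wd f g"
  by (intro wd_of_antideriv has_vector_derivative_antideriv assms)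

section \<open>Compactness of approximate null vectors\<close>

lemma L2_shift:
  assumes "f \<in> L2" shows "(\<lambda>x. f (x + q)) \<in> L2" "L2_norm (\<lambda>x. f (x + q)) = L2_norm f"
proof -
  show "(\<lambda>x. f (x + q)) \<in> L2" using lborel_integrable_real_affine[OF L2_integrable[OF assms], of 1 q] assms
    by (auto simp: L2_iff add.commute intro!: measurable_compose[of "\<lambda>x. x + q" borel borel f])
  show "L2_norm (\<lambda>x. f (x + q)) = L2_norm f"
    using lborel_integral_real_affine[of 1 "\<lambda>x. (cmod (f x))\<^sup>2" q] by (simp add: L2_norm_def add.commute)
qed

lemma set_integral_shift:
  fixes h :: "real \<Rightarrow> 'a::{banach, second_countable_topology}"
  shows "(LINT t:{a+q..b+q}|lborel. h t) = (LINT t:{a..b}|lborel. h (t + q))"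
proof -
  have "(LINT t:{a+q..b+q}|lborel. h t) = (LINT t|lborel. indicator {a+q..b+q} (q + 1 * t) *\<^sub>R h (q + 1 * t))"
    using lborel_integral_real_affine[of 1 "\<lambda>t. indicator {a+q..b+q} t *\<^sub>R h t" q] by (simp add: set_lebesgue_integral_def)
  also have "\<dots> = (LINT t:{a..b}|lborel. h (t + q))" unfolding set_lebesgue_integral_def
    by (intro Bochner_Integration.integral_cong) (auto simp: indicator_def add.commute)
  finally show ?thesis .
qed

lemma set_integral_tendsto:
  fixes h :: "nat \<Rightarrow> real \<Rightarrow> 'a::{banach, second_countable_topology}"
  assumes "\<And>i. h i \<in> borel_measurable borel" "\<And>x. (\<lambda>i. h i x) \<longlonglongrightarrow> g x" "\<And>i x. norm (h i x) \<le> M"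
  shows "(\<lambda>i. LINT t:{a..b::real}|lborel. h i t) \<longlonglongrightarrow> (LINT t:{a..b}|lborel. g t)"
  unfolding set_lebesgue_integral_def
proof (rule integral_dominated_convergence[where w="\<lambda>t. M * indicator {a..b} t"])
  have [measurable]: "g \<in> borel_measurable borel" by (rule borel_measurable_LIMSEQ_metric[of h]) (use assms in auto)
  note [measurable] = assms(1)
  show "(\<lambda>x. indicat_real {a..b} x *\<^sub>R g x) \<in> borel_measurable lborel" by measurable
  show "(\<lambda>x. indicat_real {a..b} x *\<^sub>R h i x) \<in> borel_measurable lborel" for i by measurable
  show "integrable lborel (\<lambda>t. M * indicat_real {a..b} t)"
    by (intro integrable_mult_right integrable_real_indicator) (auto simp: emeasure_lborel_Icc_eq)
  show "AE x in lborel. (\<lambda>i. indicat_real {a..b} x *\<^sub>R h i x) \<longlonglongrightarrow> indicat_real {a..b} x *\<^sub>R g x"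
    by (intro AE_I2 tendsto_intros assms)
  show "AE x in lborel. norm (indicat_real {a..b} x *\<^sub>R h i x) \<le> M * indicat_real {a..b} x" for i using assms(3) by (auto simp: indicator_def)
qed

text \<open>Fatou's lemma: the pointwise limit inherits square integrability from the uniform bound,
  with no claim of convergence in norm.\<close>

lemma L2_limit:
  assumes h: "\<And>i. h i \<in> L2" "\<And>i. L2_norm (h i) \<le> M" and lim: "\<And>x. (\<lambda>i. h i x) \<longlonglongrightarrow> g x"
  shows "g \<in> L2"
proof -
  have hm[measurable]: "h i \<in> borel_measurable borel" for i using h(1) by auto
  have [measurable]: "g \<in> borel_measurable borel" by (rule borel_measurable_LIMSEQ_metric[of h]) (use lim in auto)
  have M: "M \<ge> 0" using h(2)[of 0] L2_norm_nonneg order_trans by blast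
  have "(\<integral>\<^sup>+x. ennreal ((cmod (g x))\<^sup>2) \<partial>lborel) = (\<integral>\<^sup>+x. liminf (\<lambda>i. ennreal ((cmod (h i x))\<^sup>2)) \<partial>lborel)"
  proof (intro nn_integral_cong)
    fix x
    have "(\<lambda>i. ennreal ((cmod (h i x))\<^sup>2)) \<longlonglongrightarrow> ennreal ((cmod (g x))\<^sup>2)" by (intro tendsto_intros lim)
    then show "ennreal ((cmod (g x))\<^sup>2) = liminf (\<lambda>i. ennreal ((cmod (h i x))\<^sup>2))" by (intro lim_imp_Liminf[symmetric]) auto
  qed
  also have "\<dots> \<le> liminf (\<lambda>i. \<integral>\<^sup>+x. ennreal ((cmod (h i x))\<^sup>2) \<partial>lborel)" by (rule nn_integral_liminf) measurable
  also have "\<dots> \<le> ennreal (M\<^sup>2)"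
  proof (rule Liminf_le)
    show "\<forall>\<^sub>F i in sequentially. (\<integral>\<^sup>+x. ennreal ((cmod (h i x))\<^sup>2) \<partial>lborel) \<le> ennreal (M\<^sup>2)"
    proof (intro always_eventually allI)
      fix i
      have "(LINT x|lborel. (cmod (h i x))\<^sup>2) \<le> M\<^sup>2" using power_mono[OF h(2)[of i], of 2] by (simp add: L2_norm_square)
      then show "(\<integral>\<^sup>+x. ennreal ((cmod (h i x))\<^sup>2) \<partial>lborel) \<le> ennreal (M\<^sup>2)"
        by (subst nn_integral_eq_integral[OF L2_integrable[OF h(1)]]) (auto intro: ennreal_leI)
    qed
  qed simp
  finally have "(\<integral>\<^sup>+x. ennreal ((cmod (g x))\<^sup>2) \<partial>lborel) < \<infinity>" by (auto intro: order.strict_trans1)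
  then show ?thesis unfolding L2_iff by (auto intro!: integrableI_nonneg)
qed

text \<open>Convergence on a dense set spreads to all points by the uniform Hoelder bound. Together
  with a diagonal subsequence this replaces Arzela-Ascoli.\<close>

lemma equicontinuous_convergent:
  fixes h :: "nat \<Rightarrow> real \<Rightarrow> complex"
  assumes H: "\<And>i x y. x \<le> y \<Longrightarrow> cmod (h i y - h i x) \<le> sqrt (y - x) * M"
    and conv: "\<And>x. x \<in> \<rat> \<Longrightarrow> convergent (\<lambda>i. h i x)"
  shows "convergent (\<lambda>i. h i x)"
proof (rule Cauchy_convergent, rule metric_CauchyI)
  fix e :: real assume e: "e > 0"
  \<comment> \<open>A shift by less than \<open>d\<close> changes every \<open>h i\<close> by less
    than e / 3; the summand 1 keeps the denominator positive when M = 0.\<close>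
  define d where "d = (e / (3 * (\<bar>M\<bar> + 1)))\<^sup>2"
  have d: "d > 0" using e by (simp add: d_def)
  obtain y where y: "y \<in> \<rat>" "x < y" "y < x + d" using Rats_dense_in_real[of x "x + d"] d by auto
  have le: "cmod (h i y - h i x) < e / 3" for i
  proof -
    have "cmod (h i y - h i x) \<le> sqrt (y - x) * M" using y by (intro H) auto
    also have "\<dots> \<le> sqrt (y - x) * \<bar>M\<bar>" using y by (intro mult_left_mono) auto
    also have "\<dots> \<le> sqrt d * \<bar>M\<bar>" using y by (intro mult_right_mono) auto
    also have "sqrt d = e / (3 * (\<bar>M\<bar> + 1))" using e by (simp add: d_def)
    also have "e / (3 * (\<bar>M\<bar> + 1)) * \<bar>M\<bar> < e / (3 * (\<bar>M\<bar> + 1)) * (\<bar>M\<bar> + 1)"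
      using e by (intro mult_strict_left_mono) auto
    also have "\<dots> = e / 3" by (simp add: field_simps)
    finally show ?thesis .
  qed
  have "Cauchy (\<lambda>i. h i y)" using conv[OF y(1)] by (rule convergent_Cauchy)
  then obtain N where N: "\<And>i j. i \<ge> N \<Longrightarrow> j \<ge> N \<Longrightarrow> dist (h i y) (h j y) < e / 3"
    using e by (metis divide_pos_pos metric_CauchyD zero_less_numeral)
  have "dist (h i x) (h j x) < e" if "i \<ge> N" "j \<ge> N" for i j
  proof -
    have "h i x - h j x = - (h i y - h i x) + (h i y - h j y) + (h j y - h j x)" by simp
    then have "cmod (h i x - h j x) \<le> cmod (h i y - h i x) + cmod (h i y - h j y) + cmod (h j y - h j x)"
      by (metis norm_minus_cancel norm_triangle_ineq order_trans add_right_mono)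
    then show ?thesis using le[of i] le[of j] N[OF that] by (simp add: dist_norm)
  qed
  then show "\<exists>N. \<forall>m\<ge>N. \<forall>n\<ge>N. dist (h m x) (h n x) < e" by blast
qed

lemma H4c_continuous:
  assumes "H4c f f1 f2 f3 f4"
  shows "continuous_on A f"
  using assms by (auto simp: H4c_def intro: antideriv_continuous)

lemma potential_exp_bound: "\<bar>exp (w::real) - 1\<bar> \<le> B \<Longrightarrow> exp w \<le> B + 1"
  by linarith

text \<open>A sequence bounded in H^4, seen from the moving centres \<open>q i\<close>, has a
  subsequence along which it and its first three derivatives converge pointwise. The relations
  between neighbouring derivatives pass to the limit in integrated form, and the residual tends to
  zero, so the limit solves the homogeneous equation with the limiting potential.\<close>

lemma compact_sequence:
  fixes f f1 f2 f3 f4 :: "nat \<Rightarrow> real \<Rightarrow> complex" and W :: "nat \<Rightarrow> real \<Rightarrow> real" and q :: "nat \<Rightarrow> real"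
  assumes c: "c\<^sup>2 < 2"
    and H: "\<And>i. H4c (f i) (f1 i) (f2 i) (f3 i) (f4 i)"
    and nf: "\<And>i. L2_norm (f i) \<le> 1"
    and W: "\<And>i. W i \<in> borel_measurable borel" "\<And>i x. \<bar>exp (W i x) - 1\<bar> \<le> B"
    and small: "(\<lambda>i. L2_norm (pot_op c (W i) (f i) (f2 i) (f4 i))) \<longlonglongrightarrow> 0"
    and Wlim: "\<And>x. (\<lambda>i. W i (x + q i)) \<longlonglongrightarrow> W0 x" and W0: "continuous_on UNIV W0"
  shows "\<exists>r g g1 g2 g3. strict_mono r \<and> (\<forall>x. (\<lambda>i. f (r i) (x + q (r i))) \<longlonglongrightarrow> g x) \<and>
    H4c g g1 g2 g3 (\<lambda>x. - (of_real (c\<^sup>2) * g2 x + of_real (exp (W0 x)) * g x))"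
proof -
  define \<eta> where "\<eta> i = (pot_op c (W i) (f i) (f2 i) (f4 i))" for i
  have HH: "H4 (f i) (f1 i) (f2 i) (f3 i) (f4 i)" for i using H by (simp add: H4c_def)
  note L = H4_L2[OF HH]
  have bp: "bounded_potential (W i)" for i unfolding bounded_potential_def using W potential_exp_bound by blast
  have \<eta>L: "\<eta> i \<in> L2" for i unfolding \<eta>_def by (intro L2_add L2_cmul L potential_mult_L2 bp)
  have B: "B \<ge> 0" using W(2)[of 0 0] by linarith
  obtain E where E: "\<And>i. L2_norm (\<eta> i) \<le> E" using convergent_imp_Bseq[OF convergentI[OF small]] unfolding Bseq_def \<eta>_def by auto
  define M where "M = ellip c * (E + B)"
  have N: "L2_norm (free_op c (f i) (f2 i) (f4 i)) \<le> E + B" for i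
  proof -
    have "L2_norm (free_op c (f i) (f2 i) (f4 i)) \<le> L2_norm (\<eta> i) + B * L2_norm (f i)" unfolding \<eta>_def by (rule H4_elliptic_potential[OF c HH W])
    also have "\<dots> \<le> E + B * 1" by (intro add_mono E mult_left_mono nf B)
    finally show ?thesis by simp
  qed
  have M: "L2_norm (f i) \<le> M" "L2_norm (f1 i) \<le> M" "L2_norm (f2 i) \<le> M" "L2_norm (f3 i) \<le> M" "L2_norm (f4 i) \<le> M" for i
    using H4_elliptic[OF c HH[of i]] mult_left_mono[OF N[of i], of "ellip c"] ellip_ge_1[OF c] unfolding M_def by (auto intro: order_trans)
  have a: "antideriv (f i) (f1 i)" "antideriv (f1 i) (f2 i)" "antideriv (f2 i) (f3 i)" "antideriv (f3 i) (f4 i)" for i using H by (auto simp: H4c_def)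
  have sup: "cmod (f i x) \<le> 2 * M" "cmod (f1 i x) \<le> 2 * M" "cmod (f2 i x) \<le> 2 * M" "cmod (f3 i x) \<le> 2 * M" for i x
    using antideriv_sup_bound[OF a(1) L(1) L(2), of i x] antideriv_sup_bound[OF a(2) L(2) L(3), of i x]
      antideriv_sup_bound[OF a(3) L(3) L(4), of i x] antideriv_sup_bound[OF a(4) L(4) L(5), of i x] M[of i] by linarith+
  have hoel: "cmod (h i (y + q i) - h i (x + q i)) \<le> sqrt (y - x) * M"
    if "x \<le> y" "antideriv (h i) (h' i)" "h' i \<in> L2" "L2_norm (h' i) \<le> M" for h h' :: "nat \<Rightarrow> real \<Rightarrow> complex" and x y i
  proof -
    have "cmod (h i (y + q i) - h i (x + q i)) \<le> sqrt ((y + q i) - (x + q i)) * L2_norm (h' i)" using that by (intro antideriv_Hoelder) auto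
    also have "\<dots> \<le> sqrt (y - x) * M" using that by (auto intro: mult_left_mono)
    finally show ?thesis .
  qed
  \<comment> \<open>The function and its three derivatives are bundled into one tuple so that a
    single diagonal subsequence serves all four.\<close>
  define P where "P i x = (f i (x + q i), f1 i (x + q i), f2 i (x + q i), f3 i (x + q i))" for i x
  have "norm (P i x) \<le> 8 * M" for i x
  proof -
    have "norm (P i x) \<le> norm (f i (x + q i)) + (norm (f1 i (x + q i)) + (norm (f2 i (x + q i)) + norm (f3 i (x + q i))))"
      unfolding P_def by (intro order_trans[OF norm_Pair_le] add_mono order_refl)
    then show ?thesis using sup[of i "x + q i"] by linarith
  qed
  then obtain r where r: "strict_mono r" and conv: "\<And>x. x \<in> \<rat> \<Longrightarrow> \<exists>l. (\<lambda>n. P (r n) x) \<longlonglongrightarrow> l"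
    using function_convergent_subsequence[of "\<rat> :: real set" P "8 * M"] countable_rat by metis
  have cP: "convergent (\<lambda>n. f (r n) (x + q (r n)))" "convergent (\<lambda>n. f1 (r n) (x + q (r n)))"
      "convergent (\<lambda>n. f2 (r n) (x + q (r n)))" "convergent (\<lambda>n. f3 (r n) (x + q (r n)))" if "x \<in> \<rat>" for x
  proof -
    obtain l where l: "(\<lambda>n. P (r n) x) \<longlonglongrightarrow> l" using conv[OF \<open>x \<in> \<rat>\<close>] by blast
    note fs = tendsto_fst[OF l] tendsto_fst[OF tendsto_snd[OF l]] tendsto_fst[OF tendsto_snd[OF tendsto_snd[OF l]]]
      tendsto_snd[OF tendsto_snd[OF tendsto_snd[OF l]]]
    show "convergent (\<lambda>n. f (r n) (x + q (r n)))" "convergent (\<lambda>n. f1 (r n) (x + q (r n)))"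
      "convergent (\<lambda>n. f2 (r n) (x + q (r n)))" "convergent (\<lambda>n. f3 (r n) (x + q (r n)))"
      using fs[unfolded P_def fst_conv snd_conv] by (auto intro: convergentI)
  qed
  have cv: "convergent (\<lambda>n. f (r n) (x + q (r n)))" "convergent (\<lambda>n. f1 (r n) (x + q (r n)))"
      "convergent (\<lambda>n. f2 (r n) (x + q (r n)))" "convergent (\<lambda>n. f3 (r n) (x + q (r n)))" for x
    by (rule equicontinuous_convergent[where M=M], rule hoel[OF _ a(1) L(2) M(2)], assumption, erule cP)
       (rule equicontinuous_convergent[where M=M], rule hoel[OF _ a(2) L(3) M(3)], assumption, erule cP,
        rule equicontinuous_convergent[where M=M], rule hoel[OF _ a(3) L(4) M(4)], assumption, erule cP,
        rule equicontinuous_convergent[where M=M], rule hoel[OF _ a(4) L(5) M(5)], assumption, erule cP)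
  define g g1 g2 g3 where "g x = lim (\<lambda>n. f (r n) (x + q (r n)))" and "g1 x = lim (\<lambda>n. f1 (r n) (x + q (r n)))"
    and "g2 x = lim (\<lambda>n. f2 (r n) (x + q (r n)))" and "g3 x = lim (\<lambda>n. f3 (r n) (x + q (r n)))" for x
  have g: "\<And>x. (\<lambda>n. f (r n) (x + q (r n))) \<longlonglongrightarrow> g x"
    and g1: "\<And>x. (\<lambda>n. f1 (r n) (x + q (r n))) \<longlonglongrightarrow> g1 x"
    and g2: "\<And>x. (\<lambda>n. f2 (r n) (x + q (r n))) \<longlonglongrightarrow> g2 x"
    and g3: "\<And>x. (\<lambda>n. f3 (r n) (x + q (r n))) \<longlonglongrightarrow> g3 x"
    using cv unfolding convergent_LIMSEQ_iff g_def g1_def g2_def g3_def by auto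
  have sh: "(\<lambda>x. h (x + q)) \<in> borel_measurable borel" if "h \<in> borel_measurable borel" for h :: "real \<Rightarrow> complex" and q
    using that by measurable
  have shW: "(\<lambda>x. W i (x + q)) \<in> borel_measurable borel" for i q using W(1)[of i] by measurable
  have gL: "g \<in> L2" "g1 \<in> L2" "g2 \<in> L2" "g3 \<in> L2" by (rule L2_limit[OF _ _ g, where M=M], simp_all add: L2_shift L M)
       (rule L2_limit[OF _ _ g1, where M=M], simp_all add: L2_shift L M,
        rule L2_limit[OF _ _ g2, where M=M], simp_all add: L2_shift L M,
        rule L2_limit[OF _ _ g3, where M=M], simp_all add: L2_shift L M)
  \<comment> \<open>A first-order relation survives the limit on every bounded interval: the
    right-hand side converges by dominated convergence, the left-hand side pointwise.\<close>
  have step: "h' b - h' a' = (LINT t:{a'..b}|lborel. k' t)"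
    if "a' \<le> b" "\<And>i. antideriv (h i) (k i)" "\<And>x. (\<lambda>n. h (r n) (x + q (r n))) \<longlonglongrightarrow> h' x"
      "\<And>x. (\<lambda>n. k (r n) (x + q (r n))) \<longlonglongrightarrow> k' x" "\<And>i x. cmod (k i x) \<le> 2 * M" "\<And>i. k i \<in> L2"
    for h k h' k' a' b
  proof -
    have "(\<lambda>n. LINT t:{a'..b}|lborel. k (r n) (t + q (r n))) \<longlonglongrightarrow> (LINT t:{a'..b}|lborel. k' t)"
      by (rule set_integral_tendsto[where M="2*M"]) (use that in \<open>auto intro: sh\<close>)
    moreover have "(LINT t:{a'..b}|lborel. k (r n) (t + q (r n))) = h (r n) (b + q (r n)) - h (r n) (a' + q (r n))" for n
      using antideriv_eq[OF that(2), of "a' + q (r n)" "b + q (r n)" "r n"] that(1) set_integral_shift[of a' "q (r n)" b "k (r n)"] by simp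
    ultimately have "(\<lambda>n. h (r n) (b + q (r n)) - h (r n) (a' + q (r n))) \<longlonglongrightarrow> (LINT t:{a'..b}|lborel. k' t)" by simp
    then show ?thesis using tendsto_diff[OF that(3)[of b] that(3)[of a']] LIMSEQ_unique by blast
  qed
  let ?g4 = "\<lambda>x. - (of_real (c\<^sup>2) * g2 x + of_real (exp (W0 x)) * g x)"
  have W0m: "W0 \<in> borel_measurable borel" by (rule borel_measurable_continuous_onI[OF W0])
  have W0b: "\<bar>exp (W0 x) - 1\<bar> \<le> B" for x
  proof (rule tendsto_upperbound[of "\<lambda>i. \<bar>exp (W i (x + q i)) - 1\<bar>" _ sequentially])
    show "(\<lambda>i. \<bar>exp (W i (x + q i)) - 1\<bar>) \<longlonglongrightarrow> \<bar>exp (W0 x) - 1\<bar>" by (intro tendsto_intros Wlim)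
  qed (auto simp: W)
  have bp0: "bounded_potential W0" unfolding bounded_potential_def using W0m potential_exp_bound[OF W0b] by blast
  have g4L: "?g4 \<in> L2" by (intro L2_uminus L2_add L2_cmul gL potential_mult_L2 bp0)
  have ag: "antideriv g g1" "antideriv g1 g2" "antideriv g2 g3" by (rule antiderivI, rule L2_set_integrable[OF gL(2)], erule step[OF _ a(1) g g1 sup(2) L(2)])
       (rule antiderivI, rule L2_set_integrable[OF gL(3)], erule step[OF _ a(2) g1 g2 sup(3) L(3)],
        rule antiderivI, rule L2_set_integrable[OF gL(4)], erule step[OF _ a(3) g2 g3 sup(4) L(4)])
  have Wr: "(\<lambda>n. W (r n) (x + q (r n))) \<longlonglongrightarrow> W0 x" for x using LIMSEQ_subseq_LIMSEQ[OF Wlim r, of x] by (simp add: o_def)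
  have a4: "antideriv g3 ?g4"
  proof (rule antiderivI[OF L2_set_integrable[OF g4L]])
    fix a' b :: real assume ab: "a' \<le> b"
    \<comment> \<open>The fourth derivatives are bounded only in norm, so their limit is taken
      through the equation: up to the vanishing residual they equal this expression, which converges
      pointwise and boundedly.\<close>
    let ?k = "\<lambda>n t. - (of_real (c\<^sup>2) * f2 (r n) (t + q (r n)) + of_real (exp (W (r n) (t + q (r n)))) * f (r n) (t + q (r n)))"
    have "(\<lambda>n. LINT t:{a'..b}|lborel. ?k n t) \<longlonglongrightarrow> (LINT t:{a'..b}|lborel. ?g4 t)"
    proof (rule set_integral_tendsto[where M="2 * (2 * M) + (B + 1) * (2 * M)"])
      show "(\<lambda>n. ?k n x) \<longlonglongrightarrow> ?g4 x" for x by (intro tendsto_intros g g2 Wr)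
      show "?k n \<in> borel_measurable borel" for n using sh[OF L2_measurable[OF L(3)]] sh[OF L2_measurable[OF L(1)]] shW by measurable
      show "norm (?k n x) \<le> 2 * (2 * M) + (B + 1) * (2 * M)" for n x
      proof -
        have "norm (?k n x) \<le> norm (of_real (c\<^sup>2) * f2 (r n) (x + q (r n))) +
            norm (of_real (exp (W (r n) (x + q (r n)))) * f (r n) (x + q (r n)))" unfolding norm_minus_cancel by (rule norm_triangle_ineq)
        also have "\<dots> \<le> 2 * (2 * M) + (B + 1) * (2 * M)" unfolding norm_mult norm_of_real using c sup W(2) potential_exp_bound[OF W(2)] B
          by (intro add_mono mult_mono) auto
        finally show ?thesis .
      qed
    qed
    moreover have "(\<lambda>n. LINT t:{a'..b}|lborel. \<eta> (r n) (t + q (r n))) \<longlonglongrightarrow> 0"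
    proof (rule Lim_null_comparison)
      show "(\<lambda>n. sqrt (b - a') * L2_norm (\<eta> (r n))) \<longlonglongrightarrow> 0"
        using LIMSEQ_subseq_LIMSEQ[OF small r] by (intro tendsto_mult_right_zero) (simp add: o_def \<eta>_def)
      have "norm (LINT t:{a'..b}|lborel. \<eta> (r n) (t + q (r n))) \<le> sqrt (b - a') * L2_norm (\<eta> (r n))" for n
      proof -
        obtain G where G: "antideriv G (\<lambda>t. \<eta> (r n) (t + q (r n)))"
          using antideriv_exists[OF L2_set_integrable[OF L2_shift(1)[OF \<eta>L]]] by blast
        show ?thesis using antideriv_Hoelder[OF G L2_shift(1)[OF \<eta>L] ab] antideriv_eq[OF G ab] by (simp add: L2_shift(2)[OF \<eta>L])
      qed
      then show "\<forall>\<^sub>F n in sequentially. norm (LINT t:{a'..b}|lborel. \<eta> (r n) (t + q (r n))) \<le> sqrt (b - a') * L2_norm (\<eta> (r n))"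
        by simp
    qed
    ultimately have "(\<lambda>n. (LINT t:{a'..b}|lborel. \<eta> (r n) (t + q (r n))) + (LINT t:{a'..b}|lborel. ?k n t)) \<longlonglongrightarrow>
       0 + (LINT t:{a'..b}|lborel. ?g4 t)" by (intro tendsto_add)
    moreover have "(LINT t:{a'..b}|lborel. \<eta> (r n) (t + q (r n))) + (LINT t:{a'..b}|lborel. ?k n t) =
        f3 (r n) (b + q (r n)) - f3 (r n) (a' + q (r n))" for n
    proof -
      have kL: "?k n \<in> L2"
        using L2_shift(1)[OF L(3)[of "r n"], of "q (r n)"] L2_shift(1)[OF potential_mult_L2[OF bp[of "r n"] L(1)[of "r n"]], of "q (r n)"]
        by (intro L2_uminus L2_add L2_cmul) auto
      have "(LINT t:{a'..b}|lborel. \<eta> (r n) (t + q (r n))) + (LINT t:{a'..b}|lborel. ?k n t) =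
         (LINT t:{a'..b}|lborel. \<eta> (r n) (t + q (r n)) + ?k n t)" by (intro set_integral_add(2)[symmetric] L2_set_integrable L2_shift \<eta>L kL)
      also have "\<dots> = (LINT t:{a'..b}|lborel. f4 (r n) (t + q (r n)))" by (simp add: \<eta>_def)
      finally show ?thesis using antideriv_eq[OF a(4), of "a' + q (r n)" "b + q (r n)" "r n"] ab set_integral_shift[of a' "q (r n)" b "f4 (r n)"] by simp
    qed
    ultimately have "(\<lambda>n. f3 (r n) (b + q (r n)) - f3 (r n) (a' + q (r n))) \<longlonglongrightarrow> (LINT t:{a'..b}|lborel. ?g4 t)" by simp
    then show "g3 b - g3 a' = (LINT t:{a'..b}|lborel. ?g4 t)" using tendsto_diff[OF g3[of b] g3[of a']] LIMSEQ_unique by blast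
  qed
  have "H4c g g1 g2 g3 ?g4" unfolding H4c_def H4_def using ag a4 gL g4L by (auto intro: wd_of_antideriv)
  then show ?thesis using r g by blast
qed

section \<open>Vanishing of approximate null vectors near the centres and on the whole line\<close>

context
  fixes f f1 f2 f3 f4 :: "nat \<Rightarrow> real \<Rightarrow> complex" and W :: "nat \<Rightarrow> real \<Rightarrow> real" and B c :: real
  assumes c: "c\<^sup>2 < 2"
    and H: "\<And>i. H4c (f i) (f1 i) (f2 i) (f3 i) (f4 i)"
    and nf: "\<And>i. L2_norm (f i) \<le> 1"
    and W: "\<And>i. W i \<in> borel_measurable borel" "\<And>i x. \<bar>exp (W i x) - 1\<bar> \<le> B"
    and small: "(\<lambda>i. L2_norm (pot_op c (W i) (f i) (f2 i) (f4 i))) \<longlonglongrightarrow> 0"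
begin

text \<open>By contradiction, on a subsequence along which the mass in the window stays at least e.
  A further subsequence converges around the centre to a solution of the limiting equation, which
  \<open>kernel\<close> declares zero; dominated convergence, with \<open>sup\<close> as majorant,
  then removes the mass.\<close>

lemma local_vanishing:
  assumes Wlim: "\<And>x. (\<lambda>i. W i (x + q i)) \<longlonglongrightarrow> W0 x" and W0: "continuous_on UNIV W0"
    and kernel: "\<And>r g g1 g2 g3 x. strict_mono r \<Longrightarrow> (\<And>x. (\<lambda>i. f (r i) (x + q (r i))) \<longlonglongrightarrow> g x) \<Longrightarrow>
      H4c g g1 g2 g3 (\<lambda>x. - (of_real (c\<^sup>2) * g2 x + of_real (exp (W0 x)) * g x)) \<Longrightarrow> g x = 0"
    and sup: "\<And>i x. cmod (f i x) \<le> M"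
  shows "(\<lambda>i. LINT x:{q i - R..q i + R}|lborel. (cmod (f i x))\<^sup>2) \<longlonglongrightarrow> 0"
proof (rule ccontr)
  let ?I = "\<lambda>i. LINT x:{q i - R..q i + R}|lborel. (cmod (f i x))\<^sup>2"
  assume "\<not> ?thesis"
  then obtain e where e: "e > 0" "\<And>N. \<exists>i\<ge>N. \<not> norm (?I i - 0) < e" unfolding LIMSEQ_iff by blast
  then have "infinite {i. \<not> norm (?I i) < e}" by (simp add: infinite_nat_iff_unbounded_le)
  then obtain u :: "nat \<Rightarrow> nat" where u: "strict_mono u" "\<And>i. \<not> norm (?I (u i)) < e" using infinite_enumerate by blast
  have "\<exists>r g g1 g2 g3. strict_mono r \<and> (\<forall>x. (\<lambda>i. f (u (r i)) (x + q (u (r i)))) \<longlonglongrightarrow> g x) \<and>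
      H4c g g1 g2 g3 (\<lambda>x. - (of_real (c\<^sup>2) * g2 x + of_real (exp (W0 x)) * g x))"
  proof (rule compact_sequence[OF c, where f="\<lambda>i. f (u i)" and ?f1.0="\<lambda>i. f1 (u i)" and ?f2.0="\<lambda>i. f2 (u i)"
      and ?f3.0="\<lambda>i. f3 (u i)" and ?f4.0="\<lambda>i. f4 (u i)" and W="\<lambda>i. W (u i)" and q="\<lambda>i. q (u i)" and B=B and ?W0.0=W0])
    show "(\<lambda>i. L2_norm (\<lambda>x. f4 (u i) x + of_real (c\<^sup>2) * f2 (u i) x + of_real (exp (W (u i) x)) * f (u i) x)) \<longlonglongrightarrow> 0"
      using LIMSEQ_subseq_LIMSEQ[OF small u(1)] by (simp add: o_def)
    show "(\<lambda>i. W (u i) (x + q (u i))) \<longlonglongrightarrow> W0 x" for x using LIMSEQ_subseq_LIMSEQ[OF Wlim u(1), of x] by (simp add: o_def)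
  qed (use H nf W W0 in auto)
  then obtain r g g1 g2 g3 where r: "strict_mono r" and g: "\<And>x. (\<lambda>i. f (u (r i)) (x + q (u (r i)))) \<longlonglongrightarrow> g x"
    and gH: "H4c g g1 g2 g3 (\<lambda>x. - (of_real (c\<^sup>2) * g2 x + of_real (exp (W0 x)) * g x))"
    by blast
  have g0: "g x = 0" for x using kernel[of "u \<circ> r" g g1 g2 g3 x] strict_mono_o[OF u(1) r] g gH by (simp add: o_def)
  have "(\<lambda>i. LINT t:{-R..R}|lborel. (cmod (f (u (r i)) (t + q (u (r i)))))\<^sup>2) \<longlonglongrightarrow> (LINT t:{-R..R}|lborel. (cmod (g t))\<^sup>2)"
  proof (rule set_integral_tendsto[where M="M\<^sup>2"])
    have [measurable]: "f i \<in> borel_measurable borel" for i by (rule borel_measurable_continuous_onI) (rule H4c_continuous[OF H])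
    show "(\<lambda>t. (cmod (f (u (r i)) (t + q (u (r i)))))\<^sup>2) \<in> borel_measurable borel" for i by measurable
    show "norm ((cmod (f (u (r i)) (x + q (u (r i)))))\<^sup>2) \<le> M\<^sup>2" for i x using sup by (simp add: power_mono)
  qed (intro tendsto_intros g)
  moreover have "(LINT t:{-R..R}|lborel. (cmod (f (u (r i)) (t + q (u (r i)))))\<^sup>2) = ?I (u (r i))" for i
    using set_integral_shift[of "-R" "q (u (r i))" R "\<lambda>x. (cmod (f (u (r i)) x))\<^sup>2"] by (simp add: algebra_simps)
  ultimately have "(\<lambda>i. ?I (u (r i))) \<longlonglongrightarrow> 0" by (simp add: g0)
  then have "(\<lambda>i. norm (?I (u (r i)))) \<longlonglongrightarrow> 0" by (rule tendsto_norm_zero)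
  then have "\<forall>\<^sub>F i in sequentially. norm (?I (u (r i))) < e" by (rule order_tendstoD(2)) (rule e(1))
  then show False using u(2) by (auto simp: eventually_sequentially)
qed

text \<open>In windows around the centres the mass vanishes by \<open>local_vanishing\<close>.
  Outside them the factor exp W is close to 1, so the free operator applied to f is small
  altogether, and its ellipticity makes the norm of f small.\<close>

lemma global_vanishing:
  assumes I: "finite I"
    and Wlim: "\<And>k x. k \<in> I \<Longrightarrow> (\<lambda>i. W i (x + q i k)) \<longlonglongrightarrow> W0 k x"
    and W0: "\<And>k. k \<in> I \<Longrightarrow> continuous_on UNIV (W0 k)"
    and kernel: "\<And>k r g g1 g2 g3 x. k \<in> I \<Longrightarrow> strict_mono r \<Longrightarrow> (\<And>x. (\<lambda>i. f (r i) (x + q (r i) k)) \<longlonglongrightarrow> g x) \<Longrightarrow>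
      H4c g g1 g2 g3 (\<lambda>x. - (of_real (c\<^sup>2) * g2 x + of_real (exp (W0 k x)) * g x)) \<Longrightarrow> g x = 0"
    and far: "\<And>e. e > 0 \<Longrightarrow> \<exists>R. \<forall>\<^sub>F i in sequentially. \<forall>x. (\<forall>k\<in>I. \<bar>x - q i k\<bar> > R) \<longrightarrow> \<bar>exp (W i x) - 1\<bar> \<le> e"
  shows "(\<lambda>i. L2_norm (f i)) \<longlonglongrightarrow> 0"
proof -
  have HH: "H4 (f i) (f1 i) (f2 i) (f3 i) (f4 i)" for i using H by (simp add: H4c_def)
  note L = H4_L2[OF HH]
  define N where "N i = L2_norm (pot_op c (W i) (f i) (f2 i) (f4 i))" for i
  have B: "B \<ge> 0" using W(2)[of 0 0] by linarith
  have bp: "bounded_potential (W i)" for i unfolding bounded_potential_def using W potential_exp_bound by blast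
  obtain E where E: "\<And>i. N i \<le> E" using convergent_imp_Bseq[OF convergentI[OF small]] unfolding Bseq_def N_def by auto
  have E0: "E \<ge> 0" using E[of 0] order_trans[OF L2_norm_nonneg] unfolding N_def by blast
  have sup: "cmod (f i x) \<le> 2 * (ellip c * (E + B))" for i x
  proof -
    have "L2_norm (free_op c (f i) (f2 i) (f4 i)) \<le> N i + B * L2_norm (f i)" unfolding N_def by (rule H4_elliptic_potential[OF c HH W])
    also have "\<dots> \<le> E + B * 1" by (intro add_mono E mult_left_mono nf B)
    finally have "L2_norm (f i) \<le> ellip c * (E + B)" "L2_norm (f1 i) \<le> ellip c * (E + B)" using H4_elliptic(1,2)[OF c HH[of i]] ellip_ge_1[OF c]
      by (auto intro!: order_trans[OF H4_elliptic(1)[OF c HH]] order_trans[OF H4_elliptic(2)[OF c HH]] mult_left_mono)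
    then show ?thesis using antideriv_sup_bound[where x=x, OF _ L(1)[of i] L(2)[of i]] H[of i] by (auto simp: H4c_def)
  qed
  have loc: "(\<lambda>i. LINT x:{q i k - R..q i k + R}|lborel. (cmod (f i x))\<^sup>2) \<longlonglongrightarrow> 0" if "k \<in> I" for k R
    by (rule local_vanishing, rule Wlim[OF that], rule W0[OF that], rule kernel[OF that], assumption, assumption, assumption, rule sup)
  have key: "\<forall>\<^sub>F i in sequentially. L2_norm (f i) \<le> e" if e: "e > 0" for e
  proof -
    \<comment> \<open>The free operator applied to \<open>f i\<close> will be bounded by the
      residual e' plus a potential term 2 e', hence by 4 e'; the factor \<open>ellip c\<close> is
      undone in advance.\<close>
    define e' where "e' = (e / ellip c) / 4"
    have el: "ellip c > 0" using ellip_ge_1[OF c] by linarith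
    have e': "e' > 0" using e el by (simp add: e'_def)
    obtain R where R: "\<forall>\<^sub>F i in sequentially. \<forall>x. (\<forall>k\<in>I. \<bar>x - q i k\<bar> > R) \<longrightarrow> \<bar>exp (W i x) - 1\<bar> \<le> e'"
      using far[OF e'] by blast
    have S: "(\<lambda>i. B\<^sup>2 * (\<Sum>k\<in>I. LINT x:{q i k - R..q i k + R}|lborel. (cmod (f i x))\<^sup>2)) \<longlonglongrightarrow> B\<^sup>2 * (\<Sum>k\<in>I. 0)"
      by (intro tendsto_intros loc)
    then have ev1: "\<forall>\<^sub>F i in sequentially. B\<^sup>2 * (\<Sum>k\<in>I. LINT x:{q i k - R..q i k + R}|lborel. (cmod (f i x))\<^sup>2) < e'\<^sup>2"
      using e' by (intro order_tendstoD(2)) auto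
    have ev2: "\<forall>\<^sub>F i in sequentially. N i < e'" using order_tendstoD(2)[OF small e'] by (simp add: N_def)
    show ?thesis using R ev1 ev2
    proof eventually_elim
      case (elim i)
      let ?q = "\<lambda>x. complex_of_real (exp (W i x) - 1)"
      have qL: "(\<lambda>x. ?q x * f i x) \<in> L2"
      proof (rule L2_bounded_mult[OF L(1)])
        show "?q \<in> borel_measurable borel" using W(1)[of i] by measurable
        show "cmod (?q x) \<le> B" for x using W(2)[of i x] by (simp only: norm_of_real)
      qed
      have int: "integrable lborel (\<lambda>x. indicator {q i k - R..q i k + R} x * (cmod (f i x))\<^sup>2)" for k
        by (rule integrable_real_mult_indicator[OF _ L2_integrable[OF L(1)], of _ i, unfolded mult.commute[of _ "indicator _ _"]]) simp
      \<comment> \<open>A point far from all centres contributes with the small factor e'. Every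
        other point lies in one of the windows, where the crude factor B is affordable.\<close>
      have "(L2_norm (\<lambda>x. ?q x * f i x))\<^sup>2 \<le>
        (LINT x|lborel. e'\<^sup>2 * (cmod (f i x))\<^sup>2 + B\<^sup>2 * (\<Sum>k\<in>I. indicator {q i k - R..q i k + R} x * (cmod (f i x))\<^sup>2))"
        unfolding L2_norm_square
      proof (intro integral_mono L2_integrable qL)
        show "integrable lborel (\<lambda>x. e'\<^sup>2 * (cmod (f i x))\<^sup>2 + B\<^sup>2 * (\<Sum>k\<in>I. indicator {q i k - R..q i k + R} x * (cmod (f i x))\<^sup>2))"
          by (intro Bochner_Integration.integrable_add integrable_mult_right Bochner_Integration.integrable_sum int L2_integrable L)
        fix x
        show "(cmod (?q x * f i x))\<^sup>2 \<le> e'\<^sup>2 * (cmod (f i x))\<^sup>2 + B\<^sup>2 * (\<Sum>k\<in>I. indicator {q i k - R..q i k + R} x * (cmod (f i x))\<^sup>2)"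
        proof (cases "\<forall>k\<in>I. \<bar>x - q i k\<bar> > R")
          case True
          then have "\<bar>exp (W i x) - 1\<bar> \<le> e'" using elim(1) by blast
          then have "(cmod (?q x))\<^sup>2 \<le> e'\<^sup>2" unfolding norm_of_real by (intro power_mono) auto
          then have "(cmod (?q x * f i x))\<^sup>2 \<le> e'\<^sup>2 * (cmod (f i x))\<^sup>2"
            unfolding norm_mult power_mult_distrib by (intro mult_right_mono) auto
          moreover have "0 \<le> B\<^sup>2 * (\<Sum>k\<in>I. indicator {q i k - R..q i k + R} x * (cmod (f i x))\<^sup>2)"
            by (intro mult_nonneg_nonneg sum_nonneg) auto
          ultimately show ?thesis by linarith
        next
          case False
          then obtain k where k: "k \<in> I" "\<bar>x - q i k\<bar> \<le> R" by force
          have "(cmod (f i x))\<^sup>2 = indicator {q i k - R..q i k + R} x * (cmod (f i x))\<^sup>2" using k by (auto simp: indicator_def abs_le_iff)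
          also have "\<dots> \<le> (\<Sum>k\<in>I. indicator {q i k - R..q i k + R} x * (cmod (f i x))\<^sup>2)" using k I by (intro member_le_sum) auto
          finally have "B\<^sup>2 * (cmod (f i x))\<^sup>2 \<le> B\<^sup>2 * (\<Sum>k\<in>I. indicator {q i k - R..q i k + R} x * (cmod (f i x))\<^sup>2)"
            by (intro mult_left_mono) auto
          moreover have "(cmod (?q x * f i x))\<^sup>2 \<le> B\<^sup>2 * (cmod (f i x))\<^sup>2"
            unfolding norm_mult power_mult_distrib norm_of_real using W(2)[of i x] by (intro mult_right_mono power_mono) auto
          moreover have "0 \<le> e'\<^sup>2 * (cmod (f i x))\<^sup>2" by simp
          ultimately show ?thesis by linarith
        qed
      qed
      also have "\<dots> = e'\<^sup>2 * (LINT x|lborel. (cmod (f i x))\<^sup>2) +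
          B\<^sup>2 * (\<Sum>k\<in>I. LINT x:{q i k - R..q i k + R}|lborel. (cmod (f i x))\<^sup>2)"
        using int L2_integrable[OF L(1)[of i]] by (simp add: set_lebesgue_integral_def)
      also have "\<dots> \<le> e'\<^sup>2 * 1 + e'\<^sup>2"
        using elim(2) power_mono[OF nf[of i], of 2] by (intro add_mono mult_left_mono) (auto simp: L2_norm_square)
      also have "\<dots> \<le> (2 * e')\<^sup>2" by (simp add: power_mult_distrib)
      finally have "(L2_norm (\<lambda>x. ?q x * f i x))\<^sup>2 \<le> (2 * e')\<^sup>2" .
      then have q: "L2_norm (\<lambda>x. ?q x * f i x) \<le> 2 * e'" by (rule power2_le_imp_le) (use e' in simp)
      have "L2_norm (free_op c (f i) (f2 i) (f4 i)) =
        L2_norm (\<lambda>x. (f4 i x + of_real (c\<^sup>2) * f2 i x + of_real (exp (W i x)) * f i x) - ?q x * f i x)" by (simp add: algebra_simps)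
      also have "\<dots> \<le> N i + L2_norm (\<lambda>x. ?q x * f i x)" unfolding N_def by (intro L2_triangle_diff L2_add L2_cmul L potential_mult_L2 bp qL)
      also have "\<dots> \<le> 4 * e'" using q elim(3) e' by linarith
      finally have "ellip c * L2_norm (free_op c (f i) (f2 i) (f4 i)) \<le> ellip c * (4 * e')" using el by (intro mult_left_mono) auto
      also have "ellip c * (4 * e') = e" using el by (simp add: e'_def)
      finally show ?case using H4_elliptic(1)[OF c HH[of i]] by linarith
    qed
  qed
  show ?thesis
  proof (rule tendstoI)
    fix e :: real assume "e > 0"
    then show "\<forall>\<^sub>F i in sequentially. dist (L2_norm (f i)) 0 < e" using key[of "e/2"] by (auto elim!: eventually_mono)
  qed
qed

end

section \<open>Weak convergence from pointwise convergence\<close>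

lemma L2_truncation:
  assumes e: "e \<in> L2" and "\<epsilon> > 0"
  shows "\<exists>R. L2_norm (\<lambda>x. e x - indicator {-R..R} x *\<^sub>R e x) < \<epsilon>"
proof -
  have "(\<lambda>n. LINT x|lborel. (cmod (e x - indicator {-real n..real n} x *\<^sub>R e x))\<^sup>2) \<longlonglongrightarrow> (LINT x|(lborel::real measure). (0::real))"
  proof (rule integral_dominated_convergence[where w="\<lambda>x. (cmod (e x))\<^sup>2"])
    show "AE x in lborel. (\<lambda>n. (cmod (e x - indicator {-real n..real n} x *\<^sub>R e x))\<^sup>2) \<longlonglongrightarrow> 0"
    proof (intro AE_I2 tendsto_eventually)
      fix x :: real
      obtain N :: nat where "\<bar>x\<bar> \<le> real N" using real_arch_simple by blast
      then show "\<forall>\<^sub>F n in sequentially. (cmod (e x - indicator {-real n..real n} x *\<^sub>R e x))\<^sup>2 = 0"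
        by (intro eventually_mono[OF eventually_ge_at_top[of N]]) (auto simp: indicator_def)
    qed
    show "AE x in lborel. norm ((cmod (e x - indicator {-real n..real n} x *\<^sub>R e x))\<^sup>2) \<le> (cmod (e x))\<^sup>2" for n
      by (auto simp: indicator_def)
  qed (use e L2_integrable in auto)
  then have "(\<lambda>n. L2_norm (\<lambda>x. e x - indicator {-real n..real n} x *\<^sub>R e x)) \<longlonglongrightarrow> sqrt 0"
    unfolding L2_norm_def by (intro tendsto_real_sqrt) simp
  then have "\<forall>\<^sub>F n in sequentially. L2_norm (\<lambda>x. e x - indicator {-real n..real n} x *\<^sub>R e x) < \<epsilon>"
    using assms(2) by (intro order_tendstoD) auto
  then show ?thesis by (auto simp: eventually_sequentially)
qed

text \<open>On a bounded interval the supremum bound allows dominated convergence; the norm bound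
  makes the error of truncating \<open>e\<close> to such an interval uniform in i.\<close>

lemma weak_pointwise_limit:
  assumes h: "\<And>i. h i \<in> L2" "\<And>i. L2_norm (h i) \<le> M" "\<And>i x. cmod (h i x) \<le> M" and lim: "\<And>x. (\<lambda>i. h i x) \<longlonglongrightarrow> g x"
    and e: "e \<in> L2"
  shows "(\<lambda>i. L2_inner (h i) e) \<longlonglongrightarrow> L2_inner g e"
proof (rule tendstoI)
  fix \<epsilon> :: real assume \<epsilon>: "\<epsilon> > 0"
  have g: "g \<in> L2" by (rule L2_limit[OF h(1,2) lim])
  have M: "M \<ge> 0" using h(2)[of 0] L2_norm_nonneg order_trans by blast
  define K where "K = M + L2_norm g + 1"
  have K: "K > 0" unfolding K_def using M L2_norm_nonneg[of g] by linarith
  obtain R where R: "L2_norm (\<lambda>x. e x - indicator {-R..R} x *\<^sub>R e x) < \<epsilon> / (2 * K)"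
    using L2_truncation[OF e, of "\<epsilon> / (2 * K)"] \<epsilon> K by auto
  let ?e = "\<lambda>x. indicator {-R..R} x *\<^sub>R e x"
  have eL: "?e \<in> L2" unfolding scaleR_conv_of_real by (rule L2_bounded_mult[OF e, of _ 1]) (auto simp: indicator_def)
  have ei: "integrable lborel ?e" using L2_set_integrable[OF e] by (simp add: set_integrable_def)
  have "(\<lambda>i. L2_inner (h i) ?e) \<longlonglongrightarrow> L2_inner g ?e" unfolding L2_inner_def
  proof (rule integral_dominated_convergence[where w="\<lambda>x. M * cmod (?e x)"])
    show "integrable lborel (\<lambda>x. M * cmod (?e x))" using ei by (intro integrable_mult_right integrable_norm)
    show "AE x in lborel. (\<lambda>i. h i x * cnj (?e x)) \<longlonglongrightarrow> g x * cnj (?e x)" by (intro AE_I2 tendsto_intros lim)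
    show "AE x in lborel. norm (h i x * cnj (?e x)) \<le> M * cmod (?e x)" for i
      by (intro AE_I2) (simp only: norm_mult complex_mod_cnj, intro mult_right_mono h norm_ge_zero)
  qed (use borel_measurable_integrable[OF L2_inner_integrable[OF g eL]] borel_measurable_integrable[OF L2_inner_integrable[OF h(1) eL]] in auto)
  then have ev: "\<forall>\<^sub>F i in sequentially. dist (L2_inner (h i) ?e) (L2_inner g ?e) < \<epsilon> / 2" using \<epsilon> by (intro tendstoD) auto
  show "\<forall>\<^sub>F i in sequentially. dist (L2_inner (h i) e) (L2_inner g e) < \<epsilon>" using ev
  proof eventually_elim
    case (elim i)
    have D: "L2_inner u e = L2_inner u ?e + L2_inner u (\<lambda>x. e x - ?e x)" if "u \<in> L2" for u using L2_inner_diff_right[OF that e eL] by simp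
    define \<delta> where "\<delta> = \<epsilon> / (2 * K)"
    have \<delta>: "\<delta> > 0" using \<epsilon> K by (simp add: \<delta>_def)
    have b: "cmod (L2_inner u (\<lambda>x. e x - ?e x)) \<le> L2_norm u * \<delta>" if "u \<in> L2" for u unfolding \<delta>_def
      by (rule order_trans[OF L2_Cauchy_Schwarz[OF that L2_diff[OF e eL]]]) (intro mult_left_mono less_imp_le[OF R] L2_norm_nonneg)
    have "cmod (L2_inner (h i) (\<lambda>x. e x - ?e x) - L2_inner g (\<lambda>x. e x - ?e x)) \<le>
        cmod (L2_inner (h i) (\<lambda>x. e x - ?e x)) + cmod (L2_inner g (\<lambda>x. e x - ?e x))" by (rule norm_triangle_ineq4)
    also have "\<dots> \<le> M * \<delta> + L2_norm g * \<delta>"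
      using \<delta> by (intro add_mono order_trans[OF b[OF h(1)[of i]]] b[OF g] mult_right_mono h(2)) auto
    also have "\<dots> = (K - 1) * \<delta>" by (simp add: K_def algebra_simps)
    also have "\<dots> < K * \<delta>" using \<delta> by (intro mult_strict_right_mono) auto
    also have "\<dots> = \<epsilon> / 2" using K by (simp add: \<delta>_def)
    finally have 1: "cmod (L2_inner (h i) (\<lambda>x. e x - ?e x) - L2_inner g (\<lambda>x. e x - ?e x)) < \<epsilon> / 2" .
    have "L2_inner (h i) e - L2_inner g e = (L2_inner (h i) ?e - L2_inner g ?e) +
       (L2_inner (h i) (\<lambda>x. e x - ?e x) - L2_inner g (\<lambda>x. e x - ?e x))" using D[OF h(1)[of i]] D[OF g] by simp
    then show ?case using elim 1 norm_triangle_ineq[of "L2_inner (h i) ?e - L2_inner g ?e" "L2_inner (h i) (\<lambda>x. e x - ?e x) - L2_inner g (\<lambda>x. e x - ?e x)"]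
      by (simp add: dist_norm)
  qed
qed

section \<open>Expansion of the Krein matrix\<close>

lemma L2_inner_tendsto:
  assumes "\<And>N. u N \<in> L2" "v \<in> L2" "e \<in> L2" "(\<lambda>N. L2_norm (\<lambda>x. v x - u N x)) \<longlonglongrightarrow> 0"
  shows "(\<lambda>N. L2_inner (u N) e) \<longlonglongrightarrow> L2_inner v e"
proof -
  have "(\<lambda>N. L2_inner v e - L2_inner (u N) e) \<longlonglongrightarrow> 0"
  proof (rule Lim_null_comparison)
    show "(\<lambda>N. L2_norm (\<lambda>x. v x - u N x) * L2_norm e) \<longlonglongrightarrow> 0" using tendsto_mult_left_zero[OF assms(4)] .
    show "\<forall>\<^sub>F N in sequentially. norm (L2_inner v e - L2_inner (u N) e) \<le> L2_norm (\<lambda>x. v x - u N x) * L2_norm e"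
      using L2_Cauchy_Schwarz[OF L2_diff[OF assms(2) assms(1)] assms(3)] assms by (simp add: L2_inner_diff_left)
  qed
  from tendsto_diff[OF tendsto_const[of "L2_inner v e"] this] show ?thesis by simp
qed

text \<open>Weak differentiation is a closed operation, since it is defined by pairings that are
  continuous in L^2.\<close>

lemma wd_limit:
  assumes u: "\<And>N. wd (u N) (u' N)" and v: "v \<in> L2" "v' \<in> L2"
    and lim: "(\<lambda>N. L2_norm (\<lambda>x. v x - u N x)) \<longlonglongrightarrow> 0" "(\<lambda>N. L2_norm (\<lambda>x. v' x - u' N x)) \<longlonglongrightarrow> 0"
  shows "wd v v'"
  unfolding wd_def is_weak_deriv_def
proof (intro conjI v ballI)
  fix \<phi> assume \<phi>: "\<phi> \<in> test_functions"
  have e: "(LINT x|lborel. f x * cfun \<psi> x) = L2_inner f (cfun \<psi>)" for f \<psi> by (simp add: L2_inner_def)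
  have l1: "(\<lambda>N. L2_inner (u N) (cfun (deriv \<phi>))) \<longlonglongrightarrow> L2_inner v (cfun (deriv \<phi>))"
    using u by (intro L2_inner_tendsto lim test_L2 test_deriv \<phi> v) (auto simp: wd_def)
  have l2: "(\<lambda>N. L2_inner (u' N) (cfun \<phi>)) \<longlonglongrightarrow> L2_inner v' (cfun \<phi>)"
    using u by (intro L2_inner_tendsto lim test_L2 \<phi> v) (auto simp: wd_def)
  have eq: "L2_inner (u N) (cfun (deriv \<phi>)) = - L2_inner (u' N) (cfun \<phi>)" for N using u[of N] \<phi> by (simp add: wd_def is_weak_deriv_def e)
  have "L2_inner v (cfun (deriv \<phi>)) = - L2_inner v' (cfun \<phi>)" by (rule LIMSEQ_unique[OF l1[unfolded eq] tendsto_minus[OF l2]])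
  then show "(LINT x|lborel. v x * cfun ((deriv ^^ 1) \<phi>) x) = (- 1) ^ 1 * (LINT x|lborel. v' x * cfun \<phi> x)" by (simp add: e)
qed

section \<open>The projection along an orthogonal frame of eigenfunctions\<close>

text \<open>The algebraic data of a single multi-pulse: eigenfunctions that are orthogonal and all
  of norm sqrt N. Orthogonality makes the projection onto the complement explicit.\<close>

locale eigenframe =
  fixes c N :: real and n :: nat and V :: "real \<Rightarrow> real" and s :: "nat \<Rightarrow> real \<Rightarrow> complex" and \<nu> :: "nat \<Rightarrow> real"
  assumes N: "N > 0" and V: "bounded_potential V"
    and s: "\<And>i. i \<in> {1..n} \<Longrightarrow> s i \<in> sobolev 4"
    and eigen: "\<And>i. i \<in> {1..n} \<Longrightarrow> lin_op c V (s i) =\<^sub>2 (\<lambda>x. of_real (\<nu> i) * s i x)"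
    and orth: "\<And>i j. i \<in> {1..n} \<Longrightarrow> j \<in> {1..n} \<Longrightarrow> L2_inner (s i) (s j) = (if i = j then of_real N else 0)"
begin

abbreviation "S \<equiv> L2_span n s"
abbreviation "A \<equiv> lin_op c V"
abbreviation "T z \<equiv> pencil c V (\<i> * z)"

definition lc :: "(nat \<Rightarrow> complex) \<Rightarrow> real \<Rightarrow> complex" where
  "lc a = (\<lambda>x. \<Sum>j=1..n. a j * s j x)"

definition coef :: "(real \<Rightarrow> complex) \<Rightarrow> nat \<Rightarrow> complex" where
  "coef f j = L2_inner f (s j) / of_real N"

text \<open>On L^2 this is \<open>proj_perp S\<close> with the Hilbert choice resolved, see
  \<open>proj_perp_eq\<close>.\<close>

definition Q :: oper where "Q f = (\<lambda>x. f x - lc (coef f) x)"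

lemma sL2: "i \<in> {1..n} \<Longrightarrow> s i \<in> L2" using s sobolev_L2 by blast

lemma span_iff: "g \<in> S \<longleftrightarrow> (\<exists>a. g = lc a)"
  by (auto simp: L2_span_def lc_def)

lemma lc_inner:
  assumes "i \<in> {1..n}" shows "L2_inner (lc a) (s i) = a i * of_real N"
proof -
  have "L2_inner (lc a) (s i) = (\<Sum>j=1..n. L2_inner (\<lambda>x. a j * s j x) (s i))" unfolding lc_def by (rule L2_inner_sum_left) (use assms sL2 in auto)
  also have "\<dots> = (\<Sum>j=1..n. if j = i then a j * of_real N else 0)"
    by (intro sum.cong) (use assms orth in \<open>auto simp: L2_inner_cmul_left\<close>)
  finally show ?thesis using assms by simp
qed

lemma lc_L2: "lc a \<in> L2" unfolding lc_def by (intro L2_sum L2_cmul sL2) auto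

lemma lc_sobolev: "lc a \<in> sobolev 4" unfolding lc_def by (intro sobolev_sum sobolev_cmul s) auto

lemma lc_perp:
  assumes "h \<in> L2" "\<And>i. i \<in> {1..n} \<Longrightarrow> L2_inner (s i) h = 0" shows "L2_inner (lc a) h = 0"
proof -
  have "L2_inner (lc a) h = (\<Sum>j=1..n. L2_inner (\<lambda>x. a j * s j x) h)" unfolding lc_def by (rule L2_inner_sum_left) (use assms sL2 in auto)
  also have "\<dots> = 0" by (intro sum.neutral ballI) (use assms in \<open>simp add: L2_inner_cmul_left\<close>)
  finally show ?thesis .
qed

lemma perp_iff: "f \<in> L2_perp S \<longleftrightarrow> f \<in> L2 \<and> (\<forall>i\<in>{1..n}. L2_inner f (s i) = 0)"
proof -
  have sp: "s i \<in> S" if "i \<in> {1..n}" for i unfolding L2_span_def using that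
    by (auto intro!: exI[of _ "\<lambda>j. if j = i then 1 else 0"] simp: if_distrib[of "\<lambda>a. a * _"] cong: if_cong)
  have "L2_inner f g = 0" if f: "f \<in> L2" "\<forall>i\<in>{1..n}. L2_inner f (s i) = 0" and gS: "g \<in> S" for g
  proof -
    obtain a where g: "g = lc a" using gS span_iff by blast
    have "L2_inner (s i) f = 0" if "i \<in> {1..n}" for i using f(2) that L2_inner_cnj[of f "s i"] by simp
    then have "L2_inner g f = 0" unfolding g by (intro lc_perp f(1))
    then show ?thesis using L2_inner_cnj[of g f] by simp
  qed
  then show ?thesis using sp by (auto simp: L2_perp_def)
qed

lemma perpD: "f \<in> L2_perp S \<Longrightarrow> f \<in> L2" "f \<in> L2_perp S \<Longrightarrow> i \<in> {1..n} \<Longrightarrow> L2_inner f (s i) = 0"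
  "f \<in> L2_perp S \<Longrightarrow> i \<in> {1..n} \<Longrightarrow> L2_inner (s i) f = 0" using L2_inner_cnj[of f "s i"] by (auto simp: perp_iff)

lemma Q_L2: "f \<in> L2 \<Longrightarrow> Q f \<in> L2"
  unfolding Q_def by (intro L2_diff lc_L2)

lemma Q_sobolev: "f \<in> sobolev 4 \<Longrightarrow> Q f \<in> sobolev 4"
  unfolding Q_def by (intro sobolev_diff lc_sobolev)

lemma Q_perp: "f \<in> L2 \<Longrightarrow> Q f \<in> L2_perp S"
  unfolding perp_iff
proof (intro conjI ballI)
  fix i assume f: "f \<in> L2" and i: "i \<in> {1..n}"
  show "L2_inner (Q f) (s i) = 0" unfolding Q_def L2_inner_diff_left[OF f lc_L2 sL2[OF i]] lc_inner[OF i] using N by (simp add: coef_def)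
qed (rule Q_L2)

lemma lc_cong: "(\<And>j. j \<in> {1..n} \<Longrightarrow> a j = b j) \<Longrightarrow> lc a = lc b"
  unfolding lc_def by (intro ext sum.cong) auto

lemma lc_zero: "lc (\<lambda>j. 0) = (\<lambda>x. 0)" by (simp add: lc_def)

lemma Q_id: assumes "f \<in> L2_perp S" shows "Q f = f"
proof -
  have "lc (coef f) = lc (\<lambda>j. 0)" by (rule lc_cong) (use assms in \<open>simp add: coef_def perpD\<close>)
  then show ?thesis by (simp add: Q_def lc_zero)
qed

lemma proj_perp_eq: "f \<in> L2 \<Longrightarrow> proj_perp S f = Q f"
proof -
  assume f: "f \<in> L2"
  define P where "P g \<longleftrightarrow> g \<in> S \<and> (\<lambda>x. f x - g x) \<in> L2_perp S" for g
  have "P (lc (coef f))" unfolding P_def using Q_perp[OF f] span_iff unfolding Q_def by blast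
  then have P: "P (SOME g. P g)" by (rule someI[where P=P])
  define g where "g = (SOME g. P g)"
  have Pg: "g \<in> S" "(\<lambda>x. f x - g x) \<in> L2_perp S" using P unfolding g_def[symmetric] by (auto simp: P_def)
  then obtain a where a: "g = lc a" unfolding span_iff by blast
  have "a i = coef f i" if i: "i \<in> {1..n}" for i
  proof -
    from perpD(2)[OF Pg(2)[unfolded a] i] have "L2_inner f (s i) = a i * of_real N" unfolding L2_inner_diff_left[OF f lc_L2 sL2[OF i]] lc_inner[OF i] by simp
    then show ?thesis using N by (simp add: coef_def)
  qed
  then have "lc a = lc (coef f)" by (rule lc_cong)
  then show ?thesis unfolding proj_perp_def P_def[symmetric] g_def[symmetric] a Q_def by simp
qed

lemma Q_add: "f \<in> L2 \<Longrightarrow> g \<in> L2 \<Longrightarrow> Q (\<lambda>x. f x + g x) = (\<lambda>x. Q f x + Q g x)"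
proof -
  assume fg: "f \<in> L2" "g \<in> L2"
  have "lc (coef (\<lambda>x. f x + g x)) = lc (\<lambda>j. coef f j + coef g j)"
    by (rule lc_cong) (simp add: coef_def L2_inner_add_left fg sL2 add_divide_distrib)
  also have "\<dots> = (\<lambda>x. lc (coef f) x + lc (coef g) x)" by (simp add: lc_def distrib_right sum.distrib)
  finally show ?thesis by (simp add: Q_def fun_eq_iff)
qed

lemma Q_cmul: "Q (\<lambda>x. a * f x) = (\<lambda>x. a * Q f x)"
proof -
  have "lc (coef (\<lambda>x. a * f x)) = lc (\<lambda>j. a * coef f j)" by (rule lc_cong) (simp add: coef_def L2_inner_cmul_left)
  also have "\<dots> = (\<lambda>x. a * lc (coef f) x)" by (simp add: lc_def sum_distrib_left mult.assoc)
  finally show ?thesis by (simp add: Q_def fun_eq_iff right_diff_distrib)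
qed

lemma Q_diff: "f \<in> L2 \<Longrightarrow> g \<in> L2 \<Longrightarrow> Q (\<lambda>x. f x - g x) = (\<lambda>x. Q f x - Q g x)"
  using Q_add[of f "\<lambda>x. (-1) * g x"] Q_cmul[of "-1" g] L2_cmul[of g "-1"] by simp

lemma Q_s: assumes i: "i \<in> {1..n}" shows "Q (s i) = (\<lambda>x. 0)"
proof -
  have "lc (coef (s i)) = lc (\<lambda>j. if j = i then 1 else 0)" by (rule lc_cong) (use i orth N in \<open>auto simp: coef_def\<close>)
  also have "\<dots> = s i" using i by (auto simp: lc_def if_distrib[of "\<lambda>a. a * _"] fun_eq_iff cong: if_cong)
  finally show ?thesis by (simp add: Q_def)
qed

lemma Q_cong: "f =\<^sub>2 g \<Longrightarrow> f \<in> L2 \<Longrightarrow> g \<in> L2 \<Longrightarrow> Q f =\<^sub>2 Q g"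
proof -
  assume a: "f =\<^sub>2 g" "f \<in> L2" "g \<in> L2"
  have "lc (coef f) = lc (coef g)"
  proof (rule lc_cong)
    fix j assume "j \<in> {1..n}"
    then have "L2_inner f (s j) = L2_inner g (s j)" using a sL2 by (intro L2_inner_cong) auto
    then show "coef f j = coef g j" by (simp add: coef_def)
  qed
  then show ?thesis unfolding Q_def using L2_eq_diff[OF a(1) L2_eq_refl] by simp
qed

lemma Q_inner: assumes f: "f \<in> L2" and h: "h \<in> L2_perp S" shows "L2_inner (Q f) h = L2_inner f h"
proof -
  have "L2_inner (lc (coef f)) h = 0" by (rule lc_perp[OF perpD(1)[OF h]]) (rule perpD(3)[OF h])
  then show ?thesis unfolding Q_def L2_inner_diff_left[OF f lc_L2 perpD(1)[OF h]] by simp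
qed

lemma Q_norm: assumes f: "f \<in> L2" shows "L2_norm (Q f) \<le> L2_norm f"
proof -
  have "(L2_norm (Q f))\<^sup>2 = cmod (L2_inner f (Q f))" unfolding Q_inner[OF f Q_perp[OF f], symmetric] L2_inner_self norm_of_real by simp
  also have "\<dots> \<le> L2_norm f * L2_norm (Q f)" by (rule L2_Cauchy_Schwarz[OF f Q_L2[OF f]])
  finally show ?thesis using L2_norm_nonneg[of "Q f"] L2_norm_nonneg[of f] by (cases "L2_norm (Q f) = 0") (auto simp: power2_eq_square)
qed

text \<open>The complement is invariant because \<open>A\<close> is symmetric and multiplies each
  \<open>s i\<close> by a real number.\<close>

lemma A_perp:
  assumes "f \<in> sobolev 4" "f \<in> L2_perp S" shows "A f \<in> L2_perp S"
  unfolding perp_iff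
proof (intro conjI ballI)
  fix i assume i: "i \<in> {1..n}"
  have "L2_inner (A f) (s i) = L2_inner f (A (s i))" by (rule lin_op_symmetric[OF assms(1) s[OF i] V])
  also have "\<dots> = L2_inner f (\<lambda>x. of_real (\<nu> i) * s i x)"
    by (intro L2_inner_cong eigen i lin_op_L2 s V L2_cmul sL2 perpD(1)[OF assms(2)] L2_eq_refl)
  also have "\<dots> = 0" using perpD(2)[OF assms(2) i] by (simp add: L2_inner_cmul_right)
  finally show "L2_inner (A f) (s i) = 0" .
qed (rule lin_op_L2[OF assms(1) V])

text \<open>The coefficient of the first derivative in the pencil at the spectral parameter
  \<open>\<i> * z\<close>.\<close>

definition \<kappa> :: "complex \<Rightarrow> complex" where "\<kappa> z = - (2 * of_real c * (\<i> * z))"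

lemma T_eq: "T z f = (\<lambda>x. - z\<^sup>2 * f x + \<kappa> z * weak_deriv 1 f x + A f x)"
  by (simp add: pencil_def \<kappa>_def power_mult_distrib)

lemma d_L2: "f \<in> sobolev 4 \<Longrightarrow> weak_deriv 1 f \<in> L2"
  by (rule sobolev_weak_deriv) auto

lemma T_L2: "f \<in> sobolev 4 \<Longrightarrow> T z f \<in> L2"
  unfolding T_eq by (intro L2_add L2_cmul d_L2 lin_op_L2 V sobolev_L2)

lemma QT_eq:
  assumes "f \<in> sobolev 4" "f \<in> L2_perp S"
  shows "Q (T z f) = (\<lambda>x. - z\<^sup>2 * f x + \<kappa> z * Q (weak_deriv 1 f) x + A f x)"
proof -
  note L = perpD(1)[OF assms(2)] d_L2[OF assms(1)] lin_op_L2[OF assms(1) V, of c]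
  show ?thesis unfolding T_eq using L by (simp only: Q_add Q_cmul L2_add L2_cmul Q_id[OF assms(2)] Q_id[OF A_perp[OF assms]])
qed

lemma compression_eq:
  assumes "f \<in> sobolev 4" "f \<in> L2_perp S"
  shows "compression S (T z) f = Q (T z f)"
  unfolding compression_def using assms by (simp add: proj_perp_eq Q_id T_L2 sobolev_L2)

text \<open>\<open>A\<close> respects the splitting into S and its complement. The equality is one
  almost everywhere, as the eigenvalue relations are.\<close>

lemma A_cong_Q:
  assumes g: "g \<in> sobolev 4" shows "A (Q g) =\<^sub>2 Q (A g)"
proof -
  have AL: "A g \<in> L2" "A (lc a) \<in> L2" for a by (intro lin_op_L2 g lc_sobolev V)+
  have "A (lc a) =\<^sub>2 lc (\<lambda>j. of_real (\<nu> j) * a j)" for a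
  proof -
    have "A (lc a) =\<^sub>2 (\<lambda>x. \<Sum>j=1..n. A (\<lambda>x. a j * s j x) x)" unfolding lc_def by (rule lin_op_sum) (intro sobolev_cmul s)
    also have "\<dots> =\<^sub>2 (\<lambda>x. \<Sum>j=1..n. a j * A (s j) x)" by (intro L2_eq_sum lin_op_linear(3)) (auto intro: s)
    also have "\<dots> =\<^sub>2 (\<lambda>x. \<Sum>j=1..n. a j * (of_real (\<nu> j) * s j x))" by (intro L2_eq_sum L2_eq_mult eigen) auto
    finally show ?thesis by (simp add: lc_def mult.left_commute mult.commute)
  qed
  then have "Q (A (lc a)) =\<^sub>2 Q (lc (\<lambda>j. of_real (\<nu> j) * a j))" for a by (intro Q_cong AL lc_L2)
  moreover have "Q (lc a) = (\<lambda>x. 0)" for a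
  proof -
    have "lc (coef (lc a)) = lc a" by (rule lc_cong) (use N in \<open>simp add: coef_def lc_inner\<close>)
    then show ?thesis by (simp add: Q_def)
  qed
  ultimately have z: "Q (A (lc a)) =\<^sub>2 (\<lambda>x. 0)" for a by simp
  have "A (Q g) =\<^sub>2 (\<lambda>x. A g x - A (lc (coef g)) x)" unfolding Q_def by (rule lin_op_linear(2)[OF g lc_sobolev])
  then have "Q (A (Q g)) =\<^sub>2 Q (\<lambda>x. A g x - A (lc (coef g)) x)" by (intro Q_cong lin_op_L2 Q_sobolev g V L2_diff AL)
  also have "\<dots> = (\<lambda>x. Q (A g) x - Q (A (lc (coef g))) x)" by (intro Q_diff AL)
  finally have "Q (A (Q g)) =\<^sub>2 (\<lambda>x. Q (A g) x - Q (A (lc (coef g))) x)" .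
  moreover have "(\<lambda>x. Q (A g) x - Q (A (lc (coef g))) x) =\<^sub>2 (\<lambda>x. Q (A g) x - 0)" by (intro L2_eq_diff z L2_eq_refl)
  ultimately have "Q (A (Q g)) =\<^sub>2 Q (A g)" using L2_eq_trans by fastforce
  then show ?thesis using Q_id[OF A_perp[OF Q_sobolev[OF g] Q_perp[OF sobolev_L2[OF g]]]] by simp
qed

lemma d_by_parts:
  assumes "f \<in> sobolev 4" "g \<in> sobolev 4"
  shows "L2_inner (weak_deriv 1 f) g = - L2_inner f (weak_deriv 1 g)"
  using sobolev_H4[OF assms(1)] sobolev_H4[OF assms(2)] unfolding H4_def by (blast intro: wd_by_parts)

end

section \<open>Solvability of the compressed pencil on the complement\<close>

text \<open>\<open>lower\<close> controls f and its four derivatives by \<open>A\<close> f on the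
  complement. \<open>resolvent\<close> supplies points of the resolvent set next to 0, from which
  surjectivity is obtained.\<close>

locale krein_frame = eigenframe +
  fixes K B :: real
  assumes K: "K > 0" and B: "B \<ge> 0"
    and deriv_bound: "\<And>i. i \<in> {1..n} \<Longrightarrow> L2_norm (weak_deriv 1 (s i)) \<le> B"
    and lower: "\<And>f j. f \<in> sobolev 4 \<Longrightarrow> f \<in> L2_perp (L2_span n s) \<Longrightarrow> j \<in> {0,1,2,3,4} \<Longrightarrow>
        L2_norm (if j = 0 then f else weak_deriv j f) \<le> K * L2_norm (lin_op c V f)"
    and resolvent: "\<And>e. e > 0 \<Longrightarrow> \<exists>l. 0 < cmod l \<and> cmod l < e \<and> l \<notin> spectrum_on (sobolev 4) (lin_op c V)"
begin

lemma lower':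
  assumes "f \<in> sobolev 4" "f \<in> L2_perp S"
  shows "L2_norm f \<le> K * L2_norm (A f)" "L2_norm (weak_deriv 1 f) \<le> K * L2_norm (A f)"
  using lower[OF assms, of 0] lower[OF assms, of 1] by auto

text \<open>Up to the factor K, the relative size of the compressed pencil minus \<open>A\<close> on
  the complement; see \<open>QT_perturb\<close>.\<close>

definition rad :: "complex \<Rightarrow> real" where "rad z = (cmod z)\<^sup>2 + cmod (\<kappa> z)"

lemma QT_perturb:
  assumes "f \<in> sobolev 4" "f \<in> L2_perp S"
  shows "L2_norm (\<lambda>x. Q (T z f) x - A f x) \<le> rad z * K * L2_norm (A f)"
proof -
  note L = perpD(1)[OF assms(2)] d_L2[OF assms(1)] Q_L2[OF d_L2[OF assms(1)]]
  have "L2_norm (\<lambda>x. Q (T z f) x - A f x) = L2_norm (\<lambda>x. - z\<^sup>2 * f x + \<kappa> z * Q (weak_deriv 1 f) x)" by (simp add: QT_eq[OF assms])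
  also have "\<dots> \<le> L2_norm (\<lambda>x. - z\<^sup>2 * f x) + L2_norm (\<lambda>x. \<kappa> z * Q (weak_deriv 1 f) x)" by (intro L2_triangle L2_cmul L)
  also have "\<dots> = (cmod z)\<^sup>2 * L2_norm f + cmod (\<kappa> z) * L2_norm (Q (weak_deriv 1 f))" unfolding L2_norm_cmul by (simp add: norm_power)
  also have "\<dots> \<le> (cmod z)\<^sup>2 * (K * L2_norm (A f)) + cmod (\<kappa> z) * (K * L2_norm (A f))"
    by (intro add_mono mult_left_mono lower'[OF assms] order_trans[OF Q_norm lower'(2)] L assms) auto
  finally show ?thesis by (simp add: rad_def algebra_simps)
qed

lemma lower_T:
  assumes "f \<in> sobolev 4" "f \<in> L2_perp S" "rad z * K \<le> 1/4"
  shows "L2_norm (A f) \<le> 2 * L2_norm (Q (T z f))" "L2_norm f \<le> 2 * K * L2_norm (Q (T z f))"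
proof -
  note L = lin_op_L2[OF assms(1) V] Q_L2[OF T_L2[OF assms(1)]]
  have "L2_norm (A f) - L2_norm (Q (T z f)) \<le> L2_norm (\<lambda>x. A f x - Q (T z f) x)" using L by (intro L2_triangle_reverse) auto
  also have "\<dots> = L2_norm (\<lambda>x. Q (T z f) x - A f x)" using L2_norm_uminus[of "\<lambda>x. Q (T z f) x - A f x"] by simp
  also have "\<dots> \<le> rad z * K * L2_norm (A f)" by (rule QT_perturb[OF assms(1,2)])
  also have "\<dots> \<le> 1/4 * L2_norm (A f)" by (intro mult_right_mono assms) auto
  finally show 1: "L2_norm (A f) \<le> 2 * L2_norm (Q (T z f))" using L2_norm_nonneg[of "A f"] by linarith
  have "L2_norm f \<le> K * L2_norm (A f)" by (rule lower'[OF assms(1,2)])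
  also have "\<dots> \<le> K * (2 * L2_norm (Q (T z f)))" using K 1 by (intro mult_left_mono) auto
  finally show "L2_norm f \<le> 2 * K * L2_norm (Q (T z f))" by simp
qed

text \<open>For a resolvent point l near 0 the equation (A - l) f = g is solvable, and f inherits
  orthogonality to S from g. As |l| K < 1/8 and rad z * K <= 1/4, the norm of A f is at most 8/7 of
  that of g, and the compressed pencil misses g by at most (1/4 + 1/8) * 8/7 < 1/2 of its
  norm.\<close>

lemma approximate_solution:
  assumes g: "g \<in> L2_perp S" and z: "rad z * K \<le> 1/4"
  shows "\<exists>f. f \<in> sobolev 4 \<and> f \<in> L2_perp S \<and> L2_norm (\<lambda>x. g x - Q (T z f) x) \<le> 1/2 * L2_norm g \<and>
    L2_norm (A f) \<le> 2 * L2_norm g"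
proof -
  obtain l where l: "0 < cmod l" "cmod l < 1 / (8 * K)" "l \<notin> spectrum_on (sobolev 4) A" using resolvent[of "1 / (8 * K)"] K by auto
  have inv: "boundedly_invertible (sobolev 4) L2 (\<lambda>f x. A f x - l * f x)" using l(3) by (simp add: spectrum_on_def)
  then obtain f where f: "f \<in> sobolev 4" "(\<lambda>x. A f x - l * f x) =\<^sub>2 g" using perpD(1)[OF g] unfolding boundedly_invertible_def by blast
  have fL: "f \<in> L2" "A f \<in> L2" using f sobolev_L2 lin_op_L2[OF _ V] by auto
  have gL: "g \<in> L2" by (rule perpD(1)[OF g])
  \<comment> \<open>Eigenvalues lie in the spectrum, so l avoids them all. By symmetry (\<nu> i - l)
    times the pairing of f with \<open>s i\<close> vanishes, and this makes f orthogonal to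
    S.\<close>
  have l_ne: "l \<noteq> of_real (\<nu> i)" if i: "i \<in> {1..n}" for i
  proof
    assume e: "l = of_real (\<nu> i)"
    have z0: "(\<lambda>x. 0) \<in> sobolev 4" using sobolev_cmul[OF s[OF i], of 0] by simp
    have "(\<lambda>x. A (s i) x - l * s i x) =\<^sub>2 (\<lambda>x. of_real (\<nu> i) * s i x - l * s i x)" by (intro L2_eq_diff eigen i) auto
    also have "(\<lambda>x. of_real (\<nu> i) * s i x - l * s i x) =\<^sub>2 (\<lambda>x. A (\<lambda>x. 0) x - l * 0)"
      using lin_op_linear(3)[OF s[OF i] s[OF i], of c V 0] by (simp add: e L2_eq_sym)
    finally have "s i =\<^sub>2 (\<lambda>x. 0)" using inv s[OF i] z0 unfolding boundedly_invertible_def by blast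
    then have "L2_inner (s i) (s i) = L2_inner (\<lambda>x. 0) (s i)" by (intro L2_inner_cong sL2 i) auto
    then show False using orth[OF i i] N by simp
  qed
  have fperp: "f \<in> L2_perp S" unfolding perp_iff
  proof (intro conjI ballI fL)
    fix i assume i: "i \<in> {1..n}"
    have "0 = L2_inner g (s i)" using perpD(2)[OF g i] by simp
    also have "\<dots> = L2_inner (\<lambda>x. A f x - l * f x) (s i)" using f(2) gL fL sL2[OF i] by (intro L2_inner_cong) (auto intro: L2_eq_sym)
    also have "\<dots> = L2_inner (A f) (s i) - l * L2_inner f (s i)" using fL sL2[OF i] by (simp add: L2_inner_diff_left L2_inner_cmul_left L2_cmul)
    also have "L2_inner (A f) (s i) = L2_inner f (A (s i))" by (rule lin_op_symmetric[OF f(1) s[OF i] V])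
    also have "\<dots> = L2_inner f (\<lambda>x. of_real (\<nu> i) * s i x)" by (intro L2_inner_cong eigen i lin_op_L2 s V L2_cmul sL2 fL L2_eq_refl)
    also have "\<dots> = of_real (\<nu> i) * L2_inner f (s i)" by (simp add: L2_inner_cmul_right)
    finally have "0 = of_real (\<nu> i) * L2_inner f (s i) - l * L2_inner f (s i)" .
    then have "(of_real (\<nu> i) - l) * L2_inner f (s i) = 0" unfolding left_diff_distrib by (rule sym)
    then have "of_real (\<nu> i) = l \<or> L2_inner f (s i) = 0" by (metis eq_iff_diff_eq_0 mult_eq_0_iff)
    then show "L2_inner f (s i) = 0" using l_ne[OF i] by blast
  qed
  have lK: "cmod l * L2_norm f \<le> 1/8 * L2_norm (A f)"
  proof -
    have "cmod l * L2_norm f \<le> 1 / (8 * K) * (K * L2_norm (A f))" using l K by (intro mult_mono lower'[OF f(1) fperp]) auto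
    then show ?thesis using K by simp
  qed
  have eq: "L2_norm (\<lambda>x. A f x - l * f x) = L2_norm g" using f(2) fL gL by (intro L2_norm_cong) auto
  have "L2_norm (A f) - L2_norm (\<lambda>x. l * f x) \<le> L2_norm (\<lambda>x. A f x - l * f x)" using fL by (intro L2_triangle_reverse) auto
  then have Ag: "L2_norm (A f) \<le> 8/7 * L2_norm g" using lK unfolding eq L2_norm_cmul by linarith
  have "L2_norm (\<lambda>x. g x - Q (T z f) x) = L2_norm (\<lambda>x. (A f x - Q (T z f) x) - l * f x)"
  proof (rule L2_norm_cong)
    show "(\<lambda>x. g x - Q (T z f) x) =\<^sub>2 (\<lambda>x. (A f x - Q (T z f) x) - l * f x)"
      using f(2) unfolding L2_eq_def by eventually_elim (simp add: algebra_simps)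
  qed (intro L2_diff L2_cmul fL gL Q_L2 T_L2 f(1))+
  also have "\<dots> \<le> L2_norm (\<lambda>x. A f x - Q (T z f) x) + L2_norm (\<lambda>x. l * f x)"
    using fL Q_L2[OF T_L2[OF f(1)]] by (intro L2_triangle_diff) auto
  also have "L2_norm (\<lambda>x. A f x - Q (T z f) x) = L2_norm (\<lambda>x. Q (T z f) x - A f x)"
    using L2_norm_uminus[of "\<lambda>x. Q (T z f) x - A f x"] by simp
  also have "\<dots> \<le> rad z * K * L2_norm (A f)" by (rule QT_perturb[OF f(1) fperp])
  also have "\<dots> \<le> 1/4 * L2_norm (A f)" by (intro mult_right_mono z) auto
  also have "L2_norm (\<lambda>x. l * f x) \<le> 1/8 * L2_norm (A f)" using lK by (simp only: L2_norm_cmul)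
  finally have "L2_norm (\<lambda>x. g x - Q (T z f) x) \<le> 1/2 * L2_norm g" using Ag L2_norm_nonneg[of g] by linarith
  then show ?thesis using f(1) fperp Ag L2_norm_nonneg[of g] by (intro exI[of _ f]) linarith
qed

lemma T_H4:
  assumes "H4 f f1 f2 f3 f4"
  shows "T z f =\<^sub>2 (\<lambda>x. - z\<^sup>2 * f x + \<kappa> z * f1 x + (f4 x + of_real (c\<^sup>2) * f2 x + of_real (exp (V x)) * f x))"
  unfolding T_eq by (intro L2_eq_add L2_eq_mult H4_weak_deriv[OF assms] H4_lin_op[OF assms] L2_eq_refl)

lemma T_add:
  assumes "f \<in> sobolev 4" "g \<in> sobolev 4"
  shows "T z (\<lambda>x. f x + g x) =\<^sub>2 (\<lambda>x. T z f x + T z g x)"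
  by (rule L2_eq_trans[OF T_H4[OF H4_add[OF assms[THEN sobolev_H4]]]]) (simp add: T_eq lin_op_def algebra_simps)

lemma T_cmul:
  assumes "f \<in> sobolev 4" shows "T z (\<lambda>x. a * f x) =\<^sub>2 (\<lambda>x. a * T z f x)"
  by (rule L2_eq_trans[OF T_H4[OF H4_cmul[OF assms[THEN sobolev_H4]]]]) (simp add: T_eq lin_op_def algebra_simps)

lemma QT_add:
  assumes "f \<in> sobolev 4" "g \<in> sobolev 4"
  shows "Q (T z (\<lambda>x. f x + g x)) =\<^sub>2 (\<lambda>x. Q (T z f) x + Q (T z g) x)"
  using Q_cong[OF T_add[OF assms, of z]] T_L2[OF sobolev_add[OF assms], of z] T_L2[OF assms(1), of z] T_L2[OF assms(2), of z] by (simp add: Q_add L2_add)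

lemma QT_cmul:
  assumes "f \<in> sobolev 4" shows "Q (T z (\<lambda>x. a * f x)) =\<^sub>2 (\<lambda>x. a * Q (T z f) x)"
  using Q_cong[OF T_cmul[OF assms, of z a]] T_L2[OF sobolev_cmul[OF assms], of z a] T_L2[OF assms, of z] by (simp add: Q_cmul L2_cmul)

lemma QT_diff:
  assumes "f \<in> sobolev 4" "g \<in> sobolev 4"
  shows "Q (T z (\<lambda>x. f x - g x)) =\<^sub>2 (\<lambda>x. Q (T z f) x - Q (T z g) x)"
proof -
  have "Q (T z (\<lambda>x. f x + (-1) * g x)) =\<^sub>2 (\<lambda>x. Q (T z f) x + Q (T z (\<lambda>x. (-1) * g x)) x)"
    by (rule QT_add[OF assms(1) sobolev_cmul[OF assms(2)]])
  also have "\<dots> =\<^sub>2 (\<lambda>x. Q (T z f) x + (-1) * Q (T z g) x)" by (intro L2_eq_add QT_cmul assms L2_eq_refl)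
  finally show ?thesis by simp
qed

lemma T_norm:
  assumes H: "H4 f f1 f2 f3 f4" and b: "\<And>x. exp (V x) \<le> b"
  shows "L2_norm (T z f) \<le> (cmod z)\<^sup>2 * L2_norm f + cmod (\<kappa> z) * L2_norm f1 + (L2_norm f4 + c\<^sup>2 * L2_norm f2 + b * L2_norm f)"
proof -
  note L = H4_L2[OF H] potential_mult_L2[OF V H4_L2(1)[OF H]]
  have "L2_norm (T z f) = L2_norm (\<lambda>x. - z\<^sup>2 * f x + \<kappa> z * f1 x + (f4 x + of_real (c\<^sup>2) * f2 x + of_real (exp (V x)) * f x))"
    by (intro L2_norm_cong T_H4[OF H] T_L2 H4_sobolev[OF H] L2_add L2_cmul L)
  also have "\<dots> \<le> L2_norm (\<lambda>x. - z\<^sup>2 * f x) + L2_norm (\<lambda>x. \<kappa> z * f1 x) +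
      (L2_norm f4 + L2_norm (\<lambda>x. of_real (c\<^sup>2) * f2 x) + L2_norm (\<lambda>x. of_real (exp (V x)) * f x))"
    by (intro order_trans[OF L2_triangle] add_mono order_refl L2_add L2_cmul L)
  also have "L2_norm (\<lambda>x. of_real (exp (V x)) * f x) \<le> b * L2_norm f"
    by (rule L2_norm_bounded_mult[OF L(1)]) (use V b in \<open>auto simp: bounded_potential_def\<close>)
  finally show ?thesis by (simp add: L2_norm_cmul norm_power)
qed

text \<open>The approximate solver is applied repeatedly to the residual, which halves each time.
  The corrections are summable together with their four derivatives, so their sum lies in the domain
  and the pencil may be applied to it.\<close>

lemma solution:
  assumes g: "g \<in> L2_perp S" and z: "rad z * K \<le> 1/4"
  shows "\<exists>f. f \<in> sobolev 4 \<and> f \<in> L2_perp S \<and> Q (T z f) =\<^sub>2 g"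
proof -
  define F where "F h = (SOME f. f \<in> sobolev 4 \<and> f \<in> L2_perp S \<and> L2_norm (\<lambda>x. h x - Q (T z f) x) \<le> 1/2 * L2_norm h \<and>
    L2_norm (A f) \<le> 2 * L2_norm h)" for h
  have F: "F h \<in> sobolev 4" "F h \<in> L2_perp S" "L2_norm (\<lambda>x. h x - Q (T z (F h)) x) \<le> 1/2 * L2_norm h"
    "L2_norm (A (F h)) \<le> 2 * L2_norm h" if "h \<in> L2_perp S" for h using someI_ex[OF approximate_solution[OF that z]] unfolding F_def by auto
  \<comment> \<open>\<open>h k\<close> is the residual after k corrections, and
    \<open>F (h k)\<close> is the next correction.\<close>
  define h where "h = rec_nat g (\<lambda>_ u x. u x - Q (T z (F u)) x)"
  have h0: "h 0 = g" and hS: "h (Suc k) = (\<lambda>x. h k x - Q (T z (F (h k))) x)" for k by (auto simp: h_def)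
  have hp: "h k \<in> L2_perp S" for k
  proof (induction k)
    case (Suc k)
    then show ?case using Q_diff[OF perpD(1)[OF Suc] Q_L2[OF T_L2[OF F(1)[OF Suc]]], of z] Q_id[OF Suc] Q_id[OF Q_perp[OF T_L2[OF F(1)[OF Suc]]], of z]
        Q_perp[OF L2_diff[OF perpD(1)[OF Suc] Q_L2[OF T_L2[OF F(1)[OF Suc]]]], of z] unfolding hS by simp
  qed (use g h0 in simp)
  have hn: "L2_norm (h k) \<le> L2_norm g * (1/2) ^ k" for k
  proof (induction k)
    case (Suc k)
    have "L2_norm (h (Suc k)) \<le> 1/2 * L2_norm (h k)" unfolding hS by (rule F(3)[OF hp])
    then show ?case using Suc by simp
  qed (simp add: h0)
  define u where "u j k = (if j = 0 then F (h k) else weak_deriv j (F (h k)))" for j k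
  have us: "u 0 k \<in> sobolev 4" for k using F(1)[OF hp] by (simp add: u_def)
  have uH: "H4 (u 0 k) (u 1 k) (u 2 k) (u 3 k) (u 4 k)" for k using sobolev_H4[OF F(1)[OF hp]] by (simp add: u_def)
  note uL = H4_L2[OF uH]
  have un: "L2_norm (u j k) \<le> (2 * K * L2_norm g) * (1/2) ^ k" if "j \<in> {0,1,2,3,4}" for j k
  proof -
    have "L2_norm (u j k) \<le> K * L2_norm (A (F (h k)))" unfolding u_def by (rule lower[OF F(1,2)[OF hp] that])
    also have "\<dots> \<le> K * (2 * (L2_norm g * (1/2) ^ k))" using K by (intro mult_left_mono order_trans[OF F(4)[OF hp]] hn) auto
    finally show ?thesis by (simp add: algebra_simps)
  qed
  have "\<exists>v\<in>L2. (\<lambda>N. L2_norm (\<lambda>x. v x - (\<Sum>k<N. u j k x))) \<longlonglongrightarrow> 0" if "j \<in> {0,1,2,3,4}" for j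
    using uL that by (intro L2_complete[where B="2 * K * L2_norm g"] un) auto
  then have "\<forall>j\<in>{0,1,2,3,4}. \<exists>v. v \<in> L2 \<and> (\<lambda>N. L2_norm (\<lambda>x. v x - (\<Sum>k<N. u j k x))) \<longlonglongrightarrow> 0" by blast
  from bchoice[OF this] obtain v where vv: "\<forall>j\<in>{0,1,2,3,4}. v j \<in> L2 \<and> (\<lambda>N. L2_norm (\<lambda>x. v j x - (\<Sum>k<N. u j k x))) \<longlonglongrightarrow> 0" ..
  then have v: "\<And>j. j \<in> {0,1,2,3,4} \<Longrightarrow> v j \<in> L2"
    "\<And>j. j \<in> {0,1,2,3,4} \<Longrightarrow> (\<lambda>N. L2_norm (\<lambda>x. v j x - (\<Sum>k<N. u j k x))) \<longlonglongrightarrow> 0" by blast+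
  define P where "P j N = (\<lambda>x. \<Sum>k<N. u j k x)" for j N
  have PH: "H4 (P 0 N) (P 1 N) (P 2 N) (P 3 N) (P 4 N)" for N unfolding P_def by (intro H4_sum uH)
  have vlim: "(\<lambda>N. L2_norm (\<lambda>x. v j x - P j N x)) \<longlonglongrightarrow> 0" if "j \<in> {0,1,2,3,4}" for j
    using v(2)[OF that] by (simp add: P_def)
  have PW: "wd (P 0 N) (P 1 N)" "wd (P 1 N) (P 2 N)" "wd (P 2 N) (P 3 N)" "wd (P 3 N) (P 4 N)" for N using PH[of N] by (auto simp: H4_def)
  have vH: "H4 (v 0) (v 1) (v 2) (v 3) (v 4)" unfolding H4_def
    by (intro conjI wd_limit[where u="P 0" and u'="P 1", OF PW(1)] wd_limit[where u="P 1" and u'="P 2", OF PW(2)]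
        wd_limit[where u="P 2" and u'="P 3", OF PW(3)] wd_limit[where u="P 3" and u'="P 4", OF PW(4)] v(1) vlim) auto
  have vs: "v 0 \<in> sobolev 4" by (rule H4_sobolev[OF vH])
  have PL: "P 0 N \<in> L2" and Ps: "P 0 N \<in> sobolev 4" for N using H4_L2[OF PH] H4_sobolev[OF PH] by auto
  have Pp: "P 0 N \<in> L2_perp S" for N unfolding perp_iff
  proof (intro conjI ballI PL)
    fix i assume i: "i \<in> {1..n}"
    show "L2_inner (P 0 N) (s i) = 0" unfolding P_def using uL sL2[OF i] perpD(2)[OF F(2)[OF hp] i] by (subst L2_inner_sum_left) (auto simp: u_def)
  qed
  have vp: "v 0 \<in> L2_perp S" unfolding perp_iff
  proof (intro conjI ballI v)
    fix i assume i: "i \<in> {1..n}"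
    have "(\<lambda>N. L2_inner (P 0 N) (s i)) \<longlonglongrightarrow> L2_inner (v 0) (s i)" by (intro L2_inner_tendsto PL v sL2 i vlim) auto
    then show "L2_inner (v 0) (s i) = 0" using perpD(2)[OF Pp i] by (simp add: LIMSEQ_const_iff)
  qed auto
  have QTP: "Q (T z (P 0 N)) =\<^sub>2 (\<lambda>x. g x - h N x)" for N
  proof (induction N)
    case 0
    have "P 0 0 = (\<lambda>x. 0 * v 0 x)" by (simp add: P_def)
    then show ?case using QT_cmul[OF vs, of z 0] by (simp add: h0)
  next
    case (Suc N)
    have "P 0 (Suc N) = (\<lambda>x. P 0 N x + F (h N) x)" by (simp add: P_def u_def)
    then have "Q (T z (P 0 (Suc N))) =\<^sub>2 (\<lambda>x. Q (T z (P 0 N)) x + Q (T z (F (h N))) x)" using QT_add[OF Ps F(1)[OF hp]] by simp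
    also have "\<dots> =\<^sub>2 (\<lambda>x. (g x - h N x) + Q (T z (F (h N))) x)" by (intro L2_eq_add Suc L2_eq_refl)
    finally show ?case by (simp add: hS algebra_simps)
  qed
  obtain b where b: "\<And>x. exp (V x) \<le> b" using V by (auto simp: bounded_potential_def)
  let ?D = "\<lambda>N x. v 0 x - P 0 N x"
  have DH: "H4 (?D N) (\<lambda>x. v 1 x - P 1 N x) (\<lambda>x. v 2 x - P 2 N x) (\<lambda>x. v 3 x - P 3 N x) (\<lambda>x. v 4 x - P 4 N x)" for N
    by (rule H4_diff[OF vH PH])
  have Ds: "?D N \<in> sobolev 4" for N by (rule H4_sobolev[OF DH])
  let ?bound = "\<lambda>N. (cmod z)\<^sup>2 * L2_norm (?D N) + cmod (\<kappa> z) * L2_norm (\<lambda>x. v 1 x - P 1 N x) +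
      (L2_norm (\<lambda>x. v 4 x - P 4 N x) + c\<^sup>2 * L2_norm (\<lambda>x. v 2 x - P 2 N x) + b * L2_norm (?D N))"
  have vQ: "Q (T z (v 0)) \<in> L2" and gL: "g \<in> L2" and hL: "h N \<in> L2" and DQ: "Q (T z (?D N)) \<in> L2" for N
    using Q_L2 T_L2 vs Ds perpD(1) g hp by blast+
  have le: "L2_norm (\<lambda>x. Q (T z (v 0)) x - g x) \<le> L2_norm g * (1/2) ^ N + ?bound N" for N
  proof -
    have "Q (T z (\<lambda>x. P 0 N x + ?D N x)) =\<^sub>2 (\<lambda>x. Q (T z (P 0 N)) x + Q (T z (?D N)) x)" by (rule QT_add[OF Ps Ds])
    also have "\<dots> =\<^sub>2 (\<lambda>x. (g x - h N x) + Q (T z (?D N)) x)" by (intro L2_eq_add QTP L2_eq_refl)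
    finally have e: "Q (T z (v 0)) =\<^sub>2 (\<lambda>x. (g x - h N x) + Q (T z (?D N)) x)" by simp
    have "L2_norm (\<lambda>x. Q (T z (v 0)) x - g x) = L2_norm (\<lambda>x. Q (T z (?D N)) x - h N x)"
    proof (rule L2_norm_cong)
      show "(\<lambda>x. Q (T z (v 0)) x - g x) =\<^sub>2 (\<lambda>x. Q (T z (?D N)) x - h N x)" using L2_eq_diff[OF e L2_eq_refl[of g]] by simp
    qed (intro L2_diff vQ gL DQ hL)+
    also have "\<dots> \<le> L2_norm (Q (T z (?D N))) + L2_norm (h N)" by (intro L2_triangle_diff DQ hL)
    also have "\<dots> \<le> ?bound N + L2_norm g * (1/2) ^ N" by (intro add_mono hn order_trans[OF Q_norm[OF T_L2[OF Ds]]] T_norm[OF DH b])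
    finally show ?thesis by simp
  qed
  have "(\<lambda>N. L2_norm g * (1/2) ^ N + ?bound N) \<longlonglongrightarrow> L2_norm g * 0 + ((cmod z)\<^sup>2 * 0 + cmod (\<kappa> z) * 0 + (0 + c\<^sup>2 * 0 + b * 0))"
    by (intro tendsto_intros vlim LIMSEQ_realpow_zero) auto
  then have "L2_norm (\<lambda>x. Q (T z (v 0)) x - g x) \<le> 0" using le by (intro LIMSEQ_le_const[of "\<lambda>N. L2_norm g * (1/2) ^ N + ?bound N"]) auto
  then have "(\<lambda>x. Q (T z (v 0)) x - g x) =\<^sub>2 (\<lambda>x. 0)"
    using L2_norm_eq_0_iff[OF L2_diff[OF vQ gL]] L2_norm_nonneg[of "\<lambda>x. Q (T z (v 0)) x - g x"] by linarith
  then have "Q (T z (v 0)) =\<^sub>2 g" by (auto simp: L2_eq_def)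
  then show ?thesis using vs vp by blast
qed

text \<open>This guarantees that, for small z, the choice made by \<open>inverse_on\<close> in
  \<open>krein_matrix\<close> is the value of a bounded inverse.\<close>

lemma boundedly_invertible_compression:
  assumes z: "rad z * K \<le> 1/4"
  shows "boundedly_invertible (sobolev 4 \<inter> L2_perp S) (L2_perp S) (compression S (T z))"
  unfolding boundedly_invertible_def
proof (intro conjI ballI impI)
  fix f assume f: "f \<in> sobolev 4 \<inter> L2_perp S"
  show "compression S (T z) f \<in> L2_perp S" using f by (simp add: compression_eq Q_perp T_L2)
next
  fix f g assume f: "f \<in> sobolev 4 \<inter> L2_perp S" and g: "g \<in> sobolev 4 \<inter> L2_perp S"
    and eq: "compression S (T z) f =\<^sub>2 compression S (T z) g"
  have d: "(\<lambda>x. f x - g x) \<in> sobolev 4" "(\<lambda>x. f x - g x) \<in> L2_perp S"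
    using f g by (auto simp: sobolev_diff perp_iff L2_inner_diff_left sL2 L2_diff)
  have "Q (T z (\<lambda>x. f x - g x)) =\<^sub>2 (\<lambda>x. Q (T z f) x - Q (T z g) x)" using f g by (intro QT_diff) auto
  also have "\<dots> =\<^sub>2 (\<lambda>x. 0)" using L2_eq_diff[OF eq L2_eq_refl[of "Q (T z g)"]] f g by (simp add: compression_eq)
  finally have "L2_norm (Q (T z (\<lambda>x. f x - g x))) = 0" using L2_norm_eq_0_iff[OF Q_L2[OF T_L2[OF d(1)]]] by blast
  then have "L2_norm (\<lambda>x. f x - g x) = 0" using lower_T(2)[OF d z] L2_norm_nonneg[of "\<lambda>x. f x - g x"] by simp
  then show "f =\<^sub>2 g" using L2_norm_eq_0_iff[OF perpD(1)[OF d(2)]] by (auto simp: L2_eq_def)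
next
  fix g assume "g \<in> L2_perp S"
  from solution[OF this z] show "\<exists>f\<in>sobolev 4 \<inter> L2_perp S. compression S (T z) f =\<^sub>2 g" by (auto simp: compression_eq)
next
  show "\<exists>C. \<forall>f\<in>sobolev 4 \<inter> L2_perp S. L2_norm f \<le> C * L2_norm (compression S (T z) f)"
    by (rule exI[of _ "2 * K"]) (auto simp: compression_eq intro: lower_T(2) z)
qed

section \<open>Entries of the Krein matrix\<close>

lemma T_zero: "T 0 f = A f"
  unfolding T_eq by (simp add: \<kappa>_def)

lemma rad_zero: "rad 0 = 0" by (simp add: rad_def \<kappa>_def)

lemma A_solution:
  assumes "g \<in> L2_perp S"
  obtains f where "f \<in> sobolev 4" "f \<in> L2_perp S" "A f =\<^sub>2 g"
proof -
  obtain f where f: "f \<in> sobolev 4" "f \<in> L2_perp S" "Q (T 0 f) =\<^sub>2 g" using solution[OF assms, of 0] by (auto simp: rad_zero)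
  from f(3) have "A f =\<^sub>2 g" unfolding T_zero Q_id[OF A_perp[OF f(1,2)]] .
  then show ?thesis using that f by blast
qed

lemma inner_A_s:
  assumes f: "f \<in> sobolev 4" and i: "i \<in> {1..n}"
  shows "L2_inner (s i) (A f) = of_real (\<nu> i) * L2_inner (s i) f"
proof -
  have "L2_inner (s i) (A f) = L2_inner (A (s i)) f" by (rule lin_op_symmetric[OF s[OF i] f V, symmetric])
  also have "\<dots> = L2_inner (\<lambda>x. of_real (\<nu> i) * s i x) f"
    by (intro L2_inner_cong eigen i lin_op_L2 s V L2_cmul sL2 sobolev_L2[OF f] L2_eq_refl)
  finally show ?thesis by (simp add: L2_inner_cmul_left)
qed

text \<open>The pencil stands in the antilinear argument of the inner product, so its coefficients
  come out conjugated. This is the origin of the conjugate of z in the expansion.\<close>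

lemma inner_T_s:
  assumes f: "f \<in> sobolev 4" and i: "i \<in> {1..n}"
  shows "L2_inner (s i) (T z f) = - (cnj z)\<^sup>2 * L2_inner (s i) f + cnj (\<kappa> z) * L2_inner (s i) (weak_deriv 1 f) +
     of_real (\<nu> i) * L2_inner (s i) f"
proof -
  note L = sobolev_L2[OF f] d_L2[OF f] lin_op_L2[OF f V] sL2[OF i]
  have "L2_inner (s i) (T z f) = L2_inner (s i) (\<lambda>x. - z\<^sup>2 * f x) + L2_inner (s i) (\<lambda>x. \<kappa> z * weak_deriv 1 f x) + L2_inner (s i) (A f)"
    unfolding T_eq using L by (simp only: L2_inner_add_right L2_add L2_cmul)
  then show ?thesis by (simp only: L2_inner_cmul_right inner_A_s[OF f i] complex_cnj_minus complex_cnj_power)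
qed

text \<open>Both z^2 \<open>s j\<close> and A (\<open>s j\<close>) are in S, so only the derivative
  term survives the projection.\<close>

lemma QT_s:
  assumes j: "j \<in> {1..n}" shows "Q (T z (s j)) =\<^sub>2 (\<lambda>x. \<kappa> z * Q (weak_deriv 1 (s j)) x)"
proof -
  note L = sL2[OF j] d_L2[OF s[OF j]] lin_op_L2[OF s[OF j] V]
  have "Q (A (s j)) =\<^sub>2 Q (\<lambda>x. of_real (\<nu> j) * s j x)" by (intro Q_cong eigen j L L2_cmul)
  then have z0: "Q (A (s j)) =\<^sub>2 (\<lambda>x. 0)" by (simp add: Q_cmul Q_s[OF j])
  have "Q (T z (s j)) = (\<lambda>x. - z\<^sup>2 * Q (s j) x + \<kappa> z * Q (weak_deriv 1 (s j)) x + Q (A (s j)) x)"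
    unfolding T_eq using L by (simp only: Q_add Q_cmul L2_add L2_cmul)
  then have "Q (T z (s j)) = (\<lambda>x. \<kappa> z * Q (weak_deriv 1 (s j)) x + Q (A (s j)) x)" by (simp add: Q_s[OF j])
  then show ?thesis using L2_eq_add[OF L2_eq_refl[of "\<lambda>x. \<kappa> z * Q (weak_deriv 1 (s j)) x"] z0] by simp
qed

text \<open>Let f be the solution whose compressed image is that of \<open>s j\<close>. To first
  order f is \<open>\<kappa> z\<close> times f0. The remainder solves the same problem with a
  right-hand side that is smaller by the factor rad z, and a second \<open>\<kappa> z\<close> comes
  from the pairing with \<open>s i\<close>; the error is thus of third order in z.\<close>

lemma krein_expansion:
  assumes i: "i \<in> {1..n}" and j: "j \<in> {1..n}" and z: "z \<noteq> 0" "rad z * K \<le> 1/4"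
    and f0: "f0 \<in> sobolev 4" "f0 \<in> L2_perp S" "A f0 =\<^sub>2 Q (weak_deriv 1 (s j))"
  shows "cmod (- krein_matrix (sobolev 4) (pencil c V) n s z i j / z -
      (of_real (\<nu> i) * L2_inner (s i) (s j) - (cnj z)\<^sup>2 * L2_inner (s i) (s j) + cnj (\<kappa> z) * L2_inner (s i) (weak_deriv 1 (s j))
        + (cnj (\<kappa> z))\<^sup>2 * L2_inner (weak_deriv 1 (s i)) f0)) \<le> 2 * K\<^sup>2 * B\<^sup>2 * (cmod (\<kappa> z))\<^sup>2 * rad z"
proof -
  define f where "f = inverse_on (sobolev 4 \<inter> L2_perp S) (compression S (T z)) (Q (T z (s j)))"
  have sj: "T z (s j) \<in> L2" by (rule T_L2[OF s[OF j]])
  have "\<exists>f. f \<in> sobolev 4 \<inter> L2_perp S \<and> compression S (T z) f =\<^sub>2 Q (T z (s j))"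
    using solution[OF Q_perp[OF sj] z(2)] by (auto simp: compression_eq)
  from someI_ex[OF this] have f: "f \<in> sobolev 4" "f \<in> L2_perp S" "Q (T z f) =\<^sub>2 Q (T z (s j))"
    unfolding f_def inverse_on_def by (auto simp: compression_eq)
  have kr: "- krein_matrix (sobolev 4) (pencil c V) n s z i j / z = L2_inner (s i) (T z (s j)) - L2_inner (s i) (T z f)"
    using z(1) unfolding krein_matrix_def Let_def by (simp only: proj_perp_eq[OF sj] f_def[symmetric] proj_perp_eq[OF perpD(1)[OF f(2)]] Q_id[OF f(2)]) simp
  define g where "g = (\<lambda>x. f x - \<kappa> z * f0 x)"
  have g: "g \<in> sobolev 4" "g \<in> L2_perp S" using f f0 sL2 unfolding g_def
    by (auto simp: sobolev_diff sobolev_cmul perp_iff L2_inner_diff_left L2_inner_cmul_left L2_diff L2_cmul)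
  have dL: "weak_deriv 1 (s i) \<in> L2" "weak_deriv 1 (s j) \<in> L2" using d_L2 s i j by auto
  have Af0: "L2_norm (A f0) \<le> B"
  proof -
    have "L2_norm (A f0) = L2_norm (Q (weak_deriv 1 (s j)))" by (intro L2_norm_cong f0 lin_op_L2 V Q_L2 dL)
    then show ?thesis using Q_norm[OF dL(2)] deriv_bound[OF j] by linarith
  qed
  have "Q (T z g) =\<^sub>2 (\<lambda>x. Q (T z f) x - Q (T z (\<lambda>x. \<kappa> z * f0 x)) x)" unfolding g_def by (intro QT_diff f f0 sobolev_cmul)
  also have "\<dots> =\<^sub>2 (\<lambda>x. Q (T z (s j)) x - \<kappa> z * Q (T z f0) x)" by (intro L2_eq_diff f QT_cmul f0)
  also have "\<dots> =\<^sub>2 (\<lambda>x. \<kappa> z * Q (weak_deriv 1 (s j)) x - \<kappa> z * Q (T z f0) x)" by (intro L2_eq_diff QT_s[OF j] L2_eq_refl)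
  also have "\<dots> =\<^sub>2 (\<lambda>x. \<kappa> z * A f0 x - \<kappa> z * Q (T z f0) x)" by (intro L2_eq_diff L2_eq_mult L2_eq_sym[OF f0(3)] L2_eq_refl)
  finally have "Q (T z g) =\<^sub>2 (\<lambda>x. - \<kappa> z * (Q (T z f0) x - A f0 x))" by (simp add: algebra_simps)
  then have "L2_norm (Q (T z g)) = cmod (\<kappa> z) * L2_norm (\<lambda>x. Q (T z f0) x - A f0 x)"
    using L2_norm_cong[of "Q (T z g)" "\<lambda>x. - \<kappa> z * (Q (T z f0) x - A f0 x)"]
      Q_L2[OF T_L2[OF g(1)], of z] Q_L2[OF T_L2[OF f0(1)], of z] lin_op_L2[OF f0(1) V, of c] by (simp only: L2_norm_cmul L2_cmul L2_diff norm_minus_cancel)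
  also have "\<dots> \<le> cmod (\<kappa> z) * (rad z * K * B)"
    by (intro mult_left_mono order_trans[OF QT_perturb[OF f0(1,2)]] Af0) (use K in \<open>auto simp: rad_def\<close>)
  finally have Tg: "L2_norm (Q (T z g)) \<le> cmod (\<kappa> z) * (rad z * K * B)" .
  have gn: "L2_norm g \<le> 2 * K * (cmod (\<kappa> z) * (rad z * K * B))"
    by (rule order_trans[OF lower_T(2)[OF g z(2)]]) (use K Tg in \<open>auto intro: mult_left_mono\<close>)
  \<comment> \<open>f is orthogonal to S, so \<open>s i\<close> sees only the derivative term, and
    the derivative is then moved to \<open>s i\<close>.\<close>
  have "L2_inner (s i) (T z f) = cnj (\<kappa> z) * L2_inner (s i) (weak_deriv 1 f)" unfolding inner_T_s[OF f(1) i] using perpD(3)[OF f(2) i] by simp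
  also have "\<dots> = - cnj (\<kappa> z) * L2_inner (weak_deriv 1 (s i)) f" using d_by_parts[OF s[OF i] f(1)] by simp
  also have "L2_inner (weak_deriv 1 (s i)) f = L2_inner (weak_deriv 1 (s i)) (\<lambda>x. \<kappa> z * f0 x + g x)" by (simp add: g_def)
  also have "\<dots> = cnj (\<kappa> z) * L2_inner (weak_deriv 1 (s i)) f0 + L2_inner (weak_deriv 1 (s i)) g"
    using dL perpD(1)[OF g(2)] perpD(1)[OF f0(2)] by (simp add: L2_inner_add_right L2_inner_cmul_right L2_cmul)
  finally have Tf0: "L2_inner (s i) (T z f) = - cnj (\<kappa> z) * (cnj (\<kappa> z) * L2_inner (weak_deriv 1 (s i)) f0 + L2_inner (weak_deriv 1 (s i)) g)" .
  have Tf: "L2_inner (s i) (T z f) = - (cnj (\<kappa> z))\<^sup>2 * L2_inner (weak_deriv 1 (s i)) f0 - cnj (\<kappa> z) * L2_inner (weak_deriv 1 (s i)) g"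
    unfolding Tf0 by (simp add: power2_eq_square algebra_simps)
  have X: "- krein_matrix (sobolev 4) (pencil c V) n s z i j / z -
      (of_real (\<nu> i) * L2_inner (s i) (s j) - (cnj z)\<^sup>2 * L2_inner (s i) (s j) + cnj (\<kappa> z) * L2_inner (s i) (weak_deriv 1 (s j))
        + (cnj (\<kappa> z))\<^sup>2 * L2_inner (weak_deriv 1 (s i)) f0) = cnj (\<kappa> z) * L2_inner (weak_deriv 1 (s i)) g"
    unfolding kr Tf inner_T_s[OF s[OF j] i] by (simp add: algebra_simps)
  have "cmod (cnj (\<kappa> z) * L2_inner (weak_deriv 1 (s i)) g) \<le> cmod (\<kappa> z) * (B * (2 * K * (cmod (\<kappa> z) * (rad z * K * B))))"
    unfolding norm_mult complex_mod_cnj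
    by (intro mult_left_mono order_trans[OF L2_Cauchy_Schwarz[OF dL(1) perpD(1)[OF g(2)]]] mult_mono deriv_bound i gn B) auto
  also have "\<dots> = 2 * K\<^sup>2 * B\<^sup>2 * (cmod (\<kappa> z))\<^sup>2 * rad z" by (simp add: power2_eq_square)
  finally show ?thesis by (simp only: X)
qed

end

section \<open>Exponential decay\<close>

lemma exp_neg_at_top: "al > 0 \<Longrightarrow> ((\<lambda>y::real. exp (- al * y)) \<longlongrightarrow> 0) at_top"
  by (rule filterlim_compose[OF exp_at_bot], rule filterlim_tendsto_neg_mult_at_bot[OF tendsto_const]) (auto intro: filterlim_ident)

text \<open>For Re l > 0 a bounded solution of v' = l v + g is obtained by integrating back from
  +infinity. The weight changes at relative rate at most a < al, so the integral of exp (- al y)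
  m(y) over y >= x is at most exp (- al x) m(x) / (al - a).\<close>

lemma first_order_bound:
  fixes v g :: "real \<Rightarrow> complex" and m m' :: "real \<Rightarrow> real"
  assumes a: "a < al" "0 < al" "Re l = al"
    and v: "\<And>x. (v has_vector_derivative (l * v x + g x)) (at x)" "\<And>x. cmod (v x) \<le> V0"
    and g: "\<And>x. cmod (g x) \<le> H * m x" and H: "H \<ge> 0"
    and m: "\<And>x. (m has_real_derivative m' x) (at x)" "\<And>x. \<bar>m' x\<bar> \<le> a * m x" "\<And>x. 0 \<le> m x"
  shows "cmod (v x) \<le> H / (al - a) * m x"
proof -
  define E where "E x = exp (- l * of_real x) * v x" for x
  define k where "k = H / (al - a)"
  \<comment> \<open>The derivative of \<open>\<phi>\<close> dominates the norm of that of
    \<open>E\<close>, and \<open>\<phi>\<close> is never positive; hence no increment of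
    \<open>E\<close> to the right of x exceeds - \<open>\<phi>\<close> x.\<close>
  define \<phi> where "\<phi> x = - k * (exp (- al * x) * m x)" for x
  have D: "((\<lambda>x. exp (- l * of_real x)) has_vector_derivative (- l * exp (- l * of_real x))) (at x)" for x
  proof -
    have "((\<lambda>z. exp (- l * z)) has_field_derivative (- l * exp (- l * of_real x))) (at (of_real x))" by (auto intro!: derivative_eq_intros)
    then show ?thesis by (rule has_vector_derivative_real_field)
  qed
  have E': "(E has_vector_derivative exp (- l * of_real x) * g x) (at x)" for x
    unfolding E_def using has_vector_derivative_mult[OF D v(1), of x] by (simp add: algebra_simps)
  have \<phi>': "(\<phi> has_vector_derivative k * exp (- al * x) * (al * m x - m' x)) (at x)" for x
    unfolding \<phi>_def has_real_derivative_iff_has_vector_derivative[symmetric] by (auto intro!: derivative_eq_intros m(1) simp: algebra_simps)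
  have bnd: "norm (exp (- l * of_real x) * g x) \<le> k * exp (- al * x) * (al * m x - m' x)" for x
  proof -
    have "norm (exp (- l * of_real x) * g x) = exp (- al * x) * cmod (g x)" using a(3) by (simp add: norm_mult)
    also have "\<dots> \<le> exp (- al * x) * (H * m x)" by (intro mult_left_mono g) auto
    also have "\<dots> = k * exp (- al * x) * ((al - a) * m x)" using a by (simp add: k_def field_simps)
    also have "\<dots> \<le> k * exp (- al * x) * (al * m x - m' x)"
    proof (intro mult_left_mono)
      show "(al - a) * m x \<le> al * m x - m' x" using m(2)[of x] by (simp add: left_diff_distrib)
    qed (use a H in \<open>auto simp: k_def\<close>)
    finally show ?thesis .
  qed
  have step: "exp (- al * x) * cmod (v x) \<le> exp (- al * y) * V0 - \<phi> x" if "x < y" for y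
  proof -
    have "norm (E y - E x) \<le> \<phi> y - \<phi> x"
    proof (rule differentiable_bound_general[OF that])
      show "continuous_on {x..y} E" "continuous_on {x..y} \<phi>" using E' \<phi>' by (meson continuous_at_imp_continuous_on has_vector_derivative_continuous)+
    qed (use E' \<phi>' bnd in auto)
    moreover have "\<phi> y \<le> 0" unfolding \<phi>_def using H a m(3)[of y] by (simp add: k_def mult_nonneg_nonneg)
    moreover have "norm (E x) = exp (- al * x) * cmod (v x)" "norm (E y) \<le> exp (- al * y) * V0" using a(3) v(2)[of y] by (auto simp: E_def norm_mult)
    moreover have "norm (E x) \<le> norm (E y) + norm (E y - E x)" by (metis norm_minus_commute norm_triangle_sub)
    ultimately show ?thesis by linarith
  qed
  have "((\<lambda>y. exp (- al * y) * V0 - \<phi> x) \<longlongrightarrow> 0 * V0 - \<phi> x) at_top" by (intro tendsto_intros exp_neg_at_top a)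
  then have "exp (- al * x) * cmod (v x) \<le> 0 * V0 - \<phi> x"
    by (rule tendsto_lowerbound) (intro eventually_mono[OF eventually_gt_at_top[of x]] step trivial_limit_at_top_linorder | assumption)+
  then have "exp (- al * x) * cmod (v x) \<le> exp (- al * x) * (k * m x)" by (simp add: \<phi>_def algebra_simps)
  then have "cmod (v x) \<le> k * m x" by (simp only: mult_le_cancel_left_pos exp_gt_zero)
  then show ?thesis by (simp add: k_def)
qed

text \<open>For Re l < 0 the reflection of the line exchanges the two ends and reverses the sign of
  l.\<close>

lemma first_order_bound_abs:
  fixes v g :: "real \<Rightarrow> complex" and m m' :: "real \<Rightarrow> real"
  assumes a: "a < al" "0 < al" "\<bar>Re l\<bar> = al"
    and v: "\<And>x. (v has_vector_derivative (l * v x + g x)) (at x)" "\<And>x. cmod (v x) \<le> V0"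
    and g: "\<And>x. cmod (g x) \<le> H * m x" and H: "H \<ge> 0"
    and m: "\<And>x. (m has_real_derivative m' x) (at x)" "\<And>x. \<bar>m' x\<bar> \<le> a * m x" "\<And>x. 0 \<le> m x"
  shows "cmod (v x) \<le> H / (al - a) * m x"
proof (cases "Re l \<ge> 0")
  case True
  then show ?thesis using a by (intro first_order_bound[OF a(1,2) _ v g H m]) auto
next
  case False
  have "cmod (v (- (- x))) \<le> H / (al - a) * m (- (- x))"
  proof (rule first_order_bound[OF a(1,2), where l="- l" and g="\<lambda>x. - g (- x)" and v="\<lambda>x. v (- x)" and m="\<lambda>x. m (- x)" and m'="\<lambda>x. - m' (- x)"])
    show "Re (- l) = al" using a False by simp
    show "((\<lambda>x. v (- x)) has_vector_derivative - l * v (- x) + - g (- x)) (at x)" for x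
    proof -
      have "(uminus has_vector_derivative (-1::real)) (at x)"
        unfolding has_real_derivative_iff_has_vector_derivative[symmetric] by (auto intro!: derivative_eq_intros)
      from vector_diff_chain_at[OF this v(1)[of "- x"]] show ?thesis by (simp add: o_def)
    qed
    show "((\<lambda>x. m (- x)) has_real_derivative - m' (- x)) (at x)" for x
    proof -
      have "(uminus has_real_derivative (-1)) (at x)" by (auto intro!: derivative_eq_intros)
      from DERIV_chain2[where f=m and g=uminus, OF m(1)[of "- x"] this] show ?thesis by simp
    qed
  qed (use v g H m in auto)
  then show ?thesis by simp
qed

text \<open>Each of the four factors of the operator costs a factor k = 1 / (al - a). The sum of the
  powers covers a function and its three derivatives at once.\<close>

definition decay_const :: "real \<Rightarrow> real" where
  "decay_const k = k + k^2 + k^3 + k^4"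

text \<open>The conditions on l say that l, - l and their conjugates are the roots of x^4 + c^2 x^2
  + 1. The operator splits into four first-order factors, inverted one after the other by
  \<open>first_order_bound_abs\<close>; the derivatives of u are combinations of the intermediate
  functions.\<close>

lemma fourth_order_bound:
  fixes u u1 u2 u3 h :: "real \<Rightarrow> complex" and m m' :: "real \<Rightarrow> real"
  assumes a: "a < al" "0 < al" "al = Re l" and l: "cmod l = 1" "2 * Re (l\<^sup>2) = - (c\<^sup>2)"
    and u: "\<And>x. (u has_vector_derivative u1 x) (at x)" "\<And>x. (u1 has_vector_derivative u2 x) (at x)"
      "\<And>x. (u2 has_vector_derivative u3 x) (at x)"
      "\<And>x. (u3 has_vector_derivative (h x - of_real (c\<^sup>2) * u2 x - u x)) (at x)"
    and b: "\<And>x. cmod (u x) \<le> M" "\<And>x. cmod (u1 x) \<le> M" "\<And>x. cmod (u2 x) \<le> M" "\<And>x. cmod (u3 x) \<le> M"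
    and h: "\<And>x. cmod (h x) \<le> H * m x" and H: "H \<ge> 0"
    and m: "\<And>x. (m has_real_derivative m' x) (at x)" "\<And>x. \<bar>m' x\<bar> \<le> a * m x" "\<And>x. 0 \<le> m x"
  shows "cmod (u x) \<le> decay_const (1 / (al - a)) * H * m x" "cmod (u1 x) \<le> decay_const (1 / (al - a)) * H * m x"
    "cmod (u2 x) \<le> decay_const (1 / (al - a)) * H * m x" "cmod (u3 x) \<le> decay_const (1 / (al - a)) * H * m x"
proof -
  define k where "k = 1 / (al - a)"
  have k: "k > 0" using a by (simp add: k_def)
  define mu where "mu = l\<^sup>2"
  have cm: "cmod mu = 1" by (simp add: mu_def norm_power l)
  have mm: "mu * cnj mu = 1" using complex_norm_square[of mu] cm by simp
  have ms: "mu + cnj mu = - of_real (c\<^sup>2)" using l(2) unfolding mu_def[symmetric] by (simp add: complex_eq_iff)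
  have M: "M \<ge> 0" using b(1)[of 0] norm_ge_zero order_trans by blast
  have fo: "cmod (v x) \<le> k * H' * m x"
    if "\<bar>Re l'\<bar> = al" "\<And>x. (v has_vector_derivative (l' * v x + g x)) (at x)" "\<And>x. cmod (v x) \<le> V0"
      "\<And>x. cmod (g x) \<le> H' * m x" "H' \<ge> 0" for v g l' V0 H' x using first_order_bound_abs[OF a(1,2) that m, of x] by (simp add: k_def)
  \<comment> \<open>Splitting off the root \<open>cnj mu\<close> of the quadratic in the second
    derivative leaves y'' = mu y + h, as mu and \<open>cnj mu\<close> have sum - c^2 and product
    1.\<close>
  define y where "y x = u2 x - cnj mu * u x" for x
  define y' where "y' x = u3 x - cnj mu * u1 x" for x
  have dy: "(y has_vector_derivative y' x) (at x)" for x unfolding y_def y'_def by (intro derivative_intros u has_vector_derivative_mult_right)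
  have dy': "(y' has_vector_derivative (mu * y x + h x)) (at x)" for x
  proof -
    have e: "(h x - of_real (c\<^sup>2) * u2 x - u x) - cnj mu * u2 x = mu * y x + h x"
    proof -
      have "(h x - of_real (c\<^sup>2) * u2 x - u x) - cnj mu * u2 x = (- of_real (c\<^sup>2) - cnj mu) * u2 x - u x + h x" by (simp add: algebra_simps)
      also have "\<dots> = mu * u2 x - (mu * cnj mu) * u x + h x" unfolding ms[symmetric] mm by simp
      finally show ?thesis by (simp add: y_def algebra_simps)
    qed
    show ?thesis unfolding y'_def[abs_def] e[symmetric] by (intro derivative_intros u has_vector_derivative_mult_right)
  qed
  have by2: "cmod (y x) \<le> 2 * M" and by': "cmod (y' x) \<le> 2 * M" for x
    using norm_triangle_ineq4[of "u2 x" "cnj mu * u x"] norm_triangle_ineq4[of "u3 x" "cnj mu * u1 x"] b[of x] by (auto simp: y_def y'_def norm_mult cm)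
  define y1 where "y1 x = y' x + l * y x" for x
  have y1: "cmod (y1 x) \<le> k * H * m x" for x
  proof (rule fo[where l'=l and g=h and ?V0.0="4 * M"])
    show "(y1 has_vector_derivative (l * y1 x + h x)) (at x)" for x
    proof -
      have "(y1 has_vector_derivative ((mu * y x + h x) + l * y' x)) (at x)"
        unfolding y1_def[abs_def] by (intro derivative_intros dy dy' has_vector_derivative_mult_right)
      then show ?thesis by (simp add: y1_def mu_def power2_eq_square algebra_simps)
    qed
    show "cmod (y1 x) \<le> 4 * M" for x using norm_triangle_ineq[of "y' x" "l * y x"] by2[of x] by'[of x] l by (simp add: y1_def norm_mult)
  qed (use a h H in auto)
  have y: "cmod (y x) \<le> k * (k * H) * m x" for x
  proof (rule fo[where l'="- l" and g=y1 and ?V0.0="2 * M"])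
    show "(y has_vector_derivative (- l * y x + y1 x)) (at x)" for x using dy[of x] by (simp add: y1_def)
  qed (use a by2 y1 H k in auto)
  define x1 where "x1 x = u1 x + cnj l * u x" for x
  have x1: "cmod (x1 x) \<le> k * (k * (k * H)) * m x" for x
  proof (rule fo[where l'="cnj l" and g=y and ?V0.0="2 * M"])
    show "(x1 has_vector_derivative (cnj l * x1 x + y x)) (at x)" for x
    proof -
      have "(x1 has_vector_derivative (u2 x + cnj l * u1 x)) (at x)" unfolding x1_def[abs_def] by (intro derivative_intros u has_vector_derivative_mult_right)
      then show ?thesis by (simp add: x1_def y_def mu_def power2_eq_square algebra_simps)
    qed
    show "cmod (x1 x) \<le> 2 * M" for x using norm_triangle_ineq[of "u1 x" "cnj l * u x"] b[of x] l by (simp add: x1_def norm_mult)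
  qed (use a y H k in auto)
  have u0: "cmod (u x) \<le> k * (k * (k * (k * H))) * m x" for x
  proof (rule fo[where l'="- cnj l" and g=x1 and ?V0.0=M])
    show "(u has_vector_derivative (- cnj l * u x + x1 x)) (at x)" for x using u(1)[of x] by (simp add: x1_def)
  qed (use a b x1 H k in auto)
  have Hm: "H * m x \<ge> 0" using H m(3) by simp
  have pos: "k * (H * m x) \<ge> 0" "k^2 * (H * m x) \<ge> 0" "k^3 * (H * m x) \<ge> 0" "k^4 * (H * m x) \<ge> 0"
    using k Hm by (auto intro!: mult_nonneg_nonneg)
  have e: "decay_const (1 / (al - a)) * H * m x = k * (H * m x) + k^2 * (H * m x) + k^3 * (H * m x) + k^4 * (H * m x)"
    by (simp add: decay_const_def k_def[symmetric] algebra_simps)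
  have b1: "cmod (y1 x) \<le> k * (H * m x)" using y1[of x] by (simp add: mult.assoc)
  have b2: "cmod (y x) \<le> k^2 * (H * m x)" using y[of x] by (simp add: power2_eq_square mult.assoc)
  have b3: "cmod (x1 x) \<le> k^3 * (H * m x)" using x1[of x] by (simp add: power3_eq_cube mult.assoc)
  have b4: "cmod (u x) \<le> k^4 * (H * m x)" using u0[of x] by (simp add: power4_eq_xxxx mult.assoc)
  show "cmod (u x) \<le> decay_const (1 / (al - a)) * H * m x" using b4 pos unfolding e by linarith
  have c1: "cmod (u1 x) \<le> cmod (x1 x) + cmod (u x)" using norm_triangle_ineq4[of "x1 x" "cnj l * u x"] l by (simp add: x1_def norm_mult)
  show "cmod (u1 x) \<le> decay_const (1 / (al - a)) * H * m x" using c1 b3 b4 pos unfolding e by linarith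
  have c2: "cmod (u2 x) \<le> cmod (y x) + cmod (u x)" using norm_triangle_ineq[of "y x" "cnj mu * u x"] cm by (simp add: y_def norm_mult)
  show "cmod (u2 x) \<le> decay_const (1 / (al - a)) * H * m x" using c2 b2 b4 pos unfolding e by linarith
  have c3: "cmod (u3 x) \<le> cmod (y1 x) + cmod (y x) + (cmod (x1 x) + cmod (u x))"
  proof -
    have "u3 x = (y1 x - l * y x) + cnj mu * u1 x" by (simp add: y1_def y'_def)
    then have "cmod (u3 x) \<le> cmod (y1 x - l * y x) + cmod (cnj mu * u1 x)" by (metis norm_triangle_ineq)
    moreover have "cmod (y1 x - l * y x) \<le> cmod (y1 x) + cmod (y x)" using norm_triangle_ineq4[of "y1 x" "l * y x"] l by (simp add: norm_mult)
    ultimately show ?thesis using c1 cm by (simp add: norm_mult)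
  qed
  show "cmod (u3 x) \<le> decay_const (1 / (al - a)) * H * m x" using c3 b1 b2 b3 b4 unfolding e by linarith
qed

section \<open>Exponential decay of solutions\<close>

text \<open>A smooth substitute for exp (- a |x|), comparable to it up to the factor 2 and with
  logarithmic derivative bounded by a, as the weighted bounds require.\<close>

definition wt :: "real \<Rightarrow> real \<Rightarrow> real" where "wt a x = 1 / cosh (a * x)"

lemma wt_pos: "0 < wt a x" by (simp add: wt_def cosh_real_pos)

lemma wt_le: "wt a x \<le> 2 * exp (- a * \<bar>x\<bar>)" if "a \<ge> 0"
proof -
  have "exp (a * \<bar>x\<bar>) / 2 \<le> cosh (a * x)"
  proof (cases "x \<ge> 0")
    case True then show ?thesis by (simp add: cosh_def)
  next
    case False then show ?thesis by (simp add: cosh_def)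
  qed
  then show ?thesis using cosh_real_pos[of "a * x"] by (simp add: wt_def field_simps exp_minus)
qed

lemma wt_ge: "exp (- a * \<bar>x\<bar>) \<le> wt a x" if "a \<ge> 0"
proof -
  have "cosh (a * x) \<le> exp (a * \<bar>x\<bar>)"
  proof (cases "x \<ge> 0")
    case True
    then have "exp (- (a * x)) \<le> exp (a * x)" using that by simp
    then show ?thesis using True by (simp add: cosh_def)
  next
    case False
    then have "exp (a * x) \<le> exp (- (a * x))" using that by (simp add: mult_nonneg_nonpos)
    then show ?thesis using False by (simp add: cosh_def)
  qed
  then show ?thesis using cosh_real_pos[of "a * x"] by (simp add: wt_def field_simps exp_minus)
qed

lemma wt_deriv:
  assumes "a \<ge> 0"
  shows "(wt a has_real_derivative - (a * sinh (a * x)) / (cosh (a * x))\<^sup>2) (at x)"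
    "\<bar>- (a * sinh (a * x)) / (cosh (a * x))\<^sup>2\<bar> \<le> a * wt a x"
proof -
  show "(wt a has_real_derivative - (a * sinh (a * x)) / (cosh (a * x))\<^sup>2) (at x)" unfolding wt_def[abs_def]
    by (auto intro!: derivative_eq_intros simp: power2_eq_square)
  have "\<bar>sinh (a * x)\<bar> \<le> cosh (a * x)" by (rule abs_le_square_iff[THEN iffD2, of _ "cosh (a * x)", unfolded abs_of_pos[OF cosh_real_pos]])
       (simp add: cosh_square_eq)
  then show "\<bar>- (a * sinh (a * x)) / (cosh (a * x))\<^sup>2\<bar> \<le> a * wt a x" using assms cosh_real_pos[of "a * x"]
    by (simp add: wt_def abs_mult power2_eq_square divide_simps mult_left_mono)
qed

text \<open>The forcing is allowed to contain a multiple of the solution that is small far out: its influence is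
  absorbed by iterating the weighted bound for the weight \<open>wt a + \<delta>\<close>, and then \<open>\<delta>\<close> tends to 0.\<close>
lemma exponential_decay:
  fixes u u1 u2 u3 h :: "real \<Rightarrow> complex"
  assumes a: "0 \<le> a" "a < al" "0 < al" "al = Re l" and l: "cmod l = 1" "2 * Re (l\<^sup>2) = - (c\<^sup>2)"
    and u: "\<And>x. (u has_vector_derivative u1 x) (at x)" "\<And>x. (u1 has_vector_derivative u2 x) (at x)"
      "\<And>x. (u2 has_vector_derivative u3 x) (at x)"
      "\<And>x. (u3 has_vector_derivative (h x - of_real (c\<^sup>2) * u2 x - u x)) (at x)"
    and b: "\<And>x. cmod (u x) \<le> M" "\<And>x. cmod (u1 x) \<le> M" "\<And>x. cmod (u2 x) \<le> M" "\<And>x. cmod (u3 x) \<le> M"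
    and far: "\<And>x. \<bar>x\<bar> \<ge> R \<Longrightarrow> cmod (h x) \<le> e * cmod (u x) + G * exp (- a * \<bar>x\<bar>)"
    and near: "\<And>x. \<bar>x\<bar> \<le> R \<Longrightarrow> cmod (h x) \<le> Hb" and nn: "G \<ge> 0" "Hb \<ge> 0" "e \<ge> 0"
    and e: "decay_const (1 / (al - a)) * e \<le> 1 / 2"
  shows "\<exists>C. \<forall>x. cmod (u x) \<le> C * exp (- a * \<bar>x\<bar>) \<and> cmod (u1 x) \<le> C * exp (- a * \<bar>x\<bar>) \<and>
     cmod (u2 x) \<le> C * exp (- a * \<bar>x\<bar>) \<and> cmod (u3 x) \<le> C * exp (- a * \<bar>x\<bar>)"
proof -
  define D where "D = decay_const (1 / (al - a))"
  have D: "D > 0" using a by (simp add: D_def decay_const_def add_pos_pos)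
  have M: "M \<ge> 0" using b(1)[of 0] norm_ge_zero order_trans by blast
  define C1 where "C1 = Hb * exp (a * \<bar>R\<bar>) + G"
  have C1: "C1 \<ge> 0" using nn by (simp add: C1_def)
  have hb: "cmod (h x) \<le> e * cmod (u x) + C1 * wt a x" for x
  proof (cases "\<bar>x\<bar> \<ge> R")
    case True
    have "G * exp (- a * \<bar>x\<bar>) \<le> C1 * wt a x" using nn wt_ge[OF a(1), of x] by (intro mult_mono) (auto simp: C1_def)
    then show ?thesis using far[OF True] by linarith
  next
    case False
    have "Hb = Hb * exp (a * \<bar>R\<bar>) * exp (- a * \<bar>R\<bar>)" by (simp add: exp_minus)
    also have "\<dots> \<le> C1 * exp (- a * \<bar>x\<bar>)" using False a nn by (intro mult_mono) (auto simp: C1_def mult_left_mono)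
    also have "\<dots> \<le> C1 * wt a x" using C1 wt_ge[OF a(1), of x] by (intro mult_left_mono) auto
    finally show ?thesis using near[of x] False nn(3) mult_nonneg_nonneg[OF nn(3) norm_ge_zero[of "u x"]] by linarith
  qed
  have gain: "cmod (u x) \<le> (W / 2 + D * C1) * (wt a x + d)" if "d \<ge> 0" "W \<ge> 0" "\<And>x. cmod (u x) \<le> W * (wt a x + d)" for W d x
  proof -
    have m: "((\<lambda>x. wt a x + d) has_real_derivative - (a * sinh (a * x)) / (cosh (a * x))\<^sup>2) (at x)" for x
      using DERIV_add[OF wt_deriv(1)[OF a(1), of x] DERIV_const[of d]] by simp
    have "cmod (u x) \<le> D * (e * W + C1) * (wt a x + d)" unfolding D_def
    proof (rule fourth_order_bound(1)[OF a(2-4) l u b _ _ m])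
      show "cmod (h x) \<le> (e * W + C1) * (wt a x + d)" for x
        using hb[of x] mult_left_mono[OF that(3)[of x] nn(3)] mult_nonneg_nonneg[OF C1 that(1)] by (simp add: algebra_simps)
      show "\<bar>- (a * sinh (a * x)) / (cosh (a * x))\<^sup>2\<bar> \<le> a * (wt a x + d)" for x
        using wt_deriv(2)[OF a(1), of x] mult_nonneg_nonneg[OF a(1) that(1)] unfolding distrib_left by linarith
      show "0 \<le> wt a x + d" for x using wt_pos[of a x] that by linarith
    qed (use nn that C1 in auto)
    also have "\<dots> \<le> (W / 2 + D * C1) * (wt a x + d)"
    proof (intro mult_right_mono)
      show "D * (e * W + C1) \<le> W / 2 + D * C1" using mult_right_mono[OF e that(2)] by (simp add: D_def algebra_simps)
      show "0 \<le> wt a x + d" using wt_pos[of a x] that by linarith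
    qed
    finally show ?thesis .
  qed
  have bd: "cmod (u x) \<le> 2 * D * C1 * (wt a x + d)" if d: "d > 0" for d x
  proof -
    \<comment> \<open>2 D C1 is the fixed point of the map from W to W / 2 + D C1. The iteration
      starts from the trivial bound M = (M / d) * d, which is where the positive summand d of the
      weight is used.\<close>
    have it: "cmod (u x) \<le> (2 * D * C1 + M / d / 2 ^ k) * (wt a x + d)" for k x
    proof (induction k arbitrary: x)
      case 0
      have "M = M / d * d" using d by simp
      also have "\<dots> \<le> (2 * D * C1 + M / d) * (wt a x + d)" using d M D C1 wt_pos[of a x] by (intro mult_mono) auto
      finally show ?case using b(1)[of x] by simp
    next
      case (Suc k)
      have "cmod (u x) \<le> ((2 * D * C1 + M / d / 2 ^ k) / 2 + D * C1) * (wt a x + d)" using d M D C1 Suc by (intro gain) auto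
      also have "(2 * D * C1 + M / d / 2 ^ k) / 2 + D * C1 = 2 * D * C1 + M / d / 2 ^ Suc k" by (simp add: field_simps)
      finally show ?case .
    qed
    have "(\<lambda>k. (2 * D * C1 + M / d * (1 / 2) ^ k) * (wt a x + d)) \<longlonglongrightarrow> (2 * D * C1 + M / d * 0) * (wt a x + d)"
      by (intro tendsto_intros LIMSEQ_realpow_zero) auto
    then have "cmod (u x) \<le> (2 * D * C1 + M / d * 0) * (wt a x + d)"
      by (rule LIMSEQ_le_const) (use it[of x] in \<open>auto simp: power_one_over field_simps\<close>)
    then show ?thesis by simp
  qed
  have bd0: "cmod (u x) \<le> 2 * D * C1 * wt a x" for x
  proof -
    have "((\<lambda>d. 2 * D * C1 * (wt a x + d)) \<longlongrightarrow> 2 * D * C1 * (wt a x + 0)) (at_right 0)" by (intro tendsto_intros)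
    then have "cmod (u x) \<le> 2 * D * C1 * (wt a x + 0)" by (rule tendsto_lowerbound) (auto simp: eventually_at_filter intro!: always_eventually bd)
    then show ?thesis by simp
  qed
  \<comment> \<open>Now that u itself decays, the whole forcing is dominated by the weight, and the
    three derivatives follow from the fourth-order bound.\<close>
  define H where "H = e * (2 * D * C1) + C1"
  have H: "H \<ge> 0" using nn D C1 by (simp add: H_def)
  have hH: "cmod (h x) \<le> H * wt a x" for x using hb[of x] mult_left_mono[OF bd0[of x] nn(3)] by (simp add: H_def algebra_simps)
  have wp: "0 \<le> wt a x" for x using wt_pos[of a x] by linarith
  note fb = fourth_order_bound[OF a(2-4) l u b hH H wt_deriv[OF a(1)] wp, folded D_def]
  have fin: "t \<le> (2 * (D * H)) * exp (- a * \<bar>x\<bar>)" if "t \<le> D * H * wt a x" for t x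
  proof -
    have "D * H * wt a x \<le> D * H * (2 * exp (- a * \<bar>x\<bar>))" using D H by (intro mult_left_mono wt_le a) auto
    then show ?thesis using that by simp
  qed
  show ?thesis by (rule exI[of _ "2 * (D * H)"]) (intro allI conjI fin fb)
qed

lemma simple_eigenvalue_multiple:
  assumes "simple_eigenvalue E T l" "f \<in> eigenspace E T l" "g \<in> eigenspace E T l" "\<not> f =\<^sub>2 (\<lambda>_. 0)"
  shows "\<exists>a. g =\<^sub>2 (\<lambda>x. a * f x)"
proof -
  obtain b :: "nat \<Rightarrow> real \<Rightarrow> complex" where b: "\<And>f. f \<in> eigenspace E T l \<Longrightarrow> \<exists>a. f =\<^sub>2 (\<lambda>x. \<Sum>i<1. a i * b i x)"
    using assms(1) unfolding simple_eigenvalue_def has_L2_dim_def by meson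
  have b': "\<exists>a. f =\<^sub>2 (\<lambda>x. a * b 0 x)" if "f \<in> eigenspace E T l" for f using b[OF that] by auto
  obtain a1 where a1: "f =\<^sub>2 (\<lambda>x. a1 * b 0 x)" using b'[OF assms(2)] by blast
  obtain a2 where a2: "g =\<^sub>2 (\<lambda>x. a2 * b 0 x)" using b'[OF assms(3)] by blast
  have "a1 \<noteq> 0" using a1 assms(4) by auto
  have "g =\<^sub>2 (\<lambda>x. (a2 / a1) * f x)" unfolding L2_eq_def
    by (rule eventually_elim2[OF a1[unfolded L2_eq_def] a2[unfolded L2_eq_def]]) (simp add: \<open>a1 \<noteq> 0\<close>)
  then show ?thesis by blast
qed

text \<open>Normalizing h gives unit vectors with vanishing residual that become orthogonal to the
  translates of each element of \<open>E k\<close>. Their limits at the centres are null vectors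
  orthogonal to \<open>E k\<close>, hence zero, and \<open>global_vanishing\<close> contradicts the
  unit norm. It serves twice: with the peaks as centres and m growing, and with m fixed and the
  single centre 0.\<close>

lemma approximate_null_contradiction:
  fixes h :: "nat \<Rightarrow> real \<Rightarrow> complex" and W :: "nat \<Rightarrow> real \<Rightarrow> real" and q :: "nat \<Rightarrow> nat \<Rightarrow> real"
  assumes c: "c\<^sup>2 < 2" and I: "finite I"
    and h: "\<And>i. h i \<in> sobolev 4"
    and large: "\<And>i. real (Suc i) * L2_norm (lin_op c (W i) (h i)) < L2_norm (h i)"
    and W: "\<And>i. continuous_on UNIV (W i)" "\<And>i x. \<bar>exp (W i x) - 1\<bar> \<le> B"
    and Wlim: "\<And>k x. k \<in> I \<Longrightarrow> (\<lambda>i. W i (x + q i k)) \<longlonglongrightarrow> W0 k x"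
    and W0: "\<And>k. k \<in> I \<Longrightarrow> continuous_on UNIV (W0 k)"
    and E: "\<And>k e. k \<in> I \<Longrightarrow> e \<in> E k \<Longrightarrow> e \<in> L2"
      "\<And>i k e. k \<in> I \<Longrightarrow> e \<in> E k \<Longrightarrow> real (Suc i) * cmod (L2_inner (h i) (\<lambda>x. e (x - q i k))) \<le> L2_norm (h i)"
    and kernel: "\<And>k g. k \<in> I \<Longrightarrow> g \<in> sobolev 4 \<Longrightarrow> lin_op c (W0 k) g =\<^sub>2 (\<lambda>x. 0) \<Longrightarrow>
      (\<And>e. e \<in> E k \<Longrightarrow> L2_inner g e = 0) \<Longrightarrow> g =\<^sub>2 (\<lambda>x. 0)"
    and far: "\<And>e. e > 0 \<Longrightarrow> \<exists>R. \<forall>\<^sub>F i in sequentially. \<forall>x. (\<forall>k\<in>I. \<bar>x - q i k\<bar> > R) \<longrightarrow> \<bar>exp (W i x) - 1\<bar> \<le> e"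
  shows False
proof -
  have hpos: "L2_norm (h i) > 0" for i
  proof -
    have "0 \<le> real (Suc i) * L2_norm (lin_op c (W i) (h i))" by simp
    then show ?thesis using large[of i] by linarith
  qed
  define f where "f i = (\<lambda>x. of_real (1 / L2_norm (h i)) * h i x)" for i
  have cm: "cmod (of_real (1 / L2_norm (h i))) = 1 / L2_norm (h i)" for i unfolding norm_of_real using hpos[of i] by simp
  have f: "f i \<in> sobolev 4" for i unfolding f_def by (intro sobolev_cmul h)
  have f1: "L2_norm (f i) = 1" for i unfolding f_def L2_norm_cmul cm using hpos[of i] by simp
  have quot: "1 / L2_norm (h i) * x \<le> 1 / real (Suc i)" if "real (Suc i) * x \<le> L2_norm (h i)" for i x using that hpos[of i] by (simp add: field_simps)
  have inv0: "(\<lambda>i. 1 / real (Suc i)) \<longlonglongrightarrow> 0" using LIMSEQ_inverse_real_of_nat by (simp add: inverse_eq_divide)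
  have Wm: "W i \<in> borel_measurable borel" for i by (rule borel_measurable_continuous_onI[OF W(1)])
  have bp: "bounded_potential (W i)" for i unfolding bounded_potential_def using Wm W(2) potential_exp_bound by blast
  have "L2_norm (lin_op c (W i) (f i)) \<le> 1 / real (Suc i)" for i
  proof -
    have "L2_norm (lin_op c (W i) (f i)) = L2_norm (\<lambda>x. of_real (1 / L2_norm (h i)) * lin_op c (W i) (h i) x)"
      unfolding f_def by (intro L2_norm_cong lin_op_linear(3)[OF h h] h lin_op_L2 sobolev_cmul bp L2_cmul)
    then show ?thesis unfolding L2_norm_cmul cm using quot[OF less_imp_le[OF large[of i]]] by simp
  qed
  then have small: "(\<lambda>i. L2_norm (lin_op c (W i) (f i))) \<longlonglongrightarrow> 0" by (intro tendsto_sandwich[OF _ _ tendsto_const inv0]) auto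
  have E2: "(\<lambda>i. L2_inner (f i) (\<lambda>x. e (x - q i k))) \<longlonglongrightarrow> 0" if "k \<in> I" "e \<in> E k" for k e
  proof (rule Lim_null_comparison[OF _ inv0], intro always_eventually allI)
    show "cmod (L2_inner (f i) (\<lambda>x. e (x - q i k))) \<le> 1 / real (Suc i)" for i
      unfolding f_def L2_inner_cmul_left norm_mult cm by (rule quot[OF E(2)[OF that]])
  qed
  have "\<forall>i. \<exists>F F1 F2 F3 F4. f i =\<^sub>2 F \<and> H4c F F1 F2 F3 F4" using sobolev_H4c[OF f] by metis
  then obtain F F1 F2 F3 F4 where F: "\<And>i. f i =\<^sub>2 F i" and H: "\<And>i. H4c (F i) (F1 i) (F2 i) (F3 i) (F4 i)" by metis
  have HH: "H4 (F i) (F1 i) (F2 i) (F3 i) (F4 i)" for i using H by (simp add: H4c_def)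
  note L = H4_L2[OF HH]
  have fL: "f i \<in> L2" for i by (rule sobolev_L2[OF f])
  have nF: "L2_norm (F i) = 1" for i using L2_norm_cong[OF L2_eq_sym[OF F] L(1) fL] f1 by simp
  then have F1n: "L2_norm (F i) \<le> 1" for i by simp
  have res: "L2_norm (pot_op c (W i) (F i) (F2 i) (F4 i)) = L2_norm (lin_op c (W i) (f i))" for i
  proof (rule L2_norm_cong)
    show "(pot_op c (W i) (F i) (F2 i) (F4 i)) =\<^sub>2 lin_op c (W i) (f i)"
      using L2_eq_sym[OF H4_lin_op[OF HH]] lin_op_cong[OF L2_eq_sym[OF F] L(1) fL] L2_eq_trans by blast
  qed (intro L2_add L2_cmul L potential_mult_L2 bp lin_op_L2 f)+
  have sm: "(\<lambda>i. L2_norm (pot_op c (W i) (F i) (F2 i) (F4 i))) \<longlonglongrightarrow> 0" unfolding res by (rule small)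
  \<comment> \<open>A uniform supremum bound, needed for the weak limit against the elements of
    \<open>E k\<close>.\<close>
  have sup: "\<exists>M. \<forall>i x. cmod (F i x) \<le> M"
  proof -
    obtain E0 where E0: "\<And>i. L2_norm (lin_op c (W i) (f i)) \<le> E0" using convergent_imp_Bseq[OF convergentI[OF small]] unfolding Bseq_def by auto
    have B: "B \<ge> 0" using W(2)[of 0 0] by linarith
    have "cmod (F i x) \<le> 2 * (ellip c * (E0 + B))" for i x
    proof -
      have "L2_norm (free_op c (F i) (F2 i) (F4 i)) \<le> L2_norm (lin_op c (W i) (f i)) + B * L2_norm (F i)"
        unfolding res[symmetric] by (rule H4_elliptic_potential[OF c HH Wm W(2)])
      also have "\<dots> \<le> E0 + B * 1" by (intro add_mono E0 mult_left_mono B F1n)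
      finally have "L2_norm (F i) \<le> ellip c * (E0 + B)" "L2_norm (F1 i) \<le> ellip c * (E0 + B)" using ellip_ge_1[OF c]
        by (auto intro!: order_trans[OF H4_elliptic(1)[OF c HH]] order_trans[OF H4_elliptic(2)[OF c HH]] mult_left_mono)
      then show ?thesis using antideriv_sup_bound[where x=x, OF _ L(1)[of i] L(2)[of i]] H[of i] by (auto simp: H4c_def)
    qed
    then show ?thesis by blast
  qed
  then obtain M where M: "\<And>i x. cmod (F i x) \<le> M" by blast
  have "(\<lambda>i. L2_norm (F i)) \<longlonglongrightarrow> 0"
  proof (rule global_vanishing[OF c H F1n Wm W(2) sm I Wlim W0 _ far])
    fix k r g g1 g2 g3 x
    assume k: "k \<in> I" and r: "strict_mono (r :: nat \<Rightarrow> nat)" and lim: "\<And>x. (\<lambda>i. F (r i) (x + q (r i) k)) \<longlonglongrightarrow> g x"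
      and gH: "H4c g g1 g2 g3 (\<lambda>x. - (of_real (c\<^sup>2) * g2 x + of_real (exp (W0 k x)) * g x))"
    have gHH: "H4 g g1 g2 g3 (\<lambda>x. - (of_real (c\<^sup>2) * g2 x + of_real (exp (W0 k x)) * g x))" using gH by (simp add: H4c_def)
    have gL: "g \<in> L2" by (rule H4_L2(1)[OF gHH])
    have "lin_op c (W0 k) g =\<^sub>2 (\<lambda>x. 0)" using H4_lin_op[OF gHH, of c "W0 k"] by simp
    moreover have "L2_inner g e = 0" if e: "e \<in> E k" for e
    proof -
      have "(\<lambda>i. L2_inner (\<lambda>x. F (r i) (x + q (r i) k)) e) \<longlonglongrightarrow> L2_inner g e"
      proof (rule weak_pointwise_limit[where M="max M 1"])
        show "L2_norm (\<lambda>x. F (r i) (x + q (r i) k)) \<le> max M 1" for i unfolding L2_shift(2)[OF L(1)] nF by simp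
        show "cmod (F (r i) (x + q (r i) k)) \<le> max M 1" for i x using M by (simp add: le_max_iff_disj)
      qed (intro L2_shift L lim E(1)[OF k e])+
      moreover have "L2_inner (\<lambda>x. F (r i) (x + q (r i) k)) e = L2_inner (f (r i)) (\<lambda>x. e (x - q (r i) k))" for i
      proof -
        have "L2_inner (\<lambda>x. F (r i) (x + q (r i) k)) e = (LINT x|lborel. F (r i) (q (r i) k + 1 * x) * cnj (e ((q (r i) k + 1 * x) - q (r i) k)))"
          by (simp add: L2_inner_def add.commute)
        also have "\<dots> = L2_inner (F (r i)) (\<lambda>x. e (x - q (r i) k))"
          using lborel_integral_real_affine[of 1 "\<lambda>x. F (r i) x * cnj (e (x - q (r i) k))" "q (r i) k"] by (simp add: L2_inner_def)
        also have "\<dots> = L2_inner (f (r i)) (\<lambda>x. e (x - q (r i) k))"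
          using L2_shift(1)[OF E(1)[OF k e], of "- q (r i) k"] by (intro L2_inner_cong L2_eq_sym[OF F] L fL L2_eq_refl) auto
        finally show ?thesis .
      qed
      moreover have "(\<lambda>i. L2_inner (f (r i)) (\<lambda>x. e (x - q (r i) k))) \<longlonglongrightarrow> 0"
        using LIMSEQ_subseq_LIMSEQ[OF E2[OF k e] r] by (simp add: o_def)
      ultimately show ?thesis using LIMSEQ_unique by fastforce
    qed
    ultimately have "g =\<^sub>2 (\<lambda>x. 0)" using kernel[OF k H4_sobolev[OF gHH]] by blast
    moreover have "continuous_on UNIV g" by (rule H4c_continuous[OF gH])
    ultimately have ae: "AE x in lborel. g x = 0" and cg: "continuous_on UNIV g" by (auto simp: L2_eq_def)
    \<comment> \<open>From almost everywhere to everywhere: by continuity a nonzero value would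
      persist on an interval of positive length.\<close>
    show "g x = 0"
    proof (rule ccontr)
      assume x: "g x \<noteq> 0"
      have op: "open {y. g y \<noteq> 0}" by (rule open_Collect_neq[OF cg continuous_on_const])
      then obtain d where d: "d > 0" "ball x d \<subseteq> {y. g y \<noteq> 0}" using x open_contains_ball by blast
      have "AE y in lborel. y \<notin> {x<..<x+d}" using ae
      proof eventually_elim
        case (elim y)
        show ?case
        proof
          assume "y \<in> {x<..<x+d}"
          then have "y \<in> ball x d" by (auto simp: dist_real_def)
          then show False using d elim by auto
        qed
      qed
      then have "emeasure lborel {x<..<x+d} = 0" by (subst (asm) AE_iff_null_sets[symmetric]) (auto simp: null_sets_def)
      then show False using d by simp
    qed
  qed (use W0 in auto)
  then show False by (simp add: nF LIMSEQ_const_iff)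
qed

section \<open>Eigenvalues of the linearization at the origin\<close>

lemma vector_4_nth [simp]:
  "(vector [x, y, z, w] :: 'a::zero ^ 4) $ 1 = x" "(vector [x, y, z, w] :: 'a::zero ^ 4) $ 2 = y"
  "(vector [x, y, z, w] :: 'a::zero ^ 4) $ 3 = z" "(vector [x, y, z, w] :: 'a::zero ^ 4) $ 4 = w" unfolding vector_def by simp_all

lemma wave_field_derivative_0:
  "(wave_field c has_derivative (\<lambda>h. vector [h $ 2, h $ 3, h $ 4, - c\<^sup>2 * h $ 3 - h $ 1])) (at 0)"
proof (subst has_derivative_componentwise_within, rule ballI)
  fix i :: "real^4" assume "i \<in> Basis"
  then obtain j where i: "i = axis j 1" by (auto simp: Basis_vec_def)
  have n: "((\<lambda>y::real^4. y $ k) has_derivative (\<lambda>h. h $ k)) (at 0)" for k by (rule bounded_linear_imp_has_derivative[OF bounded_linear_vec_nth])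
  have e: "((\<lambda>y::real^4. exp (y $ 1)) has_derivative (\<lambda>h. h $ 1)) (at 0)" using has_derivative_exp[OF n[of 1]] by simp
  have "((\<lambda>y. wave_field c y $ j) has_derivative (\<lambda>h. (vector [h $ 2, h $ 3, h $ 4, - c\<^sup>2 * h $ 3 - h $ 1] :: real^4) $ j)) (at 0)"
    using exhaust_4[of j]
  proof (elim disjE)
    assume j: "j = 4"
    have "((\<lambda>y::real^4. - c\<^sup>2 * y $ 3 - exp (y $ 1) + 1) has_derivative (\<lambda>h. - c\<^sup>2 * h $ 3 - h $ 1 + 0)) (at 0)"
      by (intro has_derivative_add has_derivative_diff has_derivative_const e has_derivative_mult_right n)
    then show ?thesis by (simp add: j wave_field_def)
  qed (use n in \<open>simp_all add: wave_field_def\<close>)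
  then show "((\<lambda>y. wave_field c y \<bullet> i) has_derivative (\<lambda>h. vector [h $ 2, h $ 3, h $ 4, - c\<^sup>2 * h $ 3 - h $ 1] \<bullet> i)) (at 0)"
    by (simp add: i inner_axis)
qed

text \<open>The Jacobian is a companion matrix: an eigenvector is a multiple of (1, l, l^2, l^3),
  and the last row is the characteristic equation.\<close>

lemma origin_eigenvalue_root:
  assumes "l \<in> origin_eigenvalues c" shows "l^4 + of_real (c\<^sup>2) * l\<^sup>2 + 1 = 0"
proof -
  let ?D = "\<lambda>h::real^4. vector [h $ 2, h $ 3, h $ 4, - c\<^sup>2 * h $ 3 - h $ 1] :: real^4"
  have fd: "frechet_derivative (wave_field c) (at 0) = ?D" using frechet_derivative_at[OF wave_field_derivative_0] by simp
  obtain v :: "complex^4" where v: "v \<noteq> 0"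
    "(\<chi> i j. complex_of_real (matrix (frechet_derivative (wave_field c) (at 0)) $ i $ j)) *v v = l *s v"
    using assms unfolding origin_eigenvalues_def Let_def by blast
  have row: "(\<Sum>j\<in>UNIV. complex_of_real (?D (axis j 1) $ i) * v $ j) = l * v $ i" for i
    using arg_cong[OF v(2), of "\<lambda>w. w $ i"] by (simp add: fd matrix_vector_mult_def matrix_def)
  have v2: "v $ 2 = l * v $ 1" using row[of 1] by (simp add: sum_4 axis_def)
  have v3: "v $ 3 = l * v $ 2" using row[of 2] by (simp add: sum_4 axis_def)
  have v4: "v $ 4 = l * v $ 3" using row[of 3] by (simp add: sum_4 axis_def)
  have r4: "- of_real (c\<^sup>2) * v $ 3 - v $ 1 = l * v $ 4" unfolding row[of 4, symmetric] by (simp add: sum_4 axis_def algebra_simps)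
  have "v $ 1 \<noteq> 0"
  proof
    assume "v $ 1 = 0"
    then have "v = 0" using v2 v3 v4 by (simp add: vec_eq_iff forall_4)
    then show False using v(1) by simp
  qed
  moreover have "(l^4 + of_real (c\<^sup>2) * l\<^sup>2 + 1) * v $ 1 = 0"
    using r4 unfolding v4 v3 v2 by (simp add: algebra_simps power2_eq_square power4_eq_xxxx) (metis add.commute add.left_commute add_eq_0_iff)
  ultimately show ?thesis by simp
qed

text \<open>The square of the eigenvalue is not real and solves a real quadratic equation with
  constant term 1. The other root is therefore its conjugate, so its modulus is 1 and twice its real
  part is - c^2.\<close>

lemma origin_eigenvalue_modulus:
  assumes "Complex al be \<in> origin_eigenvalues c" "al > 0" "be > 0"
  shows "cmod (Complex al be) = 1" "2 * Re ((Complex al be)\<^sup>2) = - (c\<^sup>2)"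
proof -
  define mu where "mu = (Complex al be)\<^sup>2"
  have im: "Im mu > 0" using assms by (simp add: mu_def power2_eq_square)
  have "mu\<^sup>2 + of_real (c\<^sup>2) * mu + 1 = 0" using origin_eigenvalue_root[OF assms(1)] by (simp add: mu_def)
  then have 1: "(Re mu)\<^sup>2 - (Im mu)\<^sup>2 + c\<^sup>2 * Re mu + 1 = 0" and 2: "2 * Re mu * Im mu + c\<^sup>2 * Im mu = 0"
    by (auto simp: complex_eq_iff Re_power2 Im_power2)
  have re: "2 * Re mu + c\<^sup>2 = 0"
  proof -
    have "(2 * Re mu + c\<^sup>2) * Im mu = 0" using 2 by (simp add: algebra_simps)
    then show ?thesis using im by simp
  qed
  then have "c\<^sup>2 = - 2 * Re mu" by simp
  then have "(Re mu)\<^sup>2 + (Im mu)\<^sup>2 = 1" using 1 by (simp add: power2_eq_square)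
  then have "(cmod mu)\<^sup>2 = 1" by (simp add: cmod_power2)
  then have "cmod mu = 1" using norm_ge_zero[of mu] unfolding power2_eq_1_iff by linarith
  then have "(cmod (Complex al be))\<^sup>2 = 1" by (simp add: mu_def norm_power)
  then show "cmod (Complex al be) = 1" using norm_ge_zero[of "Complex al be"] unfolding power2_eq_1_iff by linarith
  show "2 * Re ((Complex al be)\<^sup>2) = - (c\<^sup>2)" using re by (simp add: mu_def)
qed

section \<open>Integrals over the line and their dependence on a parameter\<close>

lemma integrable_exp_abs:
  assumes "\<eta> > 0" shows "integrable lborel (\<lambda>x::real. exp (- \<eta> * \<bar>x\<bar>))"
proof -
  have "set_integrable lebesgue {0..} (\<lambda>x::real. exp (- \<eta> * x))"
    by (intro nonnegative_absolutely_integrable_1 integrable_on_exp_minus_to_infinity assms) auto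
  then have 1: "integrable lborel (\<lambda>x::real. indicator {0..} x *\<^sub>R exp (- \<eta> * x))"
    unfolding set_integrable_def by (subst (asm) integrable_completion) auto
  have 2: "integrable lborel (\<lambda>x::real. indicator {0..} (- x) *\<^sub>R exp (- \<eta> * (- x)))"
    using lborel_integrable_real_affine[OF 1, of "-1" 0] by simp
  show ?thesis by (rule Bochner_Integration.integrable_bound[OF Bochner_Integration.integrable_add[OF 1 2]]) (auto simp: indicator_def abs_if)
qed

lemma exp_decay_small:
  fixes C \<eta> d :: real
  assumes "\<eta> > 0" "d > 0" shows "\<exists>R. \<forall>x::real. \<bar>x\<bar> \<ge> R \<longrightarrow> C * exp (- \<eta> * \<bar>x\<bar>) \<le> d"
proof -
  have "((\<lambda>y. C * exp (- \<eta> * y)) \<longlongrightarrow> C * 0) at_top" by (intro tendsto_intros exp_neg_at_top assms)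
  then have "\<forall>\<^sub>F y in at_top. C * exp (- \<eta> * y) < d" using assms(2) by (intro order_tendstoD(2)) auto
  then obtain R where "\<And>y. y \<ge> R \<Longrightarrow> C * exp (- \<eta> * y) < d" by (auto simp: eventually_at_top_linorder)
  then show ?thesis by (intro exI[of _ R]) (auto intro: less_imp_le)
qed

lemma exp_decay_bound: "\<eta> \<ge> 0 \<Longrightarrow> (\<And>x::real. y x \<le> C * exp (- \<eta> * \<bar>x\<bar>)) \<Longrightarrow> 0 \<le> y 0 \<Longrightarrow> y x \<le> C" 
proof -
  assume a: "\<eta> \<ge> 0" "\<And>x::real. y x \<le> C * exp (- \<eta> * \<bar>x\<bar>)" "0 \<le> y 0"
  have "C \<ge> 0" using a(2)[of 0] a(3) by simp
  then have "C * exp (- \<eta> * \<bar>x\<bar>) \<le> C * 1" using a(1) by (intro mult_left_mono) auto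
  then show ?thesis using a(2)[of x] by simp
qed

text \<open>The mean value theorem bounds all difference quotients by \<open>w\<close>, so dominated
  convergence applies along every sequence of parameters.\<close>

lemma leibniz_lborel:
  fixes G G' :: "real \<Rightarrow> real \<Rightarrow> real"
  assumes ab: "a < c" "c < b" 
    and D: "\<And>y x. y \<in> {a..b} \<Longrightarrow> ((\<lambda>y. G y x) has_real_derivative G' y x) (at y within {a..b})"
    and int: "\<And>y. y \<in> {a..b} \<Longrightarrow> integrable lborel (G y)"
    and w: "integrable lborel w" "\<And>y x. y \<in> {a..b} \<Longrightarrow> \<bar>G' y x\<bar> \<le> w x"
  shows "((\<lambda>y. LINT x|lborel. G y x) has_real_derivative (LINT x|lborel. G' c x)) (at c)"
proof -
  have c: "c \<in> {a..b}" using ab by auto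
  have "((\<lambda>y. LINT x|lborel. G y x) has_real_derivative (LINT x|lborel. G' c x)) (at c within {a..b})"
    unfolding has_field_derivative_iff tendsto_at_iff_sequentially
  proof (intro allI impI)
    fix X assume X: "\<forall>i. X i \<in> {a..b} - {c}" "X \<longlonglongrightarrow> c"
    have Xi: "X i \<in> {a..b}" "X i \<noteq> c" for i using X by auto
    let ?q = "\<lambda>i x. (G (X i) x - G c x) / (X i - c)"
    have qm: "?q i \<in> borel_measurable borel" for i
      using borel_measurable_integrable[OF int[OF Xi(1)], of i] borel_measurable_integrable[OF int[OF c]] by measurable
    have lim: "(\<lambda>i. ?q i x) \<longlonglongrightarrow> G' c x" for x
      using D[OF c, of x] X unfolding has_field_derivative_iff tendsto_at_iff_sequentially by (auto simp: o_def)
    have "(\<lambda>i. LINT x|lborel. ?q i x) \<longlonglongrightarrow> (LINT x|lborel. G' c x)"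
    proof (rule integral_dominated_convergence[OF _ _ w(1)])
      show "G' c \<in> borel_measurable lborel" using borel_measurable_LIMSEQ_metric[where f="?q" and g="G' c" and M=borel] qm lim by simp
      show "AE x in lborel. norm (?q i x) \<le> w x" for i
      proof (intro AE_I2)
        fix x
        have "norm (G (X i) x - G c x) \<le> w x * norm (X i - c)"
          by (rule field_differentiable_bound[of "{a..b}" "\<lambda>y. G y x" "\<lambda>y. G' y x"]) (use D w Xi c in auto)
        then show "norm (?q i x) \<le> w x" using Xi(2)[of i] by (simp add: abs_divide divide_le_eq)
      qed
    qed (use qm lim in auto)
    moreover have "(LINT x|lborel. ?q i x) = ((LINT x|lborel. G (X i) x) - (LINT x|lborel. G c x)) / (X i - c)" for i
      using int[OF Xi(1)] int[OF c] Xi(2) by simp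
    ultimately show "((\<lambda>y. ((LINT x|lborel. G y x) - (LINT x|lborel. G c x)) / (y - c)) \<circ> X) \<longlonglongrightarrow> (LINT x|lborel. G' c x)"
      by (simp only: o_def)
  qed
  then show ?thesis using ab at_within_interior[of c "{a..b}"] by simp
qed

text \<open>The identity P(c,y) - P(c,x-1) = integral of p(c) over [x-1, y] is differentiated in the
  parameter, which gives an integral formula for \<open>Pc\<close>, and then in y. Continuity of
  \<open>pc\<close> justifies both differentiations.\<close>

lemma mixed_derivative:
  fixes P p Pc pc :: "real \<Rightarrow> real \<Rightarrow> real"
  assumes c: "c \<in> {cm<..<cp}"
    and Px: "\<And>c x. c \<in> {cm<..<cp} \<Longrightarrow> ((P c) has_real_derivative p c x) (at x)"
    and Pc: "\<And>c x. c \<in> {cm<..<cp} \<Longrightarrow> ((\<lambda>c. P c x) has_real_derivative Pc c x) (at c)"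
    and pc: "\<And>c x. c \<in> {cm<..<cp} \<Longrightarrow> ((\<lambda>c. p c x) has_real_derivative pc c x) (at c)"
    and cp: "\<And>c. c \<in> {cm<..<cp} \<Longrightarrow> continuous_on UNIV (p c)"
    and cpc: "continuous_on ({cm<..<cp} \<times> UNIV) (\<lambda>(c, x). pc c x)"
  shows "(Pc c has_real_derivative pc c x) (at x)"
proof -
  have cpc1: "continuous_on A (pc c)" for A
  proof -
    have "continuous_on A (\<lambda>x. (c, x))" by (intro continuous_intros)
    moreover have "(\<lambda>x. (c, x)) ` A \<subseteq> {cm<..<cp} \<times> UNIV" using c by auto
    ultimately have "continuous_on A (\<lambda>x. case (c, x) of (c, x) \<Rightarrow> pc c x)" by (rule continuous_on_compose2[OF cpc])
    then show ?thesis by simp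
  qed
  have eq: "Pc c y - Pc c (x - 1) = integral {x-1..y} (pc c)" if y: "x - 1 \<le> y" for y
  proof -
    have "((\<lambda>c. integral (cbox (x-1) y) (p c)) has_field_derivative integral (cbox (x-1) y) (pc c)) (at c within {cm<..<cp})"
    proof (rule leibniz_rule_field_derivative)
      show "p c integrable_on cbox (x-1) y" if "c \<in> {cm<..<cp}" for c by (rule integrable_continuous) (rule continuous_on_subset[OF cp[OF that]], simp)
      show "continuous_on ({cm<..<cp} \<times> cbox (x-1) y) (\<lambda>(c, x). pc c x)" by (rule continuous_on_subset[OF cpc]) auto
    qed (use c pc in \<open>auto intro: has_field_derivative_at_within\<close>)
    then have "((\<lambda>c. integral (cbox (x-1) y) (p c)) has_field_derivative integral (cbox (x-1) y) (pc c)) (at c)"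
      by (simp only: at_within_open[OF c open_greaterThanLessThan])
    moreover have "((\<lambda>c. P c y - P c (x-1)) has_field_derivative (Pc c y - Pc c (x-1))) (at c)" by (intro derivative_intros Pc c)
    then have "((\<lambda>c. integral (cbox (x-1) y) (p c)) has_field_derivative (Pc c y - Pc c (x-1))) (at c)"
    proof (rule has_field_derivative_transform_within_open[where S="{cm<..<cp}"])
      fix d assume d: "d \<in> {cm<..<cp}"
      have "(p d has_integral P d y - P d (x-1)) {x-1..y}" by (rule fundamental_theorem_of_calculus[OF y])
          (use Px[OF d] in \<open>auto simp: has_real_derivative_iff_has_vector_derivative[symmetric] intro: has_field_derivative_at_within\<close>)
      then show "P d y - P d (x-1) = integral (cbox (x-1) y) (p d)" by (simp add: integral_unique)
    qed (use c in auto)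
    ultimately show ?thesis using DERIV_unique by fastforce
  qed
  have "((\<lambda>y. integral {x-1..y} (pc c)) has_vector_derivative pc c x) (at x within {x-1..x+1})" by (rule integral_has_vector_derivative[OF cpc1]) auto
  then have "((\<lambda>y. integral {x-1..y} (pc c)) has_vector_derivative pc c x) (at x)" by (simp add: at_within_interior[of x "{x-1..x+1}"])
  then have "((\<lambda>y. Pc c (x-1) + integral {x-1..y} (pc c)) has_real_derivative 0 + pc c x) (at x)"
    unfolding has_real_derivative_iff_has_vector_derivative by (intro has_vector_derivative_add has_vector_derivative_const)
  then have "((\<lambda>y. Pc c (x-1) + integral {x-1..y} (pc c)) has_real_derivative pc c x) (at x)" by simp
  then show ?thesis
  proof (rule has_field_derivative_transform_within_open[where S="{x-1<..<x+1}"])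
    fix y assume "y \<in> {x-1<..<x+1}"
    then show "Pc c (x-1) + integral {x-1..y} (pc c) = Pc c y" using eq[of y] by simp
  qed auto
qed

section \<open>The family of pulses\<close>

text \<open>The derivative of the pulse in c, taken as a directional derivative of the joint map
  because \<open>Ck_on\<close> then gives its joint continuity at once.\<close>

definition dcY :: "(real \<Rightarrow> real \<Rightarrow> real^4) \<Rightarrow> real \<Rightarrow> real \<Rightarrow> real^4" where
  "dcY Y c x = frechet_derivative (\<lambda>(c, x). Y c x) (at (c, x)) (1, 0)"

lemma component_derivative:
  assumes "solves_on c UNIV Y"
  shows "((\<lambda>x. Y x $ i) has_real_derivative wave_field c (Y x) $ i) (at x)"
  unfolding has_real_derivative_iff_has_vector_derivative
  by (rule bounded_linear.has_vector_derivative[OF bounded_linear_vec_nth]) (use assms in \<open>simp add: solves_on_def\<close>)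

lemma wave_field_nth:
  "wave_field c y $ 1 = y $ 2" "wave_field c y $ 2 = y $ 3" "wave_field c y $ 3 = y $ 4"
  "wave_field c y $ 4 = - c\<^sup>2 * y $ 3 - exp (y $ 1) + 1" by (simp_all add: wave_field_def)

lemma exp_near_0:
  fixes e :: real
  assumes "e > 0" shows "\<exists>d>0. \<forall>u::real. \<bar>u\<bar> \<le> d \<longrightarrow> \<bar>exp u - 1 - u\<bar> \<le> e * \<bar>u\<bar>" "\<exists>d>0. \<forall>u::real. \<bar>u\<bar> \<le> d \<longrightarrow> \<bar>exp u - 1\<bar> \<le> e"
proof -
  have "(exp has_derivative (\<lambda>h. h)) (at (0::real))" using has_derivative_exp[OF has_derivative_ident, of "0::real"] by simp
  then obtain d where d: "d > 0" "\<And>u::real. \<bar>u\<bar> < d \<Longrightarrow> \<bar>exp u - 1 - u\<bar> \<le> e * \<bar>u\<bar>"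
    unfolding has_derivative_at_alt using assms by force
  show "\<exists>d>0. \<forall>u::real. \<bar>u\<bar> \<le> d \<longrightarrow> \<bar>exp u - 1 - u\<bar> \<le> e * \<bar>u\<bar>"
    by (rule exI[of _ "d/2"]) (use d in auto)
  have "isCont exp (0::real)" by simp
  then obtain d where d: "d > 0" "\<And>u::real. dist u 0 < d \<Longrightarrow> dist (exp u) (exp 0) < e" unfolding continuous_at_eps_delta using assms by blast
  show "\<exists>d>0. \<forall>u::real. \<bar>u\<bar> \<le> d \<longrightarrow> \<bar>exp u - 1\<bar> \<le> e"
    by (rule exI[of _ "d/2"]) (use d in \<open>auto simp: dist_real_def intro: less_imp_le\<close>)
qed

context
  fixes Y :: "real \<Rightarrow> real \<Rightarrow> real^4" and cm cp :: real
  assumes pf: "pulse_family cm cp Y"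
begin

lemma family_hypothesis: "c \<in> {cm<..<cp} \<Longrightarrow> hypothesis1 c (Y c)"
  using pf by (auto simp: pulse_family_def)

lemma family_solves: "c \<in> {cm<..<cp} \<Longrightarrow> solves_on c UNIV (Y c)"
  using family_hypothesis by (auto simp: hypothesis1_def homoclinic_orbit_def)

lemma family_derivative: "c \<in> {cm<..<cp} \<Longrightarrow> ((\<lambda>x. Y c x $ i) has_real_derivative wave_field c (Y c x) $ i) (at x)"
  by (rule component_derivative[OF family_solves])

lemma family_differentiable:
  assumes "c \<in> {cm<..<cp}" shows "(\<lambda>(c, x). Y c x) differentiable (at (c, x))"
proof -
  have "Ck_on (Suc 0) ({cm<..<cp} \<times> UNIV) (\<lambda>(c, x). Y c x)" using pf unfolding pulse_family_def by blast
  then show ?thesis using assms by auto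
qed

lemma dcY_continuous: "continuous_on ({cm<..<cp} \<times> UNIV) (\<lambda>(c, x). dcY Y c x)"
proof -
  have "Ck_on (Suc 0) ({cm<..<cp} \<times> UNIV) (\<lambda>(c, x). Y c x)" using pf unfolding pulse_family_def by blast
  then have "continuous_on ({cm<..<cp} \<times> UNIV) (\<lambda>z. frechet_derivative (\<lambda>(c, x). Y c x) (at z) (1, 0))" by simp
  then show ?thesis by (rule continuous_on_eq) (auto simp: dcY_def)
qed

lemma family_continuous: "continuous_on ({cm<..<cp} \<times> UNIV) (\<lambda>(c, x). Y c x)"
proof (rule continuous_at_imp_continuous_on, intro ballI)
  fix z assume "z \<in> {cm<..<cp} \<times> (UNIV :: real set)"
  then show "isCont (\<lambda>(c, x). Y c x) z" using differentiable_imp_continuous_within[OF family_differentiable] by (cases z) auto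
qed

lemma dcY_derivative:
  assumes "c \<in> {cm<..<cp}"
  shows "((\<lambda>c. Y c x) has_vector_derivative dcY Y c x) (at c)"
proof -
  let ?F = "frechet_derivative (\<lambda>(c, x). Y c x) (at (c, x))"
  have F: "((\<lambda>(c, x). Y c x) has_derivative ?F) (at (c, x))" using family_differentiable[OF assms] frechet_derivative_works by blast
  have "((\<lambda>c. (c, x)) has_derivative (\<lambda>h. (h, 0))) (at c)" by (auto intro!: derivative_eq_intros)
  from has_derivative_compose[OF this F]
  have "((\<lambda>c. Y c x) has_derivative (\<lambda>h. ?F (h, 0))) (at c)" by simp
  moreover have "?F (h, 0) = h *\<^sub>R ?F (1, 0)" for h
  proof -
    have "linear ?F" using F has_derivative_linear by blast
    then show ?thesis using linear_scale[of ?F h "(1, 0)"] by simp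
  qed
  then have "(\<lambda>h. ?F (h, 0)) = (\<lambda>h. h *\<^sub>R ?F (1, 0))" by blast
  ultimately show ?thesis unfolding has_vector_derivative_def dcY_def by (simp only:)
qed

lemma dcY_component: "c \<in> {cm<..<cp} \<Longrightarrow> ((\<lambda>c. Y c x $ i) has_real_derivative dcY Y c x $ i) (at c)"
  unfolding has_real_derivative_iff_has_vector_derivative by (rule bounded_linear.has_vector_derivative[OF bounded_linear_vec_nth dcY_derivative])

text \<open>The c-derivative of the right-hand side \<open>wave_field c (Y c x)\<close>; the term
  with - 2 c stems from the explicit coefficient c^2.\<close>

definition variational :: "real \<Rightarrow> real \<Rightarrow> 4 \<Rightarrow> real" where
  "variational c x i = (if i = 1 then dcY Y c x $ 2 else if i = 2 then dcY Y c x $ 3 else if i = 3 then dcY Y c x $ 4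
     else - 2 * c * Y c x $ 3 - c\<^sup>2 * dcY Y c x $ 3 - exp (Y c x $ 1) * dcY Y c x $ 1)"

lemma dcY_equation:
  assumes c: "c \<in> {cm<..<cp}"
  shows "((\<lambda>x. dcY Y c x $ i) has_real_derivative variational c x i) (at x)"
proof (rule mixed_derivative[OF c, where P="\<lambda>c x. Y c x $ i" and p="\<lambda>c x. wave_field c (Y c x) $ i" and Pc="\<lambda>c x. dcY Y c x $ i"])
  fix c x assume c: "c \<in> {cm<..<cp}"
  show "((\<lambda>x. Y c x $ i) has_real_derivative wave_field c (Y c x) $ i) (at x)" by (rule family_derivative[OF c])
  show "((\<lambda>c. Y c x $ i) has_real_derivative dcY Y c x $ i) (at c)" by (rule dcY_component[OF c])
  show "((\<lambda>c. wave_field c (Y c x) $ i) has_real_derivative variational c x i) (at c)" using exhaust_4[of i]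
    by (elim disjE) (auto simp: wave_field_nth variational_def intro!: derivative_eq_intros dcY_component[OF c])
next
  fix c assume c: "c \<in> {cm<..<cp}"
  have cont: "continuous_on UNIV (\<lambda>x. Y c x $ j)" for j using family_derivative[OF c] by (meson DERIV_isCont continuous_at_imp_continuous_on)
  show "continuous_on UNIV (\<lambda>x. wave_field c (Y c x) $ i)"
    using exhaust_4[of i] by (elim disjE) (auto simp: wave_field_nth intro!: continuous_intros cont)
next
  let ?S = "{cm<..<cp} \<times> (UNIV :: real set)"
  have 1: "continuous_on ?S (\<lambda>z. Y (fst z) (snd z) $ j)" for j using continuous_on_component[OF family_continuous] by (simp add: case_prod_beta)
  have 2: "continuous_on ?S (\<lambda>z. dcY Y (fst z) (snd z) $ j)" for j using continuous_on_component[OF dcY_continuous] by (simp add: case_prod_beta)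
  show "continuous_on ?S (\<lambda>(c, x). variational c x i)" using exhaust_4[of i]
    by (elim disjE) (auto simp: variational_def case_prod_beta intro!: continuous_intros 1 2)
qed

lemma family_decay:
  assumes "{a..b} \<subseteq> {cm<..<cp}"
  shows "\<exists>C. \<exists>\<eta>>0. \<forall>c\<in>{a..b}. \<forall>x i. \<bar>Y c x $ i\<bar> \<le> C * exp (- \<eta> * \<bar>x\<bar>) \<and> \<bar>dcY Y c x $ i\<bar> \<le> C * exp (- \<eta> * \<bar>x\<bar>)"
proof -
  obtain C \<eta> where C: "\<eta> > 0" "\<And>c x. c \<in> {a..b} \<Longrightarrow> norm (Y c x) \<le> C * exp (- \<eta> * \<bar>x\<bar>)"
    "\<And>c x. c \<in> {a..b} \<Longrightarrow> norm (vector_derivative (\<lambda>c. Y c x) (at c)) \<le> C * exp (- \<eta> * \<bar>x\<bar>)"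
    using pf assms unfolding pulse_family_def by blast
  have "norm (dcY Y c x) \<le> C * exp (- \<eta> * \<bar>x\<bar>)" if "c \<in> {a..b}" for c x
    using C(3)[OF that, of x] vector_derivative_at[OF dcY_derivative, of c x] assms that by auto
  then show ?thesis using C(1,2) component_le_norm_cart order_trans by meson
qed

text \<open>The family comes with an unspecified rate, which is raised here to any a below
  \<open>al\<close>. Far out the nonlinearity is a small multiple of the solution and is absorbed by
  \<open>exponential_decay\<close>. For the c-derivative the inhomogeneity is a multiple of the
  third component of Y, whose rate a is known from the first half.\<close>

lemma sharp_decay:
  assumes c: "c \<in> {cm<..<cp}" and al: "0 \<le> a" "a < al" "al = Re l" "cmod l = 1" "2 * Re (l\<^sup>2) = - (c\<^sup>2)"
  shows "\<exists>C. \<forall>x i. \<bar>Y c x $ i\<bar> \<le> C * exp (- a * \<bar>x\<bar>) \<and> \<bar>dcY Y c x $ i\<bar> \<le> C * exp (- a * \<bar>x\<bar>)"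
proof -
  have "{c..c} \<subseteq> {cm<..<cp}" using c by auto
  from family_decay[OF this] obtain C \<eta> where \<eta>: "\<eta> > 0"
    and C: "\<And>x i. \<bar>Y c x $ i\<bar> \<le> C * exp (- \<eta> * \<bar>x\<bar>)" "\<And>x i. \<bar>dcY Y c x $ i\<bar> \<le> C * exp (- \<eta> * \<bar>x\<bar>)" by auto
  have M: "\<bar>Y c x $ i\<bar> \<le> C" "\<bar>dcY Y c x $ i\<bar> \<le> C" for x i
    using exp_decay_bound[of \<eta> "\<lambda>x. \<bar>Y c x $ i\<bar>" C x] exp_decay_bound[of \<eta> "\<lambda>x. \<bar>dcY Y c x $ i\<bar>" C x] \<eta> C(1)[of _ i] C(2)[of _ i]
    by simp_all
  have C0: "C \<ge> 0" using M(1)[of 0 1] by linarith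
  define k where "k = decay_const (1 / (al - a))"
  have k: "k > 0" using al by (simp add: k_def decay_const_def add_pos_pos)
  define e where "e = 1 / (2 * k)"
  have e: "e > 0" "k * e \<le> 1 / 2" using k by (auto simp: e_def)
  obtain d1 where d1: "d1 > 0" "\<And>u::real. \<bar>u\<bar> \<le> d1 \<Longrightarrow> \<bar>exp u - 1 - u\<bar> \<le> e * \<bar>u\<bar>" using exp_near_0(1)[OF e(1)] by blast
  obtain d2 where d2: "d2 > 0" "\<And>u::real. \<bar>u\<bar> \<le> d2 \<Longrightarrow> \<bar>exp u - 1\<bar> \<le> e" using exp_near_0(2)[OF e(1)] by blast
  obtain R where R: "\<And>x. \<bar>x\<bar> \<ge> R \<Longrightarrow> C * exp (- \<eta> * \<bar>x\<bar>) \<le> min d1 d2"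
    using exp_decay_small[OF \<eta>, of "min d1 d2" C] d1 d2 by auto
  have far: "\<bar>Y c x $ 1\<bar> \<le> d1" "\<bar>Y c x $ 1\<bar> \<le> d2" if "\<bar>x\<bar> \<ge> R" for x using R[OF that] C(1)[of x 1] by auto
  have hv: "((\<lambda>x. complex_of_real (f x)) has_vector_derivative complex_of_real f') (at x)" if "(f has_real_derivative f') (at x)" for f f' x
    using that by (intro has_vector_derivative_of_real) (simp add: has_real_derivative_iff_has_vector_derivative)
  note dY = family_derivative[OF c] and dD = dcY_equation[OF c]
  have e1: "\<bar>exp (Y c x $ 1)\<bar> \<le> exp C" for x using M(1)[of x 1] by simp
  have "\<exists>C'. \<forall>x. cmod (of_real (Y c x $ 1)) \<le> C' * exp (- a * \<bar>x\<bar>) \<and> cmod (of_real (Y c x $ 2)) \<le> C' * exp (- a * \<bar>x\<bar>) \<and>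
     cmod (of_real (Y c x $ 3)) \<le> C' * exp (- a * \<bar>x\<bar>) \<and> cmod (of_real (Y c x $ 4)) \<le> C' * exp (- a * \<bar>x\<bar>)"
  proof (rule exponential_decay[where h="\<lambda>x. of_real (- (exp (Y c x $ 1) - 1 - Y c x $ 1))" and M=C and R=R and e=e and G=0 and Hb="exp C + 1 + C" and c=c and l=l and al=al])
    show "((\<lambda>x. complex_of_real (Y c x $ 1)) has_vector_derivative of_real (Y c x $ 2)) (at x)"
      "((\<lambda>x. complex_of_real (Y c x $ 2)) has_vector_derivative of_real (Y c x $ 3)) (at x)"
      "((\<lambda>x. complex_of_real (Y c x $ 3)) has_vector_derivative of_real (Y c x $ 4)) (at x)" for x
      using hv[OF dY, of 1 x] hv[OF dY, of 2 x] hv[OF dY, of 3 x] by (simp_all only: wave_field_nth)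
    show "((\<lambda>x. complex_of_real (Y c x $ 4)) has_vector_derivative
        (of_real (- (exp (Y c x $ 1) - 1 - Y c x $ 1)) - of_real (c\<^sup>2) * of_real (Y c x $ 3) - of_real (Y c x $ 1))) (at x)" for x
      using hv[OF dY, of 4 x] by (simp add: wave_field_nth algebra_simps)
    show "cmod (of_real (- (exp (Y c x $ 1) - 1 - Y c x $ 1))) \<le> e * cmod (of_real (Y c x $ 1)) + 0 * exp (- a * \<bar>x\<bar>)" if "\<bar>x\<bar> \<ge> R" for x
      using d1(2)[OF far(1)[OF that]] unfolding norm_of_real abs_minus_cancel by simp
    show "cmod (of_real (- (exp (Y c x $ 1) - 1 - Y c x $ 1))) \<le> exp C + 1 + C" for x
      using e1[of x] M(1)[of x 1] unfolding norm_of_real abs_minus_cancel by linarith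
  qed (use al e C0 M in \<open>auto simp: k_def\<close>)
  then obtain C1 where C1: "\<And>x. \<bar>Y c x $ 1\<bar> \<le> C1 * exp (- a * \<bar>x\<bar>)" "\<And>x. \<bar>Y c x $ 2\<bar> \<le> C1 * exp (- a * \<bar>x\<bar>)"
    "\<And>x. \<bar>Y c x $ 3\<bar> \<le> C1 * exp (- a * \<bar>x\<bar>)" "\<And>x. \<bar>Y c x $ 4\<bar> \<le> C1 * exp (- a * \<bar>x\<bar>)"
    unfolding norm_of_real by blast
  have C1nn: "C1 \<ge> 0" using C1(1)[of 0] by simp
  have "\<exists>C'. \<forall>x. cmod (of_real (dcY Y c x $ 1)) \<le> C' * exp (- a * \<bar>x\<bar>) \<and> cmod (of_real (dcY Y c x $ 2)) \<le> C' * exp (- a * \<bar>x\<bar>) \<and>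
     cmod (of_real (dcY Y c x $ 3)) \<le> C' * exp (- a * \<bar>x\<bar>) \<and> cmod (of_real (dcY Y c x $ 4)) \<le> C' * exp (- a * \<bar>x\<bar>)"
  proof (rule exponential_decay[where h="\<lambda>x. of_real (- 2 * c * Y c x $ 3 - (exp (Y c x $ 1) - 1) * dcY Y c x $ 1)" and M=C and R=R and e=e
        and G="2 * \<bar>c\<bar> * C1" and Hb="2 * \<bar>c\<bar> * C + (exp C + 1) * C" and c=c and l=l and al=al])
    show "((\<lambda>x. complex_of_real (dcY Y c x $ 1)) has_vector_derivative of_real (dcY Y c x $ 2)) (at x)"
      "((\<lambda>x. complex_of_real (dcY Y c x $ 2)) has_vector_derivative of_real (dcY Y c x $ 3)) (at x)"
      "((\<lambda>x. complex_of_real (dcY Y c x $ 3)) has_vector_derivative of_real (dcY Y c x $ 4)) (at x)" for x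
      using hv[OF dD, of 1 x] hv[OF dD, of 2 x] hv[OF dD, of 3 x] by (simp_all add: variational_def)
    show "((\<lambda>x. complex_of_real (dcY Y c x $ 4)) has_vector_derivative
        (of_real (- 2 * c * Y c x $ 3 - (exp (Y c x $ 1) - 1) * dcY Y c x $ 1) - of_real (c\<^sup>2) * of_real (dcY Y c x $ 3) - of_real (dcY Y c x $ 1))) (at x)" for x
      using hv[OF dD, of 4 x] by (simp add: variational_def algebra_simps)
    show "cmod (of_real (- 2 * c * Y c x $ 3 - (exp (Y c x $ 1) - 1) * dcY Y c x $ 1)) \<le>
        e * cmod (of_real (dcY Y c x $ 1)) + 2 * \<bar>c\<bar> * C1 * exp (- a * \<bar>x\<bar>)" if "\<bar>x\<bar> \<ge> R" for x
    proof -
      have "\<bar>2 * c * Y c x $ 3\<bar> \<le> 2 * \<bar>c\<bar> * (C1 * exp (- a * \<bar>x\<bar>))" unfolding abs_mult by (intro mult_mono C1) auto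
      moreover have "\<bar>(exp (Y c x $ 1) - 1) * dcY Y c x $ 1\<bar> \<le> e * \<bar>dcY Y c x $ 1\<bar>"
        unfolding abs_mult by (intro mult_right_mono d2(2) far(2) that) auto
      ultimately show ?thesis unfolding norm_of_real by (simp add: mult.assoc)
    qed
    show "cmod (of_real (- 2 * c * Y c x $ 3 - (exp (Y c x $ 1) - 1) * dcY Y c x $ 1)) \<le> 2 * \<bar>c\<bar> * C + (exp C + 1) * C" for x
    proof -
      have "\<bar>2 * c * Y c x $ 3\<bar> \<le> 2 * \<bar>c\<bar> * C" unfolding abs_mult by (intro mult_mono M) auto
      moreover have "\<bar>exp (Y c x $ 1) - 1\<bar> \<le> exp C + 1" using e1[of x] exp_gt_zero[of "Y c x $ 1"] exp_gt_zero[of C] by linarith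
      then have "\<bar>(exp (Y c x $ 1) - 1) * dcY Y c x $ 1\<bar> \<le> (exp C + 1) * C" unfolding abs_mult using exp_gt_zero[of C] by (intro mult_mono M) auto
      ultimately show ?thesis unfolding norm_of_real by (simp add: mult.assoc)
    qed
  qed (use al e C0 M C1nn in \<open>auto simp: k_def\<close>)
  then obtain C2 where C2: "\<And>x. \<bar>dcY Y c x $ 1\<bar> \<le> C2 * exp (- a * \<bar>x\<bar>)" "\<And>x. \<bar>dcY Y c x $ 2\<bar> \<le> C2 * exp (- a * \<bar>x\<bar>)"
    "\<And>x. \<bar>dcY Y c x $ 3\<bar> \<le> C2 * exp (- a * \<bar>x\<bar>)" "\<And>x. \<bar>dcY Y c x $ 4\<bar> \<le> C2 * exp (- a * \<bar>x\<bar>)"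
    unfolding norm_of_real by blast
  have up: "t \<le> max C1 C2 * exp (- a * \<bar>x\<bar>)" if "t \<le> C1 * exp (- a * \<bar>x\<bar>) \<or> t \<le> C2 * exp (- a * \<bar>x\<bar>)" for t x
  proof -
    have "C1 * exp (- a * \<bar>x\<bar>) \<le> max C1 C2 * exp (- a * \<bar>x\<bar>)" "C2 * exp (- a * \<bar>x\<bar>) \<le> max C1 C2 * exp (- a * \<bar>x\<bar>)"
      by (intro mult_right_mono; simp)+
    with that show ?thesis by (elim disjE) linarith+
  qed
  show ?thesis
  proof (rule exI[of _ "max C1 C2"], intro allI conjI up)
    fix x and i :: 4
    show "\<bar>Y c x $ i\<bar> \<le> C1 * exp (- a * \<bar>x\<bar>) \<or> \<bar>Y c x $ i\<bar> \<le> C2 * exp (- a * \<bar>x\<bar>)"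
      using exhaust_4[of i] C1 by auto
    show "\<bar>dcY Y c x $ i\<bar> \<le> C1 * exp (- a * \<bar>x\<bar>) \<or> \<bar>dcY Y c x $ i\<bar> \<le> C2 * exp (- a * \<bar>x\<bar>)"
      using exhaust_4[of i] C2 by auto
  qed
qed

section \<open>The formula for d''(c)\<close>

lemma deriv_profile: "c \<in> {cm<..<cp} \<Longrightarrow> deriv (profile (Y c)) = (\<lambda>x. Y c x $ 2)"
  using family_derivative[of c 1] by (auto simp: profile_def[abs_def] wave_field_nth intro!: DERIV_imp_deriv)

text \<open>On a compact interval around c the localization rates are uniform; this provides the
  majorant for differentiating the squared norm of U' under the integral.\<close>

lemma d_second_eq:
  assumes c: "c \<in> {cm<..<cp}"
  shows "d_second Y c = - ((LINT x|lborel. (Y c x $ 2)\<^sup>2) + 2 * c * (LINT x|lborel. Y c x $ 2 * dcY Y c x $ 2))"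
proof -
  define a b where "a = (cm + c) / 2" and "b = (c + cp) / 2"
  have ab: "a < c" "c < b" "{a..b} \<subseteq> {cm<..<cp}" using c by (auto simp: a_def b_def field_simps)
  obtain C \<eta> where \<eta>: "\<eta> > 0" and C: "\<And>c x i. c \<in> {a..b} \<Longrightarrow> \<bar>Y c x $ i\<bar> \<le> C * exp (- \<eta> * \<bar>x\<bar>)"
    "\<And>c x i. c \<in> {a..b} \<Longrightarrow> \<bar>dcY Y c x $ i\<bar> \<le> C * exp (- \<eta> * \<bar>x\<bar>)" using family_decay[OF ab(3)] by meson
  have C0: "C \<ge> 0" using order_trans[OF abs_ge_zero C(1)[of c 0 1]] ab by simp
  have e2: "(C * exp (- \<eta> * \<bar>x\<bar>)) * (C * exp (- \<eta> * \<bar>x\<bar>)) \<le> C\<^sup>2 * exp (- \<eta> * \<bar>x\<bar>)" for x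
  proof -
    have "(C * exp (- \<eta> * \<bar>x\<bar>)) * (C * exp (- \<eta> * \<bar>x\<bar>)) = C\<^sup>2 * (exp (- \<eta> * \<bar>x\<bar>) * exp (- \<eta> * \<bar>x\<bar>))" by (simp add: power2_eq_square)
    also have "\<dots> \<le> C\<^sup>2 * (exp (- \<eta> * \<bar>x\<bar>) * 1)" using \<eta> by (intro mult_left_mono) auto
    finally show ?thesis by simp
  qed
  let ?G = "\<lambda>y x. (Y y x $ 2)\<^sup>2" and ?G' = "\<lambda>y x. 2 * (Y y x $ 2 * dcY Y y x $ 2)"
  have wint: "integrable lborel (\<lambda>x. 2 * (C\<^sup>2 * exp (- \<eta> * \<bar>x\<bar>)))" by (intro integrable_mult_right integrable_exp_abs \<eta>)
  have prod: "\<bar>u * v\<bar> \<le> C\<^sup>2 * exp (- \<eta> * \<bar>x\<bar>)" if "\<bar>u\<bar> \<le> C * exp (- \<eta> * \<bar>x\<bar>)" "\<bar>v\<bar> \<le> C * exp (- \<eta> * \<bar>x\<bar>)" for u v x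
    unfolding abs_mult by (rule order_trans[OF mult_mono[OF that] e2]) (use C0 in auto)
  have D: "((\<lambda>y. LINT x|lborel. ?G y x) has_real_derivative (LINT x|lborel. ?G' c x)) (at c)"
  proof (rule leibniz_lborel[OF ab(1,2) _ _ wint])
    fix y assume y: "y \<in> {a..b}"
    then have yI: "y \<in> {cm<..<cp}" using ab(3) by blast
    show "((\<lambda>y. (Y y x $ 2)\<^sup>2) has_real_derivative ?G' y x) (at y within {a..b})" for x
      by (rule has_field_derivative_at_within) (auto intro!: derivative_eq_intros dcY_component[OF yI])
    show "integrable lborel (\<lambda>x. (Y y x $ 2)\<^sup>2)"
    proof (rule Bochner_Integration.integrable_bound[OF wint])
      have "continuous_on UNIV (\<lambda>x. Y y x $ 2)" using family_derivative[OF yI] by (meson DERIV_isCont continuous_at_imp_continuous_on)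
      then have "continuous_on UNIV (\<lambda>x. (Y y x $ 2)\<^sup>2)" by (rule continuous_on_power)
      then show "(\<lambda>x. (Y y x $ 2)\<^sup>2) \<in> borel_measurable lborel" using borel_measurable_continuous_onI by simp
      show "AE x in lborel. norm ((Y y x $ 2)\<^sup>2) \<le> norm (2 * (C\<^sup>2 * exp (- \<eta> * \<bar>x\<bar>)))"
      proof (intro AE_I2)
        fix x
        have "\<bar>Y y x $ 2 * Y y x $ 2\<bar> \<le> C\<^sup>2 * exp (- \<eta> * \<bar>x\<bar>)" by (rule prod[OF C(1)[OF y] C(1)[OF y]])
        moreover have "0 \<le> C\<^sup>2 * exp (- \<eta> * \<bar>x\<bar>)" by simp
        ultimately have "\<bar>Y y x $ 2 * Y y x $ 2\<bar> \<le> \<bar>2 * (C\<^sup>2 * exp (- \<eta> * \<bar>x\<bar>))\<bar>" by linarith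
        then show "norm ((Y y x $ 2)\<^sup>2) \<le> norm (2 * (C\<^sup>2 * exp (- \<eta> * \<bar>x\<bar>)))" by (simp only: power2_eq_square real_norm_def)
      qed
    qed
    show "\<bar>?G' y x\<bar> \<le> 2 * (C\<^sup>2 * exp (- \<eta> * \<bar>x\<bar>))" for x
      using prod[OF C(1)[OF y, of x 2] C(2)[OF y, of x 2]] by (simp add: abs_mult)
  qed
  have "((\<lambda>y. y * (LINT x|lborel. ?G y x)) has_real_derivative 1 * (LINT x|lborel. ?G c x) + (LINT x|lborel. ?G' c x) * c) (at c)"
    by (rule DERIV_mult'[OF DERIV_ident D, THEN DERIV_cong]) simp
  then have "((\<lambda>y. y * (L2_norm (cfun (deriv (profile (Y y)))))\<^sup>2) has_real_derivative 1 * (LINT x|lborel. ?G c x) + (LINT x|lborel. ?G' c x) * c) (at c)"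
    by (rule has_field_derivative_transform_within_open[where S="{cm<..<cp}"]) (use c in \<open>auto simp: deriv_profile L2_norm_square\<close>)
  then show ?thesis unfolding d_second_def by (subst DERIV_imp_deriv) auto
qed

end

section \<open>The primary pulse\<close>

text \<open>A one-sided big O along m. It is an eventual statement so that asymptotic bounds chain
  freely; \<open>dom_global\<close> recovers all m at the end.\<close>

definition dominated :: "(nat \<Rightarrow> real) \<Rightarrow> (nat \<Rightarrow> real) \<Rightarrow> bool" (infix "\<preceq>" 50) where
  "f \<preceq> g \<longleftrightarrow> (\<exists>K\<ge>0. \<forall>\<^sub>F m in sequentially. f m \<le> K * g m)"

lemma domI: "K \<ge> 0 \<Longrightarrow> \<forall>\<^sub>F m in sequentially. f m \<le> K * g m \<Longrightarrow> f \<preceq> g"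
  by (auto simp: dominated_def)

lemma dom_mono: "\<forall>\<^sub>F m in sequentially. f m \<le> g m \<Longrightarrow> g \<preceq> h \<Longrightarrow> f \<preceq> h"
proof -
  assume fg: "\<forall>\<^sub>F m in sequentially. f m \<le> g m" and "g \<preceq> h"
  then obtain K where K: "K \<ge> 0" "\<forall>\<^sub>F m in sequentially. g m \<le> K * h m" by (auto simp: dominated_def)
  have "\<forall>\<^sub>F m in sequentially. f m \<le> K * h m" using fg K(2) by eventually_elim (rule order_trans)
  then show ?thesis by (rule domI[OF K(1)])
qed

lemma dom_refl: "f \<preceq> f" by (rule domI[of 1]) auto

lemma dom_add: "f \<preceq> h \<Longrightarrow> g \<preceq> h \<Longrightarrow> (\<lambda>m. f m + g m) \<preceq> h"
proof -
  assume "f \<preceq> h" "g \<preceq> h"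
  then obtain K L where "K \<ge> 0" "\<forall>\<^sub>F m in sequentially. f m \<le> K * h m" "L \<ge> 0" "\<forall>\<^sub>F m in sequentially. g m \<le> L * h m"
    by (auto simp: dominated_def)
  moreover have "\<forall>\<^sub>F m in sequentially. f m + g m \<le> (K + L) * h m" using calculation(2,4) by eventually_elim (simp add: distrib_right)
  ultimately show ?thesis by (intro domI[of "K + L"]) auto
qed

lemma dom_zero: "(\<And>m. h m \<ge> 0) \<Longrightarrow> (\<lambda>m. 0) \<preceq> h"
  by (rule domI[of 0]) auto

lemma dom_sum: "(\<And>m. h m \<ge> 0) \<Longrightarrow> (\<And>i. i \<in> I \<Longrightarrow> f i \<preceq> h) \<Longrightarrow> (\<lambda>m. \<Sum>i\<in>I. f i m) \<preceq> h"
  by (induction I rule: infinite_finite_induct) (auto intro: dom_add dom_zero)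

lemma dom_cmult: "C \<ge> 0 \<Longrightarrow> f \<preceq> h \<Longrightarrow> (\<lambda>m. C * f m) \<preceq> h"
proof -
  assume C: "C \<ge> 0" and "f \<preceq> h"
  then obtain K where K: "K \<ge> 0" "\<forall>\<^sub>F m in sequentially. f m \<le> K * h m" by (auto simp: dominated_def)
  have "\<forall>\<^sub>F m in sequentially. C * f m \<le> (C * K) * h m"
    using K(2) by eventually_elim (use C in \<open>simp add: mult.assoc mult_left_mono\<close>)
  then show ?thesis using C K(1) by (intro domI[of "C * K"]) auto
qed

lemma dom_mult:
  assumes "f \<preceq> f'" "g \<preceq> g'" "\<And>m. 0 \<le> g m" "\<And>m. 0 \<le> f' m"
  shows "(\<lambda>m. f m * g m) \<preceq> (\<lambda>m. f' m * g' m)"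
proof -
  obtain K L where K: "K \<ge> 0" "\<forall>\<^sub>F m in sequentially. f m \<le> K * f' m" and L: "L \<ge> 0" "\<forall>\<^sub>F m in sequentially. g m \<le> L * g' m"
    using assms by (auto simp: dominated_def)
  have "\<forall>\<^sub>F m in sequentially. f m * g m \<le> (K * L) * (f' m * g' m)" using K(2) L(2)
  proof eventually_elim
    case (elim m)
    have "f m * g m \<le> (K * f' m) * (L * g' m)" using elim assms K by (intro mult_mono) auto
    then show ?case by (simp add: algebra_simps)
  qed
  then show ?thesis using K L by (intro domI[of "K * L"]) auto
qed

lemma dom_trans: "f \<preceq> g \<Longrightarrow> g \<preceq> h \<Longrightarrow> f \<preceq> h"
proof -
  assume "f \<preceq> g" "g \<preceq> h"
  then obtain K L where K: "K \<ge> 0" "\<forall>\<^sub>F m in sequentially. f m \<le> K * g m" and L: "L \<ge> 0" "\<forall>\<^sub>F m in sequentially. g m \<le> L * h m"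
    by (auto simp: dominated_def)
  have "\<forall>\<^sub>F m in sequentially. f m \<le> (K * L) * h m" using K(2) L(2)
  proof eventually_elim
    case (elim m)
    have "K * g m \<le> K * (L * h m)" using elim K by (intro mult_left_mono) auto
    then show ?case using elim by simp
  qed
  then show ?thesis using K L by (intro domI[of "K * L"]) auto
qed

text \<open>For a positive comparison sequence the finitely many exceptional indices are absorbed by the constant.\<close>
lemma dom_global:
  assumes "f \<preceq> g" "\<And>m. g m > 0" obtains K where "K \<ge> 0" "\<And>m. f m \<le> K * g m"
proof -
  obtain K M where K: "K \<ge> 0" "\<And>m. m \<ge> M \<Longrightarrow> f m \<le> K * g m" using assms(1) by (auto simp: dominated_def eventually_sequentially)
  define L where "L = (\<Sum>m<M. \<bar>f m\<bar> / g m)"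
  have L: "L \<ge> 0" unfolding L_def by (intro sum_nonneg divide_nonneg_pos assms(2)) simp
  have "f m \<le> (K + L) * g m" for m
  proof (cases "m \<ge> M")
    case True
    then show ?thesis using K(2)[OF True] L assms(2)[of m] by (simp add: distrib_right add_increasing2)
  next
    case False
    have "\<bar>f m\<bar> / g m \<le> L" unfolding L_def using False by (intro member_le_sum) (auto intro!: divide_nonneg_pos assms(2))
    then have "\<bar>f m\<bar> \<le> L * g m" using assms(2)[of m] by (simp add: divide_le_eq)
    then show ?thesis using K(1) assms(2)[of m] by (simp add: distrib_right) (smt (verit) mult_nonneg_nonneg)
  qed
  then show ?thesis using that[of "K + L"] K L by auto
qed

section \<open>Exponentially localized functions and pairings of real functions\<close>

lemma exp_lipschitz:
  fixes u v B :: real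
  assumes "\<bar>u\<bar> \<le> B" "\<bar>v\<bar> \<le> B" shows "\<bar>exp u - exp v\<bar> \<le> exp B * \<bar>u - v\<bar>"
proof -
  have "norm (exp u - exp v) \<le> exp B * norm (u - v)" by (rule field_differentiable_bound[of "{-B..B}" exp exp])
      (use assms in \<open>auto intro!: has_field_derivative_at_within DERIV_exp\<close>)
  then show ?thesis by simp
qed

lemma exp_decay_L2:
  fixes f :: "real \<Rightarrow> complex"
  assumes "f \<in> borel_measurable borel" "\<eta> > 0" "\<And>x. cmod (f x) \<le> C * exp (- \<eta> * \<bar>x\<bar>)" shows "f \<in> L2"
proof (rule L2_bound)
  show "integrable lborel (\<lambda>x. C\<^sup>2 * exp (- \<eta> * \<bar>x\<bar>))" by (intro integrable_mult_right integrable_exp_abs assms)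
  show "(cmod (f x))\<^sup>2 \<le> C\<^sup>2 * exp (- \<eta> * \<bar>x\<bar>)" for x
  proof -
    have "(cmod (f x))\<^sup>2 \<le> (C * exp (- \<eta> * \<bar>x\<bar>))\<^sup>2" by (intro power_mono assms) auto
    also have "\<dots> = C\<^sup>2 * (exp (- \<eta> * \<bar>x\<bar>) * exp (- \<eta> * \<bar>x\<bar>))" by (simp add: power2_eq_square)
    also have "\<dots> \<le> C\<^sup>2 * (exp (- \<eta> * \<bar>x\<bar>) * 1)" using assms(2) by (intro mult_left_mono) auto
    finally show ?thesis by simp
  qed
qed (rule assms)

lemma exp_decay_shift_bound:
  fixes g :: "real \<Rightarrow> complex" and B \<eta> p :: real
  assumes g: "g \<in> borel_measurable borel" and \<eta>: "\<eta> > 0" and b: "AE x in lborel. cmod (g x) \<le> B * exp (- \<eta> * \<bar>x - p\<bar>)"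
  shows "cmod (LINT x|lborel. g x) \<le> B * (LINT x|lborel. exp (- \<eta> * \<bar>x\<bar>))"
proof -
  have int: "integrable lborel (\<lambda>x. exp (- \<eta> * \<bar>x - p\<bar>))"
    using lborel_integrable_real_affine[OF integrable_exp_abs[OF \<eta>], of 1 "-p"] by (simp add: add.commute)
  have gi: "integrable lborel g"
    by (rule Bochner_Integration.integrable_bound[OF integrable_mult_right[OF int, of B]]) (use g b in \<open>auto elim!: eventually_mono\<close>)
  have "cmod (LINT x|lborel. g x) \<le> (LINT x|lborel. cmod (g x))" by (rule integral_norm_bound)
  also have "\<dots> \<le> (LINT x|lborel. B * exp (- \<eta> * \<bar>x - p\<bar>))" by (rule integral_mono_AE) (use gi int b in auto)
  also have "\<dots> = B * (LINT x|lborel. exp (- \<eta> * \<bar>x\<bar>))"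
    using lborel_integral_real_affine[of 1 "\<lambda>x. exp (- \<eta> * \<bar>x\<bar>)" "-p"] by (simp add: add.commute)
  finally show ?thesis .
qed

lemma exp_decay_L2_norm:
  fixes f :: "real \<Rightarrow> complex"
  assumes f: "f \<in> borel_measurable borel" and \<eta>: "\<eta> > 0" and b: "\<And>x. cmod (f x) \<le> C * exp (- \<eta> * \<bar>x - p\<bar>)"
  shows "L2_norm f \<le> C * L2_norm (\<lambda>x. of_real (exp (- \<eta> * \<bar>x\<bar>)))" "f \<in> L2"
proof -
  have C: "C \<ge> 0" using order_trans[OF norm_ge_zero b[of p]] by simp
  have eL: "(\<lambda>x. complex_of_real (exp (- \<eta> * \<bar>x\<bar>))) \<in> L2" by (rule exp_decay_L2[OF _ \<eta>, of _ 1]) auto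
  have eS: "(\<lambda>x. complex_of_real (exp (- \<eta> * \<bar>x - p\<bar>))) \<in> L2" using L2_shift(1)[OF eL, of "-p"] by simp
  have "(\<lambda>x. f (x + p)) \<in> L2" by (rule exp_decay_L2[OF _ \<eta>, of _ C]) (use f b[of "_ + p"] in auto)
  from L2_shift(1)[OF this, of "-p"] show fL: "f \<in> L2" by simp
  have "L2_norm f \<le> L2_norm (\<lambda>x. of_real C * of_real (exp (- \<eta> * \<bar>x - p\<bar>)))"
    by (rule L2_norm_mono[OF fL L2_cmul[OF eS]]) (use b C in \<open>simp add: norm_mult\<close>)
  also have "\<dots> = C * L2_norm (\<lambda>x. of_real (exp (- \<eta> * \<bar>x\<bar>)))" using L2_shift(2)[OF eL, of "-p"] C by (simp add: L2_norm_cmul)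
  finally show "L2_norm f \<le> C * L2_norm (\<lambda>x. of_real (exp (- \<eta> * \<bar>x\<bar>)))" .
qed

lemma wd_cnj: "wd f g \<Longrightarrow> wd (\<lambda>x. cnj (f x)) (\<lambda>x. cnj (g x))"
proof -
  assume w: "wd f g"
  have e: "(LINT x|lborel. cnj (h x) * cfun \<psi> x) = cnj (LINT x|lborel. h x * cfun \<psi> x)" for h \<psi> by (simp flip: Bochner_Integration.integral_cnj)
  show ?thesis using w by (auto simp: wd_def is_weak_deriv_def e L2_cnj)
qed

text \<open>The derivative of a real function is real almost everywhere, so the pairing equals its
  conjugate, while integration by parts makes it minus its conjugate.\<close>

lemma real_by_parts_zero:
  assumes "wd (cfun f) g" shows "L2_inner (cfun f) g = 0"
proof -
  have "wd (cfun f) (\<lambda>x. cnj (g x))" using wd_cnj[OF assms] by simp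
  then have "g =\<^sub>2 (\<lambda>x. cnj (g x))" using wd_unique assms by blast
  then have "L2_inner (cfun f) g = L2_inner (cfun f) (\<lambda>x. cnj (g x))" using wd_L2[OF assms] by (intro L2_inner_cong) auto
  also have "\<dots> = cnj (L2_inner (cfun f) g)" unfolding L2_inner_def by (subst Bochner_Integration.integral_cnj[symmetric]) simp
  also have "\<dots> = - L2_inner (cfun f) g" using wd_by_parts[OF assms assms] by (simp add: L2_inner_cnj)
  finally show ?thesis by (simp add: eq_neg_iff_add_eq_0 mult_2[symmetric])
qed

definition sh :: "(real \<Rightarrow> real) \<Rightarrow> real \<Rightarrow> real \<Rightarrow> complex" where "sh f p = (\<lambda>x. of_real (f (x - p)))"

text \<open>\<open>U1\<close> to \<open>U3\<close> are the derivatives of the pulse,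
  \<open>D\<close> is its derivative in c. The rate 7/8 \<open>al\<close> lies below
  \<open>al\<close>, where \<open>sharp_decay\<close> reaches, and above the 3/4 \<open>al\<close>
  spent on overlaps; the difference 1/8 \<open>al\<close> keeps the overlap integrals
  finite.\<close>

locale pulse =
  fixes c al C0 :: real and U U1 U2 U3 D D1 D2 D3 :: "real \<Rightarrow> real"
  assumes c: "c > 0" "c\<^sup>2 < 2" and al: "al > 0"
    and dU: "\<And>x. (U has_real_derivative U1 x) (at x)" "\<And>x. (U1 has_real_derivative U2 x) (at x)"
      "\<And>x. (U2 has_real_derivative U3 x) (at x)" "\<And>x. (U3 has_real_derivative (- c\<^sup>2 * U2 x - exp (U x) + 1)) (at x)"
    and dD: "\<And>x. (D has_real_derivative D1 x) (at x)" "\<And>x. (D1 has_real_derivative D2 x) (at x)"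
      "\<And>x. (D2 has_real_derivative D3 x) (at x)" "\<And>x. (D3 has_real_derivative (- 2 * c * U2 x - c\<^sup>2 * D2 x - exp (U x) * D x)) (at x)"
    and decay: "\<And>f x. f \<in> {U, U1, U2, U3, D, D1, D2, D3} \<Longrightarrow> \<bar>f x\<bar> \<le> C0 * exp (- (7/8 * al) * \<bar>x\<bar>)"
    and simple: "simple_eigenvalue (sobolev 4) (lin_op c U) 0"
    and nontrivial: "\<exists>x. U x \<noteq> 0"
begin

abbreviation "E y \<equiv> exp (- (7/8 * al) * \<bar>y\<bar>)"
abbreviation "F y \<equiv> exp (- (1/8 * al) * \<bar>y\<bar>)"

text \<open>\<open>U4\<close>, \<open>U5\<close> and \<open>D4\<close> are the next derivatives of
  \<open>U\<close> and \<open>D\<close>, expressed through the differential equations.\<close>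

definition U4 where "U4 x = - c\<^sup>2 * U2 x - exp (U x) + 1"
definition U5 where "U5 x = - c\<^sup>2 * U3 x - exp (U x) * U1 x"
definition D4 where "D4 x = - 2 * c * U2 x - c\<^sup>2 * D2 x - exp (U x) * D x"
definition C1 where "C1 = C0 * (1 + 2 * c + c\<^sup>2 + exp C0)"

lemma C0: "C0 \<ge> 0" using decay[of U 0] by simp

lemma U_bound: "\<bar>U x\<bar> \<le> C0"
  using decay[of U x] al C0 mult_left_mono[of "E x" 1 C0] by simp

lemma C1: "C0 \<le> C1" "C1 \<ge> 0"
proof -
  show "C0 \<le> C1" unfolding C1_def using C0 c by (simp add: mult_le_cancel_left1)
  then show "C1 \<ge> 0" using C0 by linarith
qed

lemma expU: "exp (U x) \<le> exp C0" using U_bound[of x] by simp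

definition fns :: "(real \<Rightarrow> real) set" where "fns = {U, U1, U2, U3, U4, U5, D, D1, D2, D3, D4}"

lemma fns_bound: assumes "f \<in> fns" shows "\<bar>f x\<bar> \<le> C1 * E x"
proof -
  have base: "\<bar>g x\<bar> \<le> C0 * E x" if "g \<in> {U, U1, U2, U3, D, D1, D2, D3}" for g using decay[OF that] .
  have E: "0 \<le> E x" by simp
  have pos: "0 \<le> C0 * E x" using C0 by simp
  have e1: "\<bar>exp (U x) - 1\<bar> \<le> exp C0 * (C0 * E x)"
  proof -
    have "\<bar>exp (U x) - exp 0\<bar> \<le> exp C0 * \<bar>U x - 0\<bar>" by (rule exp_lipschitz) (use U_bound C0 in auto)
    also have "\<dots> \<le> exp C0 * (C0 * E x)" using base[of U] by (intro mult_left_mono) auto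
    finally show ?thesis by simp
  qed
  have m: "\<bar>exp (U x) * g x\<bar> \<le> exp C0 * (C0 * E x)" if "g \<in> {U, U1, U2, U3, D, D1, D2, D3}" for g
    unfolding abs_mult using expU[of x] base[OF that] by (intro mult_mono) auto
  have q: "\<bar>c\<^sup>2 * g x\<bar> \<le> c\<^sup>2 * (C0 * E x)" "\<bar>2 * c * g x\<bar> \<le> 2 * c * (C0 * E x)" if "g \<in> {U, U1, U2, U3, D, D1, D2, D3}" for g
    unfolding abs_mult using base[OF that] c by (auto intro!: mult_left_mono)
  have C1E: "C1 * E x = C0 * E x + 2 * c * (C0 * E x) + c\<^sup>2 * (C0 * E x) + exp C0 * (C0 * E x)" by (simp add: C1_def algebra_simps)
  have nn: "0 \<le> 2 * c * (C0 * E x)" "0 \<le> c\<^sup>2 * (C0 * E x)" "0 \<le> exp C0 * (C0 * E x)" using pos c by (auto intro!: mult_nonneg_nonneg)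
  have q': "\<bar>c\<^sup>2 * U2 x\<bar> \<le> c\<^sup>2 * (C0 * E x)" "\<bar>c\<^sup>2 * U3 x\<bar> \<le> c\<^sup>2 * (C0 * E x)" "\<bar>c\<^sup>2 * D2 x\<bar> \<le> c\<^sup>2 * (C0 * E x)"
    "\<bar>2 * c * U2 x\<bar> \<le> 2 * c * (C0 * E x)" "\<bar>exp (U x) * U1 x\<bar> \<le> exp C0 * (C0 * E x)" "\<bar>exp (U x) * D x\<bar> \<le> exp C0 * (C0 * E x)"
    by (rule q m; simp)+
  have neg: "- c\<^sup>2 * y = - (c\<^sup>2 * y)" "- 2 * c * y = - (2 * c * y)" for y by simp_all
  have U4: "\<bar>U4 x\<bar> \<le> C1 * E x" unfolding C1E U4_def neg using q'(1) e1 nn pos by linarith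
  have U5: "\<bar>U5 x\<bar> \<le> C1 * E x" unfolding C1E U5_def neg using q'(2,5) nn pos by linarith
  have D4: "\<bar>D4 x\<bar> \<le> C1 * E x" unfolding C1E D4_def neg using q'(3,4,6) nn pos by linarith
  have "C0 * E x \<le> C1 * E x" using C1 by (intro mult_right_mono) auto
  then have up: "\<bar>g x\<bar> \<le> C1 * E x" if "g \<in> {U, U1, U2, U3, D, D1, D2, D3}" for g using base[OF that] by linarith
  consider "f \<in> {U, U1, U2, U3, D, D1, D2, D3}" | "f = U4" | "f = U5" | "f = D4" using assms unfolding fns_def by blast
  then show ?thesis using up U4 U5 D4 by cases auto
qed

lemma dU4: "(U4 has_real_derivative U5 x) (at x)"
  unfolding U4_def[abs_def] U5_def by (auto intro!: derivative_eq_intros dU)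

lemma fns_continuous: assumes "f \<in> fns" shows "continuous_on A f"
proof -
  have cd: "continuous_on A g" if "\<And>x. (g has_real_derivative g' x) (at x)" for g g' using that by (meson DERIV_isCont continuous_at_imp_continuous_on)
  note base = cd[OF dU(1)] cd[OF dU(2)] cd[OF dU(3)] cd[OF dU(4)] cd[OF dU4] cd[OF dD(1)] cd[OF dD(2)] cd[OF dD(3)] cd[OF dD(4)]
  have "continuous_on A U5" "continuous_on A D4" unfolding U5_def[abs_def] D4_def[abs_def] by (intro continuous_intros base)+
  then show ?thesis using assms base unfolding fns_def by auto
qed

lemma sh_continuous: "f \<in> fns \<Longrightarrow> continuous_on A (sh f p)"
  unfolding sh_def by (intro continuous_intros continuous_on_compose2[OF fns_continuous[of f UNIV]]) auto

lemma sh_measurable: "f \<in> fns \<Longrightarrow> sh f p \<in> borel_measurable borel"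
  by (intro borel_measurable_continuous_onI sh_continuous)

lemma sh_bound: "f \<in> fns \<Longrightarrow> cmod (sh f p x) \<le> C1 * E (x - p)"
  unfolding sh_def using fns_bound by simp

lemma E_pos: "7/8 * al > 0" "1/8 * al > 0" using al by auto

definition IE where "IE = (LINT x|lborel. E x)"
definition IF where "IF = (LINT x|lborel. F x)"
definition NE where "NE = L2_norm (\<lambda>x. complex_of_real (E x))"
definition NF where "NF = L2_norm (\<lambda>x. complex_of_real (F x))"

lemma consts_nonneg: "IE \<ge> 0" "IF \<ge> 0" "NE \<ge> 0" "NF \<ge> 0"
  by (auto simp: IE_def IF_def NE_def NF_def)

lemma sh_L2: assumes "f \<in> fns" shows "sh f p \<in> L2" "L2_norm (sh f p) \<le> C1 * NE"
  using exp_decay_L2_norm[OF sh_measurable[OF assms] E_pos(1), of p C1 p] sh_bound[OF assms] by (auto simp: NE_def)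

lemma sh_wd:
  assumes "f \<in> fns" "g \<in> fns" "\<And>x. (f has_real_derivative g x) (at x)" shows "wd (sh f p) (sh g p)"
proof (rule classical_wd)
  fix x
  have "((\<lambda>x. f (x - p)) has_real_derivative g (x - p) * 1) (at x)" by (rule DERIV_chain2[where f=f, OF assms(3)]) (auto intro!: derivative_eq_intros)
  then show "(sh f p has_vector_derivative sh g p x) (at x)"
    unfolding sh_def by (intro has_vector_derivative_of_real) (simp add: has_real_derivative_iff_has_vector_derivative)
qed (auto intro: sh_continuous sh_L2 assms)

lemma H4_U: "H4 (sh U1 p) (sh U2 p) (sh U3 p) (sh U4 p) (sh U5 p)"
  unfolding H4_def by (intro conjI sh_wd dU(2,3) dU4 dU(4)[folded U4_def]) (auto simp: fns_def)

lemma H4_D: "H4 (sh D p) (sh D1 p) (sh D2 p) (sh D3 p) (sh D4 p)"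
  unfolding H4_def by (intro conjI sh_wd dD(1-3) dD(4)[folded D4_def]) (auto simp: fns_def)

lemma U_sobolev: "sh U1 p \<in> sobolev 4" by (rule H4_sobolev[OF H4_U])
lemma D_sobolev: "sh D p \<in> sobolev 4" by (rule H4_sobolev[OF H4_D])

text \<open>The translate of U' is a null vector for the translated potential, so only the
  difference of the two potentials remains.\<close>

lemma A_U: "lin_op c W (sh U1 p) =\<^sub>2 (\<lambda>x. of_real (exp (W x) - exp (U (x - p))) * sh U1 p x)"
  using H4_lin_op[OF H4_U, of c W p] by (simp add: sh_def U5_def algebra_simps)

lemma A_D: "lin_op c W (sh D p) =\<^sub>2 (\<lambda>x. - 2 * of_real c * sh U2 p x + of_real (exp (W x) - exp (U (x - p))) * sh D p x)"
  using H4_lin_op[OF H4_D, of c W p] by (simp add: sh_def D4_def algebra_simps)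

text \<open>If U' vanished almost everywhere, U would be constant, and decay leaves 0 as the only
  constant.\<close>

lemma U1_nonzero: "\<not> sh U1 p =\<^sub>2 (\<lambda>x. 0)"
proof
  assume z: "sh U1 p =\<^sub>2 (\<lambda>x. 0)"
  have "antideriv (cfun (\<lambda>x. U (x - p))) (sh U1 p)"
  proof (rule has_vector_derivative_antideriv)
    fix x
    have "((\<lambda>x. U (x - p)) has_real_derivative U1 (x - p) * 1) (at x)" by (rule DERIV_chain2[where f=U, OF dU(1)]) (auto intro!: derivative_eq_intros)
    then show "(cfun (\<lambda>x. U (x - p)) has_vector_derivative sh U1 p x) (at x)"
      unfolding sh_def by (intro has_vector_derivative_of_real) (simp add: has_real_derivative_iff_has_vector_derivative)
  qed (rule sh_continuous, simp add: fns_def)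
  from antideriv_cong[OF this z L2_zero] have 0: "antideriv (cfun (\<lambda>x. U (x - p))) (\<lambda>x. 0)" using sh_L2(1)[of U1 p] by (simp add: fns_def)
  have "U (x - p) = U (y - p)" if "x \<le> y" for x y using antideriv_eq[OF 0 that] by (simp add: set_lebesgue_integral_def)
  then have const: "U (x - p) = U (y - p)" for x y by (metis linear)
  obtain x0 where x0: "U x0 \<noteq> 0" using nontrivial by blast
  obtain R where R: "\<And>x. \<bar>x\<bar> \<ge> R \<Longrightarrow> C0 * E x \<le> \<bar>U x0\<bar> / 2"
    using exp_decay_small[OF E_pos(1), of "\<bar>U x0\<bar> / 2" C0] x0 by auto
  have "\<bar>U \<bar>R\<bar>\<bar> \<le> \<bar>U x0\<bar> / 2" using decay[of U "\<bar>R\<bar>"] R[of "\<bar>R\<bar>"] abs_ge_self[of R] by simp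
  then show False using const[of "\<bar>R\<bar> + p" "x0 + p"] x0 by simp
qed

definition N where "N = (LINT x|lborel. (U1 x)\<^sup>2)"
text \<open>Half of the c-derivative of the squared norm of U', so that d''(c) = - (N + 2 c
  kap).\<close>

definition kap where "kap = (LINT x|lborel. U1 x * D1 x)"

lemma sh_inner:
  "L2_inner (sh f p) (sh g p) = of_real (LINT x|lborel. f x * g x)"
proof -
  have "L2_inner (sh f p) (sh g p) = (LINT x|lborel. of_real (f (x - p) * g (x - p)))" by (simp add: L2_inner_def sh_def)
  also have "\<dots> = of_real (LINT x|lborel. f (x - p) * g (x - p))" by (rule integral_complex_of_real)
  also have "(LINT x|lborel. f (x - p) * g (x - p)) = (LINT x|lborel. f x * g x)" using lborel_integral_real_affine[of 1 "\<lambda>x. f x * g x" "-p"] by simp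
  finally show ?thesis .
qed

lemma U1_inner: "L2_inner (sh U1 p) (sh U1 p) = of_real N"
  by (simp add: sh_inner N_def power2_eq_square)

lemma U1_norm: "L2_norm (sh U1 p) = sqrt N"
proof -
  have "complex_of_real ((L2_norm (sh U1 p))\<^sup>2) = of_real N" using U1_inner[of p] L2_inner_self[of "sh U1 p"] by simp
  then have "(L2_norm (sh U1 p))\<^sup>2 = N" by (simp only: of_real_eq_iff)
  then show ?thesis by (metis L2_norm_nonneg real_sqrt_unique)
qed

lemma N_pos: "N > 0"
proof -
  have "L2_norm (sh U1 0) \<noteq> 0" using U1_nonzero[of 0] L2_norm_eq_0_iff[OF sh_L2(1)[of U1 0]] by (simp add: fns_def)
  then have "sqrt N \<noteq> 0" by (simp add: U1_norm)
  moreover have "N \<ge> 0" by (simp add: N_def)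
  ultimately show ?thesis by simp
qed

lemma U1_U2_inner: "L2_inner (sh U1 p) (sh U2 p) = 0"
proof -
  have "wd (cfun (\<lambda>x. U1 (x - p))) (sh U2 p)" using H4_U[of p] by (simp add: H4_def sh_def)
  from real_by_parts_zero[OF this] show ?thesis by (simp add: sh_def)
qed

lemma U2_D_inner: "L2_inner (sh U2 p) (sh D p) = - of_real kap"
proof -
  have "L2_inner (sh U2 p) (sh D p) = - L2_inner (sh U1 p) (sh D1 p)"
    using wd_by_parts[of "sh U1 p" "sh U2 p" "sh D p" "sh D1 p"] H4_U[of p] H4_D[of p] by (simp add: H4_def)
  then show ?thesis by (simp add: sh_inner kap_def)
qed

text \<open>A share of 3/4 \<open>al\<close> of each rate is spent on the distance 2 X, which yields
  the exponent 3/2. Of the remaining shares of 1/8 only the one at u is kept, as an integrable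
  factor.\<close>

lemma overlap:
  assumes "\<bar>u - v\<bar> \<ge> 2 * X"
  shows "E (y - u) * E (y - v) \<le> exp (- (3 * al / 2) * X) * F (y - u)"
proof -
  have "\<bar>y - u\<bar> + \<bar>y - v\<bar> \<ge> 2 * X" using assms by linarith
  then have "- (3/4 * al) * (\<bar>y - u\<bar> + \<bar>y - v\<bar>) \<le> - (3/4 * al) * (2 * X)" using al by (simp add: mult_left_mono)
  moreover have "- (1/8 * al) * \<bar>y - v\<bar> \<le> 0" using al by simp
  ultimately have "- (7/8 * al) * \<bar>y - u\<bar> + - (7/8 * al) * \<bar>y - v\<bar> \<le> - (3 * al / 2) * X + - (1/8 * al) * \<bar>y - u\<bar>"
    by (simp add: algebra_simps)
  then show ?thesis by (simp only: exp_add[symmetric] exp_le_cancel_iff)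
qed

lemma E_le_F: "E y \<le> F y" using al by (auto simp: mult_right_mono)

lemma U_kernel:
  assumes "g \<in> sobolev 4" "lin_op c U g =\<^sub>2 (\<lambda>x. 0)" "L2_inner g (sh U1 0) = 0"
  shows "g =\<^sub>2 (\<lambda>x. 0)"
proof -
  have "sh U1 0 \<in> eigenspace (sobolev 4) (lin_op c U) 0" using A_U[of U 0] U_sobolev[of 0] by (simp add: eigenspace_def)
  moreover have "g \<in> eigenspace (sobolev 4) (lin_op c U) 0" using assms by (simp add: eigenspace_def)
  ultimately obtain b where b: "g =\<^sub>2 (\<lambda>x. b * sh U1 0 x)" using simple_eigenvalue_multiple[OF simple] U1_nonzero by blast
  have L: "sh U1 0 \<in> L2" by (rule sh_L2) (simp add: fns_def)
  have "L2_inner g (sh U1 0) = L2_inner (\<lambda>x. b * sh U1 0 x) (sh U1 0)" by (intro L2_inner_cong b L2_eq_refl sobolev_L2[OF assms(1)] L L2_cmul)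
  then have "b * of_real N = 0" using assms(3) by (simp add: L2_inner_cmul_left U1_inner)
  then have "b = 0" using N_pos by simp
  then show ?thesis using b by simp
qed

end

section \<open>Multi-pulses\<close>

lemma L2_inner_AE_bound:
  assumes "AE x in lborel. cmod (f x * cnj (g x)) \<le> B * exp (- \<eta> * \<bar>x - p\<bar>)" "\<eta> > 0" "f \<in> L2" "g \<in> L2"
  shows "cmod (L2_inner f g) \<le> B * (LINT x|lborel. exp (- \<eta> * \<bar>x\<bar>))"
  unfolding L2_inner_def by (rule exp_decay_shift_bound[OF _ assms(2,1)]) (use borel_measurable_integrable[OF L2_inner_integrable[OF assms(3,4)]] in simp)

text \<open>Merges a constant valid for large m with the individual constants of the finitely many
  other m.\<close>

lemma eventually_ex_uniform:
  fixes P :: "nat \<Rightarrow> real \<Rightarrow> bool"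
  assumes mono: "\<And>m K K'. P m K \<Longrightarrow> K \<le> K' \<Longrightarrow> P m K'" and each: "\<And>m. m \<ge> m0 \<Longrightarrow> \<exists>K. P m K"
    and ev: "\<forall>\<^sub>F m in sequentially. P m K0"
  shows "\<exists>K>0. \<forall>m\<ge>m0. P m K"
proof -
  obtain M where M: "\<And>m. m \<ge> M \<Longrightarrow> P m K0" using ev by (auto simp: eventually_sequentially)
  obtain k where k: "\<And>m. m \<ge> m0 \<Longrightarrow> P m (k m)" using each by metis
  define K where "K = \<bar>K0\<bar> + (\<Sum>m\<in>{m0..<M}. \<bar>k m\<bar>) + 1"
  have s: "(\<Sum>m\<in>{m0..<M}. \<bar>k m\<bar>) \<ge> 0" by (intro sum_nonneg) auto
  have "P m K" if "m \<ge> m0" for m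
  proof (cases "m \<ge> M")
    case True
    have "K0 \<le> K" unfolding K_def using s by linarith
    then show ?thesis by (rule mono[OF M[OF True]])
  next
    case False
    have "\<bar>k m\<bar> \<le> (\<Sum>m\<in>{m0..<M}. \<bar>k m\<bar>)" using False that by (intro member_le_sum) auto
    then have "k m \<le> K" unfolding K_def by linarith
    then show ?thesis by (rule mono[OF k[OF that]])
  qed
  moreover have "K > 0" unfolding K_def using s by linarith
  ultimately show ?thesis by blast
qed

text \<open>\<open>X m\<close> stands for the smallest half-distance of peaks of \<open>V m\<close>,
  \<open>V1 m\<close> for its derivative, and the one constant \<open>Cr\<close> for all error
  bounds. The eigenfunctions of index below n have remainders of order exp (- 2 al X);
  \<open>s m n\<close> is a multiple of \<open>V1 m\<close>, which is known to order exp (- al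
  X).\<close>

locale multipulse = pulse +
  fixes n m0 :: nat and p :: "nat \<Rightarrow> nat \<Rightarrow> real" and X :: "nat \<Rightarrow> real" and V V1 :: "nat \<Rightarrow> real \<Rightarrow> real"
    and \<nu> :: "nat \<Rightarrow> nat \<Rightarrow> real" and s :: "nat \<Rightarrow> nat \<Rightarrow> real \<Rightarrow> complex" and Cr :: real
  assumes n: "n \<ge> 2"
    and X: "\<And>m. m \<ge> m0 \<Longrightarrow> X m > 0" "filterlim X at_top sequentially"
    and p: "\<And>m j k. m \<ge> m0 \<Longrightarrow> j \<in> {1..n} \<Longrightarrow> k \<in> {1..n} \<Longrightarrow> j \<noteq> k \<Longrightarrow> \<bar>p m j - p m k\<bar> \<ge> 2 * X m"
    and V_cont: "\<And>m. m \<ge> m0 \<Longrightarrow> continuous_on UNIV (V m)"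
    and V_lim: "\<And>m. m \<ge> m0 \<Longrightarrow> (V m \<longlongrightarrow> 0) at_top" "\<And>m. m \<ge> m0 \<Longrightarrow> (V m \<longlongrightarrow> 0) at_bot"
    and V_r: "\<And>m y. m \<ge> m0 \<Longrightarrow> \<bar>V m y - (\<Sum>k=1..n. U (y - p m k))\<bar> \<le> Cr * exp (- al * X m)"
    and V1_r: "\<And>m y. m \<ge> m0 \<Longrightarrow> \<bar>V1 m y - (\<Sum>k=1..n. U1 (y - p m k))\<bar> \<le> Cr * exp (- al * X m)"
    and V1: "\<And>m. m \<ge> m0 \<Longrightarrow> cfun (V1 m) \<in> sobolev 4"
    and s_S: "\<And>m i. m \<ge> m0 \<Longrightarrow> i \<in> {1..n} \<Longrightarrow> s m i \<in> sobolev 4"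
    and s_A: "\<And>m i. m \<ge> m0 \<Longrightarrow> i \<in> {1..n} \<Longrightarrow> lin_op c (V m) (s m i) =\<^sub>2 (\<lambda>x. of_real (\<nu> m i) * s m i x)"
    and s_orth: "\<And>m i j. m \<ge> m0 \<Longrightarrow> i \<in> {1..n} \<Longrightarrow> j \<in> {1..n} \<Longrightarrow> L2_inner (s m i) (s m j) = (if i = j then of_real N else 0)"
    and nu: "\<And>m i. m \<ge> m0 \<Longrightarrow> i \<in> {1..n-1} \<Longrightarrow> \<bar>\<nu> m i\<bar> \<le> Cr * exp (- 2 * al * X m)" "\<And>m. m \<ge> m0 \<Longrightarrow> \<nu> m n = 0"
    and s_dec: "\<And>m i. m \<ge> m0 \<Longrightarrow> i \<in> {1..n-1} \<Longrightarrow>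
      \<exists>e. \<forall>y. cmod (s m i y - (\<Sum>k=1..n. e k * sh U1 (p m k) y)) \<le> Cr * exp (- 2 * al * X m)"
    and s_n: "\<And>m. m \<ge> m0 \<Longrightarrow> \<exists>b. s m n =\<^sub>2 (\<lambda>y. b * cfun (V1 m) y)"
    and ker: "\<And>m g. m \<ge> m0 \<Longrightarrow> g \<in> sobolev 4 \<Longrightarrow> lin_op c (V m) g =\<^sub>2 (\<lambda>x. 0) \<Longrightarrow> L2_inner g (s m n) = 0 \<Longrightarrow> g =\<^sub>2 (\<lambda>x. 0)"
    and res: "\<And>m e. m \<ge> m0 \<Longrightarrow> e > 0 \<Longrightarrow> \<exists>l. 0 < cmod l \<and> cmod l < e \<and> l \<notin> spectrum_on (sobolev 4) (lin_op c (V m))"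
begin

abbreviation "A m \<equiv> lin_op c (V m)"
abbreviation "ph m k \<equiv> sh U1 (p m k)"
abbreviation "ps m k \<equiv> sh U2 (p m k)"
abbreviation "Dm m k \<equiv> sh D (p m k)"

text \<open>\<open>\<sigma>\<close> is the accuracy of the n-pulse and \<open>\<tau>\<close>,
  defined next, the target accuracy. From m0 on the square of \<open>\<sigma>\<close> is below
  \<open>\<tau>\<close> and \<open>\<tau>\<close> is below \<open>\<sigma>\<close>: two small
  factors of order \<open>\<sigma>\<close> reach the target.\<close>

definition \<sigma> where "\<sigma> m = exp (- al * X m)"
definition \<tau> where "\<tau> m = exp (- (3 * al / 2) * X m)"
definition Bv where "Bv = real n * C0 + Cr"
definition BP where "BP = exp Bv * Bv"
text \<open>The error made by replacing the potential of the n-pulse by that of its k-th pulse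
  alone.\<close>

definition q where "q m k y = exp (V m y) - exp (U (y - p m k))"
definition Cq where "Cq = exp Bv * (Cr + C0 * real n)"

lemma in_fns [simp, intro]: "U \<in> fns" "U1 \<in> fns" "U2 \<in> fns" "D \<in> fns" by (auto simp: fns_def)

lemma scales:
  assumes "m \<ge> m0"
  shows "0 < \<sigma> m" "\<sigma> m \<le> 1" "0 < \<tau> m" "\<tau> m \<le> \<sigma> m" "\<sigma> m * \<sigma> m \<le> \<tau> m" "exp (- 2 * al * X m) = \<sigma> m * \<sigma> m"
  using X(1)[OF assms] al mult_pos_pos[OF al X(1)[OF assms]] by (auto simp: \<sigma>_def \<tau>_def exp_add[symmetric])

lemma ev_m0: "\<forall>\<^sub>F m in sequentially. m \<ge> m0" by (rule eventually_ge_at_top)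

lemma scale_pos: "0 \<le> \<sigma> m" "0 \<le> \<tau> m" "0 < \<tau> m" "0 < \<sigma> m" by (auto simp: \<sigma>_def \<tau>_def)

lemma \<sigma>_lim: "\<sigma> \<longlonglongrightarrow> 0"
  unfolding \<sigma>_def by (rule filterlim_compose[OF exp_neg_at_top[OF al] X(2)])

lemma \<tau>_dom: "\<tau> \<preceq> \<sigma>" "(\<lambda>m. \<sigma> m * \<sigma> m) \<preceq> \<tau>"
  by (rule domI[of 1]; use scales in \<open>auto intro: eventually_mono[OF ev_m0]\<close>)+

lemma dom_\<sigma>_small: "f \<preceq> \<sigma> \<Longrightarrow> e > 0 \<Longrightarrow> \<forall>\<^sub>F m in sequentially. f m \<le> e"
proof -
  assume "f \<preceq> \<sigma>" and e: "e > 0"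
  then obtain K where K: "K \<ge> 0" "\<forall>\<^sub>F m in sequentially. f m \<le> K * \<sigma> m" by (auto simp: dominated_def)
  have "(\<lambda>m. K * \<sigma> m) \<longlonglongrightarrow> K * 0" by (intro tendsto_intros \<sigma>_lim)
  then have "\<forall>\<^sub>F m in sequentially. K * \<sigma> m < e" using e by (intro order_tendstoD(2)) auto
  with K(2) show ?thesis by eventually_elim linarith
qed

lemma Cr: "Cr \<ge> 0"
proof -
  have "0 \<le> Cr * exp (- al * X m0)" using order_trans[OF abs_ge_zero V_r[of m0 0]] by simp
  then show ?thesis by (simp add: zero_le_mult_iff)
qed

lemma Bv: "Bv \<ge> 0" "C0 \<le> Bv"
proof -
  have "C0 * 1 \<le> C0 * real n" using n C0 by (intro mult_left_mono) auto
  then show "C0 \<le> Bv" "Bv \<ge> 0" using Cr C0 by (auto simp: Bv_def mult.commute)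
qed

lemma V_decomp:
  assumes m: "m \<ge> m0" and k: "k \<in> {1..n}"
  shows "\<bar>V m y - U (y - p m k)\<bar> \<le> Cr * \<sigma> m + C0 * (\<Sum>l\<in>{1..n}-{k}. E (y - p m l))"
proof -
  have "(\<Sum>l=1..n. U (y - p m l)) = U (y - p m k) + (\<Sum>l\<in>{1..n}-{k}. U (y - p m l))" using k by (simp add: sum.remove)
  then have "\<bar>V m y - U (y - p m k)\<bar> \<le> Cr * \<sigma> m + \<bar>\<Sum>l\<in>{1..n}-{k}. U (y - p m l)\<bar>"
    using V_r[OF m, of y] unfolding \<sigma>_def by linarith
  also have "\<bar>\<Sum>l\<in>{1..n}-{k}. U (y - p m l)\<bar> \<le> (\<Sum>l\<in>{1..n}-{k}. C0 * E (y - p m l))"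
    by (intro order_trans[OF sum_abs] sum_mono decay) simp
  finally show ?thesis by (simp add: sum_distrib_left)
qed

lemma V_far:
  assumes m: "m \<ge> m0" shows "\<bar>V m y\<bar> \<le> Cr * \<sigma> m + C0 * (\<Sum>l=1..n. E (y - p m l))"
proof -
  have "\<bar>\<Sum>l=1..n. U (y - p m l)\<bar> \<le> (\<Sum>l=1..n. C0 * E (y - p m l))" by (intro order_trans[OF sum_abs] sum_mono decay) simp
  then show ?thesis using V_r[OF m, of y] unfolding \<sigma>_def by (simp add: sum_distrib_left)
qed

lemma V_bound: assumes m: "m \<ge> m0" shows "\<bar>V m y\<bar> \<le> Bv"
proof -
  have "(\<Sum>l=1..n. E (y - p m l)) \<le> (\<Sum>l=1..n. 1)" using al by (intro sum_mono) simp
  then have "C0 * (\<Sum>l=1..n. E (y - p m l)) \<le> C0 * real n" using C0 by (intro mult_left_mono) auto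
  moreover have "Cr * \<sigma> m \<le> Cr * 1" using Cr scales[OF m] by (intro mult_left_mono) auto
  ultimately show ?thesis using V_far[OF m, of y] by (simp add: Bv_def mult.commute)
qed

lemma pot_bound: assumes m: "m \<ge> m0" shows "\<bar>exp (V m y) - 1\<bar> \<le> exp Bv * \<bar>V m y\<bar>" "\<bar>exp (V m y) - 1\<bar> \<le> BP"
proof -
  show 1: "\<bar>exp (V m y) - 1\<bar> \<le> exp Bv * \<bar>V m y\<bar>" using exp_lipschitz[of "V m y" Bv 0] V_bound[OF m] Bv by simp
  have "exp Bv * \<bar>V m y\<bar> \<le> BP" unfolding BP_def using V_bound[OF m] by (intro mult_left_mono) auto
  then show "\<bar>exp (V m y) - 1\<bar> \<le> BP" using 1 by linarith
qed

lemma V_bp: "m \<ge> m0 \<Longrightarrow> bounded_potential (V m)"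
  unfolding bounded_potential_def using V_cont potential_exp_bound[OF pot_bound(2)] by (auto intro: borel_measurable_continuous_onI)

lemma q_bound:
  assumes m: "m \<ge> m0" and k: "k \<in> {1..n}"
  shows "\<bar>q m k y\<bar> \<le> exp Bv * (Cr * \<sigma> m + C0 * (\<Sum>l\<in>{1..n}-{k}. E (y - p m l)))" "\<bar>q m k y\<bar> \<le> 2 * exp Bv"
proof -
  have U: "\<bar>U (y - p m k)\<bar> \<le> Bv" using U_bound Bv order_trans by blast
  have "\<bar>q m k y\<bar> \<le> exp Bv * \<bar>V m y - U (y - p m k)\<bar>" unfolding q_def by (rule exp_lipschitz[OF V_bound[OF m] U])
  also have "\<dots> \<le> exp Bv * (Cr * \<sigma> m + C0 * (\<Sum>l\<in>{1..n}-{k}. E (y - p m l)))" by (intro mult_left_mono V_decomp m k) auto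
  finally show "\<bar>q m k y\<bar> \<le> exp Bv * (Cr * \<sigma> m + C0 * (\<Sum>l\<in>{1..n}-{k}. E (y - p m l)))" .
  have "exp (V m y) \<le> exp Bv" "exp (U (y - p m k)) \<le> exp Bv" using V_bound[OF m, of y] U by auto
  moreover have "exp (V m y) > 0" "exp (U (y - p m k)) > 0" by auto
  ultimately show "\<bar>q m k y\<bar> \<le> 2 * exp Bv" unfolding q_def by linarith
qed

text \<open>The potential error consists of the error of the n-pulse and of the tails of the other
  pulses. The tails are of order one near the other peaks and become small only against the weight
  at peak k.\<close>

lemma qE_bound:
  assumes m: "m \<ge> m0" and k: "k \<in> {1..n}"
  shows "\<bar>q m k y\<bar> * E (y - p m k) \<le> Cq * \<sigma> m * F (y - p m k)"
proof -
  let ?F = "F (y - p m k)"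
  have "\<bar>q m k y\<bar> * E (y - p m k) \<le> exp Bv * (Cr * \<sigma> m + C0 * (\<Sum>l\<in>{1..n}-{k}. E (y - p m l))) * E (y - p m k)"
    by (intro mult_right_mono q_bound m k) auto
  also have "\<dots> = exp Bv * (Cr * \<sigma> m * E (y - p m k) + C0 * (\<Sum>l\<in>{1..n}-{k}. E (y - p m k) * E (y - p m l)))"
    by (simp add: algebra_simps sum_distrib_left)
  also have "\<dots> \<le> exp Bv * (Cr * \<sigma> m * ?F + C0 * (\<Sum>l\<in>{1..n}-{k}. \<sigma> m * ?F))"
  proof (intro mult_left_mono add_mono sum_mono E_le_F C0)
    fix l assume l: "l \<in> {1..n} - {k}"
    have "E (y - p m k) * E (y - p m l) \<le> \<tau> m * ?F" unfolding \<tau>_def by (rule overlap) (use p[OF m k] l in auto)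
    also have "\<dots> \<le> \<sigma> m * ?F" using scales[OF m] by (intro mult_right_mono) auto
    finally show "E (y - p m k) * E (y - p m l) \<le> \<sigma> m * ?F" .
  qed (use Cr scale_pos in auto)
  also have "\<dots> \<le> exp Bv * (Cr * \<sigma> m * ?F + C0 * (real n * (\<sigma> m * ?F)))"
    using k C0 scale_pos by (intro mult_left_mono add_mono order_refl) (auto intro!: mult_right_mono)
  also have "\<dots> = Cq * \<sigma> m * ?F" by (simp add: Cq_def algebra_simps)
  finally show ?thesis .
qed

definition qf where "qf m k f y = complex_of_real (q m k y) * sh f (p m k) y"

lemma Cq: "Cq \<ge> 0" unfolding Cq_def using Cr C0 by simp

lemma qf_bound:
  assumes m: "m \<ge> m0" and k: "k \<in> {1..n}" and f: "f \<in> fns"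
  shows "cmod (qf m k f y) \<le> C1 * (Cq * \<sigma> m) * F (y - p m k)" "cmod (qf m k f y) \<le> 2 * exp Bv * (C1 * E (y - p m k))"
proof -
  have e: "cmod (qf m k f y) \<le> \<bar>q m k y\<bar> * (C1 * E (y - p m k))" unfolding qf_def norm_mult norm_of_real by (intro mult_left_mono sh_bound f) auto
  have "C1 * (\<bar>q m k y\<bar> * E (y - p m k)) \<le> C1 * (Cq * \<sigma> m * F (y - p m k))" by (intro mult_left_mono qE_bound m k C1)
  then show "cmod (qf m k f y) \<le> C1 * (Cq * \<sigma> m) * F (y - p m k)" using e by (simp add: algebra_simps)
  show "cmod (qf m k f y) \<le> 2 * exp Bv * (C1 * E (y - p m k))" by (rule order_trans[OF e]) (intro mult_right_mono q_bound m k, use C1 in auto)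
qed

lemma qf_measurable: "m \<ge> m0 \<Longrightarrow> f \<in> fns \<Longrightarrow> qf m k f \<in> borel_measurable borel"
proof -
  assume m: "m \<ge> m0" and f: "f \<in> fns"
  have "continuous_on UNIV (\<lambda>y. U (y - p m k))" by (rule continuous_on_compose2[OF fns_continuous[of U UNIV]]) (auto intro!: continuous_intros)
  then have "continuous_on UNIV (qf m k f)" unfolding qf_def[abs_def] q_def by (intro continuous_intros V_cont m sh_continuous f)
  then show ?thesis by (rule borel_measurable_continuous_onI)
qed

lemma qf_L2:
  assumes m: "m \<ge> m0" and k: "k \<in> {1..n}" and f: "f \<in> fns"
  shows "qf m k f \<in> L2" "L2_norm (qf m k f) \<le> C1 * Cq * NF * \<sigma> m"
  using exp_decay_L2_norm[OF qf_measurable[OF m f] E_pos(2), of k "C1 * (Cq * \<sigma> m)" "p m k"] qf_bound(1)[OF m k f] by (auto simp: NF_def algebra_simps)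

lemma A_ph: "m \<ge> m0 \<Longrightarrow> A m (ph m k) =\<^sub>2 qf m k U1"
  using A_U[of "V m" "p m k"] by (simp add: qf_def[abs_def] q_def)

lemma A_Dm: "m \<ge> m0 \<Longrightarrow> A m (Dm m k) =\<^sub>2 (\<lambda>x. - 2 * of_real c * ps m k x + qf m k D x)"
  using A_D[of "V m" "p m k"] by (simp add: qf_def[abs_def] q_def)

text \<open>In the second bound the potential error is merely bounded; the smallness comes from the
  two separated pulses, as in the first.\<close>

lemma cross_bound:
  assumes m: "m \<ge> m0" and k: "k \<in> {1..n}" "l \<in> {1..n}" "k \<noteq> l" and f: "f \<in> fns" "g \<in> fns"
  shows "cmod (L2_inner (sh f (p m k)) (sh g (p m l))) \<le> C1 * C1 * IF * \<tau> m"
    "cmod (L2_inner (qf m k f) (sh g (p m l))) \<le> 2 * exp Bv * (C1 * C1) * IF * \<tau> m"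
proof -
  have ov: "E (x - p m k) * E (x - p m l) \<le> \<tau> m * F (x - p m k)" for x unfolding \<tau>_def by (rule overlap) (rule p[OF m k])
  have "cmod (sh f (p m k) x * cnj (sh g (p m l) x)) \<le> (C1 * C1 * \<tau> m) * F (x - p m k)" for x
  proof -
    have "cmod (sh f (p m k) x * cnj (sh g (p m l) x)) \<le> (C1 * E (x - p m k)) * (C1 * E (x - p m l))"
      unfolding norm_mult complex_mod_cnj by (intro mult_mono sh_bound f) (use C1 in auto)
    also have "\<dots> = (C1 * C1) * (E (x - p m k) * E (x - p m l))" by (simp add: algebra_simps)
    also have "\<dots> \<le> (C1 * C1) * (\<tau> m * F (x - p m k))" by (intro mult_left_mono ov) (use C1 in auto)
    finally show ?thesis by (simp add: mult.assoc)
  qed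
  then have "cmod (L2_inner (sh f (p m k)) (sh g (p m l))) \<le> (C1 * C1 * \<tau> m) * (LINT x|lborel. F x)"
    by (intro L2_inner_AE_bound[OF _ E_pos(2)] sh_L2 f AE_I2)
  then show "cmod (L2_inner (sh f (p m k)) (sh g (p m l))) \<le> C1 * C1 * IF * \<tau> m" by (simp add: IF_def algebra_simps)
  have "cmod (qf m k f x * cnj (sh g (p m l) x)) \<le> (2 * exp Bv * (C1 * C1) * \<tau> m) * F (x - p m k)" for x
  proof -
    have "cmod (qf m k f x * cnj (sh g (p m l) x)) \<le> (2 * exp Bv * (C1 * E (x - p m k))) * (C1 * E (x - p m l))"
      unfolding norm_mult complex_mod_cnj by (intro mult_mono qf_bound(2) m k sh_bound f) (use C1 in auto)
    also have "\<dots> = (2 * exp Bv * (C1 * C1)) * (E (x - p m k) * E (x - p m l))" by (simp add: algebra_simps)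
    also have "\<dots> \<le> (2 * exp Bv * (C1 * C1)) * (\<tau> m * F (x - p m k))" by (intro mult_left_mono ov) (use C1 in auto)
    finally show ?thesis by (simp add: mult.assoc)
  qed
  then have "cmod (L2_inner (qf m k f) (sh g (p m l))) \<le> (2 * exp Bv * (C1 * C1) * \<tau> m) * (LINT x|lborel. F x)"
    by (intro L2_inner_AE_bound[OF _ E_pos(2)] sh_L2 qf_L2 m k f AE_I2)
  then show "cmod (L2_inner (qf m k f) (sh g (p m l))) \<le> 2 * exp Bv * (C1 * C1) * IF * \<tau> m" by (simp add: IF_def algebra_simps)
qed

text \<open>Remainders are known in the supremum norm, and the localized partner supplies the
  integrability.\<close>

lemma sup_inner:
  assumes w: "w \<in> L2" "AE y in lborel. cmod (w y) \<le> B" and f: "f \<in> fns"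
  shows "cmod (L2_inner w (sh f r)) \<le> B * (C1 * IE)"
proof -
  have "cmod (L2_inner w (sh f r)) \<le> (B * C1) * (LINT x|lborel. E x)"
  proof (rule L2_inner_AE_bound[OF _ E_pos(1) w(1) sh_L2(1)[OF f]])
    show "AE x in lborel. cmod (w x * cnj (sh f r x)) \<le> B * C1 * E (x - r)" using w(2)
    proof eventually_elim
      case (elim x)
      have "0 \<le> B" using elim norm_ge_zero order_trans by blast
      with elim have "cmod (w x * cnj (sh f r x)) \<le> B * (C1 * E (x - r))" unfolding norm_mult complex_mod_cnj by (intro mult_mono sh_bound f) auto
      then show ?case by (simp add: mult.assoc)
    qed
  qed
  then show ?thesis by (simp add: IE_def)
qed

lemma sup_inner_qf:
  assumes w: "w \<in> L2" "AE y in lborel. cmod (w y) \<le> B" and f: "f \<in> fns" and m: "m \<ge> m0" and k: "k \<in> {1..n}"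
  shows "cmod (L2_inner w (qf m k f)) \<le> B * (C1 * Cq * IF * \<sigma> m)"
proof -
  have "cmod (L2_inner w (qf m k f)) \<le> (B * (C1 * (Cq * \<sigma> m))) * (LINT x|lborel. F x)"
  proof (rule L2_inner_AE_bound[OF _ E_pos(2) w(1) qf_L2(1)[OF m k f]])
    show "AE x in lborel. cmod (w x * cnj (qf m k f x)) \<le> B * (C1 * (Cq * \<sigma> m)) * F (x - p m k)" using w(2)
    proof eventually_elim
      case (elim x)
      have "0 \<le> B" using elim norm_ge_zero order_trans by blast
      with elim have "cmod (w x * cnj (qf m k f x)) \<le> B * (C1 * (Cq * \<sigma> m) * F (x - p m k))"
        unfolding norm_mult complex_mod_cnj by (intro mult_mono qf_bound m k f) auto
      then show ?case by (simp add: mult.assoc)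
    qed
  qed
  then show ?thesis by (simp add: IF_def algebra_simps)
qed

section \<open>Coefficients and remainders of the eigenfunctions\<close>

text \<open>Two cases in one choice. For i < n these are the coefficients of the given
  decomposition. For i = n they all equal a factor b with s_n = b V', which reduces the remainder to
  the difference bounded in \<open>V1_r\<close>.\<close>

definition d where
  "d m i = (SOME e. if i < n then (\<forall>y. cmod (s m i y - (\<Sum>k=1..n. e k * ph m k y)) \<le> Cr * exp (- 2 * al * X m))
     else (\<exists>b. (\<forall>k. e k = b) \<and> s m n =\<^sub>2 (\<lambda>y. b * cfun (V1 m) y)))"

definition w where "w m i = (\<lambda>y. s m i y - (\<Sum>k=1..n. d m i k * ph m k y))"

text \<open>Boundedness of the coefficients is established only in \<open>dS_bound\<close>; until
  then estimates carry the factor 1 + \<open>dS\<close>.\<close>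

definition dS where "dS m i = (\<Sum>k=1..n. cmod (d m i k))"

lemma dS: "dS m i \<ge> 0" "k \<in> {1..n} \<Longrightarrow> cmod (d m i k) \<le> dS m i"
  unfolding dS_def by (auto intro: sum_nonneg member_le_sum)

lemma d_less: assumes "m \<ge> m0" "i \<in> {1..n-1}" shows "cmod (w m i y) \<le> Cr * (\<sigma> m * \<sigma> m)"
proof -
  have i: "i < n" using assms(2) n by auto
  have "\<exists>e. if i < n then (\<forall>y. cmod (s m i y - (\<Sum>k=1..n. e k * ph m k y)) \<le> Cr * exp (- 2 * al * X m))
     else (\<exists>b. (\<forall>k. e k = b) \<and> s m n =\<^sub>2 (\<lambda>y. b * cfun (V1 m) y))" using s_dec[OF assms] i by simp
  from someI_ex[OF this] show ?thesis using i scales(6)[OF assms(1)] unfolding d_def[symmetric] w_def by simp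
qed

lemma d_n: assumes "m \<ge> m0" shows "\<exists>b. (\<forall>k. d m n k = b) \<and> s m n =\<^sub>2 (\<lambda>y. b * cfun (V1 m) y)"
proof -
  obtain b where "s m n =\<^sub>2 (\<lambda>y. b * cfun (V1 m) y)" using s_n[OF assms] by blast
  then have "\<exists>e. if n < n then (\<forall>y. cmod (s m n y - (\<Sum>k=1..n. e k * ph m k y)) \<le> Cr * exp (- 2 * al * X m))
     else (\<exists>b. (\<forall>k. e k = b) \<and> s m n =\<^sub>2 (\<lambda>y. b * cfun (V1 m) y))" by (intro exI[of _ "\<lambda>_. b"]) auto
  from someI_ex[OF this] show ?thesis unfolding d_def[symmetric] by simp
qed

lemma sum_ph_S: "(\<lambda>y. \<Sum>k=1..n. e k * ph m k y) \<in> sobolev 4"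
  by (intro sobolev_sum sobolev_cmul U_sobolev)

lemma w_S: "m \<ge> m0 \<Longrightarrow> i \<in> {1..n} \<Longrightarrow> w m i \<in> sobolev 4"
  unfolding w_def by (intro sobolev_diff s_S sum_ph_S)

lemma w_L2: "m \<ge> m0 \<Longrightarrow> i \<in> {1..n} \<Longrightarrow> w m i \<in> L2"
  by (rule sobolev_L2[OF w_S])

lemma s_L2: "m \<ge> m0 \<Longrightarrow> i \<in> {1..n} \<Longrightarrow> s m i \<in> L2"
  by (rule sobolev_L2[OF s_S])

lemma s_eq: "s m i = (\<lambda>y. (\<Sum>k=1..n. d m i k * ph m k y) + w m i y)"
  by (simp add: w_def)

text \<open>The index n limits this to the first power of \<open>\<sigma>\<close>; for the other
  indices \<open>d_less\<close> has the square.\<close>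

lemma w_sup:
  assumes m: "m \<ge> m0" and i: "i \<in> {1..n}"
  shows "AE y in lborel. cmod (w m i y) \<le> Cr * \<sigma> m * (1 + dS m i)"
proof (cases "i < n")
  case True
  have "cmod (w m i y) \<le> Cr * \<sigma> m * (1 + dS m i)" for y
  proof -
    have "cmod (w m i y) \<le> Cr * (\<sigma> m * \<sigma> m)" using True i by (intro d_less m) auto
    also have "\<dots> \<le> Cr * (\<sigma> m * (1 + dS m i))" using scales[OF m] dS(1)[of m i] Cr by (intro mult_left_mono) auto
    finally show ?thesis by (simp add: mult.assoc)
  qed
  then show ?thesis by simp
next
  case False
  then have [simp]: "i = n" using i by simp
  obtain b where b: "\<And>k. d m n k = b" "s m n =\<^sub>2 (\<lambda>y. b * cfun (V1 m) y)" using d_n[OF m] by blast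
  have cb: "cmod b \<le> dS m n" using dS(2)[of 1 m n] b(1)[of 1] n by simp
  show ?thesis using b(2) unfolding L2_eq_def
  proof eventually_elim
    case (elim y)
    have "w m n y = b * of_real (V1 m y - (\<Sum>k=1..n. U1 (y - p m k)))" using elim by (simp add: w_def b(1) sh_def right_diff_distrib sum_distrib_left)
    then have "cmod (w m n y) = cmod b * \<bar>V1 m y - (\<Sum>k=1..n. U1 (y - p m k))\<bar>" by (simp only: norm_mult norm_of_real)
    also have "\<dots> \<le> dS m n * (Cr * \<sigma> m)" unfolding \<sigma>_def by (intro mult_mono V1_r m cb) (use dS in auto)
    also have "\<dots> \<le> (1 + dS m n) * (Cr * \<sigma> m)" using Cr scale_pos(1)[of m] by (intro mult_right_mono) auto
    finally show ?case by (simp add: algebra_simps)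
  qed
qed

lemma A_w:
  assumes m: "m \<ge> m0" and i: "i \<in> {1..n}"
  shows "A m (w m i) =\<^sub>2 (\<lambda>y. of_real (\<nu> m i) * s m i y - (\<Sum>k=1..n. d m i k * qf m k U1 y))"
proof -
  have "A m (\<lambda>y. \<Sum>k=1..n. d m i k * ph m k y) =\<^sub>2 (\<lambda>y. \<Sum>k=1..n. A m (\<lambda>y. d m i k * ph m k y) y)"
    by (intro lin_op_sum sobolev_cmul U_sobolev)
  also have "\<dots> =\<^sub>2 (\<lambda>y. \<Sum>k=1..n. d m i k * A m (ph m k) y)" by (intro L2_eq_sum lin_op_linear(3)[OF U_sobolev U_sobolev])
  also have "\<dots> =\<^sub>2 (\<lambda>y. \<Sum>k=1..n. d m i k * qf m k U1 y)" by (intro L2_eq_sum L2_eq_mult A_ph m)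
  finally have 1: "A m (\<lambda>y. \<Sum>k=1..n. d m i k * ph m k y) =\<^sub>2 (\<lambda>y. \<Sum>k=1..n. d m i k * qf m k U1 y)" .
  have "A m (w m i) =\<^sub>2 (\<lambda>y. A m (s m i) y - A m (\<lambda>y. \<Sum>k=1..n. d m i k * ph m k y) y)"
    unfolding w_def by (intro lin_op_linear s_S m i sum_ph_S)
  also have "\<dots> =\<^sub>2 (\<lambda>y. of_real (\<nu> m i) * s m i y - (\<Sum>k=1..n. d m i k * qf m k U1 y))" by (intro L2_eq_diff s_A m i 1)
  finally show ?thesis .
qed

lemma s_norm: "m \<ge> m0 \<Longrightarrow> i \<in> {1..n} \<Longrightarrow> L2_norm (s m i) = sqrt N"
proof -
  assume "m \<ge> m0" "i \<in> {1..n}"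
  then have "complex_of_real ((L2_norm (s m i))\<^sup>2) = of_real N" using s_orth[of m i i] L2_inner_self[of "s m i"] by simp
  then have "(L2_norm (s m i))\<^sup>2 = N" by (simp only: of_real_eq_iff)
  then show ?thesis by (metis L2_norm_nonneg real_sqrt_unique)
qed

lemma nu_bound: assumes m: "m \<ge> m0" and i: "i \<in> {1..n}" shows "\<bar>\<nu> m i\<bar> \<le> Cr * (\<sigma> m * \<sigma> m)"
proof (cases "i = n")
  case True then show ?thesis using nu(2)[OF m] Cr scale_pos(1)[of m] by simp
next
  case False
  then have "i \<in> {1..n-1}" using i by auto
  from nu(1)[OF m this] show ?thesis unfolding scales(6)[OF m] .
qed

definition Cw where "Cw = Cr * sqrt N + C1 * Cq * NF"

lemma Aw_norm:
  assumes m: "m \<ge> m0" and i: "i \<in> {1..n}"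
  shows "L2_norm (A m (w m i)) \<le> Cw * \<sigma> m * (1 + dS m i)"
proof -
  have L: "(\<lambda>y. of_real (\<nu> m i) * s m i y) \<in> L2" "(\<lambda>y. \<Sum>k=1..n. d m i k * qf m k U1 y) \<in> L2"
    by (intro L2_cmul s_L2 m i L2_sum qf_L2; auto)+
  have "L2_norm (A m (w m i)) = L2_norm (\<lambda>y. of_real (\<nu> m i) * s m i y - (\<Sum>k=1..n. d m i k * qf m k U1 y))"
    by (intro L2_norm_cong A_w m i lin_op_L2 w_S V_bp L2_diff L)
  also have "\<dots> \<le> L2_norm (\<lambda>y. of_real (\<nu> m i) * s m i y) + L2_norm (\<lambda>y. \<Sum>k=1..n. d m i k * qf m k U1 y)"
    by (rule L2_triangle_diff[OF L])
  also have "L2_norm (\<lambda>y. of_real (\<nu> m i) * s m i y) \<le> Cr * sqrt N * \<sigma> m"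
  proof -
    have "L2_norm (\<lambda>y. of_real (\<nu> m i) * s m i y) = \<bar>\<nu> m i\<bar> * sqrt N" by (simp add: L2_norm_cmul s_norm[OF m i])
    also have "\<dots> \<le> (Cr * \<sigma> m) * sqrt N"
    proof (intro mult_right_mono order_trans[OF nu_bound[OF m i]] mult_left_mono Cr)
      show "\<sigma> m * \<sigma> m \<le> \<sigma> m" using scales[OF m] by linarith
    qed (use N_pos in auto)
    finally show ?thesis by (simp add: algebra_simps)
  qed
  also have "L2_norm (\<lambda>y. \<Sum>k=1..n. d m i k * qf m k U1 y) \<le> (\<Sum>k=1..n. L2_norm (\<lambda>y. d m i k * qf m k U1 y))"
    by (rule L2_norm_sum) (intro L2_cmul qf_L2 m; auto)
  also have "\<dots> \<le> (\<Sum>k=1..n. cmod (d m i k) * (C1 * Cq * NF * \<sigma> m))" unfolding L2_norm_cmul by (intro sum_mono mult_left_mono qf_L2 m) auto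
  also have "\<dots> = C1 * Cq * NF * \<sigma> m * dS m i" by (simp add: dS_def sum_distrib_left sum_distrib_right algebra_simps)
  finally have "L2_norm (A m (w m i)) \<le> Cr * sqrt N * \<sigma> m + C1 * Cq * NF * \<sigma> m * dS m i" by simp
  also have "\<dots> \<le> Cw * \<sigma> m * (1 + dS m i)"
  proof -
    have "0 \<le> Cr * sqrt N * \<sigma> m * dS m i" "0 \<le> C1 * Cq * NF * \<sigma> m"
      using Cr N_pos scale_pos[of m] dS(1)[of m i] C1 Cq consts_nonneg by auto
    then show ?thesis by (simp add: Cw_def algebra_simps)
  qed
  finally show ?thesis .
qed

lemma Cw: "Cw \<ge> 0" unfolding Cw_def using Cr N_pos C1 Cq consts_nonneg by auto

section \<open>Coercivity modulo the translates of U'\<close>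

text \<open>The overlaps with the translates of U' stay on the right-hand side, because the
  complement of S has not yet been compared with the complement of these translates;
  \<open>Q_ph\<close> does so later.\<close>

lemma coercive:
  "\<exists>C\<ge>0. \<forall>\<^sub>F m in sequentially. \<forall>f\<in>sobolev 4. L2_norm f \<le> C * (L2_norm (A m f) + (\<Sum>k=1..n. cmod (L2_inner f (ph m k))))"
proof (rule ccontr)
  let ?R = "\<lambda>m f. L2_norm (A m f) + (\<Sum>k=1..n. cmod (L2_inner f (ph m k)))"
  assume a: "\<not> (\<exists>C\<ge>0. \<forall>\<^sub>F m in sequentially. \<forall>f\<in>sobolev 4. L2_norm f \<le> C * ?R m f)"
  have neg: "\<not> (\<forall>\<^sub>F m in sequentially. \<forall>f\<in>sobolev 4. L2_norm f \<le> real (Suc i) * ?R m f)" for i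
  proof
    assume "\<forall>\<^sub>F m in sequentially. \<forall>f\<in>sobolev 4. L2_norm f \<le> real (Suc i) * ?R m f"
    then have "\<exists>C\<ge>0. \<forall>\<^sub>F m in sequentially. \<forall>f\<in>sobolev 4. L2_norm f \<le> C * ?R m f"
      by (rule exI[of _ "real (Suc i)", OF conjI[rotated]]) simp
    with a show False by blast
  qed
  \<comment> \<open>The counterexamples are taken at indices m >= i, so that the peaks separate
    along the sequence.\<close>
  have "\<exists>m f. m \<ge> max i m0 \<and> f \<in> sobolev 4 \<and> L2_norm f > real (Suc i) * ?R m f" for i
  proof (rule ccontr)
    assume a: "\<not> (\<exists>m f. m \<ge> max i m0 \<and> f \<in> sobolev 4 \<and> L2_norm f > real (Suc i) * ?R m f)"
    have "\<forall>\<^sub>F m in sequentially. \<forall>f\<in>sobolev 4. L2_norm f \<le> real (Suc i) * ?R m f"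
      by (rule eventually_mono[OF eventually_ge_at_top[of "max i m0"]]) (use a in \<open>meson not_le_imp_less\<close>)
    then show False using neg by blast
  qed
  then obtain mi h where mi: "\<And>i. mi i \<ge> max i m0" and h: "\<And>i. h i \<in> sobolev 4"
    and hn: "\<And>i. L2_norm (h i) > real (Suc i) * ?R (mi i) (h i)" by metis
  have m: "mi i \<ge> m0" for i using mi[of i] by simp
  have part: "real (Suc i) * x \<le> real (Suc i) * ?R (mi i) (h i)"
    if x: "x = L2_norm (A (mi i) (h i)) \<or> (\<exists>k\<in>{1..n}. x = cmod (L2_inner (h i) (ph (mi i) k)))" for x i
  proof (rule mult_left_mono)
    from x show "x \<le> ?R (mi i) (h i)"
    proof
      assume "\<exists>k\<in>{1..n}. x = cmod (L2_inner (h i) (ph (mi i) k))"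
      then obtain k where k: "k \<in> {1..n}" "x = cmod (L2_inner (h i) (ph (mi i) k))" by blast
      have "x \<le> (\<Sum>k=1..n. cmod (L2_inner (h i) (ph (mi i) k)))" unfolding k(2) using k(1) by (intro member_le_sum) auto
      then show ?thesis using L2_norm_nonneg[of "A (mi i) (h i)"] by linarith
    qed (simp add: sum_nonneg)
  qed simp
  have mlim: "filterlim mi at_top sequentially" by (rule filterlim_at_top_mono[OF filterlim_ident]) (use mi in auto)
  have \<sigma>l: "(\<lambda>i. \<sigma> (mi i)) \<longlonglongrightarrow> 0" by (rule filterlim_compose[OF \<sigma>_lim mlim])
  have Xl: "filterlim (\<lambda>i. X (mi i)) at_top sequentially" by (rule filterlim_compose[OF X(2) mlim])
  show False
  proof (rule approximate_null_contradiction[where h=h and I="{1..n}" and W="\<lambda>i. V (mi i)" and q="\<lambda>i. p (mi i)" and ?W0.0="\<lambda>k. U"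
      and E="\<lambda>k. {sh U1 0}" and B=BP, OF c(2)])
    show "real (Suc i) * L2_norm (A (mi i) (h i)) < L2_norm (h i)" for i by (rule le_less_trans[OF part hn]) simp
    show "continuous_on UNIV (V (mi i))" for i by (rule V_cont[OF m])
    show "\<bar>exp (V (mi i) x) - 1\<bar> \<le> BP" for i x by (rule pot_bound(2)[OF m])
    show "continuous_on UNIV U" for k :: nat by (rule fns_continuous) simp
    show "e \<in> L2" if "e \<in> {sh U1 0}" for e using that sh_L2 by auto
    show "real (Suc i) * cmod (L2_inner (h i) (\<lambda>x. e (x - p (mi i) k))) \<le> L2_norm (h i)" if "k \<in> {1..n}" "e \<in> {sh U1 0}" for i k e
    proof -
      have e: "(\<lambda>x. e (x - p (mi i) k)) = ph (mi i) k" using that by (auto simp: sh_def)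
      show ?thesis unfolding e by (rule order_trans[OF part less_imp_le[OF hn]]) (use that(1) in blast)
    qed
    show "g =\<^sub>2 (\<lambda>x. 0)" if "g \<in> sobolev 4" "lin_op c U g =\<^sub>2 (\<lambda>x. 0)" "\<And>e. e \<in> {sh U1 0} \<Longrightarrow> L2_inner g e = 0" for g
      by (rule U_kernel[OF that(1,2)]) (rule that(3), simp)
    show "(\<lambda>i. V (mi i) (x + p (mi i) k)) \<longlonglongrightarrow> U x" if k: "k \<in> {1..n}" for k x
    proof -
      \<comment> \<open>At distance |x| from peak k the other pulses are at least X - |x| away, so
        for fixed x their contribution tends to 0.\<close>
      have b: "\<bar>V (mi i) (x + p (mi i) k) - U x\<bar> \<le> Cr * \<sigma> (mi i) + C0 * (real n * (exp (7/8 * al * \<bar>x\<bar>) * exp (- (7/8 * al) * X (mi i))))" for i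
      proof -
        have "E (x + p (mi i) k - p (mi i) l) \<le> exp (7/8 * al * \<bar>x\<bar>) * exp (- (7/8 * al) * X (mi i))" if l: "l \<in> {1..n} - {k}" for l
        proof -
          have "2 * X (mi i) \<le> \<bar>p (mi i) k - p (mi i) l\<bar>" using l by (intro p m k) auto
          then have "X (mi i) - \<bar>x\<bar> \<le> \<bar>x + p (mi i) k - p (mi i) l\<bar>" using X(1)[OF m[of i]] by linarith
          then have "- (7/8 * al) * \<bar>x + p (mi i) k - p (mi i) l\<bar> \<le> - (7/8 * al) * (X (mi i) - \<bar>x\<bar>)"
            using al by (intro mult_left_mono_neg) auto
          also have "\<dots> = 7/8 * al * \<bar>x\<bar> + - (7/8 * al) * X (mi i)"
            by (simp only: right_diff_distrib mult_minus_left diff_minus_eq_add add.commute)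
          finally show ?thesis by (simp only: exp_add[symmetric] exp_le_cancel_iff)
        qed
        then have "(\<Sum>l\<in>{1..n}-{k}. E (x + p (mi i) k - p (mi i) l)) \<le> (\<Sum>l\<in>{1..n}-{k}. exp (7/8 * al * \<bar>x\<bar>) * exp (- (7/8 * al) * X (mi i)))"
          by (intro sum_mono)
        also have "\<dots> \<le> real n * (exp (7/8 * al * \<bar>x\<bar>) * exp (- (7/8 * al) * X (mi i)))" using k by (simp add: mult_right_mono)
        finally have "C0 * (\<Sum>l\<in>{1..n}-{k}. E (x + p (mi i) k - p (mi i) l)) \<le> C0 * (real n * (exp (7/8 * al * \<bar>x\<bar>) * exp (- (7/8 * al) * X (mi i))))"
          by (intro mult_left_mono C0)
        then show ?thesis using V_decomp[OF m k, of i "x + p (mi i) k"] by simp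
      qed
      have "(\<lambda>i. Cr * \<sigma> (mi i) + C0 * (real n * (exp (7/8 * al * \<bar>x\<bar>) * exp (- (7/8 * al) * X (mi i))))) \<longlonglongrightarrow>
          Cr * 0 + C0 * (real n * (exp (7/8 * al * \<bar>x\<bar>) * 0))"
        by (intro tendsto_intros \<sigma>l filterlim_compose[OF exp_neg_at_top[OF E_pos(1)] Xl])
      then have lim0: "(\<lambda>i. Cr * \<sigma> (mi i) + C0 * (real n * (exp (7/8 * al * \<bar>x\<bar>) * exp (- (7/8 * al) * X (mi i))))) \<longlonglongrightarrow> 0"
        by (simp only: mult_zero_right add_0_right)
      have "(\<lambda>i. V (mi i) (x + p (mi i) k) - U x) \<longlonglongrightarrow> 0"
        by (rule Lim_null_comparison[OF _ lim0], intro always_eventually allI) (simp only: real_norm_def b)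
      then show ?thesis by (simp add: LIM_zero_iff)
    qed
    fix e :: real assume e: "e > 0"
    \<comment> \<open>Half of e for the error of the n-pulse and half for the tails, both divided by
      the Lipschitz factor exp Bv of the exponential.\<close>
    define e' where "e' = e / (2 * exp Bv)"
    have e': "e' > 0" using e by (simp add: e'_def)
    obtain R where R: "\<And>x. \<bar>x\<bar> \<ge> R \<Longrightarrow> (C0 * real n) * E x \<le> e'" using exp_decay_small[OF E_pos(1) e'] by blast
    have "(\<lambda>i. Cr * \<sigma> (mi i)) \<longlonglongrightarrow> Cr * 0" by (intro tendsto_intros \<sigma>l)
    then have ev: "\<forall>\<^sub>F i in sequentially. Cr * \<sigma> (mi i) < e'" using e' by (intro order_tendstoD(2)) auto
    show "\<exists>R. \<forall>\<^sub>F i in sequentially. \<forall>x. (\<forall>k\<in>{1..n}. \<bar>x - p (mi i) k\<bar> > R) \<longrightarrow> \<bar>exp (V (mi i) x) - 1\<bar> \<le> e"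
    proof (rule exI[of _ R], use ev in eventually_elim, intro allI impI)
      fix i x assume s: "Cr * \<sigma> (mi i) < e'" and x: "\<forall>k\<in>{1..n}. \<bar>x - p (mi i) k\<bar> > R"
      have np: "0 < real n" using n by simp
      have "C0 * E (x - p (mi i) l) \<le> e' / real n" if "l \<in> {1..n}" for l
        using R[of "x - p (mi i) l"] x that np by (simp add: le_divide_eq algebra_simps less_imp_le)
      then have "(\<Sum>l=1..n. C0 * E (x - p (mi i) l)) \<le> (\<Sum>l=1..n. e' / real n)" by (rule sum_mono)
      also have "\<dots> = e'" using np by simp
      finally have "\<bar>V (mi i) x\<bar> \<le> 2 * e'" using V_far[OF m, of i x] s by (simp add: sum_distrib_left)
      then have "exp Bv * \<bar>V (mi i) x\<bar> \<le> exp Bv * (2 * e')" by (intro mult_left_mono) auto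
      also have "\<dots> = e" by (simp add: e'_def)
      finally show "\<bar>exp (V (mi i) x) - 1\<bar> \<le> e" using pot_bound(1)[OF m, of i x] by linarith
    qed
  qed (use h in auto)
qed

end

lemma dom_mult_bounded: "f \<preceq> (\<lambda>_. 1) \<Longrightarrow> g \<preceq> h \<Longrightarrow> (\<And>m. 0 \<le> g m) \<Longrightarrow> (\<lambda>m. f m * g m) \<preceq> h"
  using dom_mult[of f "\<lambda>_. 1" g h] by simp

lemma cmod_L2_inner_commute: "cmod (L2_inner f g) = cmod (L2_inner g f)"
  by (metis L2_inner_cnj complex_mod_cnj)

context multipulse
begin

abbreviation "Sp m \<equiv> L2_perp (L2_span n (s m))"
abbreviation "Q m \<equiv> eigenframe.Q N n (s m)"

lemma sh_L2' [simp, intro]: "f \<in> fns \<Longrightarrow> sh f r \<in> L2" by (rule sh_L2)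

lemma dom_ev: "K \<ge> 0 \<Longrightarrow> (\<And>m. m \<ge> m0 \<Longrightarrow> f m \<le> K * g m) \<Longrightarrow> f \<preceq> g"
  by (rule domI[of K], assumption, rule eventually_mono[OF ev_m0])

lemma dom_le: "(\<And>m. m \<ge> m0 \<Longrightarrow> f m \<le> g m) \<Longrightarrow> g \<preceq> h \<Longrightarrow> f \<preceq> h"
  by (rule dom_mono[OF eventually_mono[OF ev_m0]])

lemma BP: "BP \<ge> 0" unfolding BP_def using Bv by simp

lemma elliptic_V:
  assumes m: "m \<ge> m0" and f: "f \<in> sobolev 4" and j: "j \<in> {0,1,2,3,4::nat}"
  shows "L2_norm (if j = 0 then f else weak_deriv j f) \<le> ellip c * (L2_norm (A m f) + BP * L2_norm f)"
proof -
  note H = sobolev_H4[OF f]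
  have Vm: "V m \<in> borel_measurable borel" using V_bp[OF m] by (simp add: bounded_potential_def)
  have "L2_norm (\<lambda>x. weak_deriv 4 f x + of_real (c\<^sup>2) * weak_deriv 2 f x + f x) \<le> L2_norm (A m f) + BP * L2_norm f"
    unfolding lin_op_def by (rule H4_elliptic_potential[OF c(2) H Vm pot_bound(2)[OF m]])
  then have le: "ellip c * L2_norm (\<lambda>x. weak_deriv 4 f x + of_real (c\<^sup>2) * weak_deriv 2 f x + f x) \<le> ellip c * (L2_norm (A m f) + BP * L2_norm f)"
    using ellip_ge_1[OF c(2)] by (intro mult_left_mono) auto
  show ?thesis using j H4_elliptic[OF c(2) H, THEN order_trans, OF le] by auto
qed

section \<open>Boundedness of the coefficients and size of the remainders\<close>

lemma d_sum:
  assumes "I \<subseteq> {1..n}" "\<And>k. k \<in> I \<Longrightarrow> cmod (t k) \<le> B" "B \<ge> 0"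
  shows "cmod (\<Sum>k\<in>I. d m i k * t k) \<le> dS m i * B"
proof -
  have "cmod (\<Sum>k\<in>I. d m i k * t k) \<le> (\<Sum>k\<in>I. cmod (d m i k) * B)"
    by (rule order_trans[OF norm_sum]) (auto simp: norm_mult intro!: sum_mono mult_left_mono assms)
  also have "\<dots> \<le> (\<Sum>k=1..n. cmod (d m i k) * B)" by (rule sum_mono2) (use assms in auto)
  finally show ?thesis by (simp add: dS_def sum_distrib_right)
qed

lemma s_inner:
  assumes m: "m \<ge> m0" and i: "i \<in> {1..n}" and g: "g \<in> L2"
  shows "L2_inner (s m i) g = (\<Sum>k=1..n. d m i k * L2_inner (ph m k) g) + L2_inner (w m i) g"
proof -
  have "L2_inner (s m i) g = L2_inner (\<lambda>y. (\<Sum>k=1..n. d m i k * ph m k y) + w m i y) g" by (subst s_eq) (rule refl)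
  also have "\<dots> = L2_inner (\<lambda>y. \<Sum>k=1..n. d m i k * ph m k y) g + L2_inner (w m i) g"
    by (rule L2_inner_add_left) (auto intro!: L2_sum L2_cmul w_L2 m i g)
  also have "L2_inner (\<lambda>y. \<Sum>k=1..n. d m i k * ph m k y) g = (\<Sum>k=1..n. L2_inner (\<lambda>y. d m i k * ph m k y) g)"
    by (rule L2_inner_sum_left) (auto intro!: L2_cmul g)
  finally show ?thesis by (simp add: L2_inner_cmul_left)
qed

lemma ph_self: "L2_inner (ph m k) (ph m k) = of_real N" by (rule U1_inner)

definition K1 where "K1 = C1 * C1 * IF + Cr * C1 * IE"

lemma K1: "K1 \<ge> 0" unfolding K1_def using C1 Cr consts_nonneg by auto

text \<open>Pairing with the k-th translate reads off the k-th coefficient, since distinct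
  translates are almost orthogonal and the remainder is uniformly small.\<close>

lemma s_ph:
  assumes m: "m \<ge> m0" and i: "i \<in> {1..n}" and k: "k \<in> {1..n}"
  shows "cmod (L2_inner (s m i) (ph m k) - of_real N * d m i k) \<le> K1 * \<sigma> m * (1 + dS m i)"
proof -
  have "L2_inner (s m i) (ph m k) - of_real N * d m i k =
      (\<Sum>l\<in>{1..n}-{k}. d m i l * L2_inner (ph m l) (ph m k)) + L2_inner (w m i) (ph m k)"
    using k by (simp add: s_inner[OF m i] sum.remove[of _ k] ph_self mult.commute)
  then have "cmod (L2_inner (s m i) (ph m k) - of_real N * d m i k) \<le>
      cmod (\<Sum>l\<in>{1..n}-{k}. d m i l * L2_inner (ph m l) (ph m k)) + cmod (L2_inner (w m i) (ph m k))" by (simp only: norm_triangle_ineq)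
  also have "\<dots> \<le> dS m i * (C1 * C1 * IF * \<sigma> m) + Cr * \<sigma> m * (1 + dS m i) * (C1 * IE)"
  proof (intro add_mono d_sum sup_inner w_L2 w_sup m i)
    fix l assume l: "l \<in> {1..n} - {k}"
    have "cmod (L2_inner (ph m l) (ph m k)) \<le> C1 * C1 * IF * \<tau> m" by (rule cross_bound(1)[OF m]) (use l k in auto)
    also have "\<dots> \<le> C1 * C1 * IF * \<sigma> m" using scales[OF m] C1 consts_nonneg by (intro mult_left_mono) auto
    finally show "cmod (L2_inner (ph m l) (ph m k)) \<le> C1 * C1 * IF * \<sigma> m" .
  qed (use C1 consts_nonneg scale_pos in auto)
  also have "\<dots> \<le> (1 + dS m i) * (C1 * C1 * IF * \<sigma> m) + Cr * \<sigma> m * (1 + dS m i) * (C1 * IE)"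
    using C1 consts_nonneg scale_pos by (intro add_right_mono mult_right_mono) auto
  also have "\<dots> = K1 * \<sigma> m * (1 + dS m i)" by (simp add: K1_def algebra_simps)
  finally show ?thesis .
qed

text \<open>A self-improving estimate: Cauchy-Schwarz bounds the pairing with a translate by N, so N
  |d| is at most N plus a small multiple of 1 + dS. Summed over k, the multiple of dS is absorbed as
  soon as n K1 \<open>\<sigma>\<close> <= N / 2.\<close>

lemma dS_bound: "\<forall>\<^sub>F m in sequentially. \<forall>i\<in>{1..n}. dS m i \<le> 2 * real n + 1"
proof -
  have "(\<lambda>m. real n * K1 * \<sigma> m) \<preceq> \<sigma>" by (intro dom_cmult dom_refl) (use K1 in auto)
  then have "\<forall>\<^sub>F m in sequentially. real n * K1 * \<sigma> m \<le> N / 2" by (rule dom_\<sigma>_small) (use N_pos in auto)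
  then show ?thesis using ev_m0
  proof eventually_elim
    case (elim m)
    show ?case
    proof
      fix i assume i: "i \<in> {1..n}"
      have "N * cmod (d m i k) \<le> N + K1 * \<sigma> m * (1 + dS m i)" if k: "k \<in> {1..n}" for k
      proof -
        have "cmod (L2_inner (s m i) (ph m k)) \<le> sqrt N * sqrt N"
          using L2_Cauchy_Schwarz[OF s_L2[OF elim(2) i], of "ph m k"] by (simp add: s_norm[OF elim(2) i] U1_norm)
        then have "cmod (L2_inner (s m i) (ph m k)) \<le> N" using N_pos by simp
        moreover have "cmod (of_real N * d m i k) \<le> cmod (L2_inner (s m i) (ph m k)) + cmod (L2_inner (s m i) (ph m k) - of_real N * d m i k)" by norm
        ultimately show ?thesis using s_ph[OF elim(2) i k] N_pos by (simp add: norm_mult)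
      qed
      then have "(\<Sum>k=1..n. N * cmod (d m i k)) \<le> (\<Sum>k=1..n. N + K1 * \<sigma> m * (1 + dS m i))" by (rule sum_mono)
      then have "N * dS m i \<le> real n * N + (real n * K1 * \<sigma> m) * (1 + dS m i)" by (simp add: dS_def sum_distrib_left[symmetric] algebra_simps)
      also have "\<dots> \<le> real n * N + N / 2 * (1 + dS m i)" using dS(1)[of m i] elim(1) by (intro add_left_mono mult_right_mono) auto
      finally have "N * dS m i \<le> N * (2 * real n + 1)" by (simp add: algebra_simps)
      then show "dS m i \<le> 2 * real n + 1" using N_pos by simp
    qed
  qed
qed

lemma dS_dom: "i \<in> {1..n} \<Longrightarrow> (\<lambda>m. 1 + dS m i) \<preceq> (\<lambda>_. 1)"
proof (rule domI[of "2 * real n + 2"])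
  assume i: "i \<in> {1..n}"
  show "\<forall>\<^sub>F m in sequentially. 1 + dS m i \<le> (2 * real n + 2) * 1" using dS_bound by eventually_elim (use i in force)
qed simp

lemma d_dom: "i \<in> {1..n} \<Longrightarrow> k \<in> {1..n} \<Longrightarrow> (\<lambda>m. cmod (d m i k)) \<preceq> (\<lambda>_. 1)"
proof (rule dom_le[OF _ dS_dom[of i]])
  fix m assume "k \<in> {1..n}"
  then show "cmod (d m i k) \<le> 1 + dS m i" using dS(2)[of k m i] by simp
qed

lemma dom_d_sum:
  assumes i: "i \<in> {1..n}" and I: "I \<subseteq> {1..n}" and h: "\<And>m. 0 \<le> h m" and t: "\<And>k. k \<in> I \<Longrightarrow> (\<lambda>m. cmod (t m k)) \<preceq> h"
  shows "(\<lambda>m. cmod (\<Sum>k\<in>I. d m i k * t m k)) \<preceq> h" "(\<lambda>m. cmod (\<Sum>k\<in>I. cnj (d m i k) * t m k)) \<preceq> h"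
proof -
  have "(\<lambda>m. \<Sum>k\<in>I. cmod (d m i k) * cmod (t m k)) \<preceq> h" by (intro dom_sum h dom_mult_bounded d_dom i t) (use I in auto)
  then show "(\<lambda>m. cmod (\<Sum>k\<in>I. d m i k * t m k)) \<preceq> h" "(\<lambda>m. cmod (\<Sum>k\<in>I. cnj (d m i k) * t m k)) \<preceq> h"
    by (rule dom_le[rotated], intro order_trans[OF norm_sum], simp add: norm_mult)+
qed

lemma w_sh_dom:
  assumes i: "i \<in> {1..n}" and f: "f \<in> fns" shows "(\<lambda>m. cmod (L2_inner (w m i) (sh f (p m k)))) \<preceq> \<sigma>"
proof (rule dom_le)
  show "cmod (L2_inner (w m i) (sh f (p m k))) \<le> (1 + dS m i) * (Cr * C1 * IE * \<sigma> m)" if m: "m \<ge> m0" for m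
    using sup_inner[OF w_L2[OF m i] w_sup[OF m i] f, of "p m k"] by (simp add: algebra_simps)
  show "(\<lambda>m. (1 + dS m i) * (Cr * C1 * IE * \<sigma> m)) \<preceq> \<sigma>"
    by (intro dom_mult_bounded dS_dom i dom_cmult dom_refl) (use Cr C1 consts_nonneg scale_pos in auto)
qed

lemma w_sh_dom_less:
  assumes i: "i \<in> {1..n-1}" and f: "f \<in> fns" shows "(\<lambda>m. cmod (L2_inner (w m i) (sh f (p m k)))) \<preceq> \<tau>"
proof (rule dom_le)
  show "cmod (L2_inner (w m i) (sh f (p m k))) \<le> (Cr * C1 * IE) * (\<sigma> m * \<sigma> m)" if m: "m \<ge> m0" for m
  proof -
    have "i \<in> {1..n}" using i by auto
    from sup_inner[OF w_L2[OF m this] AE_I2[OF d_less[OF m i]] f, of "p m k"] show ?thesis by (simp add: algebra_simps)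
  qed
  show "(\<lambda>m. (Cr * C1 * IE) * (\<sigma> m * \<sigma> m)) \<preceq> \<tau>" by (intro dom_cmult \<tau>_dom) (use Cr C1 consts_nonneg in auto)
qed

lemma w_qf_dom:
  assumes i: "i \<in> {1..n}" and k: "k \<in> {1..n}" and f: "f \<in> fns" shows "(\<lambda>m. cmod (L2_inner (w m i) (qf m k f))) \<preceq> \<tau>"
proof (rule dom_le)
  show "cmod (L2_inner (w m i) (qf m k f)) \<le> (1 + dS m i) * ((Cr * C1 * Cq * IF) * (\<sigma> m * \<sigma> m))" if m: "m \<ge> m0" for m
    using sup_inner_qf[OF w_L2[OF m i] w_sup[OF m i] f m k] by (simp add: algebra_simps)
  show "(\<lambda>m. (1 + dS m i) * ((Cr * C1 * Cq * IF) * (\<sigma> m * \<sigma> m))) \<preceq> \<tau>"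
    by (intro dom_mult_bounded dS_dom i dom_cmult \<tau>_dom) (use Cr C1 Cq consts_nonneg scale_pos in auto)
qed

lemma cross_dom:
  assumes k: "k \<in> {1..n}" "l \<in> {1..n}" "k \<noteq> l" and f: "f \<in> fns" "g \<in> fns"
  shows "(\<lambda>m. cmod (L2_inner (sh f (p m k)) (sh g (p m l)))) \<preceq> \<tau>"
    "(\<lambda>m. cmod (L2_inner (qf m k f) (sh g (p m l)))) \<preceq> \<tau>"
  by (rule dom_ev[OF _ cross_bound(1)[OF _ k f]], use C1 consts_nonneg in simp, assumption)
    (rule dom_ev[OF _ cross_bound(2)[OF _ k f]], use C1 consts_nonneg in simp)

lemma qf_dom: "k \<in> {1..n} \<Longrightarrow> f \<in> fns \<Longrightarrow> (\<lambda>m. L2_norm (qf m k f)) \<preceq> \<sigma>"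
  by (rule dom_ev[OF _ qf_L2(2)]) (use C1 Cq consts_nonneg in auto)

lemma e_dom:
  assumes "i \<in> {1..n}" "k \<in> {1..n}"
  shows "(\<lambda>m. cmod (L2_inner (s m i) (ph m k) - of_real N * d m i k)) \<preceq> \<sigma>"
proof (rule dom_le)
  show "cmod (L2_inner (s m i) (ph m k) - of_real N * d m i k) \<le> (1 + dS m i) * (K1 * \<sigma> m)" if "m \<ge> m0" for m
    using s_ph[OF that assms] by (simp add: algebra_simps)
  show "(\<lambda>m. (1 + dS m i) * (K1 * \<sigma> m)) \<preceq> \<sigma>"
    by (intro dom_mult_bounded dS_dom assms dom_cmult dom_refl) (use K1 scale_pos in auto)
qed

text \<open>A supremum bound does not control the norm on the whole line. Coercivity does, because A
  w and the overlaps of w with the translates are of order \<open>\<sigma>\<close>; ellipticity adds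
  the derivative.\<close>

lemma w_dom: assumes i: "i \<in> {1..n}" shows "(\<lambda>m. L2_norm (w m i)) \<preceq> \<sigma>" "(\<lambda>m. L2_norm (weak_deriv 1 (w m i))) \<preceq> \<sigma>"
proof -
  have Aw: "(\<lambda>m. L2_norm (A m (w m i))) \<preceq> \<sigma>"
  proof (rule dom_le)
    show "L2_norm (A m (w m i)) \<le> (1 + dS m i) * (Cw * \<sigma> m)" if "m \<ge> m0" for m using Aw_norm[OF that i] by (simp add: algebra_simps)
    show "(\<lambda>m. (1 + dS m i) * (Cw * \<sigma> m)) \<preceq> \<sigma>" by (intro dom_mult_bounded dS_dom i dom_cmult dom_refl) (use Cw scale_pos in auto)
  qed
  obtain C where C: "C \<ge> 0" and ev: "\<forall>\<^sub>F m in sequentially. \<forall>f\<in>sobolev 4. L2_norm f \<le> C * (L2_norm (A m f) + (\<Sum>k=1..n. cmod (L2_inner f (ph m k))))"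
    using coercive by blast
  have "\<forall>\<^sub>F m in sequentially. L2_norm (w m i) \<le> C * (L2_norm (A m (w m i)) + (\<Sum>k=1..n. cmod (L2_inner (w m i) (ph m k))))"
    using ev ev_m0 by eventually_elim (use w_S i in blast)
  moreover have "(\<lambda>m. C * (L2_norm (A m (w m i)) + (\<Sum>k=1..n. cmod (L2_inner (w m i) (ph m k))))) \<preceq> \<sigma>"
    by (intro dom_cmult C dom_add Aw dom_sum w_sh_dom i scale_pos) simp
  ultimately show w: "(\<lambda>m. L2_norm (w m i)) \<preceq> \<sigma>" by (rule dom_mono)
  show "(\<lambda>m. L2_norm (weak_deriv 1 (w m i))) \<preceq> \<sigma>"
  proof (rule dom_le)
    show "L2_norm (weak_deriv 1 (w m i)) \<le> ellip c * (L2_norm (A m (w m i)) + BP * L2_norm (w m i))" if "m \<ge> m0" for m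
      using elliptic_V[OF that w_S[OF that i], of 1] by simp
    show "(\<lambda>m. ellip c * (L2_norm (A m (w m i)) + BP * L2_norm (w m i))) \<preceq> \<sigma>"
      by (intro dom_cmult dom_add Aw w BP) (use ellip_ge_1[OF c(2)] in simp)
  qed
qed

lemma dom_tau: "f \<preceq> \<sigma> \<Longrightarrow> g \<preceq> \<sigma> \<Longrightarrow> (\<And>m. 0 \<le> g m) \<Longrightarrow> (\<lambda>m. f m * g m) \<preceq> \<tau>"
  by (rule dom_trans[OF dom_mult \<tau>_dom(2)]) (auto simp: scale_pos)

lemma tau_sigma: "f \<preceq> \<tau> \<Longrightarrow> f \<preceq> \<sigma>" by (rule dom_trans[OF _ \<tau>_dom(1)])

section \<open>From the translates to the complement of S\<close>

text \<open>By orthogonality of the eigenfunctions the defect is exactly the pairing of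
  \<open>w m i\<close> with \<open>s m j\<close>.\<close>

lemma gram:
  assumes i: "i \<in> {1..n}" and j: "j \<in> {1..n}"
  shows "(\<lambda>m. cmod ((if i = j then of_real N else 0) - (\<Sum>k=1..n. d m i k * L2_inner (ph m k) (s m j)))) \<preceq> \<sigma>"
proof (rule dom_le)
  fix m assume m: "m \<ge> m0"
  have "(if i = j then of_real N else 0) - (\<Sum>k=1..n. d m i k * L2_inner (ph m k) (s m j)) = L2_inner (w m i) (s m j)"
    using s_inner[OF m i s_L2[OF m j]] s_orth[OF m i j] by (simp add: algebra_simps)
  then show "cmod ((if i = j then of_real N else 0) - (\<Sum>k=1..n. d m i k * L2_inner (ph m k) (s m j))) \<le> sqrt N * L2_norm (w m i)"
    using L2_Cauchy_Schwarz[OF w_L2[OF m i] s_L2[OF m j]] by (simp add: s_norm[OF m j] mult.commute)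
qed (intro dom_cmult w_dom i, use N_pos in simp)

lemma frame: "m \<ge> m0 \<Longrightarrow> eigenframe c N n (V m) (s m) (\<nu> m)"
  by unfold_locales (auto simp: N_pos V_bp s_S s_A s_orth)

text \<open>A trace argument that avoids inverting the coefficient matrix. There are as many
  translates as eigenfunctions, so the squared distances of the translates from S and those of the
  eigenfunctions from the span of the translates have matching sums up to small errors; the latter
  are small because each eigenfunction is almost a combination of translates.\<close>

lemma Q_ph:
  assumes k: "k \<in> {1..n}" shows "(\<lambda>m. (L2_norm (Q m (ph m k)))\<^sup>2) \<preceq> \<sigma>"
proof -
  let ?a = "\<lambda>m i k. L2_inner (s m i) (ph m k)"
  let ?e = "\<lambda>m i k. ?a m i k - of_real N * d m i k"
  have gr: "(\<lambda>m. cmod (of_real N - (\<Sum>k=1..n. d m i k * cnj (?a m i k)))) \<preceq> \<sigma>" if i: "i \<in> {1..n}" for i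
    using gram[OF i i] by (simp add: L2_inner_cnj)
  have one: "(\<lambda>m. cmod (of_real (N\<^sup>2) - (\<Sum>k=1..n. ?a m i k * cnj (?a m i k)))) \<preceq> \<sigma>" if i: "i \<in> {1..n}" for i
  proof (rule dom_le)
    fix m assume m: "m \<ge> m0"
    have eq: "of_real (N\<^sup>2) - (\<Sum>k=1..n. ?a m i k * cnj (?a m i k)) =
        of_real N * (of_real N - (\<Sum>k=1..n. d m i k * cnj (?a m i k))) - (\<Sum>k=1..n. ?e m i k * cnj (?a m i k))"
      by (simp add: algebra_simps power2_eq_square sum_distrib_left sum_subtractf)
    show "cmod (of_real (N\<^sup>2) - (\<Sum>k=1..n. ?a m i k * cnj (?a m i k))) \<le>
        N * cmod (of_real N - (\<Sum>k=1..n. d m i k * cnj (?a m i k))) + (\<Sum>k=1..n. N * cmod (?e m i k))" unfolding eq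
    proof (rule order_trans[OF norm_triangle_ineq4], intro add_mono)
      show "cmod (\<Sum>k=1..n. ?e m i k * cnj (?a m i k)) \<le> (\<Sum>k=1..n. N * cmod (?e m i k))"
      proof (rule order_trans[OF norm_sum], rule sum_mono)
        fix k
        have "cmod (?a m i k) \<le> sqrt N * sqrt N" using L2_Cauchy_Schwarz[OF s_L2[OF m i], of "ph m k"] by (simp add: s_norm[OF m i] U1_norm)
        then have "cmod (?a m i k) \<le> N" using N_pos by simp
        then show "cmod (?e m i k * cnj (?a m i k)) \<le> N * cmod (?e m i k)"
          unfolding norm_mult complex_mod_cnj by (subst mult.commute) (intro mult_right_mono, auto)
      qed
    qed (use N_pos in \<open>simp add: norm_mult\<close>)
  qed (intro dom_add dom_cmult gr i dom_sum e_dom scale_pos, use N_pos in auto)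
  show ?thesis
  proof (rule dom_le)
    fix m assume m: "m \<ge> m0"
    interpret ef: eigenframe c N n "V m" "s m" "\<nu> m" by (rule frame[OF m])
    \<comment> \<open>Pythagoras for the frame, written with the coefficients of the
      translate.\<close>
    have nrm: "of_real ((L2_norm (Q m (ph m k)))\<^sup>2) = of_real N - (\<Sum>i=1..n. ?a m i k * cnj (?a m i k)) / of_real N" for k
    proof -
      have "of_real ((L2_norm (Q m (ph m k)))\<^sup>2) = L2_inner (Q m (ph m k)) (Q m (ph m k))" by (simp add: L2_inner_self)
      also have "\<dots> = L2_inner (ph m k) (Q m (ph m k))" by (rule ef.Q_inner[OF _ ef.Q_perp]) auto
      also have "\<dots> = L2_inner (ph m k) (ph m k) - L2_inner (ph m k) (ef.lc (ef.coef (ph m k)))"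
        unfolding ef.Q_def by (rule L2_inner_diff_right) (auto intro: ef.lc_L2)
      also have "L2_inner (ph m k) (ef.lc (ef.coef (ph m k))) = (\<Sum>i=1..n. L2_inner (ph m k) (\<lambda>x. ef.coef (ph m k) i * s m i x))"
        unfolding ef.lc_def by (rule L2_inner_sum_right) (auto intro!: L2_cmul s_L2 m)
      also have "\<dots> = (\<Sum>i=1..n. ?a m i k * cnj (?a m i k)) / of_real N"
        unfolding L2_inner_cmul_right by (simp add: ef.coef_def L2_inner_cnj sum_divide_distrib)
      finally show ?thesis by (simp add: ph_self)
    qed
    have "complex_of_real (\<Sum>k=1..n. (L2_norm (Q m (ph m k)))\<^sup>2) = (\<Sum>k=1..n. of_real N - (\<Sum>i=1..n. ?a m i k * cnj (?a m i k)) / of_real N)"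
      by (simp only: of_real_sum nrm)
    also have "\<dots> = of_real (real n * N) - (\<Sum>k=1..n. \<Sum>i=1..n. ?a m i k * cnj (?a m i k)) / of_real N"
      by (simp add: sum_subtractf sum_divide_distrib[symmetric])
    also have "(\<Sum>k=1..n. \<Sum>i=1..n. ?a m i k * cnj (?a m i k)) = (\<Sum>i=1..n. \<Sum>k=1..n. ?a m i k * cnj (?a m i k))" by (rule sum.swap)
    also have "of_real (real n * N) - (\<Sum>i=1..n. \<Sum>k=1..n. ?a m i k * cnj (?a m i k)) / of_real N =
        (\<Sum>i=1..n. of_real (N\<^sup>2) - (\<Sum>k=1..n. ?a m i k * cnj (?a m i k))) / of_real N"
      using N_pos by (simp add: sum_subtractf diff_divide_distrib power2_eq_square)
    finally have "complex_of_real (\<Sum>k=1..n. (L2_norm (Q m (ph m k)))\<^sup>2) =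
        (\<Sum>i=1..n. of_real (N\<^sup>2) - (\<Sum>k=1..n. ?a m i k * cnj (?a m i k))) / of_real N" .
    then have "cmod (complex_of_real (\<Sum>k=1..n. (L2_norm (Q m (ph m k)))\<^sup>2)) =
        cmod (\<Sum>i=1..n. of_real (N\<^sup>2) - (\<Sum>k=1..n. ?a m i k * cnj (?a m i k))) / N" using N_pos by (simp add: norm_divide)
    also have "\<dots> \<le> (\<Sum>i=1..n. cmod (of_real (N\<^sup>2) - (\<Sum>k=1..n. ?a m i k * cnj (?a m i k)))) / N"
      using N_pos by (intro divide_right_mono norm_sum) auto
    finally have "(\<Sum>k=1..n. (L2_norm (Q m (ph m k)))\<^sup>2) \<le> (1/N) * (\<Sum>i=1..n. cmod (of_real (N\<^sup>2) - (\<Sum>k=1..n. ?a m i k * cnj (?a m i k))))"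
      unfolding norm_of_real by (simp add: abs_of_nonneg sum_nonneg)
    moreover have "(L2_norm (Q m (ph m k)))\<^sup>2 \<le> (\<Sum>k=1..n. (L2_norm (Q m (ph m k)))\<^sup>2)" using k by (intro member_le_sum) auto
    ultimately show "(L2_norm (Q m (ph m k)))\<^sup>2 \<le> (1/N) * (\<Sum>i=1..n. cmod (of_real (N\<^sup>2) - (\<Sum>k=1..n. ?a m i k * cnj (?a m i k))))"
      by linarith
  qed (intro dom_cmult dom_sum one scale_pos, use N_pos in auto)
qed

text \<open>For f in the complement, the overlap with a translate is the overlap with its small
  projection, so the overlaps in \<open>coercive\<close> are absorbed.\<close>

lemma lower_large: "\<exists>K. \<forall>\<^sub>F m in sequentially. \<forall>f\<in>sobolev 4 \<inter> Sp m. L2_norm f \<le> K * L2_norm (A m f)"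
proof -
  obtain C where C: "C \<ge> 0" and ev: "\<forall>\<^sub>F m in sequentially. \<forall>f\<in>sobolev 4. L2_norm f \<le> C * (L2_norm (A m f) + (\<Sum>k=1..n. cmod (L2_inner f (ph m k))))"
    using coercive by blast
  \<comment> \<open>Small enough for the n overlaps together to take at most half of the norm of
    f.\<close>
  define h where "h = 1 / (2 * (C + 1) * real n)"
  have np: "real n > 0" using n by simp
  have h: "h > 0" "C * (real n * h) \<le> 1 / 2" using C np by (auto simp: h_def divide_simps)
  have "\<forall>\<^sub>F m in sequentially. \<forall>k\<in>{1..n}. (L2_norm (Q m (ph m k)))\<^sup>2 \<le> h\<^sup>2"
    by (intro eventually_ball_finite ballI dom_\<sigma>_small[OF Q_ph]) (use h in auto)
  then have "\<forall>\<^sub>F m in sequentially. \<forall>f\<in>sobolev 4 \<inter> Sp m. L2_norm f \<le> (2 * C) * L2_norm (A m f)" using ev ev_m0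
  proof eventually_elim
    case (elim m)
    interpret ef: eigenframe c N n "V m" "s m" "\<nu> m" by (rule frame[OF elim(3)])
    show ?case
    proof
      fix f assume f: "f \<in> sobolev 4 \<inter> Sp m"
      have fL: "f \<in> L2" using f sobolev_L2 by blast
      have "cmod (L2_inner f (ph m k)) \<le> h * L2_norm f" if k: "k \<in> {1..n}" for k
      proof -
        have "cmod (L2_inner f (ph m k)) = cmod (L2_inner (Q m (ph m k)) f)" using ef.Q_inner[of "ph m k" f] f by (simp add: cmod_L2_inner_commute[of f])
        also have "\<dots> \<le> L2_norm (Q m (ph m k)) * L2_norm f" by (rule L2_Cauchy_Schwarz[OF ef.Q_L2 fL]) simp
        also have "\<dots> \<le> h * L2_norm f" using elim(1) k h by (intro mult_right_mono) (auto intro: power2_le_imp_le)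
        finally show ?thesis .
      qed
      then have "(\<Sum>k=1..n. cmod (L2_inner f (ph m k))) \<le> (\<Sum>k=1..n. h * L2_norm f)" by (rule sum_mono)
      then have "C * (L2_norm (A m f) + (\<Sum>k=1..n. cmod (L2_inner f (ph m k)))) \<le> C * (L2_norm (A m f) + real n * (h * L2_norm f))"
        using C by (intro mult_left_mono) auto
      then have "L2_norm f \<le> C * L2_norm (A m f) + (C * (real n * h)) * L2_norm f" using elim(2) f by (auto simp: algebra_simps intro: order_trans)
      also have "\<dots> \<le> C * L2_norm (A m f) + 1/2 * L2_norm f" by (intro add_left_mono mult_right_mono h) simp
      finally show "L2_norm f \<le> (2 * C) * L2_norm (A m f)" by simp
    qed
  qed
  then show ?thesis by blast
qed

lemma V_eventually_small:
  assumes m: "m \<ge> m0" and e: "e > 0" shows "\<exists>R. \<forall>x. \<bar>x\<bar> > R \<longrightarrow> \<bar>exp (V m x) - 1\<bar> \<le> e"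
proof -
  have "((\<lambda>x. exp (V m x) - 1) \<longlongrightarrow> exp 0 - 1) at_top" "((\<lambda>x. exp (V m x) - 1) \<longlongrightarrow> exp 0 - 1) at_bot"
    by (intro tendsto_intros V_lim m)+
  then have "\<forall>\<^sub>F x in at_top. dist (exp (V m x) - 1) 0 < e" "\<forall>\<^sub>F x in at_bot. dist (exp (V m x) - 1) 0 < e"
    using e by (auto dest: tendstoD)
  then obtain R1 R2 where R: "\<And>x. x \<ge> R1 \<Longrightarrow> \<bar>exp (V m x) - 1\<bar> < e" "\<And>x. x \<le> R2 \<Longrightarrow> \<bar>exp (V m x) - 1\<bar> < e"
    by (auto simp: eventually_at_top_linorder eventually_at_bot_linorder)
  have "\<bar>exp (V m x) - 1\<bar> \<le> e" if "\<bar>x\<bar> > max R1 (- R2)" for x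
  proof (cases "x \<ge> 0")
    case True
    then show ?thesis using R(1)[of x] that by auto
  next
    case False
    then show ?thesis using R(2)[of x] that by auto
  qed
  then show ?thesis by blast
qed

text \<open>Compactness for a single m, with the constant sequence of potentials: \<open>V m\<close>
  tends to 0 at both ends, so one centre suffices, and a null vector orthogonal to
  \<open>s m n\<close> vanishes.\<close>

lemma lower_each: assumes m: "m \<ge> m0" shows "\<exists>K. \<forall>f\<in>sobolev 4 \<inter> Sp m. L2_norm f \<le> K * L2_norm (A m f)"
proof (rule ccontr)
  interpret ef: eigenframe c N n "V m" "s m" "\<nu> m" by (rule frame[OF m])
  assume a: "\<not> (\<exists>K. \<forall>f\<in>sobolev 4 \<inter> Sp m. L2_norm f \<le> K * L2_norm (A m f))"
  have "\<exists>f. f \<in> sobolev 4 \<and> f \<in> Sp m \<and> L2_norm f > real (Suc i) * L2_norm (A m f)" for i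
  proof (rule ccontr)
    assume "\<not> ?thesis"
    then have "\<forall>f\<in>sobolev 4 \<inter> Sp m. L2_norm f \<le> real (Suc i) * L2_norm (A m f)" by force
    with a show False by blast
  qed
  then obtain h where h: "\<And>i. h i \<in> sobolev 4" "\<And>i. h i \<in> Sp m" "\<And>i. L2_norm (h i) > real (Suc i) * L2_norm (A m (h i))" by metis
  show False
  proof (rule approximate_null_contradiction[where h=h and I="{0}" and W="\<lambda>_. V m" and q="\<lambda>_ _. 0" and ?W0.0="\<lambda>_. V m" and E="\<lambda>_. {s m n}" and B=BP, OF c(2)])
    have nn: "n \<in> {1..n}" using n by simp
    show "continuous_on UNIV (V m)" "continuous_on UNIV (V m)" by (rule V_cont[OF m])+
    show "\<bar>exp (V m x) - 1\<bar> \<le> BP" for x by (rule pot_bound(2)[OF m])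
    show "e \<in> L2" if "e \<in> {s m n}" for e using that s_L2[OF m nn] by simp
    show "real (Suc i) * cmod (L2_inner (h i) (\<lambda>x. e (x - 0))) \<le> L2_norm (h i)" if "e \<in> {s m n}" for i e
      using that ef.perpD(2)[OF h(2) nn] by simp
    show "g =\<^sub>2 (\<lambda>x. 0)" if "g \<in> sobolev 4" "A m g =\<^sub>2 (\<lambda>x. 0)" "\<And>e. e \<in> {s m n} \<Longrightarrow> L2_inner g e = 0" for g
      by (rule ker[OF m that(1,2)]) (rule that(3), simp)
    show "\<exists>R. \<forall>\<^sub>F i in sequentially. \<forall>x. (\<forall>k\<in>{0::nat}. \<bar>x - 0\<bar> > R) \<longrightarrow> \<bar>exp (V m x) - 1\<bar> \<le> e" if "e > 0" for e
      using V_eventually_small[OF m that] by auto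
  qed (use h in auto)
qed

definition B where "B = ellip c * ((Cr + BP) * sqrt N)"

lemma s_deriv_norm:
  assumes m: "m \<ge> m0" and i: "i \<in> {1..n}" shows "L2_norm (weak_deriv 1 (s m i)) \<le> B"
proof -
  have "L2_norm (weak_deriv 1 (s m i)) \<le> ellip c * (L2_norm (A m (s m i)) + BP * L2_norm (s m i))" using elliptic_V[OF m s_S[OF m i], of 1] by simp
  also have "L2_norm (A m (s m i)) = \<bar>\<nu> m i\<bar> * sqrt N" using L2_norm_cong[OF s_A[OF m i]] lin_op_L2[OF s_S[OF m i] V_bp[OF m]] s_L2[OF m i]
    by (simp add: L2_cmul L2_norm_cmul s_norm[OF m i])
  also have "ellip c * (\<bar>\<nu> m i\<bar> * sqrt N + BP * L2_norm (s m i)) \<le> ellip c * (Cr * sqrt N + BP * sqrt N)"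
  proof (intro mult_left_mono add_mono mult_right_mono)
    have "\<bar>\<nu> m i\<bar> \<le> Cr * (\<sigma> m * \<sigma> m)" by (rule nu_bound[OF m i])
    also have "\<dots> \<le> Cr * 1" using scales[OF m] Cr by (intro mult_left_mono mult_le_one) auto
    finally show "\<bar>\<nu> m i\<bar> \<le> Cr" by simp
  qed (use s_norm[OF m i] BP N_pos ellip_ge_1[OF c(2)] in auto)
  finally show ?thesis by (simp add: B_def algebra_simps)
qed

lemma B: "B \<ge> 0"
  using order_trans[OF L2_norm_nonneg s_deriv_norm[of m0 1]] n by simp

lemma frame_ex: "\<exists>K. \<forall>m\<ge>m0. krein_frame c N n (V m) (s m) (\<nu> m) K B"
proof -
  have "\<exists>K>0. \<forall>m\<ge>m0. \<forall>f\<in>sobolev 4 \<inter> Sp m. L2_norm f \<le> K * L2_norm (A m f)"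
  proof -
    obtain K0 where K0: "\<forall>\<^sub>F m in sequentially. \<forall>f\<in>sobolev 4 \<inter> Sp m. L2_norm f \<le> K0 * L2_norm (A m f)"
      using lower_large by blast
    show ?thesis
    proof (rule eventually_ex_uniform[OF _ lower_each K0])
      fix m K K' assume a: "\<forall>f\<in>sobolev 4 \<inter> Sp m. L2_norm f \<le> K * L2_norm (A m f)" and "K \<le> (K'::real)"
      then show "\<forall>f\<in>sobolev 4 \<inter> Sp m. L2_norm f \<le> K' * L2_norm (A m f)" using mult_right_mono[OF _ L2_norm_nonneg] order_trans by blast
    qed
  qed
  then obtain K where K: "K > 0" "\<And>m f. m \<ge> m0 \<Longrightarrow> f \<in> sobolev 4 \<Longrightarrow> f \<in> Sp m \<Longrightarrow> L2_norm f \<le> K * L2_norm (A m f)"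
    by blast
  have e1: "ellip c \<ge> 1" by (rule ellip_ge_1[OF c(2)])
  \<comment> \<open>Ellipticity extends the bound from f to its four derivatives at the price of
    this larger constant.\<close>
  have "krein_frame c N n (V m) (s m) (\<nu> m) (ellip c * (1 + BP * K)) B" if m: "m \<ge> m0" for m
  proof -
    interpret ef: eigenframe c N n "V m" "s m" "\<nu> m" by (rule frame[OF m])
    show ?thesis
    proof unfold_locales
      show "0 < ellip c * (1 + BP * K)" using e1 BP K by (intro mult_pos_pos add_pos_nonneg mult_nonneg_nonneg) auto
      show "L2_norm (if j = 0 then f else weak_deriv j f) \<le> ellip c * (1 + BP * K) * L2_norm (A m f)"
        if f: "f \<in> sobolev 4" "f \<in> Sp m" "j \<in> {0, 1, 2, 3, 4}" for f j
      proof -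
        have "ellip c * (L2_norm (A m f) + BP * L2_norm f) \<le> ellip c * (L2_norm (A m f) + BP * (K * L2_norm (A m f)))"
          using e1 BP by (intro mult_left_mono add_left_mono K m f) auto
        then show ?thesis using elliptic_V[OF m f(1,3)] by (simp add: algebra_simps)
      qed
    qed (use B s_deriv_norm[OF m] res[OF m] in auto)
  qed
  then show ?thesis by blast
qed

definition KK where "KK = (SOME K. \<forall>m\<ge>m0. krein_frame c N n (V m) (s m) (\<nu> m) K B)"

lemma frame_KK: "m \<ge> m0 \<Longrightarrow> krein_frame c N n (V m) (s m) (\<nu> m) KK B"
  using someI_ex[OF frame_ex] unfolding KK_def by blast

section \<open>Pairings of the eigenfunctions with their derivatives\<close>

text \<open>The limit of the pairing of s_i' with f_j. The factor - 4 c^2 of the second-order term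
  turns it into - 2 c kap, which together with - N is d''(c).\<close>

abbreviation lim_coef :: "nat \<Rightarrow> nat \<Rightarrow> complex" where "lim_coef i j \<equiv> (if i = j then of_real (kap / (2 * c)) else 0)"
abbreviation "ds m i \<equiv> weak_deriv 1 (s m i)"
abbreviation "dw m i \<equiv> weak_deriv 1 (w m i)"

lemma wd_s: "m \<ge> m0 \<Longrightarrow> i \<in> {1..n} \<Longrightarrow> wd (s m i) (ds m i)" "m \<ge> m0 \<Longrightarrow> i \<in> {1..n} \<Longrightarrow> wd (w m i) (dw m i)"
  using sobolev_H4[OF s_S] sobolev_H4[OF w_S] by (auto simp: H4_def)

lemma ds_L2 [simp]: "m \<ge> m0 \<Longrightarrow> i \<in> {1..n} \<Longrightarrow> ds m i \<in> L2" "m \<ge> m0 \<Longrightarrow> i \<in> {1..n} \<Longrightarrow> dw m i \<in> L2"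
  using wd_L2(2)[OF wd_s(1)] wd_L2(2)[OF wd_s(2)] by auto

lemma wd_ph: "wd (ph m k) (ps m k)" using H4_U by (simp add: H4_def)

lemma ds_eq: assumes m: "m \<ge> m0" and i: "i \<in> {1..n}" shows "ds m i =\<^sub>2 (\<lambda>x. (\<Sum>k=1..n. d m i k * ps m k x) + dw m i x)"
proof (rule wd_unique[OF wd_s(1)[OF m i]])
  show "wd (s m i) (\<lambda>x. (\<Sum>k=1..n. d m i k * ps m k x) + dw m i x)" by (subst s_eq) (intro wd_add wd_sum wd_cmul wd_ph wd_s m i)
qed

lemma ds_inner:
  assumes m: "m \<ge> m0" and i: "i \<in> {1..n}" and g: "g \<in> L2"
  shows "L2_inner (ds m i) g = (\<Sum>k=1..n. d m i k * L2_inner (ps m k) g) + L2_inner (dw m i) g"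
proof -
  have L: "(\<lambda>y. \<Sum>k=1..n. d m i k * ps m k y) \<in> L2" by (auto intro!: L2_sum L2_cmul)
  have "L2_inner (ds m i) g = L2_inner (\<lambda>x. (\<Sum>k=1..n. d m i k * ps m k x) + dw m i x) g"
    by (intro L2_inner_cong ds_eq m i L2_eq_refl g ds_L2 L2_add L)
  also have "\<dots> = L2_inner (\<lambda>y. \<Sum>k=1..n. d m i k * ps m k y) g + L2_inner (dw m i) g" by (rule L2_inner_add_left[OF L ds_L2(2)[OF m i] g])
  also have "L2_inner (\<lambda>y. \<Sum>k=1..n. d m i k * ps m k y) g = (\<Sum>k=1..n. L2_inner (\<lambda>y. d m i k * ps m k y) g)"
    by (rule L2_inner_sum_left) (auto intro!: L2_cmul g)
  finally show ?thesis by (simp add: L2_inner_cmul_left)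
qed

text \<open>On the localized part of s_j' the quadratic supremum bound of w_i applies; on the
  derivative of the remainder two norms of order \<open>\<sigma>\<close> multiply.\<close>

lemma w_ds_dom:
  assumes i: "i \<in> {1..n-1}" and j: "j \<in> {1..n}" shows "(\<lambda>m. cmod (L2_inner (ds m j) (w m i))) \<preceq> \<tau>" (is "?L \<preceq> _")
proof -
  have i': "i \<in> {1..n}" using i by auto
  have 1: "(\<lambda>m. cmod (L2_inner (ps m k) (w m i))) \<preceq> \<tau>" for k by (subst cmod_L2_inner_commute) (rule w_sh_dom_less[OF i], simp)
  have R: "(\<lambda>m. cmod (\<Sum>k=1..n. d m j k * L2_inner (ps m k) (w m i)) + L2_norm (dw m j) * L2_norm (w m i)) \<preceq> \<tau>" (is "?R \<preceq> _")
    by (intro dom_add dom_d_sum(1) 1 j order_refl scale_pos dom_tau w_dom i') simp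
  show ?thesis
  proof (rule dom_le[OF _ R])
    fix m assume m: "m \<ge> m0"
    have "L2_inner (ds m j) (w m i) = (\<Sum>k=1..n. d m j k * L2_inner (ps m k) (w m i)) + L2_inner (dw m j) (w m i)" by (rule ds_inner[OF m j w_L2[OF m i']])
    then have "cmod (L2_inner (ds m j) (w m i)) \<le> cmod (\<Sum>k=1..n. d m j k * L2_inner (ps m k) (w m i)) + cmod (L2_inner (dw m j) (w m i))"
      by (simp only: norm_triangle_ineq)
    also have "\<dots> \<le> ?R m" by (intro add_left_mono L2_Cauchy_Schwarz ds_L2 w_L2 m i' j)
    finally show "?L m \<le> ?R m" .
  qed
qed

text \<open>The diagonal term vanishes because U' and U'' are orthogonal, and the others are
  overlaps of distinct pulses. The derivative of the remainder is moved onto U'', where the sharper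
  bound for j < n is available.\<close>

lemma ph_ds_less:
  assumes j: "j \<in> {1..n-1}" and k: "k \<in> {1..n}" shows "(\<lambda>m. cmod (L2_inner (ph m k) (ds m j))) \<preceq> \<tau>" (is "?L \<preceq> _")
proof -
  have j': "j \<in> {1..n}" using j by auto
  have R: "(\<lambda>m. cmod (\<Sum>l\<in>{1..n}-{k}. d m j l * L2_inner (ps m l) (ph m k)) + cmod (L2_inner (w m j) (ps m k))) \<preceq> \<tau>" (is "?R \<preceq> _")
    by (intro dom_add dom_d_sum(1) j' scale_pos cross_dom(1) w_sh_dom_less j) (use k in auto)
  show ?thesis
  proof (rule dom_le[OF _ R])
    fix m assume m: "m \<ge> m0"
    have "L2_inner (ds m j) (ph m k) = (\<Sum>l=1..n. d m j l * L2_inner (ps m l) (ph m k)) + L2_inner (dw m j) (ph m k)" by (rule ds_inner[OF m j']) simp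
    also have "L2_inner (dw m j) (ph m k) = - L2_inner (w m j) (ps m k)" by (rule wd_by_parts[OF wd_s(2)[OF m j'] wd_ph])
    also have "(\<Sum>l=1..n. d m j l * L2_inner (ps m l) (ph m k)) = (\<Sum>l\<in>{1..n}-{k}. d m j l * L2_inner (ps m l) (ph m k))"
    proof -
      have "L2_inner (ps m k) (ph m k) = 0" using U1_U2_inner[of "p m k"] L2_inner_cnj[of "ph m k" "ps m k"] by simp
      then show ?thesis using k by (simp add: sum.remove[of _ k])
    qed
    finally show "?L m \<le> ?R m" unfolding cmod_L2_inner_commute[of "ph m k"] using norm_triangle_ineq4 by simp
  qed
qed

text \<open>The diagonal overlap with the potential error is tested by pairing the equation for the remainder with \<open>\<partial>\<^sub>cU\<close>.\<close>
lemma d_qf_dom: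
  assumes i: "i \<in> {1..n-1}" and k: "k \<in> {1..n}"
  shows "(\<lambda>m. cmod (d m i k) * cmod (L2_inner (qf m k U1) (Dm m k))) \<preceq> \<tau>" (is "?L \<preceq> _")
proof -
  have i': "i \<in> {1..n}" using i by auto
  have R: "(\<lambda>m. (Cr * sqrt N * C1 * NE) * (\<sigma> m * \<sigma> m) +
      (2 * c) * cmod (L2_inner (w m i) (ps m k)) + cmod (L2_inner (w m i) (qf m k D)) + cmod (\<Sum>l\<in>{1..n}-{k}. d m i l * L2_inner (qf m l U1) (Dm m k))) \<preceq> \<tau>" (is "?R \<preceq> _")
    by (intro dom_add dom_cmult \<tau>_dom w_sh_dom_less w_qf_dom dom_d_sum(1) i i' k scale_pos cross_dom(2)) (use k Cr N_pos C1 consts_nonneg c in auto)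
  show ?thesis
  proof (rule dom_le[OF _ R])
    fix m assume m: "m \<ge> m0"
    have DL: "Dm m k \<in> L2" by simp
    have L: "(\<lambda>y. \<Sum>l=1..n. d m i l * qf m l U1 y) \<in> L2" "(\<lambda>y. of_real (\<nu> m i) * s m i y) \<in> L2"
      "(\<lambda>x. - 2 * of_real c * ps m k x + qf m k D x) \<in> L2" by (auto intro!: L2_sum L2_cmul L2_add qf_L2 s_L2 m i' k)
    have "L2_inner (A m (w m i)) (Dm m k) = L2_inner (\<lambda>y. of_real (\<nu> m i) * s m i y - (\<Sum>l=1..n. d m i l * qf m l U1 y)) (Dm m k)"
      by (intro L2_inner_cong A_w m i' L2_eq_refl lin_op_L2 w_S V_bp DL L2_diff L)
    also have "\<dots> = of_real (\<nu> m i) * L2_inner (s m i) (Dm m k) - L2_inner (\<lambda>y. \<Sum>l=1..n. d m i l * qf m l U1 y) (Dm m k)"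
      by (simp only: L2_inner_diff_left[OF L(2,1) DL] L2_inner_cmul_left)
    also have "L2_inner (\<lambda>y. \<Sum>l=1..n. d m i l * qf m l U1 y) (Dm m k) = (\<Sum>l=1..n. L2_inner (\<lambda>y. d m i l * qf m l U1 y) (Dm m k))"
      by (rule L2_inner_sum_left) (auto intro!: L2_cmul qf_L2 m)
    also have "\<dots> = d m i k * L2_inner (qf m k U1) (Dm m k) + (\<Sum>l\<in>{1..n}-{k}. d m i l * L2_inner (qf m l U1) (Dm m k))"
      using k by (simp add: L2_inner_cmul_left sum.remove[of _ k])
    finally have 1: "L2_inner (A m (w m i)) (Dm m k) = of_real (\<nu> m i) * L2_inner (s m i) (Dm m k) -
        (d m i k * L2_inner (qf m k U1) (Dm m k) + (\<Sum>l\<in>{1..n}-{k}. d m i l * L2_inner (qf m l U1) (Dm m k)))" .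
    \<comment> \<open>The same pairing with A moved to the other side, where it produces - 2 c U''
      and a potential error; against w_i with i < n both are of order \<open>\<tau>\<close>.\<close>
    have "L2_inner (A m (w m i)) (Dm m k) = L2_inner (w m i) (A m (Dm m k))" by (rule lin_op_symmetric[OF w_S[OF m i'] D_sobolev V_bp[OF m]])
    also have "\<dots> = L2_inner (w m i) (\<lambda>x. - 2 * of_real c * ps m k x + qf m k D x)"
      by (intro L2_inner_cong A_Dm m L2_eq_refl w_L2 i' lin_op_L2 D_sobolev V_bp L)
    also have "\<dots> = cnj (- 2 * of_real c) * L2_inner (w m i) (ps m k) + L2_inner (w m i) (qf m k D)"
      unfolding L2_inner_cmul_right[symmetric] by (rule L2_inner_add_right) (auto intro!: L2_cmul qf_L2 w_L2 m i' k)
    finally have "d m i k * L2_inner (qf m k U1) (Dm m k) = of_real (\<nu> m i) * L2_inner (s m i) (Dm m k) +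
        2 * of_real c * L2_inner (w m i) (ps m k) - L2_inner (w m i) (qf m k D) - (\<Sum>l\<in>{1..n}-{k}. d m i l * L2_inner (qf m l U1) (Dm m k))"
      unfolding 1 by (simp add: algebra_simps)
    then have "cmod (d m i k * L2_inner (qf m k U1) (Dm m k)) \<le> cmod (of_real (\<nu> m i) * L2_inner (s m i) (Dm m k)) +
        cmod (2 * of_real c * L2_inner (w m i) (ps m k)) + cmod (L2_inner (w m i) (qf m k D)) + cmod (\<Sum>l\<in>{1..n}-{k}. d m i l * L2_inner (qf m l U1) (Dm m k))"
      by (simp only:) (intro order_trans[OF norm_triangle_ineq4] order_trans[OF norm_triangle_ineq] add_mono order_refl)
    also have "cmod (of_real (\<nu> m i) * L2_inner (s m i) (Dm m k)) \<le> (Cr * (\<sigma> m * \<sigma> m)) * (sqrt N * (C1 * NE))"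
    proof -
      have "cmod (L2_inner (s m i) (Dm m k)) \<le> sqrt N * (C1 * NE)" using L2_Cauchy_Schwarz[OF s_L2[OF m i'] DL] sh_L2(2)[of D "p m k"] N_pos
        by (simp add: s_norm[OF m i']) (meson mult_left_mono order_trans real_sqrt_ge_zero less_imp_le)
      then show ?thesis unfolding norm_mult norm_of_real by (intro mult_mono nu_bound m i') (use Cr scale_pos in auto)
    qed
    finally show "?L m \<le> ?R m" using c(1) by (simp add: norm_mult algebra_simps)
  qed
qed

text \<open>The critical entry, since s_n is known only to order \<open>\<sigma>\<close>. Pairing A
  s_n = 0 with the c-derivative at peak k expresses <U', s_n'> by the pairing of s_n with a
  potential error. Its diagonal part is the quantity of \<open>d_qf_dom\<close>, which is small only
  together with the coefficient \<open>d m i k\<close>; hence this factor in the statement.\<close>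

lemma ph_ds_n:
  assumes i: "i \<in> {1..n-1}" and k: "k \<in> {1..n}"
  shows "(\<lambda>m. cmod (d m i k * L2_inner (ph m k) (ds m n))) \<preceq> \<tau>" (is "?L \<preceq> _")
proof -
  have i': "i \<in> {1..n}" and nn: "n \<in> {1..n}" using i n by auto
  have x: "(\<lambda>m. cmod (L2_inner (ph m l) (qf m k D))) \<preceq> \<tau>" if "l \<in> {1..n} - {k}" for l
    by (subst cmod_L2_inner_commute) (rule cross_dom(2), use that k in auto)
  have R: "(\<lambda>m. (1 / (2 * c)) * (cmod (d m n k) * (cmod (d m i k) * cmod (L2_inner (qf m k U1) (Dm m k))) +
      cmod (d m i k) * (cmod (\<Sum>l\<in>{1..n}-{k}. d m n l * L2_inner (ph m l) (qf m k D)) + cmod (L2_inner (w m n) (qf m k D))))) \<preceq> \<tau>" (is "?R \<preceq> _")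
    by (intro dom_cmult dom_add dom_mult_bounded d_dom d_qf_dom dom_d_sum(1) w_qf_dom x i i' nn k scale_pos) (use c in auto)
  show ?thesis
  proof (rule dom_le[OF _ R])
    fix m assume m: "m \<ge> m0"
    have sL: "s m n \<in> L2" by (rule s_L2[OF m nn])
    have qL: "qf m k D \<in> L2" by (rule qf_L2[OF m k]) simp
    have "0 = L2_inner (Dm m k) (A m (s m n))"
    proof -
      have "A m (s m n) =\<^sub>2 (\<lambda>x. 0)" using s_A[OF m nn] nu(2)[OF m] by simp
      then have "L2_inner (Dm m k) (A m (s m n)) = L2_inner (Dm m k) (\<lambda>x. 0)" by (intro L2_inner_cong L2_eq_refl lin_op_L2 s_S m nn V_bp L2_zero) auto
      then show ?thesis by simp
    qed
    also have "\<dots> = L2_inner (A m (Dm m k)) (s m n)" by (rule lin_op_symmetric[OF D_sobolev s_S[OF m nn] V_bp[OF m], symmetric])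
    also have "\<dots> = L2_inner (\<lambda>x. - 2 * of_real c * ps m k x + qf m k D x) (s m n)"
      by (intro L2_inner_cong A_Dm m L2_eq_refl sL lin_op_L2 D_sobolev V_bp L2_add L2_cmul qL) auto
    also have "\<dots> = - 2 * of_real c * L2_inner (ps m k) (s m n) + L2_inner (qf m k D) (s m n)"
      unfolding L2_inner_cmul_left[symmetric] by (rule L2_inner_add_left) (auto intro!: L2_cmul qL sL)
    also have "L2_inner (ps m k) (s m n) = - L2_inner (ph m k) (ds m n)" by (rule wd_by_parts[OF wd_ph wd_s(1)[OF m nn]])
    finally have "2 * of_real c * L2_inner (ph m k) (ds m n) = - L2_inner (qf m k D) (s m n)" by (simp add: algebra_simps add_eq_0_iff)
    then have e1: "L2_inner (ph m k) (ds m n) = - (1 / (2 * of_real c)) * L2_inner (qf m k D) (s m n)" using c(1) by (simp add: field_simps)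
    have e2: "cmod (L2_inner (qf m k D) (s m n)) \<le> cmod (d m n k) * cmod (L2_inner (qf m k U1) (Dm m k)) +
        cmod (\<Sum>l\<in>{1..n}-{k}. d m n l * L2_inner (ph m l) (qf m k D)) + cmod (L2_inner (w m n) (qf m k D))"
    proof -
      have "L2_inner (s m n) (qf m k D) = (\<Sum>l=1..n. d m n l * L2_inner (ph m l) (qf m k D)) + L2_inner (w m n) (qf m k D)" by (rule s_inner[OF m nn qL])
      also have "(\<Sum>l=1..n. d m n l * L2_inner (ph m l) (qf m k D)) =
          d m n k * L2_inner (ph m k) (qf m k D) + (\<Sum>l\<in>{1..n}-{k}. d m n l * L2_inner (ph m l) (qf m k D))" using k by (simp add: sum.remove[of _ k])
      \<comment> \<open>The potential error is a real factor and may be moved from one argument to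
        the other.\<close>
      also have "L2_inner (ph m k) (qf m k D) = L2_inner (qf m k U1) (Dm m k)"
        unfolding L2_inner_def by (rule Bochner_Integration.integral_cong) (auto simp: qf_def sh_def)
      finally show ?thesis unfolding cmod_L2_inner_commute[of _ "s m n"]
        by (simp only: norm_mult[symmetric]) (intro order_trans[OF norm_triangle_ineq] add_mono order_refl)
    qed
    have "cmod (d m i k * L2_inner (ph m k) (ds m n)) = (1 / (2 * c)) * (cmod (d m i k) * cmod (L2_inner (qf m k D) (s m n)))"
      unfolding e1 using c(1) by (simp add: norm_mult norm_divide)
    also have "\<dots> \<le> (1 / (2 * c)) * (cmod (d m i k) * (cmod (d m n k) * cmod (L2_inner (qf m k U1) (Dm m k)) +
        cmod (\<Sum>l\<in>{1..n}-{k}. d m n l * L2_inner (ph m l) (qf m k D)) + cmod (L2_inner (w m n) (qf m k D))))"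
      using c(1) by (intro mult_left_mono e2) auto
    finally show "?L m \<le> ?R m" by (simp add: algebra_simps)
  qed
qed

text \<open>For i < n the decomposition of s_i is inserted. For i = n and j < n integration by parts
  exchanges the two indices. For i = j = n the pairing vanishes because s_n is a multiple of a real
  function.\<close>

lemma b_dom:
  assumes i: "i \<in> {1..n}" and j: "j \<in> {1..n}" shows "(\<lambda>m. cmod (L2_inner (s m i) (ds m j))) \<preceq> \<tau>"
proof -
  have less: "(\<lambda>m. cmod (L2_inner (s m i) (ds m j))) \<preceq> \<tau>" if i: "i \<in> {1..n-1}" and j: "j \<in> {1..n}" for i j
  proof (rule dom_le)
    have i': "i \<in> {1..n}" using i by auto
    fix m assume m: "m \<ge> m0"
    have "L2_inner (s m i) (ds m j) = (\<Sum>k=1..n. d m i k * L2_inner (ph m k) (ds m j)) + L2_inner (w m i) (ds m j)"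
      by (rule s_inner[OF m i' ds_L2(1)[OF m j]])
    then have "cmod (L2_inner (s m i) (ds m j)) \<le> cmod (\<Sum>k=1..n. d m i k * L2_inner (ph m k) (ds m j)) + cmod (L2_inner (w m i) (ds m j))"
      by (simp only: norm_triangle_ineq)
    also have "\<dots> \<le> (\<Sum>k=1..n. cmod (d m i k * L2_inner (ph m k) (ds m j))) + cmod (L2_inner (ds m j) (w m i))"
      unfolding cmod_L2_inner_commute[of "w m i"] by (intro add_right_mono norm_sum)
    finally show "cmod (L2_inner (s m i) (ds m j)) \<le> (\<Sum>k=1..n. cmod (d m i k * L2_inner (ph m k) (ds m j))) + cmod (L2_inner (ds m j) (w m i))" .
  next
    have i': "i \<in> {1..n}" using i by auto
    have "(\<lambda>m. cmod (d m i k * L2_inner (ph m k) (ds m j))) \<preceq> \<tau>" if k: "k \<in> {1..n}" for k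
    proof (cases "j = n")
      case True then show ?thesis using ph_ds_n[OF i k] by simp
    next
      case False
      then have "j \<in> {1..n-1}" using j by auto
      then show ?thesis unfolding norm_mult by (intro dom_mult_bounded d_dom i' k ph_ds_less) auto
    qed
    then show "(\<lambda>m. (\<Sum>k=1..n. cmod (d m i k * L2_inner (ph m k) (ds m j))) + cmod (L2_inner (ds m j) (w m i))) \<preceq> \<tau>"
      by (intro dom_add dom_sum w_ds_dom i j scale_pos)
  qed
  consider "i \<in> {1..n-1}" | "i = n" "j \<in> {1..n-1}" | "i = n" "j = n" using i j by fastforce
  then show ?thesis
  proof cases
    case 1 then show ?thesis using less j by blast
  next
    case 2
    have "cmod (L2_inner (s m i) (ds m j)) \<le> cmod (L2_inner (s m j) (ds m i))" if m: "m \<ge> m0" for m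
      using wd_by_parts[OF wd_s(1)[OF m i] wd_s(1)[OF m j]] by (simp add: cmod_L2_inner_commute[of "s m j"])
    then show ?thesis using less[OF 2(2) i] by (rule dom_le)
  next
    case 3
    have nn: "n \<in> {1..n}" using n by simp
    have "L2_inner (s m n) (ds m n) = 0" if m: "m \<ge> m0" for m
    proof -
      obtain b where b: "s m n =\<^sub>2 (\<lambda>y. b * cfun (V1 m) y)" using s_n[OF m] by blast
      define g where "g = weak_deriv 1 (cfun (V1 m))"
      have g: "wd (cfun (V1 m)) g" using sobolev_H4[OF V1[OF m]] by (simp add: H4_def g_def)
      have L: "(\<lambda>y. b * cfun (V1 m) y) \<in> L2" "(\<lambda>y. b * g y) \<in> L2" using wd_L2[OF g] by (auto intro: L2_cmul)
      have "wd (s m n) (\<lambda>y. b * g y)" by (rule wd_cong[OF wd_cmul[OF g] L2_eq_sym[OF b] L2_eq_refl s_L2[OF m nn] L(2)])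
      then have "ds m n =\<^sub>2 (\<lambda>y. b * g y)" by (rule wd_unique[OF wd_s(1)[OF m nn]])
      then have "L2_inner (s m n) (ds m n) = L2_inner (\<lambda>y. b * cfun (V1 m) y) (\<lambda>y. b * g y)" by (intro L2_inner_cong b s_L2 ds_L2 m nn L)
      then show ?thesis using real_by_parts_zero[OF g] by (simp add: L2_inner_cmul_left L2_inner_cmul_right)
    qed
    then show ?thesis unfolding 3 by (intro dom_ev[of 0]) auto
  qed
qed

section \<open>The second-order coefficient\<close>

definition f0 where
  "f0 m j = (SOME f. f \<in> sobolev 4 \<and> f \<in> Sp m \<and> A m f =\<^sub>2 Q m (ds m j))"

lemma f0:
  assumes m: "m \<ge> m0" and j: "j \<in> {1..n}"
  shows "f0 m j \<in> sobolev 4" "f0 m j \<in> Sp m" "A m (f0 m j) =\<^sub>2 Q m (ds m j)"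
proof -
  interpret kf: krein_frame c N n "V m" "s m" "\<nu> m" KK B by (rule frame_KK[OF m])
  obtain f where "f \<in> sobolev 4" "f \<in> Sp m" "A m f =\<^sub>2 Q m (ds m j)" using kf.A_solution[OF kf.Q_perp[OF ds_L2(1)[OF m j]]] by blast
  then have "\<exists>f. f \<in> sobolev 4 \<and> f \<in> Sp m \<and> A m f =\<^sub>2 Q m (ds m j)" by blast
  from someI_ex[OF this] show "f0 m j \<in> sobolev 4" "f0 m j \<in> Sp m" "A m (f0 m j) =\<^sub>2 Q m (ds m j)" unfolding f0_def by blast+
qed

text \<open>Since \<open>A(U) \<partial>\<^sub>cU = -2cU''\<close>, this is an approximate preimage of \<open>s\<^sub>j'\<close>.\<close>
definition g0 where "g0 m j = (\<lambda>y. - (1 / (2 * of_real c)) * (\<Sum>l=1..n. d m j l * Dm m l y))"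

lemma g0_S: "g0 m j \<in> sobolev 4"
  unfolding g0_def by (intro sobolev_cmul sobolev_sum D_sobolev)

lemma g0_norm: assumes "j \<in> {1..n}" shows "(\<lambda>m. L2_norm (g0 m j)) \<preceq> (\<lambda>_. 1)" (is "?L \<preceq> _")
proof -
  have R: "(\<lambda>m. (1 / (2 * c)) * (\<Sum>l=1..n. cmod (d m j l) * (C1 * NE))) \<preceq> (\<lambda>_. 1)" (is "?R \<preceq> _")
    by (intro dom_cmult dom_sum dom_mult_bounded d_dom assms dom_ev[of "C1 * NE"]) (use c C1 consts_nonneg in auto)
  show ?thesis
  proof (rule dom_le[OF _ R])
    fix m assume m: "m \<ge> m0"
    have "L2_norm (g0 m j) = (1 / (2 * c)) * L2_norm (\<lambda>y. \<Sum>l=1..n. d m j l * Dm m l y)"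
      unfolding g0_def L2_norm_cmul using c(1) by (simp add: norm_divide norm_mult)
    also have "\<dots> \<le> (1 / (2 * c)) * (\<Sum>l=1..n. L2_norm (\<lambda>y. d m j l * Dm m l y))"
      using c(1) by (intro mult_left_mono L2_norm_sum) (auto intro!: L2_cmul)
    also have "\<dots> \<le> ?R m" unfolding L2_norm_cmul using c(1) by (intro mult_left_mono sum_mono sh_L2) auto
    finally show "?L m \<le> ?R m" .
  qed
qed

lemma A_g0:
  assumes m: "m \<ge> m0" and j: "j \<in> {1..n}"
  shows "(\<lambda>y. ds m j y - A m (g0 m j) y) =\<^sub>2 (\<lambda>y. dw m j y + (1 / (2 * of_real c)) * (\<Sum>l=1..n. d m j l * qf m l D y))"
proof -
  have F: "(\<lambda>y. \<Sum>l=1..n. d m j l * Dm m l y) \<in> sobolev 4" by (intro sobolev_sum sobolev_cmul D_sobolev)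
  have "A m (g0 m j) =\<^sub>2 (\<lambda>y. - (1 / (2 * of_real c)) * A m (\<lambda>y. \<Sum>l=1..n. d m j l * Dm m l y) y)"
    unfolding g0_def using lin_op_linear(3)[OF F F] .
  also have "\<dots> =\<^sub>2 (\<lambda>y. - (1 / (2 * of_real c)) * (\<Sum>l=1..n. A m (\<lambda>y. d m j l * Dm m l y) y))"
    by (intro L2_eq_mult lin_op_sum sobolev_cmul D_sobolev)
  also have "\<dots> =\<^sub>2 (\<lambda>y. - (1 / (2 * of_real c)) * (\<Sum>l=1..n. d m j l * A m (Dm m l) y))"
    by (intro L2_eq_mult L2_eq_sum lin_op_linear(3)[OF D_sobolev D_sobolev])
  also have "\<dots> =\<^sub>2 (\<lambda>y. - (1 / (2 * of_real c)) * (\<Sum>l=1..n. d m j l * (- 2 * of_real c * ps m l y + qf m l D y)))"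
    by (intro L2_eq_mult L2_eq_sum A_Dm m)
  finally have 1: "A m (g0 m j) =\<^sub>2 (\<lambda>y. - (1 / (2 * of_real c)) * (\<Sum>l=1..n. d m j l * (- 2 * of_real c * ps m l y + qf m l D y)))" .
  have "(\<lambda>y. ds m j y - A m (g0 m j) y) =\<^sub>2 (\<lambda>y. ((\<Sum>l=1..n. d m j l * ps m l y) + dw m j y) -
      - (1 / (2 * of_real c)) * (\<Sum>l=1..n. d m j l * (- 2 * of_real c * ps m l y + qf m l D y)))" by (intro L2_eq_diff ds_eq m j 1)
  also have "\<dots> = (\<lambda>y. dw m j y + (1 / (2 * of_real c)) * (\<Sum>l=1..n. d m j l * qf m l D y))"
  proof
    fix y
    have "(\<Sum>l=1..n. d m j l * (- 2 * of_real c * ps m l y + qf m l D y)) =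
        - 2 * of_real c * (\<Sum>l=1..n. d m j l * ps m l y) + (\<Sum>l=1..n. d m j l * qf m l D y)"
    proof -
      have "(\<Sum>l=1..n. d m j l * (- 2 * of_real c * ps m l y + qf m l D y)) = (\<Sum>l=1..n. - 2 * of_real c * (d m j l * ps m l y) + d m j l * qf m l D y)"
        by (intro sum.cong refl) (simp add: algebra_simps)
      then show ?thesis by (simp only: sum.distrib sum_distrib_left)
    qed
    then show "((\<Sum>l=1..n. d m j l * ps m l y) + dw m j y) -
      - (1 / (2 * of_real c)) * (\<Sum>l=1..n. d m j l * (- 2 * of_real c * ps m l y + qf m l D y)) =
      dw m j y + (1 / (2 * of_real c)) * (\<Sum>l=1..n. d m j l * qf m l D y)" using c(1) by (simp add: field_simps)
  qed
  finally show ?thesis .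
qed

text \<open>\<open>A\<close> commutes with the projection, so the difference u lies in the
  complement and satisfies A u = Q (s_j' - A g0). The right-hand side is of order
  \<open>\<sigma>\<close>, and the lower bound on the complement is uniform in m.\<close>

lemma f0_g0: assumes j: "j \<in> {1..n}" shows "(\<lambda>m. L2_norm (\<lambda>y. f0 m j y - Q m (g0 m j) y)) \<preceq> \<sigma>" (is "?L \<preceq> _")
proof -
  have R: "(\<lambda>m. \<bar>KK\<bar> * (L2_norm (dw m j) + (1 / (2 * c)) * (\<Sum>l=1..n. cmod (d m j l) * L2_norm (qf m l D)))) \<preceq> \<sigma>" (is "?R \<preceq> _")
    by (intro dom_cmult dom_add w_dom j dom_sum dom_mult_bounded d_dom qf_dom scale_pos) (use c in auto)
  show ?thesis
  proof (rule dom_le[OF _ R])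
    fix m assume m: "m \<ge> m0"
    interpret kf: krein_frame c N n "V m" "s m" "\<nu> m" KK B by (rule frame_KK[OF m])
    let ?h = "\<lambda>y. dw m j y + (1 / (2 * of_real c)) * (\<Sum>l=1..n. d m j l * qf m l D y)"
    let ?u = "\<lambda>y. f0 m j y - Q m (g0 m j) y"
    have qL: "(\<lambda>y. \<Sum>l=1..n. d m j l * qf m l D y) \<in> L2" by (auto intro!: L2_sum L2_cmul qf_L2 m)
    have L: "?h \<in> L2" by (intro L2_add L2_cmul qL ds_L2 m j)
    note S = f0[OF m j]
    have gL: "g0 m j \<in> L2" by (rule sobolev_L2[OF g0_S])
    have AgL: "A m (g0 m j) \<in> L2" by (rule lin_op_L2[OF g0_S V_bp[OF m]])
    have uS: "?u \<in> sobolev 4" by (intro sobolev_diff S kf.Q_sobolev g0_S)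
    have uP: "?u \<in> Sp m" using kf.perpD[OF S(2)] kf.perpD[OF kf.Q_perp[OF gL]] by (simp add: kf.perp_iff L2_diff L2_inner_diff_left kf.sL2)
    have "A m ?u =\<^sub>2 (\<lambda>y. A m (f0 m j) y - A m (Q m (g0 m j)) y)" by (rule lin_op_linear(2)[OF S(1) kf.Q_sobolev[OF g0_S]])
    also have "\<dots> =\<^sub>2 (\<lambda>y. Q m (ds m j) y - Q m (A m (g0 m j)) y)" by (intro L2_eq_diff S kf.A_cong_Q g0_S)
    also have "\<dots> = Q m (\<lambda>y. ds m j y - A m (g0 m j) y)" by (rule kf.Q_diff[OF ds_L2(1)[OF m j] AgL, symmetric])
    also have "\<dots> =\<^sub>2 Q m ?h" by (intro kf.Q_cong A_g0 m j L L2_diff ds_L2 AgL)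
    finally have "A m ?u =\<^sub>2 Q m ?h" .
    then have "L2_norm (A m ?u) = L2_norm (Q m ?h)" by (intro L2_norm_cong lin_op_L2 uS V_bp m kf.Q_L2 L)
    also have "\<dots> \<le> L2_norm ?h" by (rule kf.Q_norm[OF L])
    also have "\<dots> \<le> L2_norm (dw m j) + L2_norm (\<lambda>y. (1 / (2 * of_real c)) * (\<Sum>l=1..n. d m j l * qf m l D y))"
      by (intro L2_triangle ds_L2 m j L2_cmul qL)
    also have "L2_norm (\<lambda>y. (1 / (2 * of_real c)) * (\<Sum>l=1..n. d m j l * qf m l D y)) = (1 / (2 * c)) * L2_norm (\<lambda>y. \<Sum>l=1..n. d m j l * qf m l D y)"
      unfolding L2_norm_cmul using c(1) by (simp add: norm_divide norm_mult)
    also have "\<dots> \<le> (1 / (2 * c)) * (\<Sum>l=1..n. L2_norm (\<lambda>y. d m j l * qf m l D y))"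
      using c(1) by (intro mult_left_mono L2_norm_sum) (auto intro!: L2_cmul qf_L2 m)
    finally have "L2_norm (A m ?u) \<le> L2_norm (dw m j) + (1 / (2 * c)) * (\<Sum>l=1..n. cmod (d m j l) * L2_norm (qf m l D))" by (simp add: L2_norm_cmul)
    moreover have "L2_norm ?u \<le> KK * L2_norm (A m ?u)" by (rule kf.lower'[OF uS uP])
    ultimately show "?L m \<le> ?R m" using kf.K by (auto intro: order_trans mult_left_mono)
  qed
qed

text \<open>Each peak contributes - kap from the pairing of U'' with the c-derivative and - 1/(2c)
  from \<open>g0\<close>. The remaining sum of products of coefficients is close to the identity
  matrix, because the eigenfunctions are orthogonal with the same norm as U'.\<close>

lemma ds_g0:
  assumes i: "i \<in> {1..n}" and j: "j \<in> {1..n}"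
  shows "(\<lambda>m. cmod (L2_inner (ds m i) (g0 m j) - lim_coef i j)) \<preceq> \<sigma>" (is "?L \<preceq> _")
proof -
  let ?\<gamma> = "1 / (2 * c)"
  let ?e = "\<lambda>m k. L2_inner (s m j) (ph m k) - of_real N * d m j k"
  let ?G = "\<lambda>m. (if i = j then of_real N else 0) - (\<Sum>k=1..n. d m i k * L2_inner (ph m k) (s m j))"
  let ?O = "\<lambda>m k. \<Sum>l\<in>{1..n}-{k}. cnj (d m j l) * L2_inner (ps m k) (Dm m l)"
  have 1: "(\<lambda>m. cmod (cnj (?e m k))) \<preceq> \<sigma>" if "k \<in> {1..n}" for k unfolding complex_mod_cnj by (rule e_dom[OF j that])
  have 2: "(\<lambda>m. cmod (?O m k)) \<preceq> \<sigma>" if "k \<in> {1..n}" for k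
    by (intro dom_d_sum(2) j scale_pos tau_sigma[OF cross_dom(1)]) (use that in auto)
  have R: "(\<lambda>m. \<bar>?\<gamma> * kap / N\<bar> * (cmod (?G m) + cmod (\<Sum>k=1..n. d m i k * cnj (?e m k))) + ?\<gamma> * cmod (\<Sum>k=1..n. d m i k * ?O m k)
      + L2_norm (g0 m j) * L2_norm (dw m i)) \<preceq> \<sigma>" (is "?R \<preceq> _")
    by (intro dom_add dom_cmult gram dom_d_sum(1) 1 2 i j order_refl scale_pos dom_mult_bounded g0_norm w_dom) (use c in auto)
  show ?thesis
  proof (rule dom_le[OF _ R])
    fix m assume m: "m \<ge> m0"
    have gL: "g0 m j \<in> L2" by (rule sobolev_L2[OF g0_S])
    have inn: "L2_inner h (g0 m j) = - of_real ?\<gamma> * (\<Sum>l=1..n. cnj (d m j l) * L2_inner h (Dm m l))" if "h \<in> L2" for h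
    proof -
      have "L2_inner h (g0 m j) = cnj (- (1 / (2 * of_real c))) * L2_inner h (\<lambda>y. \<Sum>l=1..n. d m j l * Dm m l y)"
        unfolding g0_def by (rule L2_inner_cmul_right)
      also have "L2_inner h (\<lambda>y. \<Sum>l=1..n. d m j l * Dm m l y) = (\<Sum>l=1..n. L2_inner h (\<lambda>y. d m j l * Dm m l y))"
        by (rule L2_inner_sum_right) (auto intro!: L2_cmul that)
      finally show ?thesis by (simp add: L2_inner_cmul_right)
    qed
    have "L2_inner (ps m k) (g0 m j) = of_real ?\<gamma> * of_real kap * cnj (d m j k) - of_real ?\<gamma> * ?O m k" if k: "k \<in> {1..n}" for k
    proof -
      have "(\<Sum>l=1..n. cnj (d m j l) * L2_inner (ps m k) (Dm m l)) = cnj (d m j k) * L2_inner (ps m k) (Dm m k) + ?O m k"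
        using k by (simp add: sum.remove[of _ k])
      moreover have "- g * (y * - K + v) = g * K * y - g * v" for g y K v :: complex by (simp add: algebra_simps)
      ultimately show ?thesis by (simp only: inn[OF sh_L2'[OF in_fns(3)]] U2_D_inner)
    qed
    then have "L2_inner (ds m i) (g0 m j) = (\<Sum>k=1..n. d m i k * (of_real ?\<gamma> * of_real kap * cnj (d m j k) - of_real ?\<gamma> * ?O m k)) + L2_inner (dw m i) (g0 m j)"
      unfolding ds_inner[OF m i gL] by simp
    also have "(\<Sum>k=1..n. d m i k * (of_real ?\<gamma> * of_real kap * cnj (d m j k) - of_real ?\<gamma> * ?O m k)) =
        of_real ?\<gamma> * of_real kap * (\<Sum>k=1..n. d m i k * cnj (d m j k)) - of_real ?\<gamma> * (\<Sum>k=1..n. d m i k * ?O m k)"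
      by (simp add: sum_distrib_left sum_subtractf right_diff_distrib mult_ac)
    \<comment> \<open>One of the two coefficients is replaced by the pairing of s_j with the
      translate, at the cost of the small \<open>?e\<close>; the resulting sum is the one treated in
      \<open>gram\<close>.\<close>
    also have "(\<Sum>k=1..n. d m i k * cnj (d m j k)) = ((if i = j then of_real N else 0) - ?G m - (\<Sum>k=1..n. d m i k * cnj (?e m k))) / of_real N"
    proof -
      have "(\<Sum>k=1..n. d m i k * L2_inner (ph m k) (s m j)) = of_real N * (\<Sum>k=1..n. d m i k * cnj (d m j k)) + (\<Sum>k=1..n. d m i k * cnj (?e m k))"
        by (simp add: L2_inner_cnj sum_distrib_left sum.distrib[symmetric] algebra_simps)
      then show ?thesis using N_pos by (simp add: field_simps)
    qed
    finally have "L2_inner (ds m i) (g0 m j) - lim_coef i j =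
        - (of_real (?\<gamma> * kap / N) * (?G m + (\<Sum>k=1..n. d m i k * cnj (?e m k)))) - of_real ?\<gamma> * (\<Sum>k=1..n. d m i k * ?O m k) + L2_inner (dw m i) (g0 m j)"
      using N_pos c(1) by (simp add: field_simps)
    moreover have "cmod (- a - b + r) \<le> cmod a + cmod b + cmod r" for a b r by norm
    ultimately have "cmod (L2_inner (ds m i) (g0 m j) - lim_coef i j) \<le>
        cmod (of_real (?\<gamma> * kap / N) * (?G m + (\<Sum>k=1..n. d m i k * cnj (?e m k)))) + cmod (of_real ?\<gamma> * (\<Sum>k=1..n. d m i k * ?O m k)) + cmod (L2_inner (dw m i) (g0 m j))"
      by (simp only:)
    also have "\<dots> \<le> ?R m"
    proof (intro add_mono)
      show "cmod (of_real (?\<gamma> * kap / N) * (?G m + (\<Sum>k=1..n. d m i k * cnj (?e m k)))) \<le> \<bar>?\<gamma> * kap / N\<bar> * (cmod (?G m) + cmod (\<Sum>k=1..n. d m i k * cnj (?e m k)))"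
        unfolding norm_mult norm_of_real by (intro mult_left_mono norm_triangle_ineq) simp
      show "cmod (of_real ?\<gamma> * (\<Sum>k=1..n. d m i k * ?O m k)) \<le> ?\<gamma> * cmod (\<Sum>k=1..n. d m i k * ?O m k)"
        unfolding norm_mult norm_of_real using c(1) by simp
      show "cmod (L2_inner (dw m i) (g0 m j)) \<le> L2_norm (g0 m j) * L2_norm (dw m i)"
        using L2_Cauchy_Schwarz[OF ds_L2(2)[OF m i] gL] by (simp add: mult.commute)
    qed
    finally show "?L m \<le> ?R m" .
  qed
qed

text \<open>Replacing the projection of \<open>g0\<close> by \<open>g0\<close> itself costs the
  components of \<open>g0\<close> along the eigenfunctions, each multiplied by a pairing that is
  small by \<open>b_dom\<close>.\<close>

lemma f0_dom:
  assumes i: "i \<in> {1..n}" and j: "j \<in> {1..n}"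
  shows "(\<lambda>m. cmod (L2_inner (ds m i) (f0 m j) - lim_coef i j)) \<preceq> \<sigma>" (is "?L \<preceq> _")
proof -
  have R: "(\<lambda>m. B * L2_norm (\<lambda>y. f0 m j y - Q m (g0 m j) y) + cmod (L2_inner (ds m i) (g0 m j) - lim_coef i j)
      + (\<Sum>l=1..n. (1 / sqrt N) * (L2_norm (g0 m j) * cmod (L2_inner (s m l) (ds m i))))) \<preceq> \<sigma>" (is "?R \<preceq> _")
    by (intro dom_add dom_cmult B f0_g0 ds_g0 i j dom_sum scale_pos dom_mult_bounded g0_norm tau_sigma[OF b_dom]) (use N_pos in auto)
  show ?thesis
  proof (rule dom_le[OF _ R])
    fix m assume m: "m \<ge> m0"
    interpret kf: krein_frame c N n "V m" "s m" "\<nu> m" KK B by (rule frame_KK[OF m])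
    let ?u = "\<lambda>y. f0 m j y - Q m (g0 m j) y"
    have gL: "g0 m j \<in> L2" by (rule sobolev_L2[OF g0_S])
    have L: "f0 m j \<in> L2" "Q m (g0 m j) \<in> L2" "ds m i \<in> L2" by (rule kf.perpD(1)[OF f0(2)[OF m j]] kf.Q_L2[OF gL] ds_L2(1)[OF m i])+
    have uL: "?u \<in> L2" using L by (intro L2_diff)
    have e1: "L2_inner (ds m i) ?u = L2_inner (ds m i) (f0 m j) - L2_inner (ds m i) (Q m (g0 m j))" by (rule L2_inner_diff_right[OF L(3,1,2)])
    have e2: "L2_inner (ds m i) (Q m (g0 m j)) = L2_inner (ds m i) (g0 m j) - L2_inner (ds m i) (kf.lc (kf.coef (g0 m j)))"
      unfolding kf.Q_def by (rule L2_inner_diff_right[OF L(3) gL kf.lc_L2])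
    have e3: "L2_inner (ds m i) (kf.lc (kf.coef (g0 m j))) = (\<Sum>l=1..n. cnj (kf.coef (g0 m j) l) * L2_inner (ds m i) (s m l))"
    proof -
      have "L2_inner (ds m i) (kf.lc (kf.coef (g0 m j))) = (\<Sum>l=1..n. L2_inner (ds m i) (\<lambda>x. kf.coef (g0 m j) l * s m l x))"
        unfolding kf.lc_def by (rule L2_inner_sum_right[OF _ L(3)]) (intro L2_cmul s_L2 m)
      then show ?thesis by (simp add: L2_inner_cmul_right)
    qed
    have "L2_inner (ds m i) (f0 m j) - lim_coef i j =
        L2_inner (ds m i) ?u + (L2_inner (ds m i) (g0 m j) - lim_coef i j)
        - (\<Sum>l=1..n. cnj (kf.coef (g0 m j) l) * L2_inner (ds m i) (s m l))" unfolding e1 e2 e3 by simp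
    moreover have "cmod (a + b - r) \<le> cmod a + cmod b + cmod r" for a b r by norm
    ultimately have "cmod (L2_inner (ds m i) (f0 m j) - lim_coef i j) \<le>
        cmod (L2_inner (ds m i) ?u) + cmod (L2_inner (ds m i) (g0 m j) - lim_coef i j)
        + cmod (\<Sum>l=1..n. cnj (kf.coef (g0 m j) l) * L2_inner (ds m i) (s m l))" by (simp only:)
    also have "\<dots> \<le> B * L2_norm ?u + cmod (L2_inner (ds m i) (g0 m j) - lim_coef i j)
        + (\<Sum>l=1..n. (1 / sqrt N) * (L2_norm (g0 m j) * cmod (L2_inner (s m l) (ds m i))))"
    proof (intro add_mono order_refl)
      show "cmod (L2_inner (ds m i) ?u) \<le> B * L2_norm ?u"
        by (rule order_trans[OF L2_Cauchy_Schwarz[OF L(3) uL]]) (intro mult_right_mono s_deriv_norm m i, simp)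
      have "cmod (cnj (kf.coef (g0 m j) l) * L2_inner (ds m i) (s m l)) \<le> (1 / sqrt N) * (L2_norm (g0 m j) * cmod (L2_inner (s m l) (ds m i)))"
        if l: "l \<in> {1..n}" for l
      proof -
        have "cmod (L2_inner (g0 m j) (s m l)) \<le> L2_norm (g0 m j) * sqrt N" using L2_Cauchy_Schwarz[OF gL s_L2[OF m l]] by (simp add: s_norm[OF m l])
        then have "cmod (kf.coef (g0 m j) l) \<le> L2_norm (g0 m j) * sqrt N / N" using N_pos by (simp add: kf.coef_def norm_divide divide_right_mono)
        also have "\<dots> = (1 / sqrt N) * L2_norm (g0 m j)" using N_pos by (simp add: divide_simps)
        finally have "cmod (kf.coef (g0 m j) l) * cmod (L2_inner (s m l) (ds m i)) \<le> (1 / sqrt N) * L2_norm (g0 m j) * cmod (L2_inner (s m l) (ds m i))"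
          by (intro mult_right_mono) auto
        then show ?thesis unfolding norm_mult complex_mod_cnj cmod_L2_inner_commute[of "ds m i"] by (simp add: mult.assoc)
      qed
      then show "cmod (\<Sum>l=1..n. cnj (kf.coef (g0 m j) l) * L2_inner (ds m i) (s m l)) \<le>
          (\<Sum>l=1..n. (1 / sqrt N) * (L2_norm (g0 m j) * cmod (L2_inner (s m l) (ds m i))))" by (intro order_trans[OF norm_sum] sum_mono)
    qed
    finally show "?L m \<le> ?R m" .
  qed
qed

end

section \<open>The expansion for multi-pulses\<close>

context multipulse
begin

lemma expansion:
  "\<exists>C. \<exists>\<epsilon>>0. \<forall>m\<ge>m0. \<forall>z::complex. 0 < cmod z \<and> cmod z < \<epsilon> \<longrightarrow>
    boundedly_invertible (sobolev 4 \<inter> Sp m) (Sp m) (compression (L2_span n (s m)) (pencil c (V m) (\<i> * z))) \<and>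
    (\<forall>i\<in>{1..n}. \<forall>j\<in>{1..n}.
      cmod (- krein_matrix (sobolev 4) (pencil c (V m)) n (s m) z i j / z
        - (of_real N * (if i = j then of_real (\<nu> m i) else 0) - of_real (N + 2 * c * kap) * (if i = j then 1 else 0) * (cnj z)\<^sup>2))
      \<le> C * (\<tau> m * cmod z + cmod z ^ 3))"
proof -
  let ?I = "\<lambda>m i j. L2_inner (ds m i) (f0 m j)"
  have KK: "KK > 0" using krein_frame.K[OF frame_KK[of m0]] by simp
  \<comment> \<open>The entries are summed so that one constant bounds all of them and, by
    \<open>dom_global\<close>, for every m.\<close>
  have "(\<lambda>m. \<Sum>i=1..n. \<Sum>j=1..n. cmod (L2_inner (s m i) (ds m j))) \<preceq> \<tau>" by (intro dom_sum scale_pos b_dom)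
  then obtain Kb where Kb: "Kb \<ge> 0" "\<And>m. (\<Sum>i=1..n. \<Sum>j=1..n. cmod (L2_inner (s m i) (ds m j))) \<le> Kb * \<tau> m"
    using dom_global scale_pos by blast
  have "(\<lambda>m. \<Sum>i=1..n. \<Sum>j=1..n. cmod (?I m i j - lim_coef i j)) \<preceq> \<sigma>" by (intro dom_sum scale_pos f0_dom)
  then obtain Ke where Ke: "Ke \<ge> 0" "\<And>m. (\<Sum>i=1..n. \<Sum>j=1..n. cmod (?I m i j - lim_coef i j)) \<le> Ke * \<sigma> m"
    using dom_global scale_pos by blast
  have entry: "g i j \<le> S" if "i \<in> {1..n}" "j \<in> {1..n}" "(\<Sum>i=1..n. \<Sum>j=1..n. g i j) \<le> S" "\<And>i j. 0 \<le> g i j" for g :: "nat \<Rightarrow> nat \<Rightarrow> real" and i j S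
  proof -
    have "g i j \<le> (\<Sum>j=1..n. g i j)" using that by (intro member_le_sum) auto
    also have "\<dots> \<le> (\<Sum>i=1..n. \<Sum>j=1..n. g i j)" using that by (intro member_le_sum) (auto intro: sum_nonneg)
    finally show ?thesis using that(3) by simp
  qed
  \<comment> \<open>For |z| <= 1 one has rad z <= (1 + 2 c) |z|, so this radius ensures rad z * KK
    <= 1/4, the condition for solvability.\<close>
  define \<epsilon> where "\<epsilon> = min 1 (1 / (4 * ((1 + 2 * c) * KK)))"
  have pos: "(1 + 2 * c) * KK > 0" using c(1) KK by simp
  have \<epsilon>: "\<epsilon> > 0" using pos by (simp add: \<epsilon>_def)
  define C where "C = 8 * c\<^sup>2 * (1 + 2 * c) * KK\<^sup>2 * B\<^sup>2 + 2 * c * Kb + 4 * c\<^sup>2 * Ke"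
  show ?thesis
  proof (rule exI[of _ C], rule exI[of _ \<epsilon>], intro conjI \<epsilon> allI impI ballI)
    fix m z assume m: "m \<ge> m0" and z: "0 < cmod z \<and> cmod z < \<epsilon>"
    interpret kf: krein_frame c N n "V m" "s m" "\<nu> m" KK B by (rule frame_KK[OF m])
    have z0: "z \<noteq> 0" and z1: "cmod z \<le> 1" using z by (auto simp: \<epsilon>_def)
    have \<kappa>: "cmod (kf.\<kappa> z) = 2 * c * cmod z" using c(1) by (simp add: kf.\<kappa>_def norm_mult)
    have rad: "kf.rad z \<le> (1 + 2 * c) * cmod z"
    proof -
      have "(cmod z)\<^sup>2 \<le> cmod z" using z z1 by (simp add: power2_eq_square mult_left_le)
      then show ?thesis by (simp add: kf.rad_def \<kappa> algebra_simps)
    qed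
    have rad4: "kf.rad z * KK \<le> 1 / 4"
    proof -
      have "kf.rad z * KK \<le> ((1 + 2 * c) * cmod z) * KK" using rad KK by (intro mult_right_mono) auto
      also have "\<dots> = ((1 + 2 * c) * KK) * cmod z" by simp
      also have "\<dots> \<le> ((1 + 2 * c) * KK) * (1 / (4 * ((1 + 2 * c) * KK)))" using z pos by (intro mult_left_mono) (auto simp: \<epsilon>_def)
      also have "\<dots> = 1 / 4"
      proof -
        have "x * (1 / (4 * x)) = 1 / 4" if "x \<noteq> 0" for x :: real using that by simp
        from this[OF less_imp_neq[OF pos, THEN not_sym]] show ?thesis .
      qed
      finally show ?thesis .
    qed
    show "boundedly_invertible (sobolev 4 \<inter> Sp m) (Sp m) (compression (L2_span n (s m)) (pencil c (V m) (\<i> * z)))"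
      by (rule kf.boundedly_invertible_compression[OF rad4])
    fix i j assume i: "i \<in> {1..n}" and j: "j \<in> {1..n}"
    let ?M = "- krein_matrix (sobolev 4) (pencil c (V m)) n (s m) z i j / z"
    let ?b = "L2_inner (s m i) (ds m j)"
    let ?F = "of_real (\<nu> m i) * L2_inner (s m i) (s m j) - (cnj z)\<^sup>2 * L2_inner (s m i) (s m j) + cnj (kf.\<kappa> z) * ?b + (cnj (kf.\<kappa> z))\<^sup>2 * ?I m i j"
    let ?T = "of_real N * (if i = j then of_real (\<nu> m i) else 0) - of_real (N + 2 * c * kap) * (if i = j then 1 else 0) * (cnj z)\<^sup>2"
    have b: "cmod ?b \<le> Kb * \<tau> m" by (rule entry[OF i j Kb(2)]) simp
    have e: "cmod (?I m i j - lim_coef i j) \<le> Ke * \<sigma> m" by (rule entry[OF i j Ke(2)]) simp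
    have k2: "(cnj (kf.\<kappa> z))\<^sup>2 = - 4 * of_real (c\<^sup>2) * (cnj z)\<^sup>2" by (simp add: kf.\<kappa>_def power_mult_distrib)
    have "?F - ?T = cnj (kf.\<kappa> z) * ?b + (cnj (kf.\<kappa> z))\<^sup>2 * (?I m i j - lim_coef i j)"
      using c(1) unfolding k2 s_orth[OF m i j] by (simp add: algebra_simps power2_eq_square)
    then have "cmod (?F - ?T) \<le> cmod (cnj (kf.\<kappa> z) * ?b) + cmod ((cnj (kf.\<kappa> z))\<^sup>2 * (?I m i j - lim_coef i j))"
      by (simp only: norm_triangle_ineq)
    also have "\<dots> \<le> 2 * c * cmod z * (Kb * \<tau> m) + (2 * c * cmod z)\<^sup>2 * (Ke * \<sigma> m)"
      unfolding norm_mult norm_power complex_mod_cnj \<kappa> using c(1) b e by (intro add_mono mult_left_mono) auto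
    also have "(2 * c * cmod z)\<^sup>2 * (Ke * \<sigma> m) = (4 * c\<^sup>2 * Ke) * (cmod z * (\<sigma> m * cmod z))"
      by (simp add: power2_eq_square algebra_simps)
    \<comment> \<open>The limit of the second-order coefficient is attained only up to
      \<open>\<sigma>\<close>. As the square of \<open>\<sigma>\<close> is at most
      \<open>\<tau>\<close>, the arithmetic-geometric mean splits \<open>\<sigma>\<close> |z|^2
      between the two admissible errors.\<close>
    also have "\<dots> \<le> (4 * c\<^sup>2 * Ke) * (cmod z * (\<tau> m + (cmod z)\<^sup>2))"
    proof (intro mult_left_mono)
      have "2 * (\<sigma> m * cmod z) \<le> (\<sigma> m)\<^sup>2 + (cmod z)\<^sup>2" using sum_squares_bound[of "\<sigma> m" "cmod z"] by simp
      moreover have "(\<sigma> m)\<^sup>2 \<le> \<tau> m" using scales(5)[OF m] by (simp add: power2_eq_square)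
      moreover have "0 \<le> \<tau> m" "0 \<le> (cmod z)\<^sup>2" using scale_pos by auto
      ultimately show "\<sigma> m * cmod z \<le> \<tau> m + (cmod z)\<^sup>2" by linarith
    qed (use Ke in auto)
    finally have FT: "cmod (?F - ?T) \<le> 2 * c * cmod z * (Kb * \<tau> m) + (4 * c\<^sup>2 * Ke) * (cmod z * (\<tau> m + (cmod z)\<^sup>2))" by simp
    have "cmod (?M - ?F) \<le> 2 * KK\<^sup>2 * B\<^sup>2 * (cmod (kf.\<kappa> z))\<^sup>2 * kf.rad z" by (rule kf.krein_expansion[OF i j z0 rad4 f0[OF m j]])
    also have "\<dots> \<le> 2 * KK\<^sup>2 * B\<^sup>2 * (2 * c * cmod z)\<^sup>2 * ((1 + 2 * c) * cmod z)"
      unfolding \<kappa> by (intro mult_left_mono rad) auto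
    also have "\<dots> = (8 * c\<^sup>2 * (1 + 2 * c) * KK\<^sup>2 * B\<^sup>2) * cmod z ^ 3" by (simp add: power2_eq_square power3_eq_cube algebra_simps)
    finally have MF: "cmod (?M - ?F) \<le> (8 * c\<^sup>2 * (1 + 2 * c) * KK\<^sup>2 * B\<^sup>2) * cmod z ^ 3" .
    define x y where "x = \<tau> m * cmod z" and "y = cmod z ^ 3"
    have xy: "0 \<le> x" "0 \<le> y" using scale_pos by (auto simp: x_def y_def)
    define P where "P = 8 * c\<^sup>2 * (1 + 2 * c) * KK\<^sup>2 * B\<^sup>2"
    have P: "P \<ge> 0" using c(1) by (simp add: P_def)
    have "cmod (?M - ?T) \<le> cmod (?M - ?F) + cmod (?F - ?T)"
    proof -
      have "cmod (a - c) \<le> cmod (a - b) + cmod (b - c)" for a b c by norm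
      then show ?thesis .
    qed
    also have "\<dots> \<le> P * y + (2 * c * Kb) * x + (4 * c\<^sup>2 * Ke) * (x + y)"
      using MF FT by (simp add: x_def y_def P_def power2_eq_square power3_eq_cube algebra_simps)
    also have "\<dots> \<le> P * (x + y) + (2 * c * Kb) * (x + y) + (4 * c\<^sup>2 * Ke) * (x + y)"
      using xy P Kb(1) Ke(1) c(1) by (intro add_mono mult_left_mono) auto
    also have "\<dots> = C * (x + y)" by (simp add: C_def P_def algebra_simps)
    finally show "cmod (?M - ?T) \<le> C * (\<tau> m * cmod z + cmod z ^ 3)" by (simp only: x_def y_def)
  qed
qed

end

section \<open>From the hypotheses on pulses and spectra to the locale assumptions\<close>

lemma jet_nth: "jet u x $ 1 = u x" "jet u x $ 2 = deriv u x"
  by (simp_all add: jet_def)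

lemma homoclinic_jet:
  assumes "homoclinic_orbit c (jet u)"
  shows "(u has_real_derivative deriv u x) (at x)" "(u \<longlongrightarrow> 0) at_top" "(u \<longlongrightarrow> 0) at_bot"
proof -
  have s: "solves_on c UNIV (jet u)" and t: "(jet u \<longlongrightarrow> 0) at_top" "(jet u \<longlongrightarrow> 0) at_bot"
    using assms by (auto simp: homoclinic_orbit_def)
  show "(u has_real_derivative deriv u x) (at x)" using component_derivative[OF s, of 1 x] by (simp add: jet_nth wave_field_nth)
  show "(u \<longlongrightarrow> 0) at_top" "(u \<longlongrightarrow> 0) at_bot"
    using tendsto_vec_nth[OF t(1), of 1] tendsto_vec_nth[OF t(2), of 1] by (simp_all add: jet_nth)
qed

lemma X_min_le: "n \<ge> 2 \<Longrightarrow> j \<in> {1..n-1} \<Longrightarrow> X_min n X \<le> X j"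
  unfolding X_min_def by (rule Min_le) auto

lemma X_min_ge: "n \<ge> 2 \<Longrightarrow> (\<And>j. j \<in> {1..n-1} \<Longrightarrow> B \<le> X j) \<Longrightarrow> B \<le> X_min n X"
  unfolding X_min_def by (subst Min_ge_iff) auto

lemma X_min_pos: "n \<ge> 2 \<Longrightarrow> (\<And>j. j \<in> {1..n-1} \<Longrightarrow> 0 < X j) \<Longrightarrow> 0 < X_min n X"
  unfolding X_min_def by (subst Min_gr_iff) auto

lemma peak_distance:
  assumes n: "n \<ge> 2" and X: "\<And>j. j \<in> {1..n-1} \<Longrightarrow> X j > 0 \<and> p (j + 1) - p j = 2 * X j"
    and jk: "j \<in> {1..n}" "k \<in> {1..n}" "j \<noteq> k"
  shows "\<bar>p j - p k\<bar> \<ge> 2 * X_min n (X :: nat \<Rightarrow> real)"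
proof -
  have pos: "X_min n X > 0" using X by (intro X_min_pos n) auto
  have "p (j + Suc i) - p j \<ge> 2 * X_min n X" if "j \<ge> 1" "j + Suc i \<le> n" for i j using that
  proof (induction i)
    case 0
    then show ?case using X[of j] X_min_le[OF n, of j X] by auto
  next
    case (Suc i)
    have "p (j + Suc i + 1) - p (j + Suc i) = 2 * X (j + Suc i)" "X (j + Suc i) > 0" using X[of "j + Suc i"] Suc.prems by auto
    then show ?case using Suc by simp
  qed
  then have *: "p k - p j \<ge> 2 * X_min n X" if "j < k" "j \<ge> 1" "k \<le> n" for j k using that less_iff_Suc_add[of j k] by auto
  show ?thesis
  proof (cases "j < k")
    case True then show ?thesis using *[OF True] jk pos by auto
  next
    case False
    then have "k < j" using jk by simp
    then show ?thesis using *[of k j] jk pos by auto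
  qed
qed

lemma eigenvalue_in_spectrum:
  assumes "eigenfunction (sobolev 4) (lin_op c W) 0 f"
  shows "0 \<in> spectrum_on (sobolev 4) (lin_op c W)"
proof -
  have f: "f \<in> sobolev 4" "lin_op c W f =\<^sub>2 (\<lambda>x. 0)" "\<not> f =\<^sub>2 (\<lambda>x. 0)"
    using assms by (auto simp: eigenfunction_def eigenspace_def)
  have z: "(\<lambda>x. 0) \<in> sobolev 4" using sobolev_cmul[OF f(1), of 0] by simp
  have "lin_op c W (\<lambda>x. 0) =\<^sub>2 (\<lambda>x. 0)" using lin_op_linear(3)[OF f(1) f(1), of c W 0] by simp
  then have "lin_op c W f =\<^sub>2 lin_op c W (\<lambda>x. 0)" using f(2) L2_eq_trans L2_eq_sym by blast
  then show ?thesis using f z unfolding spectrum_on_def boundedly_invertible_def by auto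
qed

text \<open>An eigenvalue outside the essential spectrum is an isolated point of the spectrum, so
  small positive numbers belong to the resolvent set.\<close>

lemma resolvent_near_0:
  assumes "eigenfunction (sobolev 4) (lin_op c W) 0 f" "0 \<notin> essential_spectrum (sobolev 4) (lin_op c W)" "e > 0"
  shows "\<exists>l. 0 < cmod l \<and> cmod l < e \<and> l \<notin> spectrum_on (sobolev 4) (lin_op c W)"
proof -
  have "\<not> 0 islimpt spectrum_on (sobolev 4) (lin_op c W)" using assms(2) eigenvalue_in_spectrum[OF assms(1)] by (auto simp: essential_spectrum_def)
  then obtain d where d: "d > 0" "\<And>l. l \<in> spectrum_on (sobolev 4) (lin_op c W) \<Longrightarrow> l \<noteq> 0 \<Longrightarrow> \<not> cmod l < d"
    by (auto simp: islimpt_approachable dist_norm)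
  let ?l = "complex_of_real (min d e / 2)"
  have l: "cmod ?l = min d e / 2" unfolding norm_of_real using d assms(3) by simp
  have "0 < cmod ?l" "cmod ?l < e" "cmod ?l < d" unfolding l using d assms(3) by auto
  then show ?thesis using d(2)[of ?l] by (metis norm_zero less_irrefl)
qed

theorem theorem6p11:
  fixes Y :: "real \<Rightarrow> real \<Rightarrow> real^4"
    and c0 cm cp c \<alpha> \<beta> lm \<delta>0 \<delta> :: real
    and U :: "real \<Rightarrow> real"
    and n m0 :: nat
    and k :: "nat \<Rightarrow> nat"
    and p X \<nu> :: "nat \<Rightarrow> nat \<Rightarrow> real"
    and V :: "nat \<Rightarrow> real \<Rightarrow> real"
    and s :: "nat \<Rightarrow> nat \<Rightarrow> real \<Rightarrow> complex"
  assumes hyp1: "hypothesis1 c0 (Y c0)"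
    and family: "c0 \<in> {cm<..<cp}" "pulse_family cm cp Y"
    and c: "c \<in> {cm<..<cp}"
    and eigenvalues: "\<alpha> > 0" "\<beta> > 0"
      "origin_eigenvalues c = {Complex \<alpha> \<beta>, Complex \<alpha> (- \<beta>), Complex (- \<alpha>) \<beta>, Complex (- \<alpha>) (- \<beta>)}"
    and U: "U = profile (Y c)"
    and hyp2: "hypothesis2 c U lm \<delta>0"
    and hyp3: "hypothesis3 Y c"
    and n: "n \<ge> 2"
    and k: "\<exists>j\<in>{1..n-1}. k j \<in> {0, 1}"
    and \<delta>: "0 < \<delta>" "\<delta> < \<delta>0"
    and pulses: "n_pulses c \<alpha> \<beta> U n k m0 p X V"
    and spectrum: "n_pulse_spectrum c \<alpha> U lm \<delta>0 \<delta> n k m0 p X V \<nu> s"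
    and simple: "\<And>m j. m \<ge> m0 \<Longrightarrow> j \<in> {1..n} \<Longrightarrow>
      simple_eigenvalue (sobolev 4) (lin_op c (V m)) (of_real (\<nu> m j))"
    and normalized: "\<And>m i j. m \<ge> m0 \<Longrightarrow> i \<in> {1..n} \<Longrightarrow> j \<in> {1..n} \<Longrightarrow>
      L2_inner (s m i) (s m j) = (if i = j then of_real ((L2_norm (cfun (deriv U)))\<^sup>2) else 0)"
  shows "\<exists>C. \<exists>\<epsilon>>0. \<forall>m\<ge>m0. \<forall>z::complex. 0 < cmod z \<and> cmod z < \<epsilon> \<longrightarrow>
    boundedly_invertible (sobolev 4 \<inter> L2_perp (L2_span n (s m))) (L2_perp (L2_span n (s m)))
      (compression (L2_span n (s m)) (pencil c (V m) (\<i> * z))) \<and>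
    (\<forall>i\<in>{1..n}. \<forall>j\<in>{1..n}.
      cmod (- krein_matrix (sobolev 4) (pencil c (V m)) n (s m) z i j / z
            - ((L2_norm (cfun (deriv U)))\<^sup>2 * (if i = j then \<nu> m i else 0)
               + d_second Y c * (if i = j then 1 else 0) * (cnj z)\<^sup>2))
      \<le> C * (exp (- (3 * \<alpha> / 2) * X_min n (X m)) * cmod z + cmod z ^ 3))"
proof -
  have h1: "c \<in> {0<..<sqrt 2}" "homoclinic_orbit c (Y c)" using family_hypothesis[OF family(2) c] by (auto simp: hypothesis1_def)
  have c0: "c > 0" "c\<^sup>2 < 2"
  proof -
    show c0: "c > 0" using h1 by simp
    have "c\<^sup>2 < (sqrt 2)\<^sup>2" using h1(1) c0 by (intro power_strict_mono) auto
    then show "c\<^sup>2 < 2" by simp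
  qed
  have ev: "cmod (Complex \<alpha> \<beta>) = 1" "2 * Re ((Complex \<alpha> \<beta>)\<^sup>2) = - (c\<^sup>2)"
    using origin_eigenvalue_modulus[of \<alpha> \<beta> c] eigenvalues by auto
  obtain C0 where C0: "\<And>x i. \<bar>Y c x $ i\<bar> \<le> C0 * exp (- (7/8 * \<alpha>) * \<bar>x\<bar>)"
    "\<And>x i. \<bar>dcY Y c x $ i\<bar> \<le> C0 * exp (- (7/8 * \<alpha>) * \<bar>x\<bar>)"
    using sharp_decay[OF family(2) c, of "7/8 * \<alpha>" \<alpha> "Complex \<alpha> \<beta>"] ev eigenvalues(1) by auto
  have U': "U = (\<lambda>x. Y c x $ 1)" by (simp add: U profile_def[abs_def])
  have dU: "deriv U = (\<lambda>x. Y c x $ 2)" unfolding U by (rule deriv_profile[OF family(2) c])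
  note dY = family_derivative[OF family(2) c] and dD = dcY_equation[OF family(2) c]
  let ?Y = "\<lambda>i x. Y c x $ i" and ?D = "\<lambda>i x. dcY Y c x $ i"
  interpret P: pulse c \<alpha> C0 U "?Y 2" "?Y 3" "?Y 4" "?D 1" "?D 2" "?D 3" "?D 4"
  proof unfold_locales
    show "(U has_real_derivative Y c x $ 2) (at x)" for x using dY[of 1 x] by (simp add: U' wave_field_nth)
    show "(?Y 2 has_real_derivative Y c x $ 3) (at x)" for x using dY[of 2 x] by (simp add: wave_field_nth)
    show "(?Y 3 has_real_derivative Y c x $ 4) (at x)" for x using dY[of 3 x] by (simp add: wave_field_nth)
    show "(?Y 4 has_real_derivative - c\<^sup>2 * Y c x $ 3 - exp (U x) + 1) (at x)" for x using dY[of 4 x] by (simp add: U' wave_field_nth)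
    show "(?D 1 has_real_derivative dcY Y c x $ 2) (at x)" for x using dD[of 1 x] by (simp add: variational_def[OF family(2)])
    show "(?D 2 has_real_derivative dcY Y c x $ 3) (at x)" for x using dD[of 2 x] by (simp add: variational_def[OF family(2)])
    show "(?D 3 has_real_derivative dcY Y c x $ 4) (at x)" for x using dD[of 3 x] by (simp add: variational_def[OF family(2)])
    show "(?D 4 has_real_derivative - 2 * c * Y c x $ 3 - c\<^sup>2 * dcY Y c x $ 3 - exp (U x) * dcY Y c x $ 1) (at x)" for x
      using dD[of 4 x] by (simp add: U' variational_def[OF family(2)])
    show "\<bar>f x\<bar> \<le> C0 * exp (- (7/8 * \<alpha>) * \<bar>x\<bar>)"
      if "f \<in> {U, ?Y 2, ?Y 3, ?Y 4, ?D 1, ?D 2, ?D 3, ?D 4}" for f x using that C0 by (auto simp: U')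
    show "simple_eigenvalue (sobolev 4) (lin_op c U) 0" using hyp2 by (simp add: hypothesis2_def)
    \<comment> \<open>If the first component vanished identically, the equations would make all
      components vanish in turn, against the nontriviality of the orbit.\<close>
    show "\<exists>x. U x \<noteq> 0"
    proof (rule ccontr)
      assume "\<not> (\<exists>x. U x \<noteq> 0)"
      then have z1: "Y c x $ 1 = 0" for x by (simp add: U')
      have const: "f' = 0" if "((\<lambda>x. g x) has_real_derivative f') (at x)" "\<And>x. g x = 0" for g f' x
        using that DERIV_unique[of g f' x 0] by (simp add: fun_eq_iff[symmetric] del: fun_eq_iff) (metis DERIV_const ext)
      have z2: "Y c x $ 2 = 0" for x using const[OF dY[of 1 x] z1] by (simp add: wave_field_nth)
      have z3: "Y c x $ 3 = 0" for x using const[OF dY[of 2 x] z2] by (simp add: wave_field_nth)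
      have z4: "Y c x $ 4 = 0" for x using const[OF dY[of 3 x] z3] by (simp add: wave_field_nth)
      have "Y c x = 0" for x using z1 z2 z3 z4 by (simp add: vec_eq_iff forall_4)
      then show False using h1(2) by (simp add: homoclinic_orbit_def)
    qed
  qed (use c0 eigenvalues in auto)
  have N: "(L2_norm (cfun (deriv U)))\<^sup>2 = P.N" by (simp add: L2_norm_square P.N_def dU)
  let ?X = "\<lambda>m. X_min n (X m)"
  have hom: "homoclinic_orbit c (jet (V m))" if "m \<ge> m0" for m using pulses that by (simp add: n_pulses_def)
  note hj = homoclinic_jet[OF hom]
  have Xp: "X m j > 0 \<and> p m (j + 1) - p m j = 2 * X m j" if "m \<ge> m0" "j \<in> {1..n-1}" for m j using pulses that unfolding n_pulses_def by blast
  obtain Xt Cx where Cx: "\<And>m j. m \<ge> m0 \<Longrightarrow> j \<in> {1..n-1} \<Longrightarrow> \<bar>X m j - (pi / \<beta> * real (2 * m + k j) + Xt)\<bar> \<le> Cx"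
    using pulses unfolding n_pulses_def by blast
  have err: "\<exists>C. \<forall>m\<ge>m0. \<forall>x. \<bar>(deriv ^^ i) (\<lambda>x. V m x - (\<Sum>j=1..n. U (x - p m j))) x\<bar> \<le> C * exp (- \<alpha> * ?X m)" for i
    using pulses unfolding n_pulses_def by blast
  obtain Ca where Ca: "\<And>m x. m \<ge> m0 \<Longrightarrow> \<bar>V m x - (\<Sum>j=1..n. U (x - p m j))\<bar> \<le> Ca * exp (- \<alpha> * ?X m)"
    using err[of 0] by auto
  obtain Cb where Cb: "\<And>m x. m \<ge> m0 \<Longrightarrow> \<bar>deriv (\<lambda>x. V m x - (\<Sum>j=1..n. U (x - p m j))) x\<bar> \<le> Cb * exp (- \<alpha> * ?X m)"
    using err[of 1] by auto
  have dV: "deriv (\<lambda>x. V m x - (\<Sum>j=1..n. U (x - p m j))) x = deriv (V m) x - (\<Sum>j=1..n. Y c (x - p m j) $ 2)" if m: "m \<ge> m0" for m x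
  proof (rule DERIV_imp_deriv)
    have "((\<lambda>x. U (x - p m j)) has_real_derivative Y c (x - p m j) $ 2 * 1) (at x)" for j
      by (rule DERIV_chain2[where f=U, OF P.dU(1)]) (auto intro!: derivative_eq_intros)
    then show "((\<lambda>x. V m x - (\<Sum>j=1..n. U (x - p m j))) has_real_derivative deriv (V m) x - (\<Sum>j=1..n. Y c (x - p m j) $ 2)) (at x)"
      by (intro DERIV_diff hj(1)[OF m] DERIV_sum) simp
  qed
  have sp: "\<nu> m n = 0 \<and> simple_eigenvalue (sobolev 4) (lin_op c (V m)) 0 \<and>
        eigenfunction (sobolev 4) (lin_op c (V m)) 0 (cfun (deriv (V m))) \<and>
        (\<forall>j\<in>{1..n}. eigenfunction (sobolev 4) (lin_op c (V m)) (of_real (\<nu> m j)) (s m j)) \<and>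
        essential_spectrum (sobolev 4) (lin_op c (V m)) = of_real ` {1 - c ^ 4 / 4..}" if "m \<ge> m0" for m
    using spectrum that unfolding n_pulse_spectrum_def by blast
  obtain Cs where Cs: "\<And>m j. m \<ge> m0 \<Longrightarrow> j \<in> {1..n-1} \<Longrightarrow> \<bar>\<nu> m j\<bar> \<le> Cs * exp (- 2 * \<alpha> * ?X m)"
    "\<And>m j. m \<ge> m0 \<Longrightarrow> j \<in> {1..n-1} \<Longrightarrow> \<exists>(d :: nat \<Rightarrow> complex) w w'. \<forall>x.
           s m j x = (\<Sum>i=1..n. d i * of_real (deriv U (x - p m i))) + w x \<and>
           (w has_vector_derivative w' x) (at x) \<and>
           cmod (w x) \<le> Cs * exp (- 2 * \<alpha> * ?X m) \<and>
           cmod (w' x) \<le> Cs * exp (- 2 * \<alpha> * ?X m)" using spectrum unfolding n_pulse_spectrum_def by blast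
  \<comment> \<open>One constant for the three separate error bounds, as \<open>multipulse\<close>
    expects.\<close>
  define Cr where "Cr = max Ca (max Cb Cs)"
  have Cr: "a \<le> Cr * exp b" if "a \<le> Ca * exp b \<or> a \<le> Cb * exp b \<or> a \<le> Cs * exp b" for a b
  proof -
    have "Ca * exp b \<le> Cr * exp b" "Cb * exp b \<le> Cr * exp b" "Cs * exp b \<le> Cr * exp b" by (intro mult_right_mono; simp add: Cr_def)+
    with that show ?thesis by (elim disjE) linarith+
  qed
  have nn: "n \<in> {1..n}" using n by simp
  have eig: "s m j \<in> sobolev 4" "lin_op c (V m) (s m j) =\<^sub>2 (\<lambda>x. of_real (\<nu> m j) * s m j x)" "\<not> s m j =\<^sub>2 (\<lambda>_. 0)"
    if "m \<ge> m0" "j \<in> {1..n}" for m j using sp[OF that(1)] that(2) by (auto simp: eigenfunction_def eigenspace_def)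
  interpret M: multipulse c \<alpha> C0 U "?Y 2" "?Y 3" "?Y 4" "?D 1" "?D 2" "?D 3" "?D 4" n m0 p ?X V "\<lambda>m. deriv (V m)" \<nu> s Cr
  proof unfold_locales
    show "n \<ge> 2" by (rule n)
    fix m assume m: "m \<ge> m0"
    note sm = sp[OF m]
    show "?X m > 0" using Xp[OF m] by (intro X_min_pos n) auto
    show "2 * ?X m \<le> \<bar>p m j - p m k\<bar>" if "j \<in> {1..n}" "k \<in> {1..n}" "j \<noteq> k" for j k
      by (rule peak_distance[OF n _ that]) (rule Xp[OF m])
    show "continuous_on UNIV (V m)" using hj(1)[OF m] by (meson DERIV_isCont continuous_at_imp_continuous_on)
    show "(V m \<longlongrightarrow> 0) at_top" "(V m \<longlongrightarrow> 0) at_bot" by (rule hj[OF m])+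
    show "\<bar>V m y - (\<Sum>k=1..n. U (y - p m k))\<bar> \<le> Cr * exp (- \<alpha> * ?X m)" for y using Cr Ca[OF m] by blast
    show "\<bar>deriv (V m) y - (\<Sum>k=1..n. Y c (y - p m k) $ 2)\<bar> \<le> Cr * exp (- \<alpha> * ?X m)" for y
      using Cr Cb[OF m, of y] unfolding dV[OF m] by blast
    show "cfun (deriv (V m)) \<in> sobolev 4" using sm by (auto simp: eigenfunction_def eigenspace_def)
    show "s m i \<in> sobolev 4" "lin_op c (V m) (s m i) =\<^sub>2 (\<lambda>x. of_real (\<nu> m i) * s m i x)" if "i \<in> {1..n}" for i
      using eig[OF m that] by auto
    show "L2_inner (s m i) (s m j) = (if i = j then of_real P.N else 0)" if "i \<in> {1..n}" "j \<in> {1..n}" for i j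
      using normalized[OF m that] by (simp only: N)
    show "\<bar>\<nu> m i\<bar> \<le> Cr * exp (- 2 * \<alpha> * ?X m)" if "i \<in> {1..n-1}" for i using Cr Cs(1)[OF m that] by blast
    show "\<nu> m n = 0" using sm by blast
    show "\<exists>e. \<forall>y. cmod (s m i y - (\<Sum>k=1..n. e k * sh (?Y 2) (p m k) y)) \<le> Cr * exp (- 2 * \<alpha> * ?X m)" if i: "i \<in> {1..n-1}" for i
    proof -
      obtain d w w' where d: "\<And>x. s m i x = (\<Sum>k=1..n. d k * of_real (deriv U (x - p m k))) + w x"
        "\<And>x. cmod (w x) \<le> Cs * exp (- 2 * \<alpha> * ?X m)" using Cs(2)[OF m i] by blast
      have "s m i y - (\<Sum>k=1..n. d k * sh (?Y 2) (p m k) y) = w y" for y by (simp add: d(1) sh_def dU)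
      then show ?thesis using Cr d(2) by (intro exI[of _ d]) auto
    qed
    have es: "s m n \<in> eigenspace (sobolev 4) (lin_op c (V m)) 0" "\<not> s m n =\<^sub>2 (\<lambda>_. 0)"
      using eig[OF m nn] sm by (auto simp: eigenspace_def)
    show "\<exists>b. s m n =\<^sub>2 (\<lambda>y. b * cfun (deriv (V m)) y)"
      by (rule simple_eigenvalue_multiple) (use sm es in \<open>auto simp: eigenfunction_def\<close>)
    show "g =\<^sub>2 (\<lambda>x. 0)" if g: "g \<in> sobolev 4" "lin_op c (V m) g =\<^sub>2 (\<lambda>x. 0)" "L2_inner g (s m n) = 0" for g
    proof -
      have "g \<in> eigenspace (sobolev 4) (lin_op c (V m)) 0" using g by (simp add: eigenspace_def)
      then obtain b where b: "g =\<^sub>2 (\<lambda>x. b * s m n x)" using simple_eigenvalue_multiple[OF _ es(1) _ es(2)] sm by blast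
      have sL: "s m n \<in> L2" by (rule sobolev_L2[OF eig(1)[OF m nn]])
      have "L2_inner g (s m n) = L2_inner (\<lambda>x. b * s m n x) (s m n)" by (intro L2_inner_cong b L2_eq_refl sobolev_L2[OF g(1)] sL L2_cmul)
      then have "b * of_real P.N = 0" using g(3) normalized[OF m nn nn] by (simp add: L2_inner_cmul_left N)
      then have "b = 0" using P.N_pos by simp
      then show ?thesis using b by simp
    qed
    show "\<exists>l. 0 < cmod l \<and> cmod l < e \<and> l \<notin> spectrum_on (sobolev 4) (lin_op c (V m))" if "e > 0" for e
    proof (rule resolvent_near_0[OF _ _ that])
      show "eigenfunction (sobolev 4) (lin_op c (V m)) 0 (cfun (deriv (V m)))" using sm by blast
      \<comment> \<open>c^4 < 4 keeps the bottom 1 - c^4/4 of the essential spectrum above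
        0.\<close>
      have "c\<^sup>2 * c\<^sup>2 < 2 * 2" using c0 by (intro mult_strict_mono) auto
      then have "1 - c ^ 4 / 4 > 0" by (simp add: power4_eq_xxxx power2_eq_square mult.assoc)
      then show "0 \<notin> essential_spectrum (sobolev 4) (lin_op c (V m))" using sm by auto
    qed
  next
    have a: "2 * pi / \<beta> > 0" using eigenvalues(2) by simp
    \<comment> \<open>The half-distances exceed a linear function of m with slope 2 pi / \<beta>,
      because their deviation from the prescribed law is bounded and the \<open>k j\<close> are
      nonnegative.\<close>
    have lim: "filterlim (\<lambda>m. (Xt - Cx) + 2 * pi / \<beta> * real m) at_top sequentially"
      by (intro filterlim_tendsto_add_at_top[OF tendsto_const] filterlim_tendsto_pos_mult_at_top[OF tendsto_const a] filterlim_real_sequentially)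
    show "filterlim ?X at_top sequentially"
    proof (rule filterlim_at_top_mono[OF lim], rule eventually_mono[OF eventually_ge_at_top[of m0]])
      fix m assume m: "m \<ge> m0"
      show "(Xt - Cx) + 2 * pi / \<beta> * real m \<le> ?X m"
      proof (rule X_min_ge[OF n])
        fix j assume "j \<in> {1..n-1}"
        then have "pi / \<beta> * real (2 * m + k j) + Xt - Cx \<le> X m j" using Cx[OF m, of j] by linarith
        moreover have "pi / \<beta> * real (2 * m) \<le> pi / \<beta> * real (2 * m + k j)" using eigenvalues(2) by (intro mult_left_mono) auto
        ultimately show "(Xt - Cx) + 2 * pi / \<beta> * real m \<le> X m j" by (simp add: algebra_simps)
      qed
    qed
  qed
  have d2: "d_second Y c = - (P.N + 2 * c * P.kap)" unfolding d_second_eq[OF family(2) c] P.N_def P.kap_def by simp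
  obtain C \<epsilon> where \<epsilon>: "\<epsilon> > 0" and ex: "\<And>m z. m \<ge> m0 \<Longrightarrow> 0 < cmod z \<Longrightarrow> cmod z < \<epsilon> \<Longrightarrow>
    boundedly_invertible (sobolev 4 \<inter> L2_perp (L2_span n (s m))) (L2_perp (L2_span n (s m))) (compression (L2_span n (s m)) (pencil c (V m) (\<i> * z))) \<and>
    (\<forall>i\<in>{1..n}. \<forall>j\<in>{1..n}.
      cmod (- krein_matrix (sobolev 4) (pencil c (V m)) n (s m) z i j / z
        - (of_real P.N * (if i = j then of_real (\<nu> m i) else 0) - of_real (P.N + 2 * c * P.kap) * (if i = j then 1 else 0) * (cnj z)\<^sup>2))
      \<le> C * (M.\<tau> m * cmod z + cmod z ^ 3))" using M.expansion by blast
  show ?thesis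
  proof (rule exI[of _ C], rule exI[of _ \<epsilon>], intro conjI \<epsilon> allI impI ballI)
    fix m z assume m: "m \<ge> m0" and z: "0 < cmod z \<and> cmod z < \<epsilon>"
    note e = ex[OF m, of z]
    show "boundedly_invertible (sobolev 4 \<inter> L2_perp (L2_span n (s m))) (L2_perp (L2_span n (s m))) (compression (L2_span n (s m)) (pencil c (V m) (\<i> * z)))"
      using e z by blast
    fix i j assume i: "i \<in> {1..n}" and j: "j \<in> {1..n}"
    have eq: "(of_real P.N * (if i = j then of_real (\<nu> m i) else 0) - of_real (P.N + 2 * c * P.kap) * (if i = j then 1 else 0) * (cnj z)\<^sup>2) =
      complex_of_real ((L2_norm (cfun (deriv U)))\<^sup>2 * (if i = j then \<nu> m i else 0)) + complex_of_real (d_second Y c * (if i = j then 1 else 0)) * (cnj z)\<^sup>2"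
      unfolding N d2 by (simp add: algebra_simps)
    have bound: "cmod (- krein_matrix (sobolev 4) (pencil c (V m)) n (s m) z i j / z
        - (of_real P.N * (if i = j then of_real (\<nu> m i) else 0) - of_real (P.N + 2 * c * P.kap) * (if i = j then 1 else 0) * (cnj z)\<^sup>2))
      \<le> C * (M.\<tau> m * cmod z + cmod z ^ 3)" using e z i j by blast
    show "cmod (- krein_matrix (sobolev 4) (pencil c (V m)) n (s m) z i j / z
            - ((L2_norm (cfun (deriv U)))\<^sup>2 * (if i = j then \<nu> m i else 0)
               + d_second Y c * (if i = j then 1 else 0) * (cnj z)\<^sup>2))
      \<le> C * (exp (- (3 * \<alpha> / 2) * X_min n (X m)) * cmod z + cmod z ^ 3)" using bound unfolding eq M.\<tau>_def by (cases "i = j") simp_all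
  qed
qed

end
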